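(* Let $\Omega\subset\mathbb{R}^3$ be a bounded Lipschitz domain, $\Omega_e:=\mathbb{R}^3\setminus\bar\Omega$, and let $0<s<1$. Let $\lambda_0,\mu_0\in\mathbb{R}$ be constants with $\mu_0>0$ and $\lambda_0+\mu_0\geq 0$. For $j=1,2$ let $\lambda^{(j)},\mu^{(j)}\in C^1(\bar\Omega)$ be real-valued with $\lambda^{(j)}\ge 0$ and $\mu^{(j)}\ge 0$, and let $W_j\subset\Omega_e$ be nonempty and open. Let $\Lambda^{(j)}$ denote the Dirichlet-to-Neumann map associated with the fractional Lamé operator $\mathcal{L}^{(j)}:=L_{\lambda^{(j)},\mu^{(j)}}+(-\Delta)^sL_{\lambda_0,\mu_0}$ in $\Omega$. Suppose $$\Lambda^{(1)}g|_{W_2}=\Lambda^{(2)}g|_{W_2}\quad\text{for all } g\in C^\infty_c(W_1;\mathbb{R}^3).$$ Then $\lambda^{(1)}=\lambda^{(2)}$ and $\mu^{(1)}=\mu^{(2)}$ in $\Omega$.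
   Context: All function spaces are real; functions $u,v,g,h$ below take values in $\mathbb{R}^3$, $u_i$ is the $i$-th component of $u$, and $u_{i,j}:=\partial_j u_i$. The fractional Laplacian is $(-\Delta)^su=\mathcal{F}^{-1}(|\xi|^{2s}\mathcal{F}u)$, acting componentwise. For $r\in\mathbb{R}$, $H^r(\mathbb{R}^3)$ is the usual $L^2$-based Sobolev space, and $\tilde H^r(\Omega)$ is the closure of $C_c^\infty(\Omega)$ in $H^r(\mathbb{R}^3)$. $\langle\cdot,\cdot\rangle$ is the distributional pairing. The Lamé operator with parameters $\lambda,\mu$ is $$(L_{\lambda,\mu}u)_i:=\sum_{j=1}^3\partial_i(\lambda u_{j,j})+\sum_{j=1}^3\partial_j(\mu(u_{i,j}+u_{j,i})),\quad 1\le i\le 3.$$ For parameters $\lambda,\mu\ge0$ on $\Omega$, the fractional Lamé operator is $\mathcal{L}:=L_{\lambda,\mu}+(-\Delta)^sL_{\lambda_0,\mu_0}$. The bilinear form associated with $-\mathcal{L}$ is $$B[u,v]=\lambda_0\Big\langle(-\Delta)^s\sum_ju_{j,j},\sum_jv_{j,j}\Big\rangle+\int_\Omega\lambda\Big(\sum_ju_{j,j}\Big)\Big(\sum_jv_{j,j}\Big)+\frac12\sum_{i,j}\Big(\mu_0\langle(-\Delta)^s(u_{i,j}+u_{j,i}),v_{i,j}+v_{j,i}\rangle+\int_\Omega\mu(u_{i,j}+u_{j,i})(v_{i,j}+v_{j,i})\Big).$$ For $g\in H^{1+s}(\mathbb{R}^3)$, the exterior Dirichlet problem $\mathcal{L}u=0$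 in $\Omega$, $u=g$ in $\Omega_e$ has a unique weak solution $u_g\in H^{1+s}(\mathbb{R}^3)$, i.e. $u_g-g\in\tilde H^{1+s}(\Omega)$ and $B[u_g,v]=0$ for all $v\in\tilde H^{1+s}(\Omega)$. The Dirichlet-to-Neumann map is defined by $\langle\Lambda g,h\rangle:=-B[u_g,h]$ for $g,h\in H^{1+s}(\mathbb{R}^3)$ (depending only on the classes of $g,h$ in $H^{1+s}(\mathbb{R}^3)/\tilde H^{1+s}(\Omega)$); for $g\in C_c^\infty(\Omega_e)$ it is $\Lambda g=(-\Delta)^sL_{\lambda_0,\mu_0}u_g|_{\Omega_e}$. The equality $\Lambda^{(1)}g|_{W_2}=\Lambda^{(2)}g|_{W_2}$ is equality of distributions on $W_2$, i.e. $\langle\Lambda^{(1)}g,h\rangle=\langle\Lambda^{(2)}g,h\rangle$ for all $h\in C_c^\infty(W_2;\mathbb{R}^3)$. *)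

theory Defs
  imports "HOL-Analysis.Analysis"
begin

type_synonym R3 = "real^3"

section \<open>Smooth functions\<close>

definition partial :: "3 \<Rightarrow> (R3 \<Rightarrow> 'b::real_normed_vector) \<Rightarrow> R3 \<Rightarrow> 'b" where
  "partial j f x = frechet_derivative f (at x) (axis j 1)"

fun ipartial :: "3 list \<Rightarrow> (R3 \<Rightarrow> 'b::real_normed_vector) \<Rightarrow> R3 \<Rightarrow> 'b" where
  "ipartial [] f = f"
| "ipartial (j # js) f = partial j (ipartial js f)"

definition smooth :: "(R3 \<Rightarrow> 'b::real_normed_vector) \<Rightarrow> bool" where
  "smooth f \<longleftrightarrow> (\<forall>js x. ipartial js f differentiable (at x))"

definition Cc_infty :: "R3 set \<Rightarrow> (R3 \<Rightarrow> 'b::real_normed_vector) set" where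
  "Cc_infty U = {\<phi>. smooth \<phi> \<and> compact (closure {x. \<phi> x \<noteq> 0}) \<and> closure {x. \<phi> x \<noteq> 0} \<subseteq> U}"

definition schwartz :: "(R3 \<Rightarrow> complex) set" where
  "schwartz = {\<phi>. smooth \<phi> \<and>
     (\<forall>js k. bounded (range (\<lambda>x. (1 + norm x) ^ k *\<^sub>R ipartial js \<phi> x)))}"

text \<open>\<open>C\<^sup>1\<close> up to the boundary, for an open set: the function and its first partial
  derivatives extend continuously to the closure.\<close>

definition C1_closure :: "R3 set \<Rightarrow> (R3 \<Rightarrow> real) set" where
  "C1_closure \<Omega> = {f. continuous_on (closure \<Omega>) f \<and> (\<forall>x\<in>\<Omega>. f differentiable (at x)) \<and>
     (\<forall>j. \<exists>G. continuous_on (closure \<Omega>) G \<and> (\<forall>x\<in>\<Omega>. G x = partial j f x))}"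

section \<open>Lipschitz domains\<close>

text \<open>Near each boundary point, \<open>\<Omega>\<close> is, in suitable orthonormal coordinates \<open>Q\<close>, the region
  above the graph of a Lipschitz function of the first two coordinates.\<close>

definition bounded_lipschitz_domain :: "R3 set \<Rightarrow> bool" where
  "bounded_lipschitz_domain \<Omega> \<longleftrightarrow>
     open \<Omega> \<and> connected \<Omega> \<and> \<Omega> \<noteq> {} \<and> bounded \<Omega> \<and>
     (\<forall>p \<in> frontier \<Omega>. \<exists>r>0. \<exists>Q :: R3 \<Rightarrow> R3. \<exists>\<gamma> :: real^2 \<Rightarrow> real. \<exists>L.
        orthogonal_transformation Q \<and> L-lipschitz_on UNIV \<gamma> \<and>
        \<Omega> \<inter> ball p r = {x \<in> ball p r. \<gamma> (vector [Q x $ 1, Q x $ 2]) < Q x $ 3})"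

section \<open>Fourier transform and Sobolev spaces\<close>

text \<open>Elements of \<open>L\<^sup>2\<close> are represented by Borel functions; none of the notions below depends on
  the choice of the representative.\<close>

definition L2 :: "(R3 \<Rightarrow> 'b::real_normed_vector) set" where
  "L2 = {f. f \<in> borel_measurable lborel \<and> integrable lborel (\<lambda>x. (norm (f x))\<^sup>2)}"

definition fourier :: "(R3 \<Rightarrow> complex) \<Rightarrow> R3 \<Rightarrow> complex" where
  "fourier \<phi> \<xi> = of_real ((2 * pi) powr (- 3 / 2)) * (LINT x|lborel. \<phi> x * cis (- (x \<bullet> \<xi>)))"

definition inv_fourier :: "(R3 \<Rightarrow> complex) \<Rightarrow> R3 \<Rightarrow> complex" where
  "inv_fourier \<phi> x = of_real ((2 * pi) powr (- 3 / 2)) * (LINT \<xi>|lborel. \<phi> \<xi> * cis (x \<bullet> \<xi>))"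

text \<open>The Fourier transform of \<open>f \<in> L\<^sup>2\<close> as a tempered distribution, \<open>\<langle>\<F> f, \<phi>\<rangle> = \<langle>f, \<F> \<phi>\<rangle>\<close>; it is an
  \<open>L\<^sup>2\<close> function, determined almost everywhere.\<close>

definition fourier_L2 :: "(R3 \<Rightarrow> real) \<Rightarrow> R3 \<Rightarrow> complex" where
  "fourier_L2 f = (SOME F. F \<in> L2 \<and>
     (\<forall>\<phi>\<in>schwartz. (LINT \<xi>|lborel. F \<xi> * \<phi> \<xi>) = (LINT x|lborel. of_real (f x) * fourier \<phi> x)))"

text \<open>\<open>H\<^sup>r\<close> for \<open>r \<ge> 0\<close>, where it is a subspace of \<open>L\<^sup>2\<close>.\<close>

definition sobolev :: "real \<Rightarrow> (R3 \<Rightarrow> real) set" where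
  "sobolev r = {f. f \<in> L2 \<and> (\<lambda>\<xi>. (1 + (norm \<xi>)\<^sup>2) powr (r / 2) *\<^sub>R fourier_L2 f \<xi>) \<in> L2}"

definition sobolev_norm :: "real \<Rightarrow> (R3 \<Rightarrow> real) \<Rightarrow> real" where
  "sobolev_norm r f =
     sqrt (LINT \<xi>|lborel. (1 + (norm \<xi>)\<^sup>2) powr r * (norm (fourier_L2 f \<xi>))\<^sup>2)"

definition sobolev_tilde :: "real \<Rightarrow> R3 set \<Rightarrow> (R3 \<Rightarrow> real) set" where
  "sobolev_tilde r \<Omega> = {f \<in> sobolev r.
     \<forall>\<epsilon>>0. \<exists>\<phi>\<in>Cc_infty \<Omega>. sobolev_norm r (\<lambda>x. f x - \<phi> x) < \<epsilon>}"

definition sobolev_vec :: "real \<Rightarrow> (R3 \<Rightarrow> R3) set" where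
  "sobolev_vec r = {u. \<forall>i. (\<lambda>x. u x $ i) \<in> sobolev r}"

definition sobolev_tilde_vec :: "real \<Rightarrow> R3 set \<Rightarrow> (R3 \<Rightarrow> R3) set" where
  "sobolev_tilde_vec r \<Omega> = {u. \<forall>i. (\<lambda>x. u x $ i) \<in> sobolev_tilde r \<Omega>}"

section \<open>Fractional Laplacian and the distributional pairing\<close>

type_synonym distribution = "(R3 \<Rightarrow> complex) \<Rightarrow> complex"

definition distr_of :: "(R3 \<Rightarrow> complex) \<Rightarrow> distribution" where
  "distr_of F = (\<lambda>\<phi>. LINT x|lborel. F x * \<phi> x)"

definition inv_fourier_distr :: "distribution \<Rightarrow> distribution" where
  "inv_fourier_distr T = (\<lambda>\<phi>. T (inv_fourier \<phi>))"

definition frac_laplacian :: "real \<Rightarrow> (R3 \<Rightarrow> real) \<Rightarrow> distribution" where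
  "frac_laplacian s w =
     inv_fourier_distr (distr_of (\<lambda>\<xi>. of_real (norm \<xi> powr (2 * s)) * fourier_L2 w \<xi>))"

text \<open>The pairing of a real distribution \<open>T \<in> H\<^sup>-\<^sup>r\<close> with \<open>v \<in> H\<^sup>r\<close>: the action of \<open>T\<close> on
  real test functions, extended to \<open>H\<^sup>r\<close> by continuity.\<close>

definition pairing :: "real \<Rightarrow> distribution \<Rightarrow> (R3 \<Rightarrow> real) \<Rightarrow> real" where
  "pairing r T v = (THE c. \<forall>\<phi>. (\<forall>n. \<phi> n \<in> Cc_infty UNIV) \<and>
       (\<lambda>n. sobolev_norm r (\<lambda>x. \<phi> n x - v x)) \<longlonglongrightarrow> 0
     \<longrightarrow> (\<lambda>n::nat. T (\<lambda>x. of_real (\<phi> n x))) \<longlonglongrightarrow> of_real c)"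

section \<open>The fractional Lame operator\<close>

text \<open>The distributional derivative \<open>\<partial>\<^sub>j f\<close>, for \<open>f\<close> with \<open>\<partial>\<^sub>j f \<in> L\<^sup>2\<close>.\<close>

definition weak_partial :: "3 \<Rightarrow> (R3 \<Rightarrow> real) \<Rightarrow> R3 \<Rightarrow> real" where
  "weak_partial j f = (SOME g. g \<in> L2 \<and>
     (\<forall>\<phi>\<in>Cc_infty UNIV. (LINT x|lborel. g x * \<phi> x) = - (LINT x|lborel. f x * partial j \<phi> x)))"

definition divergence :: "(R3 \<Rightarrow> R3) \<Rightarrow> R3 \<Rightarrow> real" where
  "divergence u x = (\<Sum>j\<in>UNIV. weak_partial j (\<lambda>y. u y $ j) x)"

definition sym_grad :: "(R3 \<Rightarrow> R3) \<Rightarrow> 3 \<Rightarrow> 3 \<Rightarrow> R3 \<Rightarrow> real" where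
  "sym_grad u i j x = weak_partial j (\<lambda>y. u y $ i) x + weak_partial i (\<lambda>y. u y $ j) x"

text \<open>The form associated with \<open>- (L\<^sub>\<lambda>\<^sub>\<mu> + (-\<Delta>)\<^sup>s L\<^sub>\<lambda>\<^sub>0\<^sub>\<mu>\<^sub>0)\<close>, where
  \<open>(L\<^sub>\<lambda>\<^sub>\<mu> u)\<^sub>i = \<Sum>\<^sub>j \<partial>\<^sub>i (\<lambda> u\<^sub>j\<^sub>,\<^sub>j) + \<Sum>\<^sub>j \<partial>\<^sub>j (\<mu> (u\<^sub>i\<^sub>,\<^sub>j + u\<^sub>j\<^sub>,\<^sub>i))\<close>; \<open>l, m\<close> stand for
  \<open>\<lambda>, \<mu>\<close> and \<open>l0, m0\<close> for \<open>\<lambda>\<^sub>0, \<mu>\<^sub>0\<close>.\<close>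

definition lame_form ::
  "R3 set \<Rightarrow> real \<Rightarrow> real \<Rightarrow> real \<Rightarrow> (R3 \<Rightarrow> real) \<Rightarrow> (R3 \<Rightarrow> real) \<Rightarrow> (R3 \<Rightarrow> R3) \<Rightarrow> (R3 \<Rightarrow> R3) \<Rightarrow> real"
where
  "lame_form \<Omega> s l0 m0 l m u v =
     l0 * pairing s (frac_laplacian s (divergence u)) (divergence v)
     + (LINT x:\<Omega>|lborel. l x * divergence u x * divergence v x)
     + 1 / 2 * (\<Sum>i\<in>UNIV. \<Sum>j\<in>UNIV.
          m0 * pairing s (frac_laplacian s (sym_grad u i j)) (sym_grad v i j)
          + (LINT x:\<Omega>|lborel. m x * sym_grad u i j x * sym_grad v i j x))"

definition weak_solution ::
  "R3 set \<Rightarrow> real \<Rightarrow> real \<Rightarrow> real \<Rightarrow> (R3 \<Rightarrow> real) \<Rightarrow> (R3 \<Rightarrow> real) \<Rightarrow> (R3 \<Rightarrow> R3) \<Rightarrow> (R3 \<Rightarrow> R3) \<Rightarrow> bool"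
where
  "weak_solution \<Omega> s l0 m0 l m g u \<longleftrightarrow>
     u \<in> sobolev_vec (1 + s) \<and> (\<lambda>x. u x - g x) \<in> sobolev_tilde_vec (1 + s) \<Omega> \<and>
     (\<forall>v \<in> sobolev_tilde_vec (1 + s) \<Omega>. lame_form \<Omega> s l0 m0 l m u v = 0)"

text \<open>The pairing \<open>\<langle>\<Lambda> g, h\<rangle>\<close> for the Dirichlet-to-Neumann map \<open>\<Lambda>\<close>; the weak solution is unique up
  to equality almost everywhere.\<close>

definition DN_map ::
  "R3 set \<Rightarrow> real \<Rightarrow> real \<Rightarrow> real \<Rightarrow> (R3 \<Rightarrow> real) \<Rightarrow> (R3 \<Rightarrow> real) \<Rightarrow> (R3 \<Rightarrow> R3) \<Rightarrow> (R3 \<Rightarrow> R3) \<Rightarrow> real"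
where
  "DN_map \<Omega> s l0 m0 l m g h =
     - lame_form \<Omega> s l0 m0 l m (SOME u. weak_solution \<Omega> s l0 m0 l m g u) h"

end

theory Submission
  imports Defs "HOL-Probability.Probability"
begin

text \<open>For either operator, the functions \<open>u\<^sub>g - g\<close> with \<open>g\<close> supported in a given nonempty open set
  outside \<open>\<Omega>\<close> are dense among the functions of order \<open>1 + s\<close> supported in \<open>\<Omega>\<close>
  (Runge property). By Hilbert space projection this reduces to unique continuation: if \<open>\<phi>\<close> is
  orthogonal to all data, then testing with a column of the cofactor matrix of the symbol gives
  \<open>(-\<Delta>)\<^sup>s\<^sup>+\<^sup>2 \<phi>\<^sub>i = 0\<close> on the open set; off the support of \<open>\<phi>\<^sub>i\<close> this is a convolution with a Riesz
  kernel, whose derivatives at a single point are, after an inversion, all monomials, so that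
  \<open>\<phi>\<^sub>i = 0\<close> by the Weierstrass theorem. Equality of the Dirichlet-to-Neumann maps makes the two
  forms agree on pairs of solutions, hence by density on all pairs supported in \<open>\<Omega>\<close>. Finally, if
  \<open>E\<close> is the difference of the forms, \<open>E (\<phi> \<psi>, \<psi>) - E (\<phi>, \<psi>\<^sup>2) / 2\<close> contains no derivative of \<open>\<phi>\<close>,
  so that the coefficients vanish pointwise.\<close>

section \<open>Hilbert space methods and square-integrable functions\<close>

section \<open>Projection in semi-inner product spaces\<close>

text \<open>The unknown coefficients live in \<Omega>, the data and test fields of the measurement
  outside it. Hence a field supported off \<Omega> meets only the constant-coefficient part with
  symbol |\<xi>|^(2s) (m0 |\<xi>|^2 I + (l0 + m0) \<xi> \<xi>^T), whose cofactor matrix is explicit;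
  this decouples the system and reduces unique continuation to one scalar component at a time. The
  same separation makes the difference of the two forms blind to the data themselves, so that
  solutions may be replaced there by u - g. Coercivity follows from m0 > 0, l0 + m0 \<ge> 0 and
  nonnegative coefficients, but it controls only the homogeneous seminorm of order 1 + s; the
  boundedness of \<Omega> supplies the low frequencies. Functions are representatives, and
  transforms, weak derivatives and solutions are selected by \<open>SOME\<close>. Forms are
  therefore only semi-inner products, and each selected object is identified almost everywhere
  through its Fourier transform or test integrals. Limits of test functions form the ambient space,
  because there all these identifications are available.\<close>

lemma discriminant_nonpos:
  fixes a b c :: real
  assumes "\<And>t. 0 \<le> a + 2 * t * b + t\<^sup>2 * c"
  shows "b\<^sup>2 \<le> a * c"
proof (cases "c = 0")
  case True
  have "b = 0"
  proof (rule ccontr)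
    assume b: "b \<noteq> 0"
    \<comment> \<open>With c = 0 this choice of t makes the expression equal to -1.\<close>
    have "0 \<le> a + 2 * (- (a + 1) / (2 * b)) * b + (- (a + 1) / (2 * b))\<^sup>2 * c" by (rule assms)
    then show False using b True by (simp add: field_simps)
  qed
  then show ?thesis using True by simp
next
  case False
  have c: "c > 0"
  proof (rule ccontr)
    assume "\<not> c > 0"
    then have c: "c < 0" using False by simp
    \<comment> \<open>Large enough for t * c to fall below -(|a| + 2 |b|), and at least 1 so that a
      is bounded by t |a|.\<close>
    define t where "t = (\<bar>a\<bar> + 2 * \<bar>b\<bar> + 1) / (- c) + 1"
    have t: "t \<ge> 1" using c by (simp add: t_def divide_nonneg_neg field_simps)
    have tc: "t * c < - (\<bar>a\<bar> + 2 * \<bar>b\<bar>)"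
      using c by (simp add: t_def field_simps)
    have "0 \<le> a + 2 * t * b + t\<^sup>2 * c" by (rule assms)
    also have "\<dots> \<le> t * \<bar>a\<bar> + t * (2 * \<bar>b\<bar>) + t * (t * c)"
    proof -
      have "a \<le> t * \<bar>a\<bar>" using t by (metis abs_ge_self abs_ge_zero mult_1 mult_right_mono order_trans)
      moreover have "t * b \<le> t * \<bar>b\<bar>" using t by (intro mult_left_mono) auto
      ultimately show ?thesis by (simp add: power2_eq_square mult.assoc)
    qed
    also have "\<dots> = t * (\<bar>a\<bar> + 2 * \<bar>b\<bar> + t * c)" by (simp add: algebra_simps)
    also have "\<dots> < 0" using tc t by (intro mult_pos_neg) auto
    finally show False by simp
  qed
  have "0 \<le> a + 2 * (- b / c) * b + (- b / c)\<^sup>2 * c" by (rule assms)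
  then have "0 \<le> a - b\<^sup>2 / c" using c by (simp add: power2_eq_square field_simps)
  then show ?thesis using c by (simp add: field_simps)
qed

text \<open>Vectors are functions with pointwise operations, not classes modulo null sets, so B is
  only positive semidefinite and all results hold up to B-null vectors. Linearity is assumed in one
  slot and transferred to the other by symmetry.\<close>

locale semi_inner =
  fixes X :: "('a \<Rightarrow> 'b::real_vector) set" and B :: "('a \<Rightarrow> 'b) \<Rightarrow> ('a \<Rightarrow> 'b) \<Rightarrow> real"
  assumes lin: "u \<in> X \<Longrightarrow> v \<in> X \<Longrightarrow> (\<lambda>x. u x + c *\<^sub>R v x) \<in> X"
    and sym: "u \<in> X \<Longrightarrow> v \<in> X \<Longrightarrow> B u v = B v u"
    and bil: "u \<in> X \<Longrightarrow> v \<in> X \<Longrightarrow> w \<in> X \<Longrightarrow> B (\<lambda>x. u x + c *\<^sub>R v x) w = B u w + c * B v w"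
    and pos: "u \<in> X \<Longrightarrow> 0 \<le> B u u"
begin

lemma add_mem: "u \<in> X \<Longrightarrow> v \<in> X \<Longrightarrow> (\<lambda>x. u x + v x) \<in> X"
  using lin[of u v 1] by simp
lemma diff_mem: "u \<in> X \<Longrightarrow> v \<in> X \<Longrightarrow> (\<lambda>x. u x - v x) \<in> X"
  using lin[of u v "-1"] by simp
lemma zero_mem: "u \<in> X \<Longrightarrow> (\<lambda>x. 0) \<in> X"
  using lin[of u u "-1"] by simp
lemma scale_mem: "u \<in> X \<Longrightarrow> (\<lambda>x. c *\<^sub>R u x) \<in> X"
  using lin[OF zero_mem, of u u c] by simp

lemma B_diff: "u \<in> X \<Longrightarrow> v \<in> X \<Longrightarrow> w \<in> X \<Longrightarrow> B (\<lambda>x. u x - v x) w = B u w - B v w"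
  using bil[of u v w "-1"] by simp
lemma bil2: "u \<in> X \<Longrightarrow> v \<in> X \<Longrightarrow> w \<in> X \<Longrightarrow> B w (\<lambda>x. u x + c *\<^sub>R v x) = B w u + c * B w v"
  using bil[of u v w c] sym[of w] lin[of u v c] by metis
lemma B_diff2: "u \<in> X \<Longrightarrow> v \<in> X \<Longrightarrow> w \<in> X \<Longrightarrow> B w (\<lambda>x. u x - v x) = B w u - B w v"
  using bil2[of u v w "-1"] by simp

lemma expand:
  assumes "u \<in> X" "v \<in> X"
  shows "B (\<lambda>x. u x + c *\<^sub>R v x) (\<lambda>x. u x + c *\<^sub>R v x) = B u u + 2 * c * B u v + c\<^sup>2 * B v v"
  using assms lin[of u v c] sym[of u v]
  by (simp add: bil bil2 power2_eq_square algebra_simps)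

lemma expand_diff:
  assumes "u \<in> X" "v \<in> X"
  shows "B (\<lambda>x. u x - v x) (\<lambda>x. u x - v x) = B u u - 2 * B u v + B v v"
  using expand[OF assms, of "-1"] by simp

lemma cauchy_schwarz:
  assumes "u \<in> X" "v \<in> X"
  shows "(B u v)\<^sup>2 \<le> B u u * B v v"
proof (rule discriminant_nonpos)
  show "0 \<le> B u u + 2 * t * B u v + t\<^sup>2 * B v v" for t
    using expand[OF assms, of t] pos[OF lin[OF assms, of t]] by simp
qed

lemma cauchy_schwarz_abs:
  assumes "u \<in> X" "v \<in> X"
  shows "\<bar>B u v\<bar> \<le> sqrt (B u u) * sqrt (B v v)"
  using cauchy_schwarz[OF assms] real_le_rsqrt[of "\<bar>B u v\<bar>" "B u u * B v v"]
  by (simp add: real_sqrt_mult)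

text \<open>A substitute for definiteness: a null vector need not vanish, but it is invisible to the
  form. Uniqueness of weak solutions is used in this shape.\<close>

lemma null_left:
  assumes "u \<in> X" "v \<in> X" "B u u = 0"
  shows "B u v = 0"
  using cauchy_schwarz_abs[OF assms(1,2)] assms(3) by simp

lemma triangle:
  assumes "u \<in> X" "v \<in> X"
  shows "sqrt (B (\<lambda>x. u x + v x) (\<lambda>x. u x + v x)) \<le> sqrt (B u u) + sqrt (B v v)"
proof (rule real_le_lsqrt)
  have "B (\<lambda>x. u x + v x) (\<lambda>x. u x + v x) = B u u + 2 * B u v + B v v"
    using expand[OF assms, of 1] by simp
  also have "\<dots> \<le> B u u + 2 * (sqrt (B u u) * sqrt (B v v)) + B v v"
    using cauchy_schwarz_abs[OF assms] by linarith
  also have "\<dots> = (sqrt (B u u) + sqrt (B v v))\<^sup>2"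
    using pos assms by (simp add: power2_sum)
  finally show "B (\<lambda>x. u x + v x) (\<lambda>x. u x + v x) \<le> (sqrt (B u u) + sqrt (B v v))\<^sup>2" .
qed (use pos assms in auto)

lemma triangle_diff:
  assumes "u \<in> X" "v \<in> X" "w \<in> X"
  shows "sqrt (B (\<lambda>x. u x - w x) (\<lambda>x. u x - w x))
    \<le> sqrt (B (\<lambda>x. u x - v x) (\<lambda>x. u x - v x)) + sqrt (B (\<lambda>x. v x - w x) (\<lambda>x. v x - w x))"
  using triangle[OF diff_mem[OF assms(1,2)] diff_mem[OF assms(2,3)]] by simp

lemma diff_commute:
  assumes "u \<in> X" "v \<in> X"
  shows "B (\<lambda>x. u x - v x) (\<lambda>x. u x - v x) = B (\<lambda>x. v x - u x) (\<lambda>x. v x - u x)"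
  using expand_diff[OF assms] expand_diff[OF assms(2,1)] sym[OF assms] by simp

text \<open>A linear subspace on which the seminorm is complete; a limit is determined only up to
  B-null vectors. Squared seminorms keep roots out of the condition.\<close>

definition complete_sub where
  "complete_sub V \<longleftrightarrow> V \<subseteq> X \<and> V \<noteq> {} \<and> (\<forall>u\<in>V. \<forall>v\<in>V. \<forall>c. (\<lambda>x. u x + c *\<^sub>R v x) \<in> V) \<and>
     (\<forall>w. (\<forall>n. w n \<in> V) \<and> (\<forall>e>0. \<exists>N. \<forall>m\<ge>N. \<forall>n\<ge>N. B (\<lambda>x. w m x - w n x) (\<lambda>x. w m x - w n x) < e)
       \<longrightarrow> (\<exists>v\<in>V. (\<lambda>n::nat. B (\<lambda>x. w n x - v x) (\<lambda>x. w n x - v x)) \<longlonglongrightarrow> 0))"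

lemma quadratic_first_order_zero:
  fixes b c :: real
  assumes "\<And>t. 0 \<le> 2 * t * b + t\<^sup>2 * c"
  shows "b = 0"
  using discriminant_nonpos[of 0 b c] assms by simp

text \<open>A minimizing sequence for the distance from g to V is Cauchy by the parallelogram law,
  and at its limit the first variation of the distance vanishes in every direction of V.\<close>

lemma projection:
  assumes V: "complete_sub V" and g: "g \<in> X"
  shows "\<exists>w\<in>V. \<forall>v\<in>V. B (\<lambda>x. g x - w x) v = 0"
proof -
  have VX: "V \<subseteq> X" and Vne: "V \<noteq> {}"
    and Vlin: "\<And>u v c. u \<in> V \<Longrightarrow> v \<in> V \<Longrightarrow> (\<lambda>x. u x + c *\<^sub>R v x) \<in> V"
    using V by (auto simp: complete_sub_def)
  define N where "N = (\<lambda>u. B u u)"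
  define S where "S = (\<lambda>w. N (\<lambda>x. g x - w x)) ` V"
  define d where "d = Inf S"
  have Sne: "S \<noteq> {}" using Vne by (simp add: S_def)
  have gX: "w \<in> V \<Longrightarrow> (\<lambda>x. g x - w x) \<in> X" for w using diff_mem g VX by blast
  have Sbd: "bdd_below S" unfolding S_def N_def using pos gX by (intro bdd_belowI[of _ 0]) auto
  have dle: "w \<in> V \<Longrightarrow> d \<le> N (\<lambda>x. g x - w x)" for w
    unfolding d_def S_def using Sbd by (intro cInf_lower) (auto simp: S_def)
  have "\<exists>w\<in>V. N (\<lambda>x. g x - w x) < d + 1 / real (Suc n)" for n
  proof -
    have "\<exists>s\<in>S. s < d + 1 / real (Suc n)"
      unfolding d_def using Sne Sbd by (subst cInf_less_iff[symmetric]) auto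
    then show ?thesis by (auto simp: S_def)
  qed
  then obtain w where w: "\<And>n. w n \<in> V" "\<And>n. N (\<lambda>x. g x - w n x) < d + 1 / real (Suc n)" by metis
  \<comment> \<open>Parallelogram law: N (w m - w n) = 2 N ?a + 2 N ?b - 4 N ((?a + ?b) / 2). The
    midpoint of w m and w n lies in V, so the last term is at most -4 d, and the excess over d of
    the other two is known.\<close>
  have Nexp: "N (\<lambda>x. w m x - w n x) \<le> 2 / real (Suc m) + 2 / real (Suc n)" for m n
  proof -
    let ?a = "\<lambda>x. g x - w m x" and ?b = "\<lambda>x. g x - w n x"
    have a: "?a \<in> X" and b: "?b \<in> X" using gX w by auto
    have wm: "w m \<in> X" and wn: "w n \<in> X" using w VX by auto
    have mid: "(\<lambda>x. (1/2) *\<^sub>R w m x + (1/2) *\<^sub>R w n x) \<in> V"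
    proof -
      have "(\<lambda>x. 0) \<in> V" using Vlin[OF w(1)[of m] w(1)[of m], of "-1"] by simp
      then have "(\<lambda>x. (1/2) *\<^sub>R w m x) \<in> V" using Vlin[of "\<lambda>x. 0" "w m" "1/2"] w by simp
      from Vlin[OF this w(1)[of n], of "1/2"] show ?thesis by simp
    qed
    have e1: "N (\<lambda>x. w m x - w n x) = N ?a - 2 * B ?b ?a + N ?b"
    proof -
      have "(\<lambda>x. w m x - w n x) = (\<lambda>x. ?b x - ?a x)" by (auto simp: fun_eq_iff)
      then show ?thesis using expand_diff[OF b a] by (simp add: N_def)
    qed
    have "(\<lambda>x. g x - ((1/2) *\<^sub>R w m x + (1/2) *\<^sub>R w n x)) = (\<lambda>x. (1/2) *\<^sub>R ?b x + (1/2) *\<^sub>R ?a x)"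
    proof
      fix x
      have "g x = (1/2) *\<^sub>R g x + (1/2) *\<^sub>R g x" by (simp flip: scaleR_add_left)
      then show "g x - ((1/2) *\<^sub>R w m x + (1/2) *\<^sub>R w n x) = (1/2) *\<^sub>R ?b x + (1/2) *\<^sub>R ?a x"
        by (simp add: scaleR_diff_right algebra_simps)
    qed
    then have "4 * d \<le> 4 * N (\<lambda>x. (1/2) *\<^sub>R ?b x + (1/2) *\<^sub>R ?a x)" using dle[OF mid] by simp
    also have "\<dots> = N ?b + 2 * B ?b ?a + N ?a"
    proof -
      let ?h = "\<lambda>x. (1/2) *\<^sub>R ?b x"
      have h: "?h \<in> X" using scale_mem[OF b] .
      have bb: "B ?h u = 1/2 * B ?b u" if "u \<in> X" for u
        using bil[OF zero_mem[OF b] b that, of "1/2"] B_diff[OF b b that] by simp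
      have "N (\<lambda>x. ?h x + (1/2) *\<^sub>R ?a x) = B ?h ?h + B ?h ?a + (1/4) * B ?a ?a"
        unfolding N_def using expand[OF h a, of "1/2"] by (simp add: power2_eq_square)
      moreover have "B ?h ?h = 1/4 * B ?b ?b" using bb[OF h] sym[OF b h] bb[OF b] by simp
      moreover have "B ?h ?a = 1/2 * B ?b ?a" using bb[OF a] .
      ultimately show ?thesis by (simp add: N_def)
    qed
    finally have "- (2 * B ?b ?a) \<le> N ?a + N ?b - 4 * d" by simp
    then show ?thesis using e1 w(2)[of m] w(2)[of n] by simp
  qed
  have "\<exists>v\<in>V. (\<lambda>n. B (\<lambda>x. w n x - v x) (\<lambda>x. w n x - v x)) \<longlonglongrightarrow> 0"
  proof -
    have "\<exists>M. \<forall>m\<ge>M. \<forall>n\<ge>M. B (\<lambda>x. w m x - w n x) (\<lambda>x. w m x - w n x) < e" if e: "e > 0" for e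
    proof -
      obtain M where M: "1 / real (Suc M) < e / 4" using e by (metis nat_approx_posE divide_pos_pos zero_less_numeral)
      have "B (\<lambda>x. w m x - w n x) (\<lambda>x. w m x - w n x) < e" if "m \<ge> M" "n \<ge> M" for m n
      proof -
        have "1 / real (Suc m) \<le> 1 / real (Suc M)" "1 / real (Suc n) \<le> 1 / real (Suc M)"
          using that by (auto simp: field_simps)
        then show ?thesis using Nexp[of m n] M by (simp add: N_def)
      qed
      then show ?thesis by blast
    qed
    then show ?thesis using V w(1) unfolding complete_sub_def by blast
  qed
  then obtain v where v: "v \<in> V" and vlim: "(\<lambda>n. B (\<lambda>x. w n x - v x) (\<lambda>x. w n x - v x)) \<longlonglongrightarrow> 0" by blast
  have vX: "v \<in> X" using v VX by auto
  have "sqrt (N (\<lambda>x. g x - v x)) \<le> sqrt d"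
  proof (rule LIMSEQ_le_const)
    have "(\<lambda>n. sqrt (d + 1 / real (Suc n)) + sqrt (B (\<lambda>x. w n x - v x) (\<lambda>x. w n x - v x))) \<longlonglongrightarrow> sqrt (d + 0) + sqrt 0"
      by (intro tendsto_intros vlim LIMSEQ_Suc[OF lim_1_over_n])
    then show "(\<lambda>n. sqrt (d + 1 / real (Suc n)) + sqrt (B (\<lambda>x. w n x - v x) (\<lambda>x. w n x - v x))) \<longlonglongrightarrow> sqrt d" by simp
    show "\<exists>M. \<forall>n\<ge>M. sqrt (N (\<lambda>x. g x - v x)) \<le> sqrt (d + 1 / real (Suc n)) + sqrt (B (\<lambda>x. w n x - v x) (\<lambda>x. w n x - v x))"
    proof (intro exI allI impI)
      fix n
      have "sqrt (N (\<lambda>x. g x - v x)) \<le> sqrt (N (\<lambda>x. g x - w n x)) + sqrt (N (\<lambda>x. w n x - v x))"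
        unfolding N_def using w VX by (intro triangle_diff g vX) auto
      also have "sqrt (N (\<lambda>x. g x - w n x)) \<le> sqrt (d + 1 / real (Suc n))"
        using w(2)[of n] by (intro real_sqrt_le_mono) auto
      finally show "sqrt (N (\<lambda>x. g x - v x)) \<le> sqrt (d + 1 / real (Suc n)) + sqrt (B (\<lambda>x. w n x - v x) (\<lambda>x. w n x - v x))"
        by (simp add: N_def)
    qed
  qed
  then have vd: "N (\<lambda>x. g x - v x) \<le> d" by simp
  show ?thesis
  proof (intro bexI[OF _ v] ballI)
    fix z assume z: "z \<in> V"
    show "B (\<lambda>x. g x - v x) z = 0"
    proof (rule quadratic_first_order_zero)
      fix t :: real
      have zX: "z \<in> X" using z VX by auto
      have "d \<le> N (\<lambda>x. g x - (v x + (- t) *\<^sub>R z x))" by (rule dle[OF Vlin[OF v z]])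
      also have "(\<lambda>x. g x - (v x + (- t) *\<^sub>R z x)) = (\<lambda>x. (g x - v x) + t *\<^sub>R z x)" by (auto simp: fun_eq_iff)
      also have "N \<dots> = N (\<lambda>x. g x - v x) + 2 * t * B (\<lambda>x. g x - v x) z + t\<^sup>2 * B z z"
        unfolding N_def by (rule expand[OF gX[OF v] zX])
      finally show "0 \<le> 2 * t * B (\<lambda>x. g x - v x) z + t\<^sup>2 * B z z" using vd by simp
    qed
  qed
qed

definition closure_in where
  "closure_in V D = {w \<in> V. \<forall>e>0. \<exists>d\<in>D. B (\<lambda>x. d x - w x) (\<lambda>x. d x - w x) < e}"

lemma closure_in_iff_sqrt:
  assumes "V \<subseteq> X" "D \<subseteq> X"
  shows "w \<in> closure_in V D \<longleftrightarrow> w \<in> V \<and> (\<forall>e>0. \<exists>d\<in>D. sqrt (B (\<lambda>x. d x - w x) (\<lambda>x. d x - w x)) < e)"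
proof -
  have *: "sqrt t < e \<longleftrightarrow> t < e\<^sup>2" if "e > 0" for t e :: real
    using that real_sqrt_less_iff[of t "e\<^sup>2"] by simp
  show ?thesis
  proof safe
    fix e :: real assume "w \<in> closure_in V D" "e > 0"
    then show "\<exists>d\<in>D. sqrt (B (\<lambda>x. d x - w x) (\<lambda>x. d x - w x)) < e"
      using *[of e] by (auto simp: closure_in_def)
  next
    assume w: "w \<in> V" "\<forall>e>0. \<exists>d\<in>D. sqrt (B (\<lambda>x. d x - w x) (\<lambda>x. d x - w x)) < e"
    have "\<exists>d\<in>D. B (\<lambda>x. d x - w x) (\<lambda>x. d x - w x) < e" if "e > 0" for e
      using w(2)[rule_format, of "sqrt e"] that by (simp add: real_sqrt_less_iff)
    then show "w \<in> closure_in V D" using w by (simp add: closure_in_def)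
  qed (simp add: closure_in_def)
qed

text \<open>Lets the projection be applied to spaces that come without closedness, such as the test
  functions or the differences u - g of solutions and data. A Cauchy sequence in the closure
  converges in V; half of the tolerance is spent on reaching the limit, half on approximating a
  member of the sequence from D.\<close>

lemma complete_closure_in:
  assumes V: "complete_sub V" and DV: "D \<subseteq> V" and D: "D \<noteq> {}"
    and Dlin: "\<And>u v c. u \<in> D \<Longrightarrow> v \<in> D \<Longrightarrow> (\<lambda>x. u x + c *\<^sub>R v x) \<in> D"
  shows "complete_sub (closure_in V D)"
proof -
  have VX: "V \<subseteq> X" and Vlin: "\<And>u v c. u \<in> V \<Longrightarrow> v \<in> V \<Longrightarrow> (\<lambda>x. u x + c *\<^sub>R v x) \<in> V"
    using V by (auto simp: complete_sub_def)
  have DX: "D \<subseteq> X" using DV VX by auto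
  let ?n = "\<lambda>u. sqrt (B u u)"
  note cl = closure_in_iff_sqrt[OF VX DX]
  have D_sub: "D \<subseteq> closure_in V D"
  proof
    fix d assume d: "d \<in> D"
    then have "B (\<lambda>x. d x - d x) (\<lambda>x. d x - d x) = 0"
      using expand_diff[of d d] DX by auto
    then show "d \<in> closure_in V D" using d DV by (force simp: closure_in_def)
  qed
  have scale: "?n (\<lambda>x. c *\<^sub>R u x) = \<bar>c\<bar> * ?n u" if "u \<in> X" for c u
  proof -
    have z: "B (\<lambda>x. 0) v = 0" if "v \<in> X" for v using B_diff[of v v v] that by simp
    have "B (\<lambda>x. 0 + c *\<^sub>R u x) (\<lambda>x. 0 + c *\<^sub>R u x) = c\<^sup>2 * B u u"
      using expand[OF zero_mem[OF that] that, of c] z that zero_mem[OF that] by simp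
    then show ?thesis by (simp add: real_sqrt_mult)
  qed
  have lin': "(\<lambda>x. u x + c *\<^sub>R v x) \<in> closure_in V D" if u: "u \<in> closure_in V D" and v: "v \<in> closure_in V D" for u v c
  proof -
    have uv: "u \<in> V" "v \<in> V" "u \<in> X" "v \<in> X" using u v VX by (auto simp: closure_in_def)
    have "\<exists>d\<in>D. ?n (\<lambda>x. d x - (u x + c *\<^sub>R v x)) < e" if e0: "e > 0" for e
    proof -
      obtain d1 where d1: "d1 \<in> D" "?n (\<lambda>x. d1 x - u x) < e / 2" using u e0 unfolding cl by (meson half_gt_zero)
      have "e / (2 * (\<bar>c\<bar> + 1)) > 0" using e0 by (auto intro!: divide_pos_pos)
      then obtain d2 where d2: "d2 \<in> D" "?n (\<lambda>x. d2 x - v x) < e / (2 * (\<bar>c\<bar> + 1))" using v unfolding cl by meson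
      have m1: "(\<lambda>x. d1 x - u x) \<in> X" "(\<lambda>x. d2 x - v x) \<in> X" using d1 d2 uv DX by (auto intro: diff_mem)
      have "?n (\<lambda>x. (d1 x - u x) + c *\<^sub>R (d2 x - v x)) \<le> ?n (\<lambda>x. d1 x - u x) + \<bar>c\<bar> * ?n (\<lambda>x. d2 x - v x)"
        using triangle[OF m1(1) scale_mem[OF m1(2), of c]] scale[OF m1(2), of c] by simp
      also have "\<bar>c\<bar> * ?n (\<lambda>x. d2 x - v x) \<le> (\<bar>c\<bar> + 1) * (e / (2 * (\<bar>c\<bar> + 1)))"
        using d2(2) pos[OF m1(2)] by (intro mult_mono) auto
      also have "\<dots> = e / 2" by (simp add: field_simps add_pos_nonneg)
      finally have "?n (\<lambda>x. (d1 x - u x) + c *\<^sub>R (d2 x - v x)) < e" using d1(2) by simp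
      moreover have "(\<lambda>x. (d1 x - u x) + c *\<^sub>R (d2 x - v x)) = (\<lambda>x. (d1 x + c *\<^sub>R d2 x) - (u x + c *\<^sub>R v x))"
        by (auto simp: fun_eq_iff scaleR_diff_right)
      ultimately show ?thesis using Dlin[OF d1(1) d2(1), of c] by auto
    qed
    then show ?thesis using Vlin[OF uv(1,2)] unfolding cl by blast
  qed
  have "\<exists>v\<in>closure_in V D. (\<lambda>n. B (\<lambda>x. w n x - v x) (\<lambda>x. w n x - v x)) \<longlonglongrightarrow> 0"
    if w: "\<And>n. w n \<in> closure_in V D"
      and c: "\<forall>e>0. \<exists>N. \<forall>m\<ge>N. \<forall>n\<ge>N. B (\<lambda>x. w m x - w n x) (\<lambda>x. w m x - w n x) < e" for w
  proof -
    have wV: "w n \<in> V" for n using w by (auto simp: closure_in_def)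
    then obtain v where v: "v \<in> V" "(\<lambda>n. B (\<lambda>x. w n x - v x) (\<lambda>x. w n x - v x)) \<longlonglongrightarrow> 0"
      using V c unfolding complete_sub_def by blast
    have "\<exists>d\<in>D. ?n (\<lambda>x. d x - v x) < e" if e0: "e > 0" for e
    proof -
      have "(\<lambda>n. ?n (\<lambda>x. w n x - v x)) \<longlonglongrightarrow> sqrt 0" by (intro tendsto_intros v)
      then have "\<forall>\<^sub>F n in sequentially. ?n (\<lambda>x. w n x - v x) < e / 2" using e0 by (intro order_tendstoD) auto
      then obtain n where n: "?n (\<lambda>x. w n x - v x) < e / 2" by (auto simp: eventually_sequentially)
      obtain d where d: "d \<in> D" "?n (\<lambda>x. d x - w n x) < e / 2" using w[of n] e0 unfolding cl by (meson half_gt_zero)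
      have "?n (\<lambda>x. d x - v x) \<le> ?n (\<lambda>x. d x - w n x) + ?n (\<lambda>x. w n x - v x)"
        using d DX wV[of n] v VX by (intro triangle_diff) auto
      then show ?thesis using d n by force
    qed
    then have "v \<in> closure_in V D" using v cl by blast
    then show ?thesis using v(2) by blast
  qed
  then show ?thesis unfolding complete_sub_def using D_sub D VX lin' by (auto simp: closure_in_def)
qed

end

section \<open>The space of square-integrable functions\<close>

lemma L2_measurable [measurable_dest]: "f \<in> L2 \<Longrightarrow> f \<in> borel_measurable lborel"
  by (simp add: L2_def)

lemma L2_integrable: "f \<in> L2 \<Longrightarrow> integrable lborel (\<lambda>x. (norm (f x))\<^sup>2)"
  by (simp add: L2_def)

lemma L2I:
  assumes "f \<in> borel_measurable lborel" "integrable lborel g" "\<And>x. (norm (f x))\<^sup>2 \<le> g x"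
  shows "f \<in> L2"
proof -
  have "integrable lborel (\<lambda>x. (norm (f x))\<^sup>2)"
    using assms(1) by (intro Bochner_Integration.integrable_bound[OF assms(2)]) (auto intro!: always_eventually order_trans[OF assms(3)])
  then show ?thesis using assms(1) by (simp add: L2_def)
qed

lemma power2_norm_add_le:
  fixes a b :: "'b::real_normed_vector"
  shows "(norm (a + b))\<^sup>2 \<le> 2 * (norm a)\<^sup>2 + 2 * (norm b)\<^sup>2"
proof -
  have "(norm (a + b))\<^sup>2 \<le> (norm a + norm b)\<^sup>2" by (simp add: power_mono norm_triangle_ineq)
  also have "\<dots> \<le> 2 * (norm a)\<^sup>2 + 2 * (norm b)\<^sup>2"
    using sum_squares_bound[of "norm a" "norm b"] by (simp add: power2_sum)
  finally show ?thesis .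
qed

lemma L2_lin:
  fixes f g :: "R3 \<Rightarrow> 'b::euclidean_space"
  assumes "f \<in> L2" "g \<in> L2"
  shows "(\<lambda>x. f x + c *\<^sub>R g x) \<in> L2"
proof (rule L2I)
  show "(\<lambda>x. f x + c *\<^sub>R g x) \<in> borel_measurable lborel" using assms by measurable
  show "integrable lborel (\<lambda>x. 2 * (norm (f x))\<^sup>2 + 2 * (c\<^sup>2 * (norm (g x))\<^sup>2))"
    using assms by (auto simp: L2_integrable)
  show "(norm (f x + c *\<^sub>R g x))\<^sup>2 \<le> 2 * (norm (f x))\<^sup>2 + 2 * (c\<^sup>2 * (norm (g x))\<^sup>2)" for x
    using power2_norm_add_le[of "f x" "c *\<^sub>R g x"] by (simp add: power_mult_distrib)
qed

lemma L2_mult_integrable_norm: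
  fixes f :: "R3 \<Rightarrow> 'b::euclidean_space" and g :: "R3 \<Rightarrow> 'c::euclidean_space"
  assumes "f \<in> L2" "g \<in> L2"
  shows "integrable lborel (\<lambda>x. norm (f x) * norm (g x))"
proof (rule Bochner_Integration.integrable_bound)
  show "integrable lborel (\<lambda>x. (norm (f x))\<^sup>2 + (norm (g x))\<^sup>2)"
    using assms by (auto simp: L2_integrable)
  show "(\<lambda>x. norm (f x) * norm (g x)) \<in> borel_measurable lborel" using assms by measurable
  have "norm (f x) * norm (g x) \<le> (norm (f x))\<^sup>2 + (norm (g x))\<^sup>2" for x
  proof -
    have "0 \<le> norm (f x) * norm (g x)" by simp
    then show ?thesis using sum_squares_bound[of "norm (f x)" "norm (g x)"] by linarith
  qed
  then show "AE x in lborel. norm (norm (f x) * norm (g x)) \<le> norm ((norm (f x))\<^sup>2 + (norm (g x))\<^sup>2)"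
    by (auto intro!: always_eventually simp: abs_mult)
qed

lemma L2_mult_integrable:
  fixes f g :: "R3 \<Rightarrow> 'b::{euclidean_space, real_normed_algebra}"
  assumes "f \<in> L2" "g \<in> L2"
  shows "integrable lborel (\<lambda>x. f x * g x)"
proof (rule Bochner_Integration.integrable_bound[OF L2_mult_integrable_norm[OF assms]])
  show "(\<lambda>x. f x * g x) \<in> borel_measurable lborel" using assms by measurable
qed (auto intro!: always_eventually simp: norm_mult_ineq)

lemma L2_inner_integrable:
  fixes f g :: "R3 \<Rightarrow> 'b::euclidean_space"
  assumes "f \<in> L2" "g \<in> L2"
  shows "integrable lborel (\<lambda>x. f x \<bullet> g x)"
proof (rule Bochner_Integration.integrable_bound[OF L2_mult_integrable_norm[OF assms]])
  show "(\<lambda>x. f x \<bullet> g x) \<in> borel_measurable lborel" using assms by measurable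
qed (auto intro!: always_eventually simp: Cauchy_Schwarz_ineq2)

definition inner_L2 :: "(R3 \<Rightarrow> 'b::euclidean_space) \<Rightarrow> (R3 \<Rightarrow> 'b) \<Rightarrow> real" where
  "inner_L2 f g = (LINT x|lborel. f x \<bullet> g x)"

definition norm_L2 :: "(R3 \<Rightarrow> 'b::euclidean_space) \<Rightarrow> real" where
  "norm_L2 f = sqrt (LINT x|lborel. (norm (f x))\<^sup>2)"

interpretation L2: semi_inner "L2 :: (R3 \<Rightarrow> 'b::euclidean_space) set" inner_L2
proof
  fix u v w :: "R3 \<Rightarrow> 'b" and c :: real
  show "u \<in> L2 \<Longrightarrow> v \<in> L2 \<Longrightarrow> (\<lambda>x. u x + c *\<^sub>R v x) \<in> L2" by (rule L2_lin)
  show "inner_L2 u v = inner_L2 v u" by (simp add: inner_L2_def inner_commute)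
  show "inner_L2 (\<lambda>x. u x + c *\<^sub>R v x) w = inner_L2 u w + c * inner_L2 v w" if "u \<in> L2" "v \<in> L2" "w \<in> L2"
    using that by (simp add: inner_L2_def inner_add_left L2_inner_integrable)
  show "0 \<le> inner_L2 u u" by (auto simp: inner_L2_def intro!: integral_nonneg_AE)
qed

lemma norm_L2_eq: "norm_L2 f = sqrt (inner_L2 f f)"
  by (simp add: norm_L2_def inner_L2_def power2_norm_eq_inner)

lemma norm_L2_nonneg [simp]: "0 \<le> norm_L2 f"
  by (auto simp: norm_L2_def intro!: integral_nonneg_AE)

lemma norm_L2_square: "(norm_L2 f)\<^sup>2 = (LINT x|lborel. (norm (f x))\<^sup>2)"
  by (auto simp: norm_L2_def intro!: real_sqrt_pow2 integral_nonneg_AE)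

lemma norm_L2_norm [simp]: "norm_L2 (\<lambda>x. norm (f x)) = norm_L2 f"
  by (simp add: norm_L2_def)

lemma norm_L2_scale [simp]: "norm_L2 (\<lambda>x. c *\<^sub>R f x) = \<bar>c\<bar> * norm_L2 f"
  by (simp add: norm_L2_def power_mult_distrib real_sqrt_mult)

lemma norm_L2_minus_commute: "norm_L2 (\<lambda>x. f x - g x) = norm_L2 (\<lambda>x. g x - f x)"
  by (simp add: norm_L2_def norm_minus_commute)

lemma norm_L2_triangle:
  "f \<in> L2 \<Longrightarrow> g \<in> L2 \<Longrightarrow> norm_L2 (\<lambda>x. f x + g x) \<le> norm_L2 f + norm_L2 g"
  unfolding norm_L2_eq by (rule L2.triangle)

lemma norm_L2_triangle_diff:
  "f \<in> L2 \<Longrightarrow> g \<in> L2 \<Longrightarrow> h \<in> L2 \<Longrightarrow>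
    norm_L2 (\<lambda>x. f x - h x) \<le> norm_L2 (\<lambda>x. f x - g x) + norm_L2 (\<lambda>x. g x - h x)"
  unfolding norm_L2_eq by (rule L2.triangle_diff)

lemma L2_norm_mem: "f \<in> L2 \<Longrightarrow> (\<lambda>x. norm (f x)) \<in> L2"
  by (auto simp: L2_def)

lemma L2_cauchy_schwarz:
  fixes f :: "R3 \<Rightarrow> 'b::euclidean_space" and g :: "R3 \<Rightarrow> 'c::euclidean_space"
  assumes "f \<in> L2" "g \<in> L2"
  shows "(LINT x|lborel. norm (f x) * norm (g x)) \<le> norm_L2 f * norm_L2 g"
proof -
  have "\<bar>inner_L2 (\<lambda>x. norm (f x)) (\<lambda>x. norm (g x))\<bar> \<le> norm_L2 (\<lambda>x. norm (f x)) * norm_L2 (\<lambda>x. norm (g x))"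
    unfolding norm_L2_eq by (intro L2.cauchy_schwarz_abs L2_norm_mem assms)
  then show ?thesis by (simp add: inner_L2_def)
qed

lemma L2_mult_bound:
  fixes f g :: "R3 \<Rightarrow> 'b::{euclidean_space, real_normed_algebra}"
  assumes "f \<in> L2" "g \<in> L2"
  shows "norm (LINT x|lborel. f x * g x) \<le> norm_L2 f * norm_L2 g"
proof -
  have "norm (LINT x|lborel. f x * g x) \<le> (LINT x|lborel. norm (f x) * norm (g x))"
    by (intro Bochner_Integration.integral_norm_bound_integral L2_mult_integrable L2_mult_integrable_norm assms norm_mult_ineq)
  also have "\<dots> \<le> norm_L2 f * norm_L2 g" by (rule L2_cauchy_schwarz[OF assms])
  finally show ?thesis .
qed

lemma L2_mono:
  fixes f :: "R3 \<Rightarrow> 'b::euclidean_space" and g :: "R3 \<Rightarrow> 'c::euclidean_space"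
  assumes "f \<in> borel_measurable lborel" "g \<in> L2" "\<And>x. norm (f x) \<le> C * norm (g x)"
  shows "f \<in> L2"
  using assms(1)
proof (rule L2I)
  show "integrable lborel (\<lambda>x. C\<^sup>2 * (norm (g x))\<^sup>2)" using assms(2) by (auto simp: L2_integrable)
  show "(norm (f x))\<^sup>2 \<le> C\<^sup>2 * (norm (g x))\<^sup>2" for x
    using power_mono[OF assms(3)[of x], of 2] by (simp add: power_mult_distrib)
qed

lemma norm_L2_mono:
  fixes f :: "R3 \<Rightarrow> 'b::euclidean_space" and g :: "R3 \<Rightarrow> 'c::euclidean_space"
  assumes "f \<in> borel_measurable lborel" "g \<in> L2" "\<And>x. norm (f x) \<le> C * norm (g x)" "C \<ge> 0"
  shows "norm_L2 f \<le> C * norm_L2 g"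
proof -
  have "norm_L2 f \<le> norm_L2 (\<lambda>x. C *\<^sub>R g x)"
    unfolding norm_L2_def
  proof (intro real_sqrt_le_mono integral_mono)
    show "integrable lborel (\<lambda>x. (norm (f x))\<^sup>2)" using L2_mono[OF assms(1-3)] by (rule L2_integrable)
    show "integrable lborel (\<lambda>x. (norm (C *\<^sub>R g x))\<^sup>2)" using assms(2) by (auto simp: L2_integrable power_mult_distrib)
    show "(norm (f x))\<^sup>2 \<le> (norm (C *\<^sub>R g x))\<^sup>2" for x
      using power_mono[OF assms(3)[of x], of 2] assms(4) by simp
  qed
  then show ?thesis using assms(4) by simp
qed

lemma L2_cong_AE:
  assumes "f \<in> L2" "g \<in> borel_measurable lborel" "AE x in lborel. f x = g x"
  shows "g \<in> L2"
proof -
  have "integrable lborel (\<lambda>x. (norm (g x))\<^sup>2)"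
    using L2_integrable[OF assms(1)]
  proof (rule Bochner_Integration.integrable_bound)
    show "(\<lambda>x. (norm (g x))\<^sup>2) \<in> borel_measurable lborel" using assms(2) by measurable
    show "AE x in lborel. norm ((norm (g x))\<^sup>2) \<le> norm ((norm (f x))\<^sup>2)" using assms(3) by eventually_elim simp
  qed
  then show ?thesis using assms by (simp add: L2_def)
qed

lemma norm_L2_cong_AE:
  assumes "f \<in> borel_measurable lborel" "g \<in> borel_measurable lborel" "AE x in lborel. f x = g x"
  shows "norm_L2 f = norm_L2 g"
  unfolding norm_L2_def using assms
  by (intro arg_cong[where f=sqrt] integral_cong_AE) (auto elim: eventually_mono)

lemma norm_L2_zero_AE:
  assumes "f \<in> L2" "norm_L2 f = 0"
  shows "AE x in lborel. f x = 0"
proof -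
  have "(LINT x|lborel. (norm (f x))\<^sup>2) = 0" using assms(2) norm_L2_square[of f] by simp
  then have "AE x in lborel. (norm (f x))\<^sup>2 = 0"
    using L2_integrable[OF assms(1)] by (subst (asm) integral_nonneg_eq_0_iff_AE) auto
  then show ?thesis by eventually_elim simp
qed

text \<open>Joint continuity of the product integral, from F G - f g = (F - f)(G - g) + (F - f) g +
  f (G - g). Many passages to the limit below are instances, often with a constant second
  sequence.\<close>

lemma tendsto_L2_mult:
  fixes f g :: "R3 \<Rightarrow> 'b::{euclidean_space, real_normed_algebra}"
  assumes fn: "\<And>n. F n \<in> L2" "f \<in> L2" "(\<lambda>n. norm_L2 (\<lambda>x. F n x - f x)) \<longlonglongrightarrow> 0"
    and gn: "\<And>n. G n \<in> L2" "g \<in> L2" "(\<lambda>n. norm_L2 (\<lambda>x. G n x - g x)) \<longlonglongrightarrow> 0"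
  shows "(\<lambda>n. LINT x|lborel. F n x * G n x) \<longlonglongrightarrow> (LINT x|lborel. f x * g x)"
proof (rule LIM_zero_cancel, rule tendsto_norm_zero_cancel, rule tendsto_sandwich[OF _ _ tendsto_const])
  let ?a = "\<lambda>n. norm_L2 (\<lambda>x. F n x - f x)" and ?b = "\<lambda>n. norm_L2 (\<lambda>x. G n x - g x)"
  show "(\<lambda>n. ?a n * ?b n + ?a n * norm_L2 g + norm_L2 f * ?b n) \<longlonglongrightarrow> 0"
  proof -
    have "(\<lambda>n. ?a n * ?b n + ?a n * norm_L2 g + norm_L2 f * ?b n) \<longlonglongrightarrow> 0 * 0 + 0 * norm_L2 g + norm_L2 f * 0"
      by (rule tendsto_add[OF tendsto_add[OF tendsto_mult[OF fn(3) gn(3)] tendsto_mult[OF fn(3) tendsto_const]] tendsto_mult[OF tendsto_const gn(3)]])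
    then show ?thesis by simp
  qed
  have "norm ((LINT x|lborel. F n x * G n x) - (LINT x|lborel. f x * g x)) \<le> ?a n * ?b n + ?a n * norm_L2 g + norm_L2 f * ?b n" for n
  proof -
    have d: "(\<lambda>x. F n x - f x) \<in> L2" "(\<lambda>x. G n x - g x) \<in> L2" by (intro L2.diff_mem fn gn)+
    have "(LINT x|lborel. F n x * G n x) - (LINT x|lborel. f x * g x) = (LINT x|lborel. F n x * G n x - f x * g x)"
      by (simp add: L2_mult_integrable fn gn)
    also have "\<dots> = (LINT x|lborel. (F n x - f x) * (G n x - g x) + (F n x - f x) * g x + f x * (G n x - g x))"
      by (intro Bochner_Integration.integral_cong refl) (simp add: algebra_simps)
    also have "\<dots> = (LINT x|lborel. (F n x - f x) * (G n x - g x)) + (LINT x|lborel. (F n x - f x) * g x) + (LINT x|lborel. f x * (G n x - g x))"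
      by (simp add: L2_mult_integrable fn gn d)
    finally have "norm ((LINT x|lborel. F n x * G n x) - (LINT x|lborel. f x * g x))
      \<le> norm (LINT x|lborel. (F n x - f x) * (G n x - g x)) + norm (LINT x|lborel. (F n x - f x) * g x)
        + norm (LINT x|lborel. f x * (G n x - g x))"
      by (metis (no_types, lifting) add_right_mono norm_triangle_ineq order_trans)
    then show ?thesis
      using L2_mult_bound[OF d] L2_mult_bound[OF d(1) gn(2)] L2_mult_bound[OF fn(2) d(2)] by linarith
  qed
  then show "\<forall>\<^sub>F n in sequentially. norm ((LINT x|lborel. F n x * G n x) - (LINT x|lborel. f x * g x)) \<le> ?a n * ?b n + ?a n * norm_L2 g + norm_L2 f * ?b n"
    by (intro always_eventually allI)
qed (auto intro!: always_eventually)

lemma norm_L2_self_diff_tendsto: "(\<lambda>n. norm_L2 (\<lambda>x. f x - f x)) \<longlonglongrightarrow> 0"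
  by (simp add: norm_L2_def)

lemma tendsto_norm_L2:
  fixes f :: "R3 \<Rightarrow> 'b::euclidean_space"
  assumes fn: "\<And>n. F n \<in> L2" "f \<in> L2" "(\<lambda>n. norm_L2 (\<lambda>x. F n x - f x)) \<longlonglongrightarrow> 0"
  shows "(\<lambda>n. norm_L2 (F n)) \<longlonglongrightarrow> norm_L2 f"
proof (rule LIM_zero_cancel, rule tendsto_rabs_zero_cancel, rule tendsto_sandwich[OF _ _ tendsto_const fn(3)])
  have "\<bar>norm_L2 (F n) - norm_L2 f\<bar> \<le> norm_L2 (\<lambda>x. F n x - f x)" for n
    using norm_L2_triangle[OF L2.diff_mem[OF fn(1)[of n] fn(2)] fn(2)]
      norm_L2_triangle[OF L2.diff_mem[OF fn(2) fn(1)[of n]] fn(1)[of n]]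
      norm_L2_minus_commute[of "F n" f] by simp
  then show "\<forall>\<^sub>F n in sequentially. \<bar>norm_L2 (F n) - norm_L2 f\<bar> \<le> norm_L2 (\<lambda>x. F n x - f x)"
    by (intro always_eventually allI)
qed (auto intro!: always_eventually)

text \<open>The weights 4^n against the decay 8^(-n) leave a convergent series of integrals. The
  weighted sum of squares is thus finite almost everywhere, its terms are bounded there, and the
  increments are O(2^(-n)).\<close>

lemma AE_Cauchy_of_fast_L2:
  fixes f :: "nat \<Rightarrow> R3 \<Rightarrow> 'b::euclidean_space"
  assumes f: "\<And>n. f n \<in> L2"
    and fast: "\<And>n. (norm_L2 (\<lambda>x. f (Suc n) x - f n x))\<^sup>2 \<le> (1/8) ^ n"
  shows "AE x in lborel. Cauchy (\<lambda>n. f n x)"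
proof -
  have [measurable]: "f n \<in> borel_measurable lborel" for n using f by measurable
  have d: "integrable lborel (\<lambda>x. (norm (f (Suc n) x - f n x))\<^sup>2)" for n
    by (intro L2_integrable L2.diff_mem f)
  have "(\<integral>\<^sup>+ x. (\<Sum>n. ennreal (4 ^ n * (norm (f (Suc n) x - f n x))\<^sup>2)) \<partial>lborel)
      = (\<Sum>n. \<integral>\<^sup>+ x. ennreal (4 ^ n * (norm (f (Suc n) x - f n x))\<^sup>2) \<partial>lborel)"
    by (intro nn_integral_suminf) measurable
  also have "\<dots> \<le> (\<Sum>n. ennreal ((1/2) ^ n))"
  proof (intro suminf_le summableI)
    fix n
    have "(\<integral>\<^sup>+ x. ennreal (4 ^ n * (norm (f (Suc n) x - f n x))\<^sup>2) \<partial>lborel)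
      = ennreal (LINT x|lborel. 4 ^ n * (norm (f (Suc n) x - f n x))\<^sup>2)"
      using d[of n] by (intro nn_integral_eq_integral) auto
    also have "\<dots> = ennreal (4 ^ n * (norm_L2 (\<lambda>x. f (Suc n) x - f n x))\<^sup>2)"
      by (simp add: norm_L2_square)
    also have "\<dots> \<le> ennreal (4 ^ n * (1/8) ^ n)" using fast[of n] by (intro ennreal_leI mult_left_mono) auto
    also have "4 ^ n * (1/8) ^ n = ((1/2) ^ n :: real)" by (simp flip: power_mult_distrib)
    finally show "(\<integral>\<^sup>+ x. ennreal (4 ^ n * (norm (f (Suc n) x - f n x))\<^sup>2) \<partial>lborel) \<le> ennreal ((1/2) ^ n)" .
  qed
  also have "\<dots> = ennreal (\<Sum>n. (1/2) ^ n)" by (intro suminf_ennreal2) (auto intro: summable_geometric)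
  also have "\<dots> < \<infinity>" by simp
  finally have fin: "(\<integral>\<^sup>+ x. (\<Sum>n. ennreal (4 ^ n * (norm (f (Suc n) x - f n x))\<^sup>2)) \<partial>lborel) \<noteq> \<infinity>" by simp
  have "AE x in lborel. (\<Sum>n. ennreal (4 ^ n * (norm (f (Suc n) x - f n x))\<^sup>2)) \<noteq> \<infinity>"
    by (rule nn_integral_PInf_AE[OF _ fin]) measurable
  then show ?thesis
  proof eventually_elim
    case (elim x)
    have "summable (\<lambda>n. 4 ^ n * (norm (f (Suc n) x - f n x))\<^sup>2)"
      using elim by (intro summable_suminf_not_top) auto
    then have "(\<lambda>n. 4 ^ n * (norm (f (Suc n) x - f n x))\<^sup>2) \<longlonglongrightarrow> 0" by (rule summable_LIMSEQ_zero)
    then have "Bseq (\<lambda>n. 4 ^ n * (norm (f (Suc n) x - f n x))\<^sup>2)" by (intro convergent_imp_Bseq convergentI)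
    then obtain K where K: "K > 0" "\<And>n. norm (4 ^ n * (norm (f (Suc n) x - f n x))\<^sup>2) \<le> K" by (auto simp: Bseq_def)
    have "norm (f (Suc n) x - f n x) \<le> sqrt K * (1/2) ^ n" for n
    proof -
      have "(2 ^ n * norm (f (Suc n) x - f n x))\<^sup>2 \<le> K"
        using K(2)[of n] by (simp add: power_mult_distrib power_mult[symmetric] mult.commute[of n 2] power_mult)
      then have "2 ^ n * norm (f (Suc n) x - f n x) \<le> sqrt K" by (rule real_le_rsqrt)
      then show ?thesis by (simp add: field_simps)
    qed
    moreover have "summable (\<lambda>n. sqrt K * (1/2) ^ n)" by (intro summable_mult summable_geometric) simp
    ultimately have "summable (\<lambda>n. f (Suc n) x - f n x)"
      by (rule summable_comparison_test'[where N=0, rotated])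
    then have "convergent (\<lambda>n. \<Sum>i<n. f (Suc i) x - f i x)" by (simp add: summable_iff_convergent)
    then have "convergent (\<lambda>n. (f n x - f 0 x) + f 0 x)"
      by (intro convergent_add convergent_const) (simp add: sum_lessThan_telescope[of "\<lambda>n. f n x", symmetric])
    then show "Cauchy (\<lambda>n. f n x)" by (simp add: convergent_Cauchy)
  qed
qed

text \<open>Riesz-Fischer: a subsequence with fast increments converges almost everywhere, and
  Fatou's lemma turns that pointwise limit into an L2 limit of the whole sequence.\<close>

theorem L2_complete:
  fixes f :: "nat \<Rightarrow> R3 \<Rightarrow> 'b::euclidean_space"
  assumes f: "\<And>n. f n \<in> L2"
    and cau: "\<And>e. e > 0 \<Longrightarrow> \<exists>N. \<forall>m\<ge>N. \<forall>n\<ge>N. norm_L2 (\<lambda>x. f m x - f n x) < e"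
  shows "\<exists>g\<in>L2. (\<lambda>n. norm_L2 (\<lambda>x. f n x - g x)) \<longlonglongrightarrow> 0"
proof -
  have [measurable]: "f n \<in> borel_measurable lborel" for n using f by measurable
  have "\<exists>N. \<forall>m\<ge>N. \<forall>n\<ge>N. (norm_L2 (\<lambda>x. f m x - f n x))\<^sup>2 \<le> (1/8) ^ k" for k
  proof -
    obtain N where N: "\<And>m n. m \<ge> N \<Longrightarrow> n \<ge> N \<Longrightarrow> norm_L2 (\<lambda>x. f m x - f n x) < sqrt ((1/8) ^ k)"
      using cau[of "sqrt ((1/8) ^ k)"] by auto
    then have "(norm_L2 (\<lambda>x. f m x - f n x))\<^sup>2 \<le> (1/8) ^ k" if "m \<ge> N" "n \<ge> N" for m n
      using power_mono[OF less_imp_le[OF N[OF that]], of 2] by simp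
    then show ?thesis by blast
  qed
  then obtain N where N: "\<And>k m n. m \<ge> N k \<Longrightarrow> n \<ge> N k \<Longrightarrow> (norm_L2 (\<lambda>x. f m x - f n x))\<^sup>2 \<le> (1/8) ^ k" by metis
  \<comment> \<open>Summing all earlier thresholds makes r monotone and at least N k, even when N is
    not monotone; the summand k makes r tend to infinity.\<close>
  define r where "r = (\<lambda>k. (\<Sum>i\<le>k. N i) + k)"
  have rN: "r k \<ge> N k" for k unfolding r_def using member_le_sum[of k "{..k}" N] by (simp add: trans_le_add1)
  have rs: "r (Suc k) \<ge> r k" for k by (simp add: r_def)
  have rk: "r k \<ge> k" for k by (simp add: r_def)
  have C: "AE x in lborel. Cauchy (\<lambda>k. f (r k) x)"
  proof (rule AE_Cauchy_of_fast_L2[OF f])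
    show "(norm_L2 (\<lambda>x. f (r (Suc n)) x - f (r n) x))\<^sup>2 \<le> (1/8) ^ n" for n
      using rN[of n] rs[of n] by (intro N) auto
  qed
  \<comment> \<open>The value 0 off the convergence set makes g the everywhere pointwise limit of
    cut-off measurable functions, hence Borel measurable.\<close>
  define g where "g = (\<lambda>x. if Cauchy (\<lambda>k. f (r k) x) then lim (\<lambda>k. f (r k) x) else 0)"
  have [measurable]: "Measurable.pred lborel (\<lambda>x. Cauchy (\<lambda>k. f (r k) x))"
    unfolding pred_def by (rule sets_Collect_Cauchy) measurable
  have g[measurable]: "g \<in> borel_measurable lborel"
  proof (rule borel_measurable_LIMSEQ_metric)
    show "(\<lambda>x. if Cauchy (\<lambda>k. f (r k) x) then f (r i) x else 0) \<in> borel_measurable lborel" for i by measurable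
    show "(\<lambda>i. if Cauchy (\<lambda>k. f (r k) x) then f (r i) x else 0) \<longlonglongrightarrow> g x" for x
      by (auto simp: g_def Cauchy_convergent_iff convergent_LIMSEQ_iff)
  qed
  have lim: "AE x in lborel. (\<lambda>k. f (r k) x) \<longlonglongrightarrow> g x"
    using C by eventually_elim (auto simp: g_def Cauchy_convergent_iff convergent_LIMSEQ_iff)
  have fatou: "(\<integral>\<^sup>+ x. ennreal ((norm (f n x - g x))\<^sup>2) \<partial>lborel) \<le> ennreal (e\<^sup>2)"
    if e: "e > 0" and M: "\<And>m. m \<ge> M \<Longrightarrow> norm_L2 (\<lambda>x. f n x - f m x) < e" for e n M
  proof -
    have "(\<integral>\<^sup>+ x. ennreal ((norm (f n x - g x))\<^sup>2) \<partial>lborel) = (\<integral>\<^sup>+ x. liminf (\<lambda>k. ennreal ((norm (f n x - f (r k) x))\<^sup>2)) \<partial>lborel)"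
    proof (intro nn_integral_cong_AE)
      show "AE x in lborel. ennreal ((norm (f n x - g x))\<^sup>2) = liminf (\<lambda>k. ennreal ((norm (f n x - f (r k) x))\<^sup>2))"
        using lim
      proof eventually_elim
        case (elim x)
        have "(\<lambda>k. ennreal ((norm (f n x - f (r k) x))\<^sup>2)) \<longlonglongrightarrow> ennreal ((norm (f n x - g x))\<^sup>2)"
          by (intro tendsto_ennrealI tendsto_intros elim)
        then show ?case by (intro lim_imp_Liminf[symmetric]) simp_all
      qed
    qed
    also have "\<dots> \<le> liminf (\<lambda>k. \<integral>\<^sup>+ x. ennreal ((norm (f n x - f (r k) x))\<^sup>2) \<partial>lborel)"
      by (intro nn_integral_liminf) measurable
    also have "\<dots> \<le> ennreal (e\<^sup>2)"
    proof -
      have "(\<integral>\<^sup>+ x. ennreal ((norm (f n x - f (r k) x))\<^sup>2) \<partial>lborel) \<le> ennreal (e\<^sup>2)" if "k \<ge> M" for k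
      proof -
        have "(\<integral>\<^sup>+ x. ennreal ((norm (f n x - f (r k) x))\<^sup>2) \<partial>lborel) = ennreal ((norm_L2 (\<lambda>x. f n x - f (r k) x))\<^sup>2)"
          unfolding norm_L2_square by (intro nn_integral_eq_integral L2_integrable L2.diff_mem f) auto
        also have "\<dots> \<le> ennreal (e\<^sup>2)"
          using M[of "r k"] that rk[of k] by (intro ennreal_leI power_mono) auto
        finally show ?thesis .
      qed
      then show ?thesis by (intro Liminf_le) (auto intro!: eventually_sequentiallyI[of M])
    qed
    finally show ?thesis .
  qed
  have fgL2: "(\<lambda>x. f n x - g x) \<in> L2 \<and> norm_L2 (\<lambda>x. f n x - g x) \<le> e"
    if e: "e > 0" and M: "\<And>m. m \<ge> M \<Longrightarrow> norm_L2 (\<lambda>x. f n x - f m x) < e" for e n M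
  proof -
    have ft: "(\<integral>\<^sup>+ x. ennreal ((norm (f n x - g x))\<^sup>2) \<partial>lborel) \<le> ennreal (e\<^sup>2)" using fatou[OF that] .
    have i: "integrable lborel (\<lambda>x. (norm (f n x - g x))\<^sup>2)"
    proof (rule integrableI_nonneg)
      show "(\<integral>\<^sup>+ x. ennreal ((norm (f n x - g x))\<^sup>2) \<partial>lborel) < \<infinity>" using ft by (auto simp: le_less_trans)
    qed auto
    have "(LINT x|lborel. (norm (f n x - g x))\<^sup>2) \<le> e\<^sup>2"
      using ft nn_integral_eq_integral[OF i] by (simp add: ennreal_le_iff)
    then show ?thesis using i e unfolding L2_def norm_L2_def by (auto intro!: real_le_lsqrt)
  qed
  obtain N0 where N0: "\<And>m. m \<ge> N0 \<Longrightarrow> norm_L2 (\<lambda>x. f N0 x - f m x) < 1" using cau[of 1] by auto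
  have "(\<lambda>x. f N0 x - g x) \<in> L2" using fgL2[of 1 N0 N0] N0 by auto
  from L2.diff_mem[OF f[of N0] this] have "g \<in> L2" by simp
  moreover have "(\<lambda>n. norm_L2 (\<lambda>x. f n x - g x)) \<longlonglongrightarrow> 0"
  proof (rule LIMSEQ_I)
    fix e :: real assume "e > 0"
    then obtain M where M: "\<And>m n. m \<ge> M \<Longrightarrow> n \<ge> M \<Longrightarrow> norm_L2 (\<lambda>x. f m x - f n x) < e / 2" using cau[of "e/2"] by auto
    have "norm_L2 (\<lambda>x. f n x - g x) < e" if "n \<ge> M" for n
      using fgL2[of "e/2" M n] M[OF that] \<open>e > 0\<close> by fastforce
    then show "\<exists>no. \<forall>n\<ge>no. norm (norm_L2 (\<lambda>x. f n x - g x) - 0) < e" by auto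
  qed
  ultimately show ?thesis by blast
qed

section \<open>Smooth test functions, integration by parts and the fundamental lemma\<close>

section \<open>Smooth functions\<close>

lemma partial_eq:
  assumes "(f has_derivative f') (at x)"
  shows "partial j f x = f' (axis j 1)"
  using frechet_derivative_at[OF assms] by (simp add: partial_def)

lemma has_derivative_frechet: "f differentiable (at x) \<Longrightarrow> (f has_derivative frechet_derivative f (at x)) (at x)"
  by (simp add: frechet_derivative_works)

lemma partial_cong_open:
  assumes "f differentiable (at x)" "open S" "x \<in> S" "\<And>y. y \<in> S \<Longrightarrow> f y = g y"
  shows "partial j f x = partial j g x"
  unfolding partial_def by (subst frechet_derivative_transform_within_open[OF assms]) simp_all

lemma partial_const [simp]: "partial j (\<lambda>x. c) = (\<lambda>x. 0)"
  by (simp add: partial_def fun_eq_iff)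

lemma partial_add:
  assumes "f differentiable (at x)" "g differentiable (at x)"
  shows "partial j (\<lambda>x. f x + g x) x = partial j f x + partial j g x"
  using partial_eq[OF has_derivative_add[OF assms[THEN has_derivative_frechet]]] by (simp add: partial_def)

lemma partial_bilinear:
  assumes "bounded_bilinear P" "f differentiable (at x)" "g differentiable (at x)"
  shows "partial j (\<lambda>x. P (f x) (g x)) x = P (partial j f x) (g x) + P (f x) (partial j g x)"
  using partial_eq[OF bounded_bilinear.FDERIV[OF assms(1) assms(2,3)[THEN has_derivative_frechet]]]
  by (simp add: partial_def add.commute)

lemma partial_linear:
  assumes "bounded_linear T" "f differentiable (at x)"
  shows "partial j (\<lambda>x. T (f x)) x = T (partial j f x)"
  using partial_eq[OF bounded_linear.has_derivative[OF assms(1) assms(2)[THEN has_derivative_frechet]]]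
  by (simp add: partial_def)

lemma differentiable_linear:
  assumes "bounded_linear T" "f differentiable F"
  shows "(\<lambda>x. T (f x)) differentiable F"
  using assms bounded_linear.has_derivative unfolding differentiable_def by blast

lemma differentiable_bilinear:
  assumes "bounded_bilinear P" "f differentiable (at x)" "g differentiable (at x)"
  shows "(\<lambda>x. P (f x) (g x)) differentiable (at x)"
  using assms bounded_bilinear.FDERIV unfolding differentiable_def by blast

text \<open>Smoothness counted by order. \<open>ipartial\<close> adds derivatives on the outside,
  whereas here the innermost derivative is peeled off; in this form the sum and product rules go
  through by induction on the order.\<close>

primrec times_diff :: "nat \<Rightarrow> (R3 \<Rightarrow> 'b::real_normed_vector) \<Rightarrow> bool" where
  "times_diff 0 f \<longleftrightarrow> (\<forall>x. f differentiable (at x))"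
| "times_diff (Suc n) f \<longleftrightarrow> (\<forall>x. f differentiable (at x)) \<and> (\<forall>j. times_diff n (partial j f))"

lemma ipartial_append: "ipartial (js @ [j]) f = ipartial js (partial j f)"
  by (induction js) auto

lemma smooth_iff_partial: "smooth f \<longleftrightarrow> (\<forall>x. f differentiable (at x)) \<and> (\<forall>j. smooth (partial j f))"
proof
  assume f: "smooth f"
  have "f differentiable (at x)" for x using f[unfolded smooth_def, rule_format, of "[]" x] by simp
  moreover have "smooth (partial j f)" for j
    using f unfolding smooth_def by (auto simp: ipartial_append[symmetric])
  ultimately show "(\<forall>x. f differentiable (at x)) \<and> (\<forall>j. smooth (partial j f))" by blast
next
  assume f: "(\<forall>x. f differentiable (at x)) \<and> (\<forall>j. smooth (partial j f))"
  show "smooth f" unfolding smooth_def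
  proof (intro allI)
    fix js x show "ipartial js f differentiable (at x)"
    proof (cases js rule: rev_exhaust)
      case (snoc ks k)
      then show ?thesis using f by (simp add: ipartial_append smooth_def)
    qed (use f in simp)
  qed
qed

lemma smoothD: "smooth f \<Longrightarrow> f differentiable (at x)"
  using smooth_iff_partial by blast

lemma smooth_partial: "smooth f \<Longrightarrow> smooth (partial j f)"
  using smooth_iff_partial by blast

lemma smooth_iff_times_diff: "smooth f \<longleftrightarrow> (\<forall>n. times_diff n f)"
proof
  show "smooth f \<Longrightarrow> \<forall>n. times_diff n f"
  proof
    fix n show "smooth f \<Longrightarrow> times_diff n f"
      by (induction n arbitrary: f) (auto intro: smoothD smooth_partial)
  qed
  assume t: "\<forall>n. times_diff n f"
  have "times_diff (length js) f \<Longrightarrow> ipartial js f differentiable (at x)" for js x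
  proof (induction js arbitrary: f rule: rev_induct)
    case (snoc j js)
    then show ?case by (simp add: ipartial_append)
  qed simp
  then show "smooth f" using t by (simp add: smooth_def)
qed

lemma times_diff_Suc: "times_diff (Suc n) f \<Longrightarrow> times_diff n f"
proof (induction n arbitrary: f)
  case (Suc n)
  have d: "\<forall>x. f differentiable (at x)" and p: "\<And>j. times_diff (Suc n) (partial j f)"
    using Suc.prems by simp_all
  have "times_diff n (partial j f)" for j by (rule Suc.IH[OF p])
  then show ?case using d by simp
qed simp

lemma times_diff_const: "times_diff n (\<lambda>x. c)"
proof (induction n arbitrary: c)
  case (Suc n)
  show ?case using Suc by (simp add: partial_def)
qed simp

lemma times_diff_add: "times_diff n f \<Longrightarrow> times_diff n g \<Longrightarrow> times_diff n (\<lambda>x. f x + g x)"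
proof (induction n arbitrary: f g)
  case (Suc n)
  have "partial j (\<lambda>x. f x + g x) = (\<lambda>x. partial j f x + partial j g x)" for j
    using Suc.prems by (intro ext partial_add) auto
  then show ?case using Suc by auto
qed auto

lemma times_diff_bilinear:
  assumes P: "bounded_bilinear P"
  shows "times_diff n f \<Longrightarrow> times_diff n g \<Longrightarrow> times_diff n (\<lambda>x. P (f x) (g x))"
proof (induction n arbitrary: f g)
  case 0 then show ?case using differentiable_bilinear[OF P, of f _ g] by auto
next
  case (Suc n)
  have e: "partial j (\<lambda>x. P (f x) (g x)) = (\<lambda>x. P (partial j f x) (g x) + P (f x) (partial j g x))" for j
    using Suc.prems by (intro ext partial_bilinear[OF P]) auto
  have "times_diff n f" "times_diff n g" using Suc.prems times_diff_Suc by blast+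
  moreover have "times_diff n (partial j f)" "times_diff n (partial j g)" for j
    using Suc.prems by auto
  ultimately have "times_diff n (partial j (\<lambda>x. P (f x) (g x)))" for j
    unfolding e by (intro times_diff_add Suc.IH)
  moreover have "(\<lambda>x. P (f x) (g x)) differentiable (at x)" for x
    using Suc.prems by (intro differentiable_bilinear[OF P]) auto
  ultimately show ?case by simp
qed

lemma times_diff_linear:
  assumes T: "bounded_linear T"
  shows "times_diff n f \<Longrightarrow> times_diff n (\<lambda>x. T (f x))"
proof (induction n arbitrary: f)
  case 0 then show ?case using differentiable_linear[OF T, of f] by auto
next
  case (Suc n)
  have e: "partial j (\<lambda>x. T (f x)) = (\<lambda>x. T (partial j f x))" for j
    using Suc.prems by (intro ext partial_linear[OF T]) auto
  have "times_diff n (partial j (\<lambda>x. T (f x)))" for j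
    unfolding e using Suc by auto
  moreover have "(\<lambda>x. T (f x)) differentiable (at x)" for x
    using Suc.prems by (intro differentiable_linear[OF T]) auto
  ultimately show ?case by simp
qed

lemma smooth_const: "smooth (\<lambda>x. c)"
  by (simp add: smooth_iff_times_diff times_diff_const)

lemma smooth_add: "smooth f \<Longrightarrow> smooth g \<Longrightarrow> smooth (\<lambda>x. f x + g x)"
  by (simp add: smooth_iff_times_diff times_diff_add)

lemma smooth_linear: "bounded_linear T \<Longrightarrow> smooth f \<Longrightarrow> smooth (\<lambda>x. T (f x))"
  by (simp add: smooth_iff_times_diff times_diff_linear)

lemma smooth_bilinear: "bounded_bilinear P \<Longrightarrow> smooth f \<Longrightarrow> smooth g \<Longrightarrow> smooth (\<lambda>x. P (f x) (g x))"
  by (simp add: smooth_iff_times_diff times_diff_bilinear)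

lemma smooth_mult:
  fixes f g :: "R3 \<Rightarrow> 'b::real_normed_algebra"
  shows "smooth f \<Longrightarrow> smooth g \<Longrightarrow> smooth (\<lambda>x. f x * g x)"
  by (rule smooth_bilinear[OF bounded_bilinear_mult])

lemma smooth_scaleR: "smooth f \<Longrightarrow> smooth (\<lambda>x. c *\<^sub>R f x)"
  by (rule smooth_linear[OF bounded_linear_scaleR_right])

lemma smooth_diff:
  assumes "smooth f" "smooth g"
  shows "smooth (\<lambda>x. f x - g x)"
  using smooth_add[OF assms(1) smooth_scaleR[OF assms(2), of "-1"]] by simp

lemma smooth_power:
  fixes f :: "R3 \<Rightarrow> 'b::real_normed_algebra_1"
  shows "smooth f \<Longrightarrow> smooth (\<lambda>x. f x ^ n)"
  by (induction n) (auto intro: smooth_const smooth_mult)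

lemma smooth_prod:
  fixes f :: "'i \<Rightarrow> R3 \<Rightarrow> real"
  assumes "\<And>i. i \<in> I \<Longrightarrow> smooth (f i)"
  shows "smooth (\<lambda>x. \<Prod>i\<in>I. f i x)"
  using assms
proof (induction I rule: infinite_finite_induct)
qed (auto intro: smooth_const smooth_mult)

lemma bounded_linear_nth: "bounded_linear (\<lambda>x::R3. x $ i)"
  by (rule bounded_linear_vec_nth)

lemma partial_nth: "partial j (\<lambda>x. x $ i) = (\<lambda>x. axis j 1 $ i)"
  using partial_eq[OF bounded_linear_imp_has_derivative[OF bounded_linear_nth]] by (auto simp: fun_eq_iff)

lemma differentiable_nth: "(\<lambda>x::R3. x $ i) differentiable (at x)"
  using bounded_linear_imp_differentiable[OF bounded_linear_nth] .

lemma smooth_nth: "smooth (\<lambda>x. x $ i)"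
  by (subst smooth_iff_partial) (auto simp: partial_nth smooth_const differentiable_nth)

lemma smooth_continuous: "smooth f \<Longrightarrow> continuous_on S f"
  by (meson continuous_at_imp_continuous_on differentiable_imp_continuous_within smoothD)

lemma smooth_measurable:
  assumes "smooth f" shows "f \<in> borel_measurable lborel"
  using smooth_continuous[OF assms, of UNIV] by (simp add: borel_measurable_continuous_onI)

section \<open>Bump functions\<close>

text \<open>This family, unlike \<open>exp (- 1 / t)\<close> alone, is closed under differentiation up to linear combinations.\<close>

definition flat :: "nat \<Rightarrow> real \<Rightarrow> real" where
  "flat m t = (if t > 0 then exp (- 1 / t) / t ^ m else 0)"

text \<open>From 1/(n t) \<le> exp (1/(n t)) with n = m + 2, raised to the n-th power. Two powers of
  t are left over: they send the difference quotient at 0 to 0 in \<open>flat_DERIV\<close>. The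
  explicit constant serves again for the heat kernel at small times.\<close>

lemma flat_bound: "\<bar>flat m t\<bar> \<le> real ((m + 2) ^ (m + 2)) * t\<^sup>2"
proof (cases "t > 0")
  case True
  let ?n = "m + 2"
  have "1 / (real ?n * t) \<le> exp (1 / (real ?n * t))"
    using exp_ge_add_one_self[of "1 / (real ?n * t)"] by linarith
  then have "(1 / (real ?n * t)) ^ ?n \<le> exp (1 / (real ?n * t)) ^ ?n"
    using True by (intro power_mono) auto
  also have "\<dots> = exp (real ?n * (1 / (real ?n * t)))" by (simp only: exp_of_nat_mult)
  also have "real ?n * (1 / (real ?n * t)) = 1 / t" using True by (simp del: of_nat_add)
  finally have le: "inverse ((real ?n * t) ^ ?n) \<le> exp (1 / t)" by (simp only: power_divide power_one inverse_eq_divide)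
  have "0 < (real ?n * t) ^ ?n" using True by (intro zero_less_power) auto
  then have "inverse (exp (1 / t)) \<le> (real ?n * t) ^ ?n"
    using le_imp_inverse_le[OF le] by (simp only: inverse_inverse_eq inverse_positive_iff_positive)
  then have "exp (- 1 / t) \<le> (real ?n * t) ^ ?n" by (simp only: exp_minus[symmetric] minus_divide_left)
  then have "exp (- 1 / t) / t ^ m \<le> (real ?n * t) ^ ?n / t ^ m"
    using True by (intro divide_right_mono) auto
  also have "\<dots> = real (?n ^ ?n) * t\<^sup>2"
  proof -
    have "(real ?n * t) ^ ?n = real (?n ^ ?n) * (t ^ m * t\<^sup>2)"
      by (simp only: power_mult_distrib of_nat_power power_add of_nat_mult ac_simps)
    then show ?thesis using True by (simp del: of_nat_power of_nat_add)
  qed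
  finally show ?thesis using True by (simp add: flat_def)
qed (simp add: flat_def)

lemma flat_DERIV: "(flat m has_real_derivative (flat (m + 2) t - real m * flat (m + 1) t)) (at t)"
proof -
  consider "t > 0" | "t < 0" | "t = 0" by linarith
  then show ?thesis
  proof cases
    case 1
    have "((\<lambda>t. exp (- 1 / t) / t ^ m) has_real_derivative (flat (m + 2) t - real m * flat (m + 1) t)) (at t)"
    proof -
      have pm: "real m * t ^ (m - Suc 0) = real m * t ^ m / t" using 1 by (cases m) auto
      have e: "((\<lambda>t. exp (- 1 / t)) has_real_derivative (exp (- 1 / t) * (1 / t\<^sup>2))) (at t)"
        using 1 by (auto intro!: derivative_eq_intros simp: power2_eq_square)
      have d: "((\<lambda>t. t ^ m) has_real_derivative (real m * t ^ (m - Suc 0))) (at t)"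
        using DERIV_pow[of m t UNIV] by simp
      show ?thesis
        by (rule DERIV_cong[OF DERIV_divide[OF e d]])
          (use 1 in \<open>simp_all add: pm flat_def power_add power2_eq_square field_simps\<close>)
    qed
    then show ?thesis
      by (rule has_field_derivative_transform_within_open[of _ _ _ "{0<..}"]) (use 1 in \<open>auto simp: flat_def\<close>)
  next
    case 2
    have "((\<lambda>t. 0) has_real_derivative (flat (m + 2) t - real m * flat (m + 1) t)) (at t)"
      using 2 by (simp add: flat_def)
    then show ?thesis
      by (rule has_field_derivative_transform_within_open[of _ _ _ "{..<0}"]) (use 2 in \<open>auto simp: flat_def\<close>)
  next
    case 3
    let ?C = "real ((m + 2) ^ (m + 2))"
    have "((\<lambda>h. (flat m (0 + h) - flat m 0) / h) \<longlongrightarrow> 0) (at 0)"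
    proof (rule tendsto_rabs_zero_cancel, rule tendsto_sandwich[OF _ _ tendsto_const])
      show "((\<lambda>h. ?C * \<bar>h\<bar>) \<longlongrightarrow> 0) (at 0)" by (auto intro!: tendsto_eq_intros)
      have "\<bar>(flat m (0 + h) - flat m 0) / h\<bar> \<le> ?C * \<bar>h\<bar>" if "h \<noteq> 0" for h
        using flat_bound[of m h] that by (simp add: flat_def[of m 0] divide_simps abs_if power2_eq_square split: if_splits)
      then show "\<forall>\<^sub>F h in at 0. \<bar>(flat m (0 + h) - flat m 0) / h\<bar> \<le> ?C * \<bar>h\<bar>"
        by (auto simp: eventually_at intro!: exI[of _ 1])
    qed auto
    then show ?thesis using 3 by (simp add: DERIV_def flat_def)
  qed
qed

lemma flat_has_derivative:
  "((\<lambda>x::R3. flat m (a * x $ i + b)) has_derivative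
     (\<lambda>h. (flat (m + 2) (a * x $ i + b) - real m * flat (m + 1) (a * x $ i + b)) * (a * h $ i))) (at x)"
proof -
  have "((\<lambda>x::R3. a * x $ i + b) has_derivative (\<lambda>h. a * h $ i)) (at x)"
    by (auto intro!: derivative_eq_intros bounded_linear_imp_has_derivative bounded_linear_nth)
  from has_derivative_compose[OF this, of "flat m"] flat_DERIV[of m "a * x $ i + b"]
  show ?thesis by (simp add: has_field_derivative_def)
qed

lemma times_diff_flat: "times_diff n (\<lambda>x. flat m (a * x $ i + b))"
proof (induction n arbitrary: m)
  case 0 show ?case using flat_has_derivative differentiable_def by (simp, blast)
next
  case (Suc n)
  have e: "partial j (\<lambda>x. flat m (a * x $ i + b)) =
    (\<lambda>x. (a * axis j 1 $ i) *\<^sub>R (flat (m + 2) (a * x $ i + b) + (- real m) *\<^sub>R flat (m + 1) (a * x $ i + b)))" for j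
    by (rule ext, subst partial_eq[OF flat_has_derivative]) simp
  have "times_diff n (partial j (\<lambda>x. flat m (a * x $ i + b)))" for j
    unfolding e by (intro times_diff_linear[OF bounded_linear_scaleR_right] times_diff_add Suc.IH)
  moreover have "(\<lambda>x. flat m (a * x $ i + b)) differentiable (at x)" for x
    using flat_has_derivative differentiable_def by blast
  ultimately show ?case by simp
qed

lemma smooth_flat: "smooth (\<lambda>x. flat m (a * x $ i + b))"
  by (simp add: smooth_iff_times_diff times_diff_flat)

text \<open>Built on a box rather than a ball: smoothness follows factor by factor, positivity holds
  exactly on the open box, and boxes are the generating family on which measures are compared
  later.\<close>

definition bump :: "R3 \<Rightarrow> R3 \<Rightarrow> R3 \<Rightarrow> real" where
  "bump a b x = (\<Prod>i\<in>UNIV. flat 0 (x $ i - a $ i) * flat 0 (b $ i - x $ i))"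

lemma flat0: "0 \<le> flat 0 t" "flat 0 t \<le> 1" "flat 0 t > 0 \<longleftrightarrow> t > 0"
  by (auto simp: flat_def)

lemma bump_nonneg: "0 \<le> bump a b x" and bump_le_1: "bump a b x \<le> 1"
  unfolding bump_def by (auto intro!: prod_nonneg prod_le_1 mult_le_one simp: flat0)

lemma bump_pos_iff: "bump a b x > 0 \<longleftrightarrow> x \<in> box a b"
proof
  assume "x \<in> box a b"
  then show "bump a b x > 0" unfolding bump_def
    by (intro prod_pos) (auto simp: flat0 mem_box_cart)
next
  assume p: "bump a b x > 0"
  have "flat 0 (x $ i - a $ i) \<noteq> 0 \<and> flat 0 (b $ i - x $ i) \<noteq> 0" for i
  proof (rule ccontr)
    assume "\<not> ?thesis"
    then have "bump a b x = 0" unfolding bump_def by (subst prod_zero_iff) auto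
    then show False using p by simp
  qed
  then have "flat 0 (x $ i - a $ i) > 0 \<and> flat 0 (b $ i - x $ i) > 0" for i
    by (metis flat0(1) order_le_less)
  then show "x \<in> box a b" by (auto simp: flat0 mem_box_cart)
qed

lemma bump_nonzero_iff: "bump a b x \<noteq> 0 \<longleftrightarrow> x \<in> box a b"
  using bump_pos_iff bump_nonneg by (metis order_le_less order_less_irrefl)

lemma smooth_bump: "smooth (bump a b)"
proof -
  have "smooth (\<lambda>x. flat 0 (x $ i - a $ i))" for i using smooth_flat[of 0 1 i "- a $ i"] by simp
  moreover have "smooth (\<lambda>x. flat 0 (b $ i - x $ i))" for i using smooth_flat[of 0 "-1" i "b $ i"] by simp
  ultimately have "smooth (\<lambda>x. bump a b x)" unfolding bump_def by (intro smooth_prod smooth_mult)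
  then show ?thesis by simp
qed

section \<open>Test functions\<close>

lemma Cc_smooth: "f \<in> Cc_infty U \<Longrightarrow> smooth f"
  by (simp add: Cc_infty_def)

lemma Cc_mono: "f \<in> Cc_infty U \<Longrightarrow> U \<subseteq> V \<Longrightarrow> f \<in> Cc_infty V"
  by (auto simp: Cc_infty_def)

lemma Cc_UNIV: "f \<in> Cc_infty U \<Longrightarrow> f \<in> Cc_infty UNIV"
  by (erule Cc_mono) simp

lemma Cc_not_support: "x \<notin> closure {x. f x \<noteq> 0} \<Longrightarrow> f x = 0"
  using closure_subset[of "{x. f x \<noteq> 0}"] by auto

text \<open>The two premises on x serve different uses: f x = 0 is what pointwise products and
  linear images offer, distance from the closed support is what derivatives need.\<close>

lemma Cc_infty_support:
  assumes "f \<in> Cc_infty U" "smooth g" "\<And>x. f x = 0 \<Longrightarrow> x \<notin> closure {x. f x \<noteq> 0} \<Longrightarrow> g x = 0"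
  shows "g \<in> Cc_infty U"
proof -
  have "closure {x. g x \<noteq> 0} \<subseteq> closure {x. f x \<noteq> 0}"
    by (intro closure_minimal subsetI closed_closure) (use assms(3) Cc_not_support in blast)
  then show ?thesis using assms(1,2) compact_Int_closed[of "closure {x. f x \<noteq> 0}" "closure {x. g x \<noteq> 0}"]
    unfolding Cc_infty_def by (auto simp: inf.absorb2)
qed

lemma Cc_mult_left:
  fixes f g :: "R3 \<Rightarrow> 'b::real_normed_algebra"
  assumes "f \<in> Cc_infty U" "smooth g" shows "(\<lambda>x. g x * f x) \<in> Cc_infty U"
  using assms by (intro Cc_infty_support[OF assms(1)] smooth_mult Cc_smooth[OF assms(1)]) auto

lemma Cc_mult_right:
  fixes f g :: "R3 \<Rightarrow> 'b::real_normed_algebra"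
  assumes "f \<in> Cc_infty U" "smooth g" shows "(\<lambda>x. f x * g x) \<in> Cc_infty U"
  using assms by (intro Cc_infty_support[OF assms(1)] smooth_mult Cc_smooth[OF assms(1)]) auto

lemma Cc_linear:
  assumes "f \<in> Cc_infty U" "bounded_linear T" shows "(\<lambda>x. T (f x)) \<in> Cc_infty U"
proof (rule Cc_infty_support[OF assms(1) smooth_linear[OF assms(2) Cc_smooth[OF assms(1)]]])
  show "T (f x) = 0" if "f x = 0" for x
    using linear_0[OF bounded_linear.linear[OF assms(2)]] that by simp
qed

lemma Cc_scale: "f \<in> Cc_infty U \<Longrightarrow> (\<lambda>x. c *\<^sub>R f x) \<in> Cc_infty U"
  by (rule Cc_linear[OF _ bounded_linear_scaleR_right])

lemma Cc_add:
  assumes "f \<in> Cc_infty U" "g \<in> Cc_infty U" shows "(\<lambda>x. f x + g x) \<in> Cc_infty U"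
proof -
  have "closure {x. f x + g x \<noteq> 0} \<subseteq> closure ({x. f x \<noteq> 0} \<union> {x. g x \<noteq> 0})"
    by (intro closure_mono) auto
  then have sub: "closure {x. f x + g x \<noteq> 0} \<subseteq> closure {x. f x \<noteq> 0} \<union> closure {x. g x \<noteq> 0}" by simp
  moreover have "compact (closure {x. f x \<noteq> 0} \<union> closure {x. g x \<noteq> 0})"
    using assms by (intro compact_Un) (auto simp: Cc_infty_def)
  ultimately have "compact (closure {x. f x + g x \<noteq> 0})"
    using compact_Int_closed[of _ "closure {x. f x + g x \<noteq> 0}"] by (fastforce simp: inf.absorb2)
  then show ?thesis using assms sub smooth_add unfolding Cc_infty_def by blast
qed

lemma Cc_diff: "f \<in> Cc_infty U \<Longrightarrow> g \<in> Cc_infty U \<Longrightarrow> (\<lambda>x. f x - g x) \<in> Cc_infty U"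
  using Cc_add[of f U "\<lambda>x. (-1) *\<^sub>R g x"] Cc_scale[of g U "-1"] by simp

lemma partial_zero_off_support:
  assumes "x \<notin> closure {x. f x \<noteq> 0}"
  shows "partial j f x = 0"
proof -
  have "partial j (\<lambda>x. 0) x = partial j f x"
  proof (rule partial_cong_open)
    show "open (- closure {x. f x \<noteq> 0})" by auto
    show "(\<lambda>x. 0) differentiable at x" by simp
    show "\<And>y. y \<in> - closure {x. f x \<noteq> 0} \<Longrightarrow> 0 = f y" by (metis ComplD Cc_not_support)
  qed (use assms in auto)
  then show ?thesis by simp
qed

lemma Cc_partial: "f \<in> Cc_infty U \<Longrightarrow> partial j f \<in> Cc_infty U"
  by (rule Cc_infty_support[of f]) (simp_all add: smooth_partial Cc_smooth partial_zero_off_support)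

lemma Cc_zero: "(\<lambda>x. 0) \<in> Cc_infty U"
  by (simp add: Cc_infty_def smooth_const)

lemma Cc_sum: "(\<And>i. i \<in> I \<Longrightarrow> f i \<in> Cc_infty U) \<Longrightarrow> (\<lambda>x. \<Sum>i\<in>I. f i x) \<in> Cc_infty U"
proof (induction I rule: infinite_finite_induct)
qed (auto intro: Cc_add Cc_zero)

lemma Cc_bounded_support:
  assumes "f \<in> Cc_infty U"
  obtains R where "R > 0" "\<And>x. norm x > R \<Longrightarrow> f x = 0"
proof -
  have "bounded (closure {x. f x \<noteq> 0})" using assms by (auto simp: Cc_infty_def compact_imp_bounded)
  then obtain R where "R > 0" "\<And>x. x \<in> closure {x. f x \<noteq> 0} \<Longrightarrow> norm x \<le> R" by (auto simp: bounded_pos)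
  then show ?thesis using Cc_not_support[of _ f] that by (metis not_le)
qed

lemma closure_bump_support: "closure {x. bump a b x \<noteq> 0} \<subseteq> cbox a b"
  using box_subset_cbox by (intro closure_minimal) (auto simp: bump_nonzero_iff closed_cbox)

lemma bump_Cc: "cbox a b \<subseteq> U \<Longrightarrow> bump a b \<in> Cc_infty U"
  using closure_bump_support[of a b] compact_Int_closed[OF compact_cbox[of a b] closed_closure[of "{x. bump a b x \<noteq> 0}"]]
  unfolding Cc_infty_def by (auto simp: smooth_bump inf.absorb2)

lemma compact_support_integrable:
  fixes f :: "R3 \<Rightarrow> 'b::euclidean_space"
  assumes "continuous_on UNIV f" "\<And>x. norm x > R \<Longrightarrow> f x = 0"
  shows "integrable lborel f"
proof -
  have "integrable lborel (\<lambda>x. indicator (cball 0 R) x *\<^sub>R f x)"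
    by (intro borel_integrable_compact continuous_on_subset[OF assms(1)]) auto
  also have "(\<lambda>x. indicator (cball 0 R) x *\<^sub>R f x) = f"
    using assms(2) by (auto simp: fun_eq_iff indicator_def not_le)
  finally show ?thesis .
qed

lemma compact_support_bounded:
  fixes f :: "R3 \<Rightarrow> 'b::real_normed_vector"
  assumes "continuous_on UNIV f" "\<And>x. norm x > R \<Longrightarrow> f x = 0"
  obtains C where "C > 0" "\<And>x. norm (f x) \<le> C"
proof -
  have "bounded (f ` cball 0 R)"
    by (intro compact_imp_bounded compact_continuous_image continuous_on_subset[OF assms(1)]) auto
  then obtain C where C: "C > 0" "\<And>x. x \<in> cball 0 R \<Longrightarrow> norm (f x) \<le> C" by (auto simp: bounded_pos)
  have "norm (f x) \<le> C" for x using C assms(2)[of x] by (cases "norm x \<le> R") auto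
  then show ?thesis using C that by blast
qed

lemma Cc_continuous: "f \<in> Cc_infty U \<Longrightarrow> continuous_on S f"
  by (intro smooth_continuous Cc_smooth)

lemma Cc_integrable:
  fixes f :: "R3 \<Rightarrow> 'b::euclidean_space"
  assumes "f \<in> Cc_infty U" shows "integrable lborel f"
  using Cc_bounded_support[OF assms] Cc_continuous[OF assms] compact_support_integrable by metis

lemma Cc_bounded:
  fixes f :: "R3 \<Rightarrow> 'b::real_normed_vector"
  assumes "f \<in> Cc_infty U"
  obtains C where "C > 0" "\<And>x. norm (f x) \<le> C"
  using Cc_bounded_support[OF assms] Cc_continuous[OF assms] compact_support_bounded by metis

lemma Cc_L2:
  fixes f :: "R3 \<Rightarrow> 'b::euclidean_space"
  assumes "f \<in> Cc_infty U" shows "f \<in> L2"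
proof -
  obtain R where R: "\<And>x. norm x > R \<Longrightarrow> f x = 0" using Cc_bounded_support[OF assms] by metis
  have "integrable lborel (\<lambda>x. (norm (f x))\<^sup>2)"
    by (rule compact_support_integrable[of _ R]) (auto intro!: continuous_intros Cc_continuous[OF assms] simp: R)
  then show ?thesis using smooth_measurable[OF Cc_smooth[OF assms]] by (simp add: L2_def)
qed

section \<open>Integration by parts\<close>

lemma integral_translate:
  fixes f :: "R3 \<Rightarrow> 'b::euclidean_space"
  assumes "f \<in> borel_measurable lborel"
  shows "(LINT x|lborel. f (c + x)) = (LINT x|lborel. f x)"
proof -
  have "(LINT x|lborel. f x) = (LINT x|distr lborel borel ((+) c). f x)" by (simp add: lborel_distr_plus)
  also have "\<dots> = (LINT x|lborel. f (c + x))" using assms by (subst integral_distr) auto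
  finally show ?thesis by simp
qed

text \<open>Mean value inequality along a coordinate axis; it supplies the bound under which
  difference quotients converge.\<close>

lemma norm_diff_le_partial:
  fixes u :: "R3 \<Rightarrow> 'b::real_normed_vector"
  assumes d: "\<And>x. u differentiable (at x)" and C: "\<And>x. norm (partial j u x) \<le> C" and t: "t \<ge> 0"
  shows "norm (u (x + t *\<^sub>R axis j 1) - u x) \<le> C * t"
proof -
  have der: "((\<lambda>t. u (x + t *\<^sub>R axis j 1)) has_derivative (\<lambda>h. h *\<^sub>R partial j u (x + t *\<^sub>R axis j 1))) (at t within S)" for t S
  proof -
    have "((\<lambda>t. x + t *\<^sub>R axis j 1) has_derivative (\<lambda>h. h *\<^sub>R axis j (1::real))) (at t within S)"
      by (auto intro!: derivative_eq_intros)
    from has_derivative_compose[OF this has_derivative_frechet[OF d]]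
    show ?thesis
      using linear_cmul[OF has_derivative_linear[OF has_derivative_frechet[OF d]]] by (simp add: partial_def)
  qed
  have "norm (u (x + t *\<^sub>R axis j 1) - u (x + 0 *\<^sub>R axis j 1)) \<le> C * norm (t - 0)"
  proof (rule differentiable_bound[OF convex_UNIV der])
    show "onorm (\<lambda>h. h *\<^sub>R partial j u (x + t *\<^sub>R axis j 1)) \<le> C" for t
    proof (rule onorm_bound)
      show "0 \<le> C" using C[of 0] norm_ge_zero order_trans by blast
      show "norm (h *\<^sub>R partial j u (x + t *\<^sub>R axis j 1)) \<le> C * norm h" for h
        using mult_left_mono[OF C, of "\<bar>h\<bar>"] by (simp add: mult.commute)
    qed
  qed auto
  then show ?thesis using t by simp
qed

text \<open>Difference quotients in direction j have integral zero by translation invariance of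
  Lebesgue measure, and they converge to the partial derivative under a fixed integrable
  bound.\<close>

lemma integral_partial_zero:
  fixes u :: "R3 \<Rightarrow> 'b::euclidean_space"
  assumes d: "\<And>x. u differentiable (at x)" and c: "continuous_on UNIV (partial j u)"
    and supp: "\<And>x. norm x > R \<Longrightarrow> u x = 0"
  shows "(LINT x|lborel. partial j u x) = 0"
proof -
  have cu: "continuous_on UNIV u"
    using d by (meson continuous_at_imp_continuous_on differentiable_imp_continuous_within)
  have iu: "integrable lborel u" by (rule compact_support_integrable[OF cu supp])
  have [measurable]: "u \<in> borel_measurable lborel" using iu by simp
  have [measurable]: "partial j u \<in> borel_measurable lborel" using c by (simp add: borel_measurable_continuous_onI)
  have psupp: "partial j u x = 0" if "norm x > R" for x
  proof (rule partial_zero_off_support)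
    have "closure {x. u x \<noteq> 0} \<subseteq> cball 0 R" using supp by (intro closure_minimal) (force simp: not_le[symmetric])+
    then show "x \<notin> closure {x. u x \<noteq> 0}" using that by auto
  qed
  obtain C where C: "C > 0" "\<And>x. norm (partial j u x) \<le> C"
    using compact_support_bounded[OF c psupp] by metis
  define q where "q = (\<lambda>n x. real (Suc n) *\<^sub>R (u (x + (1 / real (Suc n)) *\<^sub>R axis j 1) - u x))"
  have q0: "(LINT x|lborel. q n x) = 0" for n
  proof -
    have "integrable lborel (\<lambda>x. u (x + (1 / real (Suc n)) *\<^sub>R axis j 1))"
    proof (rule compact_support_integrable[of _ "R + 1"])
      show "continuous_on UNIV (\<lambda>x. u (x + (1 / real (Suc n)) *\<^sub>R axis j 1))"
        by (intro continuous_on_compose2[OF cu] continuous_intros) auto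
      show "u (x + (1 / real (Suc n)) *\<^sub>R axis j 1) = 0" if "norm x > R + 1" for x
      proof (rule supp)
        have "norm x \<le> norm (x + (1 / real (Suc n)) *\<^sub>R axis j (1::real)) + norm ((1 / real (Suc n)) *\<^sub>R axis j (1::real) :: R3)"
          by (metis add_diff_cancel_right' norm_triangle_ineq4)
        also have "norm ((1 / real (Suc n)) *\<^sub>R axis j (1::real) :: R3) \<le> 1" by (simp add: norm_axis_1 field_simps)
        finally show "R < norm (x + (1 / real (Suc n)) *\<^sub>R axis j (1::real))" using that by simp
      qed
    qed
    moreover have "(LINT x|lborel. u (x + (1 / real (Suc n)) *\<^sub>R axis j 1)) = (LINT x|lborel. u x)"
      using integral_translate[of u "(1 / real (Suc n)) *\<^sub>R axis j 1"] by (simp add: add.commute)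
    ultimately show ?thesis unfolding q_def using iu by simp
  qed
  \<comment> \<open>The shifts have length at most 1, so all quotients vanish outside the ball of
    radius R + 1, and inside it the derivative bound C applies.\<close>
  have "(\<lambda>n. LINT x|lborel. q n x) \<longlonglongrightarrow> (LINT x|lborel. partial j u x)"
  proof (rule integral_dominated_convergence[where w="\<lambda>x. indicator (cball 0 (R + 1)) x *\<^sub>R C"])
    show "integrable lborel (\<lambda>x::R3. indicator (cball 0 (R + 1)) x *\<^sub>R C)"
      by (intro borel_integrable_compact) auto
    show "q n \<in> borel_measurable lborel" for n unfolding q_def by measurable
    show "AE x in lborel. (\<lambda>n. q n x) \<longlonglongrightarrow> partial j u x"
    proof (intro always_eventually allI)
      fix x
      have "((\<lambda>t. x + t *\<^sub>R axis j 1) has_derivative (\<lambda>h. h *\<^sub>R axis j (1::real))) (at 0)"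
        by (auto intro!: derivative_eq_intros)
      from has_derivative_compose[OF this has_derivative_frechet[OF d]]
      have "((\<lambda>t. u (x + t *\<^sub>R axis j 1)) has_derivative (\<lambda>h. h *\<^sub>R partial j u x)) (at 0)"
        using linear_cmul[OF has_derivative_linear[OF has_derivative_frechet[OF d]]] by (simp add: partial_def)
      then have l: "((\<lambda>t. norm (u (x + t *\<^sub>R axis j 1) - u x - t *\<^sub>R partial j u x) / norm t) \<longlongrightarrow> 0) (at 0)"
        by (simp add: has_derivative_at)
      have "((\<lambda>t. (u (x + t *\<^sub>R axis j 1) - u x) /\<^sub>R t) \<longlongrightarrow> partial j u x) (at 0)"
      proof (rule LIM_zero_cancel, rule tendsto_norm_zero_cancel, rule Lim_transform_eventually[OF l])
        have "norm (u (x + t *\<^sub>R axis j 1) - u x - t *\<^sub>R partial j u x) / norm t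
          = norm ((u (x + t *\<^sub>R axis j 1) - u x) /\<^sub>R t - partial j u x)" if "t \<noteq> 0" for t
        proof -
          have "(u (x + t *\<^sub>R axis j 1) - u x) /\<^sub>R t - partial j u x = (u (x + t *\<^sub>R axis j 1) - u x - t *\<^sub>R partial j u x) /\<^sub>R t"
            using that by (simp add: scaleR_diff_right)
          then show ?thesis by (simp add: divide_inverse mult.commute)
        qed
        then show "\<forall>\<^sub>F t in at 0. norm (u (x + t *\<^sub>R axis j 1) - u x - t *\<^sub>R partial j u x) / norm t
          = norm ((u (x + t *\<^sub>R axis j 1) - u x) /\<^sub>R t - partial j u x)"
          by (simp add: eventually_at_filter)
      qed
      moreover have "filterlim (\<lambda>n. 1 / real (Suc n)) (at 0) sequentially"
        unfolding filterlim_at using LIMSEQ_Suc[OF lim_1_over_n] by auto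
      ultimately have "(\<lambda>n. (u (x + (1 / real (Suc n)) *\<^sub>R axis j 1) - u x) /\<^sub>R (1 / real (Suc n))) \<longlonglongrightarrow> partial j u x"
        by (rule filterlim_compose)
      then show "(\<lambda>n. q n x) \<longlonglongrightarrow> partial j u x" by (simp add: q_def)
    qed
    show "AE x in lborel. norm (q n x) \<le> indicator (cball 0 (R + 1)) x *\<^sub>R C" for n
    proof (intro always_eventually allI)
      fix x
      show "norm (q n x) \<le> indicator (cball 0 (R + 1)) x *\<^sub>R C"
      proof (cases "norm x \<le> R + 1")
        case True
        have "norm (q n x) = real (Suc n) * norm (u (x + (1 / real (Suc n)) *\<^sub>R axis j 1) - u x)"
          by (simp add: q_def)
        also have "\<dots> \<le> real (Suc n) * (C * (1 / real (Suc n)))"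
          by (intro mult_left_mono norm_diff_le_partial[OF d C(2)]) auto
        also have "\<dots> = C" by simp
        finally show ?thesis using True by simp
      next
        case False
        have "norm x \<le> norm (x + (1 / real (Suc n)) *\<^sub>R axis j (1::real)) + norm ((1 / real (Suc n)) *\<^sub>R axis j (1::real) :: R3)"
          by (metis add_diff_cancel_right' norm_triangle_ineq4)
        also have "norm ((1 / real (Suc n)) *\<^sub>R axis j (1::real) :: R3) \<le> 1" by (simp add: norm_axis_1 field_simps)
        finally have "R < norm (x + (1 / real (Suc n)) *\<^sub>R axis j (1::real))" "R < norm x" using False by simp_all
        then show ?thesis using False by (simp add: q_def supp)
      qed
    qed
  qed measurable
  then show ?thesis by (simp add: q0 LIMSEQ_const_iff)
qed

text \<open>The kernels to come are regular only on a neighbourhood U of the support of \<phi>. The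
  product extends by zero, since U and the complement of the support are open and cover the
  space.\<close>

lemma continuous_on_mult_support:
  fixes \<phi> :: "R3 \<Rightarrow> real" and k :: "R3 \<Rightarrow> 'b::real_normed_vector"
  assumes "continuous_on UNIV \<phi>" "closure {x. \<phi> x \<noteq> 0} \<subseteq> U" "open U" "continuous_on U k"
  shows "continuous_on UNIV (\<lambda>x. \<phi> x *\<^sub>R k x)"
proof -
  have "continuous_on U (\<lambda>x. \<phi> x *\<^sub>R k x)"
    by (intro continuous_intros assms continuous_on_subset[OF assms(1)]) auto
  moreover have "continuous_on (- closure {x. \<phi> x \<noteq> 0}) (\<lambda>x. \<phi> x *\<^sub>R k x)"
    by (rule continuous_on_cong[THEN iffD2, OF refl _ continuous_on_const[of _ 0]])
       (metis ComplD Cc_not_support scaleR_zero_left)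
  ultimately have "continuous_on (U \<union> - closure {x. \<phi> x \<noteq> 0}) (\<lambda>x. \<phi> x *\<^sub>R k x)"
    using assms(3) by (intro continuous_on_open_Un) auto
  moreover have "U \<union> - closure {x. \<phi> x \<noteq> 0} = UNIV" using assms(2) by auto
  ultimately show ?thesis by simp
qed

lemma Cc_mult_continuous_integrable:
  fixes \<phi> :: "R3 \<Rightarrow> real" and k :: "R3 \<Rightarrow> 'b::euclidean_space"
  assumes "\<phi> \<in> Cc_infty U" "open U" "continuous_on U k"
  shows "integrable lborel (\<lambda>x. \<phi> x *\<^sub>R k x)"
proof -
  obtain R where "\<And>x. norm x > R \<Longrightarrow> \<phi> x = 0" using Cc_bounded_support[OF assms(1)] by metis
  then show ?thesis using assms
    by (intro compact_support_integrable[of _ R] continuous_on_mult_support[OF Cc_continuous[OF assms(1)]])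
       (auto simp: Cc_infty_def)
qed

lemma integration_by_parts:
  fixes \<phi> :: "R3 \<Rightarrow> real" and k :: "R3 \<Rightarrow> 'b::euclidean_space"
  assumes \<phi>: "\<phi> \<in> Cc_infty U" and U: "open U" and k: "\<And>x. x \<in> U \<Longrightarrow> k differentiable (at x)"
    and ck: "continuous_on U (partial j k)"
  shows "(LINT x|lborel. partial j \<phi> x *\<^sub>R k x) = - (LINT x|lborel. \<phi> x *\<^sub>R partial j k x)"
proof -
  let ?u = "\<lambda>x. \<phi> x *\<^sub>R k x"
  have sub: "closure {x. \<phi> x \<noteq> 0} \<subseteq> U" using \<phi> by (auto simp: Cc_infty_def)
  have cont: "continuous_on U k"
    using k by (meson continuous_at_imp_continuous_on differentiable_imp_continuous_within)
  have du: "?u differentiable (at x) \<and> partial j ?u x = partial j \<phi> x *\<^sub>R k x + \<phi> x *\<^sub>R partial j k x" for x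
  proof (cases "x \<in> closure {x. \<phi> x \<noteq> 0}")
    case True
    then have "x \<in> U" using sub by auto
    then show ?thesis using smoothD[OF Cc_smooth[OF \<phi>]] k
      by (intro conjI differentiable_bilinear[OF bounded_bilinear_scaleR] partial_bilinear[OF bounded_bilinear_scaleR])
  next
    case False
    have "{x. ?u x \<noteq> 0} \<subseteq> {x. \<phi> x \<noteq> 0}" by auto
    then have "x \<notin> closure {x. ?u x \<noteq> 0}" using False closure_mono by blast
    then have p: "partial j ?u x = 0" by (rule partial_zero_off_support)
    have "((\<lambda>x. 0) has_derivative (\<lambda>x. 0)) (at x)" by simp
    then have "(?u has_derivative (\<lambda>x. 0)) (at x)"
      by (rule has_derivative_transform_within_open[of _ _ _ _ "- closure {x. \<phi> x \<noteq> 0}"])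
         (use False in \<open>auto dest!: Cc_not_support\<close>)
    then show ?thesis using p Cc_not_support[OF False] partial_zero_off_support[OF False]
      by (auto simp: differentiable_def)
  qed
  have pe: "partial j ?u = (\<lambda>x. partial j \<phi> x *\<^sub>R k x + \<phi> x *\<^sub>R partial j k x)" using du by auto
  obtain R where R: "\<And>x. norm x > R \<Longrightarrow> \<phi> x = 0" using Cc_bounded_support[OF \<phi>] by metis
  have \<phi>': "partial j \<phi> \<in> Cc_infty U" by (rule Cc_partial[OF \<phi>])
  have sub': "closure {x. partial j \<phi> x \<noteq> 0} \<subseteq> U" using \<phi>' by (auto simp: Cc_infty_def)
  have "(LINT x|lborel. partial j ?u x) = 0"
  proof (rule integral_partial_zero[of _ _ R])
    show "continuous_on UNIV (partial j ?u)" unfolding pe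
      by (intro continuous_on_add continuous_on_mult_support[OF Cc_continuous[OF \<phi>] sub U ck]
          continuous_on_mult_support[OF Cc_continuous[OF \<phi>'] sub' U cont])
  qed (use du R in auto)
  then show ?thesis unfolding pe
    using Cc_mult_continuous_integrable[OF \<phi>' U cont] Cc_mult_continuous_integrable[OF \<phi> U ck]
    by (simp add: eq_neg_iff_add_eq_0)
qed

section \<open>The fundamental lemma of the calculus of variations\<close>

text \<open>The test functions 1 - (1 - bump)^n lie between 0 and 1, vanish off the box and increase
  to 1 on it, so testing against them amounts to testing against boxes.\<close>

lemma integral_box_zero:
  fixes f :: "R3 \<Rightarrow> real"
  assumes [measurable]: "f \<in> borel_measurable lborel"
    and loc: "\<And>R. integrable lborel (\<lambda>x. indicator (cball 0 R) x *\<^sub>R f x)"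
    and z: "\<And>\<phi>. \<phi> \<in> Cc_infty UNIV \<Longrightarrow> (LINT x|lborel. \<phi> x * f x) = 0"
  shows "integrable lborel (\<lambda>x. indicator (box a b) x * f x) \<and> (LINT x|lborel. indicator (box a b) x * f x) = 0"
proof -
  obtain R where R: "cbox a b \<subseteq> cball 0 R"
    using bounded_cbox[of a b] by (auto simp: bounded_iff subset_eq)
  define p where "p = (\<lambda>n x. 1 - (1 - bump a b x) ^ n)"
  have pC: "p n \<in> Cc_infty UNIV" for n
    unfolding p_def
  proof (rule Cc_infty_support[OF bump_Cc[of a b]])
    show "smooth (\<lambda>x. 1 - (1 - bump a b x) ^ n)"
      by (intro smooth_diff smooth_const smooth_power smooth_bump)
  qed auto
  have [measurable]: "p n \<in> borel_measurable lborel" for n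
    by (rule smooth_measurable[OF Cc_smooth[OF pC]])
  have p01: "0 \<le> p n x" "p n x \<le> 1" for n x
    using bump_nonneg[of a b x] bump_le_1[of a b x] by (auto simp: p_def power_le_one)
  have pout: "p n x = 0" if "x \<notin> cball 0 R" for n x
  proof -
    have "x \<notin> box a b" using that R box_subset_cbox[of a b] by auto
    then have "bump a b x = 0" using bump_nonzero_iff by blast
    then show ?thesis by (simp add: p_def)
  qed
  have conv: "(\<lambda>n. p n x * f x) \<longlonglongrightarrow> indicator (box a b) x * f x" for x
  proof (cases "x \<in> box a b")
    case True
    have "(\<lambda>n. (1 - bump a b x) ^ n) \<longlonglongrightarrow> 0"
      using True bump_pos_iff[of a b x] bump_le_1[of a b x] by (intro LIMSEQ_realpow_zero) auto
    then have "(\<lambda>n. (1 - (1 - bump a b x) ^ n) * f x) \<longlonglongrightarrow> (1 - 0) * f x"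
      by (rule tendsto_mult_right[OF tendsto_diff[OF tendsto_const]])
    then show ?thesis using True by (simp add: p_def)
  next
    case False
    then have "bump a b x = 0" using bump_nonzero_iff by blast
    then show ?thesis using False by (simp add: p_def)
  qed
  have w: "integrable lborel (\<lambda>x. indicator (cball 0 R) x *\<^sub>R \<bar>f x\<bar>)"
    using integrable_abs[OF loc[of R]] by (simp add: abs_mult)
  have bd: "norm (p n x * f x) \<le> indicator (cball 0 R) x *\<^sub>R \<bar>f x\<bar>" for n x
  proof (cases "x \<in> cball 0 R")
    case True
    then show ?thesis using mult_right_mono[OF p01(2)[of n x], of "\<bar>f x\<bar>"] p01[of n x] by (simp add: abs_mult)
  qed (simp add: pout)
  have "(\<lambda>n. LINT x|lborel. p n x * f x) \<longlonglongrightarrow> (LINT x|lborel. indicator (box a b) x * f x)"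
    by (rule integral_dominated_convergence[OF _ _ w]) (use conv bd in auto)
  moreover have "integrable lborel (\<lambda>x. indicator (box a b) x * f x)"
    by (rule integrable_dominated_convergence[OF _ _ w, where s="\<lambda>n x. p n x * f x"]) (use conv bd in auto)
  ultimately show ?thesis using z[OF pC] by (simp add: LIMSEQ_const_iff)
qed

text \<open>The positive and negative parts of f are densities of two measures that are finite and
  equal on boxes, an intersection-stable generator. Equal measures have densities that agree almost
  everywhere.\<close>

lemma AE_zero_of_integral_box_zero:
  fixes f :: "R3 \<Rightarrow> real"
  assumes [measurable]: "f \<in> borel_measurable lborel"
    and z: "\<And>a b. integrable lborel (\<lambda>x. indicator (box a b) x * f x) \<and> (LINT x|lborel. indicator (box a b) x * f x) = 0"
  shows "AE x in lborel. f x = 0"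
proof -
  define M where "M = density lborel (\<lambda>x. ennreal (max 0 (f x)))"
  define N where "N = density lborel (\<lambda>x. ennreal (max 0 (- f x)))"
  have fin: "emeasure (density lborel (\<lambda>x. ennreal (max 0 (c * f x)))) (box a b)
      = ennreal (LINT x|lborel. indicator (box a b) x * max 0 (c * f x))" for a b c
  proof -
    have i: "integrable lborel (\<lambda>x. indicator (box a b) x * max 0 (c * f x))"
    proof (rule Bochner_Integration.integrable_bound)
      show "integrable lborel (\<lambda>x. c * (indicator (box a b) x * f x))" using z[of a b] by simp
    qed (auto simp: indicator_def intro!: always_eventually)
    have "emeasure (density lborel (\<lambda>x. ennreal (max 0 (c * f x)))) (box a b)
        = (\<integral>\<^sup>+x. ennreal (indicator (box a b) x * max 0 (c * f x)) \<partial>lborel)"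
      by (subst emeasure_density) (auto intro!: nn_integral_cong simp: indicator_def)
    then show ?thesis using nn_integral_eq_integral[OF i] by simp
  qed
  have MN: "M = N"
  proof (rule measure_eqI_generator_eq)
    let ?E = "range (\<lambda>(a, b). box a b::R3 set)"
    show "Int_stable ?E" by (auto simp: Int_stable_def box_Int_box)
    show "?E \<subseteq> Pow UNIV" "sets M = sigma_sets UNIV ?E" "sets N = sigma_sets UNIV ?E"
      by (simp_all add: borel_eq_box M_def N_def)
    let ?A = "\<lambda>n::nat. box (- (real n *\<^sub>R One)) (real n *\<^sub>R One) :: R3 set"
    show "range ?A \<subseteq> ?E" "(\<Union>i. ?A i) = UNIV" unfolding UN_box_eq_UNIV by auto
    show "emeasure M (?A i) \<noteq> \<infinity>" for i using fin[of 1] by (simp add: M_def)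
    show "emeasure M S = emeasure N S" if SE: "S \<in> ?E" for S
    proof -
      obtain a b where S: "S = box a b" using SE by auto
      have i: "integrable lborel (\<lambda>x. indicator (box a b) x * max 0 (c * f x))" for c
      proof (rule Bochner_Integration.integrable_bound)
        show "integrable lborel (\<lambda>x. c * (indicator (box a b) x * f x))" using z[of a b] by simp
      qed (auto simp: indicator_def intro!: always_eventually)
      have "(LINT x|lborel. indicator (box a b) x * max 0 (f x)) - (LINT x|lborel. indicator (box a b) x * max 0 (- f x))
        = (LINT x|lborel. indicator (box a b) x * f x)"
      proof -
        have "(LINT x|lborel. indicator (box a b) x * max 0 (f x)) - (LINT x|lborel. indicator (box a b) x * max 0 (- f x))
          = (LINT x|lborel. indicator (box a b) x * max 0 (f x) - indicator (box a b) x * max 0 (- f x))"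
          using i[of 1] i[of "-1"] by simp
        also have "\<dots> = (LINT x|lborel. indicator (box a b) x * f x)"
          by (intro Bochner_Integration.integral_cong refl) (auto simp: indicator_def max_def)
        finally show ?thesis .
      qed
      then show ?thesis using fin[of 1 a b] fin[of "-1" a b] z[of a b] by (simp add: M_def N_def S)
    qed
  qed
  have "AE x in lborel. ennreal (max 0 (f x)) = ennreal (max 0 (- f x))"
    using MN unfolding M_def N_def by (intro sigma_finite_measure.density_unique[OF sigma_finite_lborel]) auto
  then show ?thesis by eventually_elim (auto simp: max_def split: if_splits)
qed

lemma fundamental_lemma:
  fixes f :: "R3 \<Rightarrow> real"
  assumes "f \<in> borel_measurable lborel"
    and "\<And>R. integrable lborel (\<lambda>x. indicator (cball 0 R) x *\<^sub>R f x)"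
    and "\<And>\<phi>. \<phi> \<in> Cc_infty UNIV \<Longrightarrow> (LINT x|lborel. \<phi> x * f x) = 0"
  shows "AE x in lborel. f x = 0"
  by (intro AE_zero_of_integral_box_zero integral_box_zero assms)

lemma integrable_indicator_L2:
  fixes f :: "R3 \<Rightarrow> 'b::euclidean_space"
  assumes "f \<in> L2"
  shows "integrable lborel (\<lambda>x. indicator (cball 0 R) x *\<^sub>R f x)"
proof (rule Bochner_Integration.integrable_bound)
  show "integrable lborel (\<lambda>x. indicator (cball 0 R) x *\<^sub>R 1 + (norm (f x))\<^sup>2)"
    by (intro Bochner_Integration.integrable_add L2_integrable assms borel_integrable_compact) auto
  have [measurable]: "cball 0 R \<in> sets (lborel :: R3 measure)" by simp
  show "(\<lambda>x. indicator (cball 0 R) x *\<^sub>R f x) \<in> borel_measurable lborel" using assms by measurable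
  have "norm (indicator (cball 0 R) x *\<^sub>R f x) \<le> norm (indicator (cball 0 R) x *\<^sub>R 1 + (norm (f x))\<^sup>2)" for x
  proof (cases "norm (f x) \<le> 1")
    case False
    then have "norm (f x) \<le> (norm (f x))\<^sup>2"
      using mult_left_mono[of 1 "norm (f x)" "norm (f x)"] by (simp add: power2_eq_square)
    then show ?thesis by (simp add: indicator_def)
  qed (simp add: indicator_def add_increasing2)
  then show "AE x in lborel. norm (indicator (cball 0 R) x *\<^sub>R f x) \<le> norm (indicator (cball 0 R) x *\<^sub>R 1 + (norm (f x))\<^sup>2)"
    by auto
qed

lemma fundamental_lemma_L2:
  fixes f :: "R3 \<Rightarrow> real"
  assumes "f \<in> L2" and "\<And>\<phi>. \<phi> \<in> Cc_infty UNIV \<Longrightarrow> (LINT x|lborel. \<phi> x * f x) = 0"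
  shows "AE x in lborel. f x = 0"
  using assms by (intro fundamental_lemma integrable_indicator_L2 L2_measurable)

text \<open>Otherwise c keeps the sign of c x0 on a small box, and a bump on that box has a nonzero
  integral against c.\<close>

lemma continuous_zero_of_integral_zero:
  fixes c :: "R3 \<Rightarrow> real"
  assumes U: "open U" and c: "continuous_on U c"
    and z: "\<And>\<phi>. \<phi> \<in> Cc_infty U \<Longrightarrow> (LINT x|lborel. \<phi> x * c x) = 0" and x0: "x0 \<in> U"
  shows "c x0 = 0"
proof (rule ccontr)
  assume n: "c x0 \<noteq> 0"
  have "open ((\<lambda>x. c x * c x0) -` {0<..} \<inter> U)"
    by (intro continuous_on_open_vimage[THEN iffD1, rule_format] U continuous_intros c)
  moreover have "x0 \<in> (\<lambda>x. c x * c x0) -` {0<..} \<inter> U"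
    using n x0 by (auto simp flip: power2_eq_square)
  ultimately obtain a b where ab: "x0 \<in> box a b" "cbox a b \<subseteq> (\<lambda>x. c x * c x0) -` {0<..} \<inter> U"
    using open_contains_cbox by meson
  then have pos: "\<And>x. x \<in> cbox a b \<Longrightarrow> c x * c x0 > 0" and sub: "cbox a b \<subseteq> U" by auto
  have B: "bump a b \<in> Cc_infty U" by (rule bump_Cc[OF sub])
  have i: "integrable lborel (\<lambda>x. bump a b x * c x)"
    using Cc_mult_continuous_integrable[OF B U c] by simp
  have nn: "0 \<le> bump a b x * c x * c x0" for x
    using bump_nonneg[of a b x] pos[of x] bump_nonzero_iff[of a b x] box_subset_cbox[of a b]
    by (cases "x \<in> box a b") (auto simp: mult.assoc intro!: mult_nonneg_nonneg less_imp_le)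
  have "(LINT x|lborel. bump a b x * c x * c x0) = 0" using z[OF B] i by simp
  then have "AE x in lborel. bump a b x * c x * c x0 = 0"
    using i nn by (subst (asm) integral_nonneg_eq_0_iff_AE) auto
  then have "AE x in lborel. x \<notin> box a b"
  proof eventually_elim
    case (elim x)
    show ?case
    proof
      assume x: "x \<in> box a b"
      then have "c x * c x0 > 0" using pos box_subset_cbox by blast
      then show False using elim x bump_nonzero_iff[of a b x] by auto
    qed
  qed
  then have "emeasure lborel (box a b) = 0"
    by (subst (asm) AE_iff_measurable[of "box a b"]) auto
  moreover have "emeasure lborel (box a b) = ennreal (\<Prod>i\<in>Basis. (b - a) \<bullet> i)"
    using ab(1) by (intro emeasure_lborel_box) (auto simp: mem_box intro: less_imp_le order.strict_trans)
  moreover have "(\<Prod>i\<in>Basis. (b - a) \<bullet> i) > 0"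
    using ab(1) by (intro prod_pos) (auto simp: mem_box inner_diff_left intro: order.strict_trans)
  ultimately show False by (metis ennreal_eq_0_iff linorder_not_le)
qed

section \<open>Fourier analysis: Gaussians, the Plancherel transform and Parseval's identity\<close>

section \<open>Integrals on products and affine substitution\<close>

lemma lborel_Fubini_integrable:
  fixes f :: "'a::euclidean_space \<times> 'b::euclidean_space \<Rightarrow> 'c::{banach, second_countable_topology}"
  assumes "f \<in> borel_measurable lborel" "integrable lborel (\<lambda>x. LINT y|lborel. norm (f (x, y)))"
    "AE x in lborel. integrable lborel (\<lambda>y. f (x, y))"
  shows "integrable lborel f"
  using lborel_pair.Fubini_integrable[of f] assms unfolding lborel_prod by blast

lemma lborel_integral_fst:
  fixes f :: "'a::euclidean_space \<times> 'b::euclidean_space \<Rightarrow> 'c::{banach, second_countable_topology}"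
  assumes "integrable lborel f"
  shows "(LINT x|lborel. LINT y|lborel. f (x, y)) = integral\<^sup>L lborel f"
  using lborel_pair.integral_fst'[of f] assms unfolding lborel_prod by blast

lemma lborel_integral_snd:
  fixes f :: "'a::euclidean_space \<times> 'b::euclidean_space \<Rightarrow> 'c::{banach, second_countable_topology}"
  assumes "integrable lborel f"
  shows "(LINT y|lborel. LINT x|lborel. f (x, y)) = integral\<^sup>L lborel f"
proof -
  have "integrable (lborel \<Otimes>\<^sub>M lborel) (\<lambda>(x, y). f (x, y))" using assms unfolding lborel_prod by simp
  from lborel_pair.Fubini_integral[OF this] show ?thesis using lborel_integral_fst[OF assms] by simp
qed

lemma lborel_swap_integrable:
  fixes f :: "'a::euclidean_space \<times> 'b::euclidean_space \<Rightarrow> 'c::{banach, second_countable_topology}"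
  assumes "integrable lborel f"
  shows "integrable lborel (\<lambda>p. f (snd p, fst p))"
  using lborel_pair.integrable_product_swap[of f] assms unfolding lborel_prod by (simp add: case_prod_beta')

lemma lborel_swap_integral:
  fixes f :: "'a::euclidean_space \<times> 'b::euclidean_space \<Rightarrow> 'c::{banach, second_countable_topology}"
  assumes "f \<in> borel_measurable lborel"
  shows "(LINT p|lborel. f (snd p, fst p)) = integral\<^sup>L lborel f"
  using lborel_pair.integral_product_swap[of f] assms unfolding lborel_prod by (simp add: case_prod_beta')

lemma integrable_tensor:
  fixes f :: "'a::euclidean_space \<Rightarrow> 'c::{real_normed_field, banach, second_countable_topology}"
    and g :: "'b::euclidean_space \<Rightarrow> 'c"
  assumes f: "integrable lborel f" and g: "integrable lborel g"
  shows "integrable lborel (\<lambda>p. f (fst p) * g (snd p))"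
proof (rule lborel_Fubini_integrable)
  have [measurable]: "f \<in> borel_measurable borel" "g \<in> borel_measurable borel" using f g by auto
  show "(\<lambda>p. f (fst p) * g (snd p)) \<in> borel_measurable lborel"
    unfolding lborel_prod[symmetric] by measurable
qed (use f g in \<open>auto simp: norm_mult\<close>)

lemma integral_tensor:
  fixes f :: "'a::euclidean_space \<Rightarrow> 'c::{real_normed_field, banach, second_countable_topology}"
    and g :: "'b::euclidean_space \<Rightarrow> 'c"
  assumes f: "integrable lborel f" and g: "integrable lborel g"
  shows "(LINT p|lborel. f (fst p) * g (snd p)) = (LINT x|lborel. f x) * (LINT y|lborel. g y)"
  using lborel_integral_fst[OF integrable_tensor[OF f g]] f g by simp

lemma lborel_affine_integrable:
  fixes G :: "'a::euclidean_space \<Rightarrow> 'b::{banach, second_countable_topology}"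
  assumes "integrable lborel G" "c \<noteq> 0"
  shows "integrable lborel (\<lambda>w. G (t + c *\<^sub>R w))"
proof -
  have m[measurable]: "G \<in> borel_measurable borel" using assms by auto
  have "integrable (density (distr lborel borel (\<lambda>x. t + c *\<^sub>R x)) (\<lambda>_. ennreal (\<bar>c\<bar>^DIM('a)))) G"
    using assms lborel_affine[of c t] by simp
  then have "integrable (distr lborel borel (\<lambda>x. t + c *\<^sub>R x)) (\<lambda>x. \<bar>c\<bar>^DIM('a) *\<^sub>R G x)"
    by (subst (asm) integrable_density) auto
  then have "integrable lborel (\<lambda>x. \<bar>c\<bar>^DIM('a) *\<^sub>R G (t + c *\<^sub>R x))"
    by (subst (asm) integrable_distr_eq) auto
  from integrable_scaleR_right[OF this, of "inverse (\<bar>c\<bar>^DIM('a))"] show ?thesis using assms(2) by simp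
qed

lemma lborel_affine_integral:
  fixes G :: "'a::euclidean_space \<Rightarrow> 'b::{banach, second_countable_topology}"
  assumes m: "G \<in> borel_measurable borel" and c: "c \<noteq> 0"
  shows "(LINT x|lborel. G x) = \<bar>c\<bar> ^ DIM('a) *\<^sub>R (LINT w|lborel. G (t + c *\<^sub>R w))"
proof -
  note m[measurable]
  have "(LINT x|lborel. G x) = (LINT x|density (distr lborel borel (\<lambda>x. t + c *\<^sub>R x)) (\<lambda>_. ennreal (\<bar>c\<bar>^DIM('a))). G x)"
    using lborel_affine[OF c, of t] by simp
  also have "\<dots> = (LINT x|distr lborel borel (\<lambda>x. t + c *\<^sub>R x). \<bar>c\<bar>^DIM('a) *\<^sub>R G x)"
    by (subst integral_density) auto
  also have "\<dots> = (LINT x|lborel. \<bar>c\<bar>^DIM('a) *\<^sub>R G (t + c *\<^sub>R x))"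
    by (subst integral_distr) auto
  finally show ?thesis by simp
qed

lemma integral_reflect:
  fixes G :: "'a::euclidean_space \<Rightarrow> 'b::{banach, second_countable_topology}"
  assumes m: "G \<in> borel_measurable borel"
  shows "(LINT y|lborel. G (x - y)) = (LINT y|lborel. G y)"
  using lborel_affine_integral[OF m, of "-1" x] by simp

lemma integrable_reflect:
  fixes G :: "'a::euclidean_space \<Rightarrow> 'b::{banach, second_countable_topology}"
  assumes m: "integrable lborel G"
  shows "integrable lborel (\<lambda>y. G (x - y))"
  using lborel_affine_integrable[OF m, of "-1" x] by simp

lemma lborel_Basis_prod_integral:
  fixes f :: "'a::euclidean_space \<Rightarrow> real \<Rightarrow> complex"
  assumes int: "\<And>b. b \<in> Basis \<Longrightarrow> integrable lborel (f b)"
  shows "integrable lborel (\<lambda>x::'a. \<Prod>b\<in>Basis. f b (x \<bullet> b))"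
    and "(LINT x|lborel. (\<Prod>b\<in>(Basis::'a set). f b (x \<bullet> b))) = (\<Prod>b\<in>(Basis::'a set). (LINT t|lborel. f b t))"
proof -
  interpret P: product_sigma_finite "\<lambda>_::'a. lborel :: real measure" by standard
  let ?T = "\<lambda>g. \<Sum>b\<in>Basis. g b *\<^sub>R b :: 'a"
  have [measurable]: "b \<in> Basis \<Longrightarrow> f b \<in> borel_measurable borel" for b using int by auto
  have m: "(\<lambda>x::'a. \<Prod>b\<in>Basis. f b (x \<bullet> b)) \<in> borel_measurable borel" by measurable
  have T: "?T \<in> measurable (\<Pi>\<^sub>M b\<in>(Basis :: 'a set). lborel) borel" by measurable
  have e: "(\<Prod>b\<in>Basis. f b (?T g \<bullet> b)) = (\<Prod>b\<in>Basis. f b (g b))" for g by (intro prod.cong) auto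
  have "integrable (\<Pi>\<^sub>M b\<in>(Basis :: 'a set). lborel) (\<lambda>g. \<Prod>b\<in>Basis. f b (?T g \<bullet> b))"
    unfolding e by (intro P.product_integrable_prod int) auto
  then show "integrable lborel (\<lambda>x::'a. \<Prod>b\<in>Basis. f b (x \<bullet> b))"
    by (subst lborel_eq, subst integrable_distr_eq[OF T m])
  have "(LINT x|lborel. (\<Prod>b\<in>(Basis::'a set). f b (x \<bullet> b))) = (LINT g|(\<Pi>\<^sub>M b\<in>(Basis :: 'a set). lborel). (\<Prod>b\<in>Basis. f b (?T g \<bullet> b)))"
    by (subst lborel_eq, subst integral_distr[OF T m]) simp
  also have "\<dots> = (\<Prod>b\<in>(Basis::'a set). (LINT t|lborel. f b t))"
    unfolding e by (intro P.product_integral_prod int) auto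
  finally show "(LINT x|lborel. (\<Prod>b\<in>(Basis::'a set). f b (x \<bullet> b))) = (\<Prod>b\<in>(Basis::'a set). (LINT t|lborel. f b t))" .
qed

section \<open>The Gaussian\<close>

lemma cis_measurable [measurable]: "cis \<in> borel_measurable borel"
  by (intro borel_measurable_continuous_onI continuous_intros)

lemma cnj_measurable [measurable]: "cnj \<in> borel_measurable borel"
  by (intro borel_measurable_continuous_onI continuous_intros)

text \<open>A rescaling of the characteristic function of the standard normal law: c = sqrt (2
  \<epsilon>) turns x^2 / 2 into \<epsilon> x^2.\<close>

lemma gaussian_fourier_1d:
  assumes e: "\<epsilon> > 0"
  shows "integrable lborel (\<lambda>x::real. of_real (exp (- \<epsilon> * x\<^sup>2)) * cis (z * x))"
    and "(LINT x|lborel. of_real (exp (- \<epsilon> * x\<^sup>2)) * cis (z * x)) = of_real (sqrt (pi / \<epsilon>) * exp (- z\<^sup>2 / (4 * \<epsilon>)))"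
proof -
  define c where "c = sqrt (2 * \<epsilon>)"
  have c: "c > 0" "c\<^sup>2 = 2 * \<epsilon>" using e by (auto simp: c_def)
  define h where "h = (\<lambda>x. std_normal_density x *\<^sub>R cis (z / c * x))"
  have hi: "integrable lborel h"
  proof (rule Bochner_Integration.integrable_bound)
    show "integrable lborel std_normal_density" by simp
    show "h \<in> borel_measurable lborel" unfolding h_def by measurable
  qed (auto simp: h_def)
  have "(LINT x|lborel. h x) = char std_normal_distribution (z / c)"
    unfolding char_def h_def by (subst integral_density) (auto simp: cis_conv_exp mult.commute)
  also have "\<dots> = of_real (exp (- z\<^sup>2 / (4 * \<epsilon>)))"
    by (simp add: char_std_normal_distribution power_divide c(2))
  finally have h: "(LINT x|lborel. h x) = of_real (exp (- z\<^sup>2 / (4 * \<epsilon>)))" .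
  have hc: "h (0 + c * x) = of_real (1 / sqrt (2 * pi)) * (of_real (exp (- \<epsilon> * x\<^sup>2)) * cis (z * x))" for x
    using c by (simp add: h_def std_normal_density_def power_mult_distrib scaleR_conv_of_real)
  have "integrable lborel (\<lambda>x. h (0 + c * x))" using c by (intro lborel_integrable_real_affine hi) auto
  then have "integrable lborel (\<lambda>x. of_real (sqrt (2 * pi)) * h (0 + c * x))" by simp
  then show i: "integrable lborel (\<lambda>x::real. of_real (exp (- \<epsilon> * x\<^sup>2)) * cis (z * x))"
    unfolding hc by simp
  have "(LINT x|lborel. h x) = c *\<^sub>R (LINT x|lborel. h (0 + c * x))"
    using lborel_integral_real_affine[of c h 0] c by simp
  also have "\<dots> = of_real (c / sqrt (2 * pi)) * (LINT x|lborel. of_real (exp (- \<epsilon> * x\<^sup>2)) * cis (z * x))"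
    unfolding hc by (subst integral_mult_right_zero) (simp add: scaleR_conv_of_real)
  finally have "of_real (sqrt (pi / \<epsilon>)) * (of_real (c / sqrt (2 * pi)) * (LINT x|lborel. of_real (exp (- \<epsilon> * x\<^sup>2)) * cis (z * x)))
     = of_real (sqrt (pi / \<epsilon>)) * complex_of_real (exp (- z\<^sup>2 / (4 * \<epsilon>)))" using h by simp
  moreover have "sqrt (pi / \<epsilon>) * (c / sqrt (2 * pi)) = 1"
    using e by (simp add: c_def real_sqrt_mult real_sqrt_divide)
  ultimately show "(LINT x|lborel. of_real (exp (- \<epsilon> * x\<^sup>2)) * cis (z * x)) = of_real (sqrt (pi / \<epsilon>) * exp (- z\<^sup>2 / (4 * \<epsilon>)))"
    by (simp only: mult.assoc[symmetric] of_real_mult[symmetric]) simp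
qed

lemma norm_R3_Basis: "(norm (x::R3))\<^sup>2 = (\<Sum>b\<in>Basis. (x \<bullet> b)\<^sup>2)"
  by (subst power2_norm_eq_inner, subst euclidean_inner) (simp add: power2_eq_square)

lemma gaussian_fourier:
  fixes z :: R3
  assumes e: "\<epsilon> > 0"
  shows "integrable lborel (\<lambda>x::R3. of_real (exp (- \<epsilon> * (norm x)\<^sup>2)) * cis (z \<bullet> x))"
    and "(LINT x|lborel. of_real (exp (- \<epsilon> * (norm (x::R3))\<^sup>2)) * cis (z \<bullet> x))
      = of_real (sqrt (pi / \<epsilon>) ^ 3 * exp (- (norm z)\<^sup>2 / (4 * \<epsilon>)))"
proof -
  define f where "f = (\<lambda>b t. complex_of_real (exp (- \<epsilon> * t\<^sup>2)) * cis ((z \<bullet> b) * t))"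
  have eq: "(\<lambda>x::R3. of_real (exp (- \<epsilon> * (norm x)\<^sup>2)) * cis (z \<bullet> x)) = (\<lambda>x::R3. \<Prod>b\<in>Basis. f b (x \<bullet> b))"
  proof
    fix x :: R3
    have "cis (z \<bullet> x) = (\<Prod>b\<in>Basis. cis ((z \<bullet> b) * (x \<bullet> b)))"
      by (subst euclidean_inner) (simp add: cis_conv_exp exp_sum sum_distrib_left of_real_sum)
    moreover have "exp (- \<epsilon> * (norm x)\<^sup>2) = (\<Prod>b\<in>Basis. exp (- \<epsilon> * (x \<bullet> b)\<^sup>2))"
      by (simp add: norm_R3_Basis sum_distrib_left exp_sum[symmetric] sum_negf)
    ultimately show "of_real (exp (- \<epsilon> * (norm x)\<^sup>2)) * cis (z \<bullet> x) = (\<Prod>b\<in>Basis. f b (x \<bullet> b))"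
      by (simp add: f_def prod.distrib)
  qed
  have i: "integrable lborel (f b)" for b unfolding f_def by (rule gaussian_fourier_1d[OF e])
  show "integrable lborel (\<lambda>x::R3. of_real (exp (- \<epsilon> * (norm x)\<^sup>2)) * cis (z \<bullet> x))"
    unfolding eq by (intro lborel_Basis_prod_integral i)
  have "(LINT x|lborel. of_real (exp (- \<epsilon> * (norm (x::R3))\<^sup>2)) * cis (z \<bullet> x)) = (\<Prod>b\<in>(Basis::R3 set). (LINT t|lborel. f b t))"
    unfolding eq by (intro lborel_Basis_prod_integral i)
  also have "\<dots> = (\<Prod>b\<in>(Basis::R3 set). of_real (sqrt (pi / \<epsilon>) * exp (- (z \<bullet> b)\<^sup>2 / (4 * \<epsilon>))))"
    unfolding f_def gaussian_fourier_1d(2)[OF e] ..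
  also have "\<dots> = of_real (sqrt (pi / \<epsilon>) ^ 3 * (\<Prod>b\<in>(Basis::R3 set). exp (- (z \<bullet> b)\<^sup>2 / (4 * \<epsilon>))))"
    by (simp add: prod.distrib flip: of_real_prod)
  also have "(\<Prod>b\<in>(Basis::R3 set). exp (- (z \<bullet> b)\<^sup>2 / (4 * \<epsilon>))) = exp (- (norm z)\<^sup>2 / (4 * \<epsilon>))"
    by (simp add: norm_R3_Basis exp_sum[symmetric] sum_negf sum_divide_distrib)
  finally show "(LINT x|lborel. of_real (exp (- \<epsilon> * (norm (x::R3))\<^sup>2)) * cis (z \<bullet> x))
      = of_real (sqrt (pi / \<epsilon>) ^ 3 * exp (- (norm z)\<^sup>2 / (4 * \<epsilon>)))" .
qed

lemma gaussian_integrable: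
  "\<epsilon> > 0 \<Longrightarrow> integrable lborel (\<lambda>x::R3. exp (- \<epsilon> * (norm x)\<^sup>2))"
  using integrable_Re[OF gaussian_fourier(1)[of \<epsilon> 0]] by simp

text \<open>The Gauss-Weierstrass kernel, normalised to mass 1. It appears as the transform of the
  Gaussian cut-off in Parseval's identity and again as the semigroup behind the fractional
  power.\<close>

definition heat :: "real \<Rightarrow> R3 \<Rightarrow> real" where
  "heat t z = exp (- (norm z)\<^sup>2 / (4 * t)) / sqrt (4 * pi * t) ^ 3"

lemma heat_nonneg: "t > 0 \<Longrightarrow> 0 \<le> heat t z"
  by (simp add: heat_def)

lemma heat_minus: "heat t (x - y) = heat t (y - x)"
  by (simp add: heat_def norm_minus_commute)

lemma heat_measurable [measurable]: "heat t \<in> borel_measurable borel"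
  unfolding heat_def by measurable

lemma heat_integrable: "t > 0 \<Longrightarrow> integrable lborel (heat t)"
  using gaussian_integrable[of "1 / (4 * t)"] by (simp add: heat_def[abs_def])

lemma heat_integral:
  assumes t: "t > 0" shows "(LINT z|lborel. heat t z) = 1"
proof -
  have "complex_of_real (LINT z|lborel. exp (- (1 / (4 * t)) * (norm (z::R3))\<^sup>2)) = of_real (sqrt (pi / (1 / (4 * t))) ^ 3)"
    using gaussian_fourier(2)[of "1 / (4 * t)" 0] t by (simp flip: integral_complex_of_real)
  then have "(LINT z|lborel. exp (- (1 / (4 * t)) * (norm (z::R3))\<^sup>2)) = sqrt (4 * pi * t) ^ 3"
    unfolding of_real_eq_iff by (simp add: mult_ac)
  then show ?thesis using t by (simp add: heat_def[abs_def])
qed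

lemma heat_scale:
  assumes "t > 0" shows "sqrt t ^ 3 * heat t (sqrt t *\<^sub>R w) = heat 1 w"
proof -
  have "sqrt (4 * pi * t) ^ 3 = sqrt (4 * pi) ^ 3 * sqrt t ^ 3" by (simp add: real_sqrt_mult power_mult_distrib)
  then show ?thesis using assms by (simp add: heat_def power_mult_distrib)
qed

section \<open>Fourier transform of integrable functions\<close>

abbreviation "fc \<equiv> (2 * pi) powr (- 3 / 2)"

lemma fc_square: "fc * fc = 1 / (2 * pi) ^ 3"
proof -
  have "fc * fc = (2 * pi) powr (- 3)" by (simp flip: powr_add)
  also have "\<dots> = inverse ((2 * pi) powr (real 3))" by (subst powr_minus[symmetric]) simp
  also have "\<dots> = 1 / (2 * pi) ^ 3" by (subst powr_realpow) (simp_all add: inverse_eq_divide)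
  finally show ?thesis .
qed

lemma integrable_mult_cis:
  fixes f :: "R3 \<Rightarrow> complex"
  assumes "integrable lborel f"
  shows "integrable lborel (\<lambda>x. f x * cis (a * (x \<bullet> \<xi>)))"
proof (rule Bochner_Integration.integrable_bound[OF assms])
  have [measurable]: "f \<in> borel_measurable borel" using assms by auto
  show "(\<lambda>x. f x * cis (a * (x \<bullet> \<xi>))) \<in> borel_measurable lborel" by measurable
qed (auto simp: norm_mult)

lemma integrable_mult_cis_minus:
  "integrable lborel f \<Longrightarrow> integrable lborel (\<lambda>x::R3. f x * cis (- (x \<bullet> \<xi>)))"
  using integrable_mult_cis[of f "-1" \<xi>] by simp

lemma fourier_measurable [measurable]:
  assumes "integrable lborel f"
  shows "fourier f \<in> borel_measurable borel"
proof -
  have [measurable]: "f \<in> borel_measurable borel" using assms by auto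
  have "(\<lambda>\<xi>. LINT x|lborel. f x * cis (- (x \<bullet> \<xi>))) \<in> borel_measurable borel"
    by (rule lborel.borel_measurable_lebesgue_integral) measurable
  then show ?thesis unfolding fourier_def[abs_def] by measurable
qed

lemma fourier_norm_le:
  assumes "integrable lborel f"
  shows "norm (fourier f \<xi>) \<le> fc * (LINT x|lborel. norm (f x))"
proof -
  have "norm (LINT x|lborel. f x * cis (- (x \<bullet> \<xi>))) \<le> (LINT x|lborel. norm (f x))"
    by (rule Bochner_Integration.integral_norm_bound_integral)
       (auto intro: integrable_mult_cis_minus integrable_norm assms simp: norm_mult)
  then show ?thesis by (simp add: fourier_def norm_mult mult_left_mono)
qed

lemma fourier_add:
  "integrable lborel f \<Longrightarrow> integrable lborel g \<Longrightarrow> fourier (\<lambda>x. f x + g x) \<xi> = fourier f \<xi> + fourier g \<xi>"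
  by (simp add: fourier_def algebra_simps integrable_mult_cis_minus)

lemma fourier_diff:
  "integrable lborel f \<Longrightarrow> integrable lborel g \<Longrightarrow> fourier (\<lambda>x. f x - g x) \<xi> = fourier f \<xi> - fourier g \<xi>"
  by (simp add: fourier_def algebra_simps integrable_mult_cis_minus)

lemma cnj_fourier: "cnj (fourier f \<xi>) = of_real fc * (LINT x|lborel. cnj (f x) * cis (x \<bullet> \<xi>))"
proof -
  have "(LINT x|lborel. cnj (f x) * cis (x \<bullet> \<xi>)) = (LINT x|lborel. cnj (f x * cis (- (x \<bullet> \<xi>))))"
    by (simp add: cis_cnj)
  also have "\<dots> = cnj (LINT x|lborel. f x * cis (- (x \<bullet> \<xi>)))" by (rule Bochner_Integration.integral_cnj)
  finally show ?thesis by (simp add: fourier_def)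
qed

lemma fourier_times_cnj:
  assumes f: "integrable lborel f" and g: "integrable lborel g"
  shows "fourier f \<xi> * cnj (fourier g \<xi>) = of_real (fc * fc) *
    (LINT p|lborel. f (fst p) * cnj (g (snd p)) * cis (- ((fst p - snd p) \<bullet> \<xi>)))"
proof -
  have g': "integrable lborel (\<lambda>x. cnj (g x))" using g by simp
  have 1: "integrable lborel (\<lambda>y. cnj (g y) * cis (y \<bullet> \<xi>))" using integrable_mult_cis[OF g', of 1] by simp
  have "(LINT p|lborel. f (fst p) * cnj (g (snd p)) * cis (- ((fst p - snd p) \<bullet> \<xi>)))
    = (LINT p|lborel. (f (fst p) * cis (- (fst p \<bullet> \<xi>))) * (cnj (g (snd p)) * cis (snd p \<bullet> \<xi>)))"
    by (intro Bochner_Integration.integral_cong refl) (simp add: inner_diff_left cis_mult mult_ac)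
  also have "\<dots> = (LINT x|lborel. f x * cis (- (x \<bullet> \<xi>))) * (LINT y|lborel. cnj (g y) * cis (y \<bullet> \<xi>))"
    by (rule integral_tensor[OF integrable_mult_cis_minus[OF f] 1])
  finally show ?thesis unfolding cnj_fourier by (simp add: fourier_def mult_ac)
qed

text \<open>The Gaussian factor makes the integral over x, y and \<xi> absolutely convergent, so the
  \<xi> integral may be carried out before the others and leaves a heat kernel in x - y. Parseval's
  identity is the limit of \<epsilon> tending to 0; at fixed \<epsilon> the formula returns in
  \<open>frac_laplacian_off_support\<close>.\<close>

lemma gaussian_parseval:
  assumes f: "integrable lborel f" and g: "integrable lborel g" and e: "\<epsilon> > 0"
  shows "(LINT \<xi>|lborel. of_real (exp (- \<epsilon> * (norm \<xi>)\<^sup>2)) * (fourier f \<xi> * cnj (fourier g \<xi>)))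
    = (LINT p|lborel. f (fst p) * cnj (g (snd p)) * of_real (heat \<epsilon> (fst p - snd p)))"
proof -
  define F where "F = (\<lambda>p. f (fst p) * cnj (g (snd p)))"
  have g': "integrable lborel (\<lambda>x. cnj (g x))" using g by simp
  have Fi: "integrable lborel F" unfolding F_def by (rule integrable_tensor[OF f g'])
  have [measurable]: "f \<in> borel_measurable borel" "g \<in> borel_measurable borel" using f g by auto
  have [measurable]: "F \<in> borel_measurable (borel \<Otimes>\<^sub>M borel)" unfolding F_def by measurable
  define E where "E = (\<lambda>\<xi>::R3. exp (- \<epsilon> * (norm \<xi>)\<^sup>2))"
  have Ei: "integrable lborel (\<lambda>\<xi>. complex_of_real (E \<xi>))" unfolding E_def using gaussian_integrable[OF e] by simp
  have [measurable]: "E \<in> borel_measurable borel" unfolding E_def by measurable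
  define H where "H = (\<lambda>q. F (fst q) * (of_real (E (snd q)) * cis (- ((fst (fst q) - snd (fst q)) \<bullet> snd q))))"
  have Hi: "integrable lborel H"
  proof (rule Bochner_Integration.integrable_bound[OF integrable_tensor[OF Fi Ei]])
    show "H \<in> borel_measurable lborel" unfolding H_def lborel_prod[symmetric] by measurable
  qed (auto simp: H_def norm_mult)
  have "(LINT \<xi>|lborel. of_real (E \<xi>) * (fourier f \<xi> * cnj (fourier g \<xi>)))
    = (LINT \<xi>|lborel. of_real (fc * fc) * (LINT p|lborel. H (p, \<xi>)))"
  proof (intro Bochner_Integration.integral_cong refl)
    fix \<xi> :: R3
    have "(LINT p|lborel. H (p, \<xi>)) = (LINT p|lborel. of_real (E \<xi>) * (F p * cis (- ((fst p - snd p) \<bullet> \<xi>))))"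
      by (intro Bochner_Integration.integral_cong refl) (simp add: H_def mult_ac)
    then show "of_real (E \<xi>) * (fourier f \<xi> * cnj (fourier g \<xi>)) = of_real (fc * fc) * (LINT p|lborel. H (p, \<xi>))"
      unfolding fourier_times_cnj[OF f g] by (simp add: F_def)
  qed
  also have "\<dots> = of_real (fc * fc) * (LINT p|lborel. LINT \<xi>|lborel. H (p, \<xi>))"
    using lborel_integral_snd[OF Hi] lborel_integral_fst[OF Hi] by simp
  also have "(LINT p|lborel. LINT \<xi>|lborel. H (p, \<xi>)) = (LINT p|lborel. F p * of_real (sqrt (pi / \<epsilon>) ^ 3 * exp (- (norm (fst p - snd p))\<^sup>2 / (4 * \<epsilon>))))"
  proof (intro Bochner_Integration.integral_cong refl)
    fix p :: "R3 \<times> R3"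
    have "(LINT \<xi>|lborel. H (p, \<xi>)) = F p * (LINT \<xi>|lborel. of_real (exp (- \<epsilon> * (norm \<xi>)\<^sup>2)) * cis ((snd p - fst p) \<bullet> \<xi>))"
      unfolding H_def E_def by (simp add: inner_diff_left)
    also have "\<dots> = F p * of_real (sqrt (pi / \<epsilon>) ^ 3 * exp (- (norm (fst p - snd p))\<^sup>2 / (4 * \<epsilon>)))"
      by (subst gaussian_fourier(2)[OF e]) (simp add: norm_minus_commute)
    finally show "(LINT \<xi>|lborel. H (p, \<xi>)) = F p * of_real (sqrt (pi / \<epsilon>) ^ 3 * exp (- (norm (fst p - snd p))\<^sup>2 / (4 * \<epsilon>)))" .
  qed
  also have "of_real (fc * fc) * \<dots> = (LINT p|lborel. F p * of_real (heat \<epsilon> (fst p - snd p)))"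
  proof -
    have c: "fc * fc * sqrt (pi / \<epsilon>) ^ 3 = 1 / sqrt (4 * pi * \<epsilon>) ^ 3"
    proof -
      have s: "sqrt (pi / \<epsilon>) / (2 * pi) = 1 / sqrt (4 * pi * \<epsilon>)"
      proof -
        have "sqrt pi * sqrt pi = pi" by simp
        moreover have "sqrt (4 * pi * \<epsilon>) = 2 * sqrt pi * sqrt \<epsilon>" by (simp add: real_sqrt_mult)
        ultimately show ?thesis using e by (simp add: real_sqrt_divide field_simps)
      qed
      have "fc * fc * sqrt (pi / \<epsilon>) ^ 3 = (sqrt (pi / \<epsilon>) / (2 * pi)) ^ 3"
        unfolding fc_square by (simp add: power_divide)
      then show ?thesis unfolding s by (simp add: power_divide)
    qed
    have "of_real (fc * fc) * (LINT p|lborel. F p * of_real (sqrt (pi / \<epsilon>) ^ 3 * exp (- (norm (fst p - snd p))\<^sup>2 / (4 * \<epsilon>))))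
      = (LINT p|lborel. of_real (fc * fc) * (F p * of_real (sqrt (pi / \<epsilon>) ^ 3 * exp (- (norm (fst p - snd p))\<^sup>2 / (4 * \<epsilon>)))))"
      by simp
    also have "\<dots> = (LINT p|lborel. F p * of_real (heat \<epsilon> (fst p - snd p)))"
    proof (intro Bochner_Integration.integral_cong refl)
      fix p :: "R3 \<times> R3"
      have "heat \<epsilon> (fst p - snd p) = (fc * fc * sqrt (pi / \<epsilon>) ^ 3) * exp (- (norm (fst p - snd p))\<^sup>2 / (4 * \<epsilon>))"
        unfolding c heat_def by simp
      then show "of_real (fc * fc) * (F p * of_real (sqrt (pi / \<epsilon>) ^ 3 * exp (- (norm (fst p - snd p))\<^sup>2 / (4 * \<epsilon>))))
          = F p * of_real (heat \<epsilon> (fst p - snd p))"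
        by (simp only: of_real_mult mult_ac)
    qed
    finally show ?thesis .
  qed
  finally show ?thesis by (simp add: E_def F_def)
qed

lemma heat_weighted_integrable:
  fixes u :: "R3 \<Rightarrow> real"
  assumes u: "integrable lborel u" and t: "t > 0"
  shows "integrable lborel (\<lambda>p. u (fst p) * heat t (fst p - snd p))"
    and "(LINT p|lborel. u (fst p) * heat t (fst p - snd p)) = (LINT x|lborel. u x)"
proof -
  have [measurable]: "u \<in> borel_measurable borel" using u by auto
  have hi: "integrable lborel (\<lambda>y. heat t (x - y))" for x using integrable_reflect[OF heat_integrable[OF t]] .
  have h1: "(LINT y|lborel. heat t (x - y)) = 1" for x
    using integral_reflect[of "heat t" x] heat_integral[OF t] by simp
  show i: "integrable lborel (\<lambda>p. u (fst p) * heat t (fst p - snd p))"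
  proof (rule lborel_Fubini_integrable)
    show "(\<lambda>p. u (fst p) * heat t (fst p - snd p)) \<in> borel_measurable lborel"
      unfolding lborel_prod[symmetric] by measurable
    show "integrable lborel (\<lambda>x. LINT y|lborel. norm (u (fst (x, y)) * heat t (fst (x, y) - snd (x, y))))"
      using u heat_nonneg[OF t] h1 by (simp add: abs_mult)
  qed (use hi in auto)
  show "(LINT p|lborel. u (fst p) * heat t (fst p - snd p)) = (LINT x|lborel. u x)"
    using lborel_integral_fst[OF i] h1 by simp
qed

text \<open>Schur test: |f x| |f y| is at most the mean of the squares, and the kernel has mass 1 in
  either variable. The bound is uniform in t.\<close>

lemma heat_form_bound:
  assumes f: "integrable lborel f" "f \<in> L2" and t: "t > 0"
  shows "norm (LINT p|lborel. f (fst p) * cnj (f (snd p)) * of_real (heat t (fst p - snd p))) \<le> (norm_L2 f)\<^sup>2"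
proof -
  let ?u = "\<lambda>x. (norm (f x))\<^sup>2"
  have u: "integrable lborel ?u" using f(2) by (rule L2_integrable)
  have [measurable]: "f \<in> borel_measurable borel" using f by auto
  note a = heat_weighted_integrable[OF u t]
  have b: "integrable lborel (\<lambda>p. ?u (snd p) * heat t (fst p - snd p))"
    "(LINT p|lborel. ?u (snd p) * heat t (fst p - snd p)) = (LINT x|lborel. ?u x)"
  proof -
    show "integrable lborel (\<lambda>p. ?u (snd p) * heat t (fst p - snd p))"
      using lborel_swap_integrable[OF a(1)] by (simp add: heat_minus)
    have "(LINT p|lborel. ?u (snd p) * heat t (snd p - fst p)) = (LINT p|lborel. ?u (fst p) * heat t (fst p - snd p))"
      using lborel_swap_integral[of "\<lambda>p. ?u (fst p) * heat t (fst p - snd p)"] a(1) by simp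
    then show "(LINT p|lborel. ?u (snd p) * heat t (fst p - snd p)) = (LINT x|lborel. ?u x)"
      using a(2) by (simp add: heat_minus)
  qed
  have "norm (LINT p|lborel. f (fst p) * cnj (f (snd p)) * of_real (heat t (fst p - snd p)))
    \<le> (LINT p|lborel. (?u (fst p) * heat t (fst p - snd p) + ?u (snd p) * heat t (fst p - snd p)) / 2)"
  proof (rule Bochner_Integration.integral_norm_bound_integral)
    show w: "integrable lborel (\<lambda>p. (?u (fst p) * heat t (fst p - snd p) + ?u (snd p) * heat t (fst p - snd p)) / 2)"
      using a(1) b(1) by simp
    have le: "norm (f (fst p) * cnj (f (snd p)) * of_real (heat t (fst p - snd p)))
      \<le> (?u (fst p) * heat t (fst p - snd p) + ?u (snd p) * heat t (fst p - snd p)) / 2" for p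
    proof -
      have "norm (f (fst p)) * norm (f (snd p)) \<le> (?u (fst p) + ?u (snd p)) / 2"
        using sum_squares_bound[of "norm (f (fst p))" "norm (f (snd p))"] by simp
      from mult_right_mono[OF this heat_nonneg[OF t, of "fst p - snd p"]]
      show ?thesis using heat_nonneg[OF t] by (simp add: norm_mult algebra_simps add_divide_distrib)
    qed
    then show "\<And>p. p \<in> space lborel \<Longrightarrow> norm (f (fst p) * cnj (f (snd p)) * of_real (heat t (fst p - snd p)))
      \<le> (?u (fst p) * heat t (fst p - snd p) + ?u (snd p) * heat t (fst p - snd p)) / 2" .
    show "integrable lborel (\<lambda>p. f (fst p) * cnj (f (snd p)) * of_real (heat t (fst p - snd p)))"
    proof (rule Bochner_Integration.integrable_bound[OF w])
      show "(\<lambda>p. f (fst p) * cnj (f (snd p)) * complex_of_real (heat t (fst p - snd p))) \<in> borel_measurable lborel"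
        unfolding lborel_prod[symmetric] by measurable
      show "AE p in lborel. norm (f (fst p) * cnj (f (snd p)) * complex_of_real (heat t (fst p - snd p)))
          \<le> norm ((?u (fst p) * heat t (fst p - snd p) + ?u (snd p) * heat t (fst p - snd p)) / 2)"
        unfolding real_norm_def by (intro always_eventually allI order_trans[OF le abs_ge_self])
    qed
  qed
  also have "\<dots> = (norm_L2 f)\<^sup>2" using a b by (simp add: norm_L2_square)
  finally show ?thesis .
qed

text \<open>One half of Plancherel's theorem: the Gaussian-weighted norm of the transform is bounded
  by the norm of f uniformly in the weight, and Fatou's lemma removes the weight. The inequality is
  what extends the transform to L2 by continuity.\<close>

lemma fourier_L2_bound:
  assumes f: "integrable lborel f" "f \<in> L2"
  shows "fourier f \<in> L2" and "norm_L2 (fourier f) \<le> norm_L2 f"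
proof -
  have [measurable]: "fourier f \<in> borel_measurable borel" using f by measurable
  define C where "C = fc * (LINT x|lborel. norm (f x))"
  have C: "norm (fourier f \<xi>) \<le> C" for \<xi> unfolding C_def by (rule fourier_norm_le[OF f(1)])
  have gi: "integrable lborel (\<lambda>\<xi>. exp (- \<epsilon> * (norm \<xi>)\<^sup>2) * (norm (fourier f \<xi>))\<^sup>2)"
    and gle: "(LINT \<xi>|lborel. exp (- \<epsilon> * (norm \<xi>)\<^sup>2) * (norm (fourier f \<xi>))\<^sup>2) \<le> (norm_L2 f)\<^sup>2" if e: "\<epsilon> > 0" for \<epsilon>
  proof -
    show i: "integrable lborel (\<lambda>\<xi>. exp (- \<epsilon> * (norm \<xi>)\<^sup>2) * (norm (fourier f \<xi>))\<^sup>2)"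
    proof (rule Bochner_Integration.integrable_bound)
      show "integrable lborel (\<lambda>\<xi>::R3. exp (- \<epsilon> * (norm \<xi>)\<^sup>2) * C\<^sup>2)" using gaussian_integrable[OF e] by simp
      show "AE \<xi> in lborel. norm (exp (- \<epsilon> * (norm \<xi>)\<^sup>2) * (norm (fourier f \<xi>))\<^sup>2) \<le> norm (exp (- \<epsilon> * (norm \<xi>)\<^sup>2) * C\<^sup>2)"
        using power_mono[OF C, of _ 2] by (auto intro!: always_eventually mult_left_mono)
    qed measurable
    have "(LINT \<xi>|lborel. complex_of_real (exp (- \<epsilon> * (norm \<xi>)\<^sup>2)) * (fourier f \<xi> * cnj (fourier f \<xi>)))
      = (LINT \<xi>|lborel. complex_of_real (exp (- \<epsilon> * (norm \<xi>)\<^sup>2) * (norm (fourier f \<xi>))\<^sup>2))"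
      by (intro Bochner_Integration.integral_cong refl) (simp only: of_real_mult complex_norm_square)
    also have "\<dots> = complex_of_real (LINT \<xi>|lborel. exp (- \<epsilon> * (norm \<xi>)\<^sup>2) * (norm (fourier f \<xi>))\<^sup>2)"
      by (rule integral_complex_of_real)
    finally have "norm (complex_of_real (LINT \<xi>|lborel. exp (- \<epsilon> * (norm \<xi>)\<^sup>2) * (norm (fourier f \<xi>))\<^sup>2)) \<le> (norm_L2 f)\<^sup>2"
      using heat_form_bound[OF f e] gaussian_parseval[OF f(1) f(1) e] by simp
    then show "(LINT \<xi>|lborel. exp (- \<epsilon> * (norm \<xi>)\<^sup>2) * (norm (fourier f \<xi>))\<^sup>2) \<le> (norm_L2 f)\<^sup>2"
      by (simp only: norm_of_real)
  qed
  have "(\<integral>\<^sup>+ \<xi>. ennreal ((norm (fourier f \<xi>))\<^sup>2) \<partial>lborel)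
    = (\<integral>\<^sup>+ \<xi>. liminf (\<lambda>n. ennreal (exp (- (1 / real (Suc n)) * (norm \<xi>)\<^sup>2) * (norm (fourier f \<xi>))\<^sup>2)) \<partial>lborel)"
  proof (intro nn_integral_cong lim_imp_Liminf[symmetric])
    fix \<xi> :: R3
    have "(\<lambda>n. exp (- (1 / real (Suc n)) * (norm \<xi>)\<^sup>2) * (norm (fourier f \<xi>))\<^sup>2) \<longlonglongrightarrow> exp (- 0 * (norm \<xi>)\<^sup>2) * (norm (fourier f \<xi>))\<^sup>2"
      by (intro tendsto_intros LIMSEQ_Suc[OF lim_1_over_n])
    then show "(\<lambda>n. ennreal (exp (- (1 / real (Suc n)) * (norm \<xi>)\<^sup>2) * (norm (fourier f \<xi>))\<^sup>2)) \<longlonglongrightarrow> ennreal ((norm (fourier f \<xi>))\<^sup>2)"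
      by (intro tendsto_ennrealI) simp
  qed simp
  also have "\<dots> \<le> liminf (\<lambda>n. \<integral>\<^sup>+ \<xi>. ennreal (exp (- (1 / real (Suc n)) * (norm \<xi>)\<^sup>2) * (norm (fourier f \<xi>))\<^sup>2) \<partial>lborel)"
    by (intro nn_integral_liminf) measurable
  also have "\<dots> \<le> ennreal ((norm_L2 f)\<^sup>2)"
  proof (intro Liminf_le always_eventually allI)
    fix n
    have "(\<integral>\<^sup>+ \<xi>. ennreal (exp (- (1 / real (Suc n)) * (norm \<xi>)\<^sup>2) * (norm (fourier f \<xi>))\<^sup>2) \<partial>lborel)
      = ennreal (LINT \<xi>|lborel. exp (- (1 / real (Suc n)) * (norm \<xi>)\<^sup>2) * (norm (fourier f \<xi>))\<^sup>2)"
      by (intro nn_integral_eq_integral gi) auto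
    also have "\<dots> \<le> ennreal ((norm_L2 f)\<^sup>2)" by (intro ennreal_leI gle) auto
    finally show "(\<integral>\<^sup>+ \<xi>. ennreal (exp (- (1 / real (Suc n)) * (norm \<xi>)\<^sup>2) * (norm (fourier f \<xi>))\<^sup>2) \<partial>lborel) \<le> ennreal ((norm_L2 f)\<^sup>2)" .
  qed simp
  finally have le: "(\<integral>\<^sup>+ \<xi>. ennreal ((norm (fourier f \<xi>))\<^sup>2) \<partial>lborel) \<le> ennreal ((norm_L2 f)\<^sup>2)" .
  have i: "integrable lborel (\<lambda>\<xi>. (norm (fourier f \<xi>))\<^sup>2)"
    by (rule integrableI_nonneg) (use le in \<open>auto simp: le_less_trans\<close>)
  then show "fourier f \<in> L2" by (simp add: L2_def)
  have "(norm_L2 (fourier f))\<^sup>2 \<le> (norm_L2 f)\<^sup>2"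
    using le nn_integral_eq_integral[OF i] by (simp add: norm_L2_square ennreal_le_iff integral_nonneg_AE)
  then show "norm_L2 (fourier f) \<le> norm_L2 f" by (rule power2_le_imp_le) simp
qed

section \<open>The Plancherel transform\<close>

lemma fourier_multiplication:
  assumes f: "integrable lborel f" and g: "integrable lborel g"
  shows "(LINT \<xi>|lborel. fourier f \<xi> * g \<xi>) = (LINT x|lborel. f x * fourier g x)"
proof -
  have [measurable]: "f \<in> borel_measurable borel" "g \<in> borel_measurable borel" using f g by auto
  define H where "H = (\<lambda>p. f (fst p) * g (snd p) * cis (- (fst p \<bullet> snd p)))"
  have Hi: "integrable lborel H"
  proof (rule Bochner_Integration.integrable_bound[OF integrable_tensor[OF f g]])
    show "H \<in> borel_measurable lborel" unfolding H_def lborel_prod[symmetric] by measurable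
  qed (auto simp: H_def norm_mult)
  have "(LINT \<xi>|lborel. fourier f \<xi> * g \<xi>) = (LINT \<xi>|lborel. of_real fc * (LINT x|lborel. H (x, \<xi>)))"
  proof (intro Bochner_Integration.integral_cong refl)
    fix \<xi>
    have "(LINT x|lborel. H (x, \<xi>)) = (LINT x|lborel. (f x * cis (- (x \<bullet> \<xi>))) * g \<xi>)"
      by (intro Bochner_Integration.integral_cong refl) (simp add: H_def)
    then show "fourier f \<xi> * g \<xi> = of_real fc * (LINT x|lborel. H (x, \<xi>))"
      by (simp add: fourier_def)
  qed
  also have "\<dots> = of_real fc * (LINT x|lborel. LINT \<xi>|lborel. H (x, \<xi>))"
    using lborel_integral_snd[OF Hi] lborel_integral_fst[OF Hi] by simp
  also have "\<dots> = (LINT x|lborel. of_real fc * (LINT \<xi>|lborel. H (x, \<xi>)))" by simp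
  also have "\<dots> = (LINT x|lborel. f x * fourier g x)"
  proof (intro Bochner_Integration.integral_cong refl)
    fix x
    have "(LINT \<xi>|lborel. H (x, \<xi>)) = (LINT \<xi>|lborel. f x * (g \<xi> * cis (- (\<xi> \<bullet> x))))"
      by (intro Bochner_Integration.integral_cong refl) (simp add: H_def inner_commute)
    then show "of_real fc * (LINT \<xi>|lborel. H (x, \<xi>)) = f x * fourier g x"
      by (simp add: fourier_def)
  qed
  finally show ?thesis .
qed

text \<open>Truncation puts an L2 function among the integrable ones, where the integral formula for
  the transform makes sense.\<close>

definition trunc :: "nat \<Rightarrow> (R3 \<Rightarrow> 'b::real_vector) \<Rightarrow> R3 \<Rightarrow> 'b" where
  "trunc n f x = indicator (cball 0 (real n)) x *\<^sub>R f x"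

lemma trunc_integrable: "f \<in> L2 \<Longrightarrow> integrable lborel (trunc n f)" for f :: "R3 \<Rightarrow> 'b::euclidean_space"
  unfolding trunc_def[abs_def] by (rule integrable_indicator_L2)

lemma trunc_L2:
  fixes f :: "R3 \<Rightarrow> 'b::euclidean_space"
  assumes "f \<in> L2" shows "trunc n f \<in> L2"
proof (rule L2_mono[of _ f 1])
  show "trunc n f \<in> borel_measurable lborel" using trunc_integrable[OF assms] by auto
qed (use assms in \<open>auto simp: trunc_def indicator_def\<close>)

lemma trunc_tendsto:
  fixes f :: "R3 \<Rightarrow> 'b::euclidean_space"
  assumes f: "f \<in> L2" shows "(\<lambda>n. norm_L2 (\<lambda>x. trunc n f x - f x)) \<longlonglongrightarrow> 0"
proof -
  have [measurable]: "trunc n f \<in> borel_measurable lborel" for n using trunc_integrable[OF f] by auto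
  have [measurable]: "f \<in> borel_measurable lborel" using f by measurable
  have "(\<lambda>n. LINT x|lborel. (norm (trunc n f x - f x))\<^sup>2) \<longlonglongrightarrow> (LINT x|(lborel::R3 measure). 0)"
  proof (rule integral_dominated_convergence[where w="\<lambda>x. (norm (f x))\<^sup>2"])
    show "AE x in lborel. (\<lambda>n. (norm (trunc n f x - f x))\<^sup>2) \<longlonglongrightarrow> 0"
    proof (intro always_eventually allI)
      fix x :: R3
      obtain N where N: "norm x \<le> real N" using real_arch_simple by blast
      have "(norm (trunc n f x - f x))\<^sup>2 = 0" if "n \<ge> N" for n
        using N that by (simp add: trunc_def)
      then show "(\<lambda>n. (norm (trunc n f x - f x))\<^sup>2) \<longlonglongrightarrow> 0"
        by (intro tendsto_eventually eventually_sequentiallyI[of N])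
    qed
    show "AE x in lborel. norm ((norm (trunc n f x - f x))\<^sup>2) \<le> (norm (f x))\<^sup>2" for n
      by (intro always_eventually allI) (auto simp: trunc_def indicator_def)
  qed (use f in \<open>auto simp: L2_integrable\<close>)
  then have "(\<lambda>n. sqrt (LINT x|lborel. (norm (trunc n f x - f x))\<^sup>2)) \<longlonglongrightarrow> sqrt 0"
    by (intro tendsto_real_sqrt) simp
  then show ?thesis by (simp add: norm_L2_def)
qed

lemma L2_convergent_Cauchy:
  fixes F :: "nat \<Rightarrow> R3 \<Rightarrow> 'b::euclidean_space"
  assumes F: "\<And>n. F n \<in> L2" "f \<in> L2" "(\<lambda>n. norm_L2 (\<lambda>x. F n x - f x)) \<longlonglongrightarrow> 0" and e: "e > 0"
  shows "\<exists>N. \<forall>m\<ge>N. \<forall>n\<ge>N. norm_L2 (\<lambda>x. F m x - F n x) < e"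
proof -
  obtain N where N: "\<And>n. n \<ge> N \<Longrightarrow> norm_L2 (\<lambda>x. F n x - f x) < e / 2"
    using LIMSEQ_D[OF F(3), of "e / 2"] e by auto
  have "norm_L2 (\<lambda>x. F m x - F n x) < e" if "m \<ge> N" "n \<ge> N" for m n
    using norm_L2_triangle_diff[OF F(1)[of m] F(2) F(1)[of n]] N[OF that(1)] N[OF that(2)]
      norm_L2_minus_commute[of f "F n"] by simp
  then show ?thesis by blast
qed

lemma plancherel_limit:
  fixes f :: "R3 \<Rightarrow> complex"
  assumes f: "f \<in> L2"
  shows "\<exists>F\<in>L2. (\<lambda>n. norm_L2 (\<lambda>\<xi>. fourier (trunc n f) \<xi> - F \<xi>)) \<longlonglongrightarrow> 0"
proof (rule L2_complete)
  note t = trunc_integrable[OF f] trunc_L2[OF f]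
  show "fourier (trunc n f) \<in> L2" for n by (rule fourier_L2_bound[OF t])
  fix e :: real assume "e > 0"
  then obtain N where N: "\<And>m n. m \<ge> N \<Longrightarrow> n \<ge> N \<Longrightarrow> norm_L2 (\<lambda>x. trunc m f x - trunc n f x) < e"
    using L2_convergent_Cauchy[OF t(2) f trunc_tendsto[OF f]] by blast
  have "norm_L2 (\<lambda>x. fourier (trunc m f) x - fourier (trunc n f) x) \<le> norm_L2 (\<lambda>x. trunc m f x - trunc n f x)" for m n
  proof -
    have "(\<lambda>\<xi>. fourier (trunc m f) \<xi> - fourier (trunc n f) \<xi>) = fourier (\<lambda>x. trunc m f x - trunc n f x)"
      using fourier_diff[OF t(1) t(1)] by auto
    then show ?thesis using fourier_L2_bound(2)[OF Bochner_Integration.integrable_diff[OF t(1) t(1)] L2.diff_mem[OF t(2) t(2)]] by simp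
  qed
  then show "\<exists>N. \<forall>m\<ge>N. \<forall>n\<ge>N. norm_L2 (\<lambda>x. fourier (trunc m f) x - fourier (trunc n f) x) < e"
    using N by (meson le_less_trans)
qed

lemma of_real_L2: "f \<in> L2 \<Longrightarrow> (\<lambda>x. complex_of_real (f x)) \<in> L2"
  unfolding L2_def by auto

lemma norm_L2_of_real [simp]: "norm_L2 (\<lambda>x. complex_of_real (f x)) = norm_L2 f"
  by (simp add: norm_L2_def)

lemma integrable_Basis_inverse:
  "integrable lborel (\<lambda>x::R3. \<Prod>b\<in>Basis. inverse (1 + (x \<bullet> b)\<^sup>2))"
proof -
  have "integrable lborel (\<lambda>t::real. inverse (1 + t\<^sup>2))"
    using integrable_inverse_1_plus_square by (simp add: set_integrable_def einterval_def)
  then have "integrable lborel (\<lambda>t::real. complex_of_real (inverse (1 + t\<^sup>2)))"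
    by (simp only: integrable_of_real)
  then have "integrable lborel (\<lambda>x::R3. \<Prod>b\<in>Basis. complex_of_real (inverse (1 + (x \<bullet> b)\<^sup>2)))"
    by (intro lborel_Basis_prod_integral(1)[of "\<lambda>b t. complex_of_real (inverse (1 + t\<^sup>2))"])
  then have "integrable lborel (\<lambda>x::R3. complex_of_real (\<Prod>b\<in>Basis. inverse (1 + (x \<bullet> b)\<^sup>2)))"
    by (simp only: of_real_prod)
  from integrable_Re[OF this] show ?thesis by (simp only: Re_complex_of_real)
qed

text \<open>(1 + |x|)^6 dominates the product over the three coordinates of 1 + (x \<bullet> b)^2,
  whose reciprocal is integrable as a tensor product of one-dimensional integrable
  functions.\<close>

lemma schwartz_integrable_L2:
  assumes "\<phi> \<in> schwartz"
  shows "integrable lborel \<phi>" and "\<phi> \<in> L2"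
proof -
  have sm: "smooth \<phi>" and bd: "\<And>k. bounded (range (\<lambda>x. (1 + norm x) ^ k *\<^sub>R \<phi> x))"
    using assms unfolding schwartz_def by (auto dest: spec[of _ "[]"])
  have m: "\<phi> \<in> borel_measurable lborel" by (rule smooth_measurable[OF sm])
  obtain C where C: "\<And>x. norm ((1 + norm x) ^ 6 *\<^sub>R \<phi> x) \<le> C" using bd[of 6] by (auto simp: bounded_iff)
  have C0: "C \<ge> 0" using C[of 0] norm_ge_zero order_trans by blast
  have le: "norm (\<phi> x) \<le> C * (\<Prod>b\<in>Basis. inverse (1 + (x \<bullet> b)\<^sup>2))" for x
  proof -
    have "(\<Prod>b\<in>Basis. 1 + (x \<bullet> b)\<^sup>2) \<le> (\<Prod>b\<in>(Basis :: R3 set). (1 + norm x)\<^sup>2)"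
    proof (intro prod_mono conjI)
      fix b :: R3 assume b: "b \<in> Basis"
      have "(x \<bullet> b)\<^sup>2 \<le> (norm x)\<^sup>2" using power_mono[OF Basis_le_norm[OF b, of x], of 2] by simp
      also have "1 + (norm x)\<^sup>2 \<le> (1 + norm x)\<^sup>2" by (simp add: power2_sum)
      finally show "1 + (x \<bullet> b)\<^sup>2 \<le> (1 + norm x)\<^sup>2" by simp
    qed auto
    also have "\<dots> = (1 + norm x) ^ 6" by (simp flip: power_mult)
    finally have p: "(\<Prod>b\<in>Basis. 1 + (x \<bullet> b)\<^sup>2) \<le> (1 + norm x) ^ 6" .
    have pp: "(\<Prod>b\<in>Basis. 1 + (x \<bullet> b)\<^sup>2) > 0" by (intro prod_pos) (auto simp: add_pos_nonneg)
    have "norm (\<phi> x) * (\<Prod>b\<in>Basis. 1 + (x \<bullet> b)\<^sup>2) \<le> norm (\<phi> x) * (1 + norm x) ^ 6"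
      using p by (intro mult_left_mono) auto
    also have "\<dots> \<le> C" using C[of x] by (simp add: mult.commute)
    finally have "norm (\<phi> x) \<le> C * inverse (\<Prod>b\<in>Basis. 1 + (x \<bullet> b)\<^sup>2)"
      using pp by (simp add: field_simps)
    then show ?thesis using prod_inversef[of "\<lambda>b. 1 + (x \<bullet> b)\<^sup>2" Basis] by (simp add: o_def)
  qed
  show i: "integrable lborel \<phi>"
  proof (rule Bochner_Integration.integrable_bound[OF _ m])
    show "integrable lborel (\<lambda>x::R3. C * (\<Prod>b\<in>Basis. inverse (1 + (x \<bullet> b)\<^sup>2)))"
      using integrable_Basis_inverse by simp
    show "AE x in lborel. norm (\<phi> x) \<le> norm (C * (\<Prod>b\<in>Basis. inverse (1 + (x \<bullet> b)\<^sup>2)))"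
      unfolding real_norm_def by (intro always_eventually allI order_trans[OF le abs_ge_self])
  qed
  obtain D where D: "\<And>x. norm (\<phi> x) \<le> D" using bd[of 0] by (auto simp: bounded_iff)
  show "\<phi> \<in> L2"
  proof (rule L2I[OF m])
    show "integrable lborel (\<lambda>x. D * norm (\<phi> x))" using i by auto
    show "(norm (\<phi> x))\<^sup>2 \<le> D * norm (\<phi> x)" for x
      using mult_right_mono[OF D[of x], of "norm (\<phi> x)"] by (simp add: power2_eq_square)
  qed
qed

lemma ipartial_linear:
  assumes T: "bounded_linear T" and f: "smooth f"
  shows "ipartial js (\<lambda>x. T (f x)) = (\<lambda>x. T (ipartial js f x))"
proof (induction js)
  case (Cons j js)
  have "ipartial js f differentiable (at x)" for x using f by (simp add: smooth_def)
  then show ?case unfolding ipartial.simps Cons.IH by (intro ext partial_linear[OF T])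
qed simp

lemma Cc_ipartial: "f \<in> Cc_infty U \<Longrightarrow> ipartial js f \<in> Cc_infty U"
  by (induction js) (auto intro: Cc_partial)

lemma Cc_schwartz:
  fixes f :: "R3 \<Rightarrow> real"
  assumes f: "f \<in> Cc_infty U"
  shows "(\<lambda>x. complex_of_real (f x)) \<in> schwartz"
  unfolding schwartz_def
proof (safe)
  show "smooth (\<lambda>x. complex_of_real (f x))" by (rule smooth_linear[OF bounded_linear_of_real Cc_smooth[OF f]])
  fix js k
  have F: "ipartial js f \<in> Cc_infty U" by (rule Cc_ipartial[OF f])
  obtain R where R: "\<And>x. norm x > R \<Longrightarrow> ipartial js f x = 0" using Cc_bounded_support[OF F] by metis
  have c: "continuous_on UNIV (\<lambda>x. (1 + norm x) ^ k *\<^sub>R complex_of_real (ipartial js f x))"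
    by (intro continuous_intros Cc_continuous[OF F])
  have "\<exists>C. \<forall>x. norm ((1 + norm x) ^ k *\<^sub>R complex_of_real (ipartial js f x)) \<le> C"
  proof (rule compact_support_bounded[OF c, of R])
    show "(1 + norm x) ^ k *\<^sub>R complex_of_real (ipartial js f x) = 0" if "norm x > R" for x
      using R[OF that] by simp
  qed blast
  then obtain C where "\<And>x. norm ((1 + norm x) ^ k *\<^sub>R complex_of_real (ipartial js f x)) \<le> C" by blast
  then show "bounded (range (\<lambda>x. (1 + norm x) ^ k *\<^sub>R ipartial js (\<lambda>x. complex_of_real (f x)) x))"
    unfolding ipartial_linear[OF bounded_linear_of_real Cc_smooth[OF f]] by (auto simp: bounded_iff)
qed

lemma fundamental_lemma_complex:
  fixes f :: "R3 \<Rightarrow> complex"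
  assumes f: "f \<in> L2" and z: "\<And>\<phi>. \<phi> \<in> Cc_infty UNIV \<Longrightarrow> (LINT x|lborel. f x * of_real (\<phi> x)) = 0"
  shows "AE x in lborel. f x = 0"
proof -
  have m[measurable]: "f \<in> borel_measurable borel" using L2_measurable[OF f] by simp
  have r: "(\<lambda>x. Re (f x)) \<in> L2" "(\<lambda>x. Im (f x)) \<in> L2"
    by (rule L2_mono[OF _ f, where C=1]; auto simp: abs_Re_le_cmod abs_Im_le_cmod)+
  have i: "integrable lborel (\<lambda>x. f x * of_real (\<phi> x))" if "\<phi> \<in> Cc_infty UNIV" for \<phi>
    by (intro L2_mult_integrable f of_real_L2 Cc_L2[OF that])
  have "AE x in lborel. Re (f x) = 0"
  proof (rule fundamental_lemma_L2[OF r(1)])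
    fix \<phi> :: "R3 \<Rightarrow> real" assume p: "\<phi> \<in> Cc_infty UNIV"
    have "(LINT x|lborel. Re (f x * of_real (\<phi> x))) = Re (LINT x|lborel. f x * of_real (\<phi> x))"
      by (rule Bochner_Integration.integral_Re[OF i[OF p]])
    then show "(LINT x|lborel. \<phi> x * Re (f x)) = 0" using z[OF p] by (simp add: mult.commute)
  qed
  moreover have "AE x in lborel. Im (f x) = 0"
  proof (rule fundamental_lemma_L2[OF r(2)])
    fix \<phi> :: "R3 \<Rightarrow> real" assume p: "\<phi> \<in> Cc_infty UNIV"
    have "(LINT x|lborel. Im (f x * of_real (\<phi> x))) = Im (LINT x|lborel. f x * of_real (\<phi> x))"
      by (rule Bochner_Integration.integral_Im[OF i[OF p]])
    then show "(LINT x|lborel. \<phi> x * Im (f x)) = 0" using z[OF p] by (simp add: mult.commute)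
  qed
  ultimately show ?thesis by eventually_elim (simp add: complex_eq_iff)
qed

text \<open>A witness for the \<open>SOME\<close> in \<open>fourier_L2\<close>: the L2 limit of the
  transforms of the truncations. The multiplication formula passes to this limit for every \<phi>
  that is both integrable and square integrable, which covers the Schwartz functions.\<close>

lemma fourier_L2_ex:
  fixes f :: "R3 \<Rightarrow> real"
  assumes f: "f \<in> L2"
  shows "\<exists>F. F \<in> L2 \<and> (\<forall>\<phi>. integrable lborel \<phi> \<and> \<phi> \<in> L2 \<longrightarrow>
    (LINT \<xi>|lborel. F \<xi> * \<phi> \<xi>) = (LINT x|lborel. of_real (f x) * fourier \<phi> x))
    \<and> (\<lambda>n. norm_L2 (\<lambda>\<xi>. fourier (trunc n (\<lambda>x. of_real (f x))) \<xi> - F \<xi>)) \<longlonglongrightarrow> 0"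
proof -
  let ?f = "\<lambda>x. complex_of_real (f x)"
  have fc: "?f \<in> L2" by (rule of_real_L2[OF f])
  note t = trunc_integrable[OF fc] trunc_L2[OF fc]
  obtain F where F: "F \<in> L2" "(\<lambda>n. norm_L2 (\<lambda>\<xi>. fourier (trunc n ?f) \<xi> - F \<xi>)) \<longlonglongrightarrow> 0"
    using plancherel_limit[OF fc] by blast
  have "(LINT \<xi>|lborel. F \<xi> * \<phi> \<xi>) = (LINT x|lborel. ?f x * fourier \<phi> x)"
    if p: "integrable lborel \<phi>" "\<phi> \<in> L2" for \<phi>
  proof (rule LIMSEQ_unique)
    show "(\<lambda>n. LINT \<xi>|lborel. fourier (trunc n ?f) \<xi> * \<phi> \<xi>) \<longlonglongrightarrow> (LINT \<xi>|lborel. F \<xi> * \<phi> \<xi>)"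
      by (rule tendsto_L2_mult[OF fourier_L2_bound(1)[OF t] F p(2) p(2) norm_L2_self_diff_tendsto])
    have "(\<lambda>n. LINT x|lborel. trunc n ?f x * fourier \<phi> x) \<longlonglongrightarrow> (LINT x|lborel. ?f x * fourier \<phi> x)"
      by (rule tendsto_L2_mult[OF t(2) fc trunc_tendsto[OF fc] fourier_L2_bound(1)[OF p] fourier_L2_bound(1)[OF p] norm_L2_self_diff_tendsto])
    then show "(\<lambda>n. LINT \<xi>|lborel. fourier (trunc n ?f) \<xi> * \<phi> \<xi>) \<longlonglongrightarrow> (LINT x|lborel. ?f x * fourier \<phi> x)"
      unfolding fourier_multiplication[OF t(1) p(1)] .
  qed
  then show ?thesis using F by blast
qed

lemma fourier_L2_spec:
  assumes "f \<in> L2"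
  shows fourier_L2_mem: "fourier_L2 f \<in> L2"
    and fourier_L2_schwartz: "\<phi> \<in> schwartz \<Longrightarrow>
      (LINT \<xi>|lborel. fourier_L2 f \<xi> * \<phi> \<xi>) = (LINT x|lborel. of_real (f x) * fourier \<phi> x)"
proof -
  have "\<exists>F. F \<in> L2 \<and> (\<forall>\<phi>\<in>schwartz. (LINT \<xi>|lborel. F \<xi> * \<phi> \<xi>) = (LINT x|lborel. of_real (f x) * fourier \<phi> x))"
    using fourier_L2_ex[OF assms] schwartz_integrable_L2 by blast
  from someI_ex[OF this]
  show "fourier_L2 f \<in> L2" "\<phi> \<in> schwartz \<Longrightarrow>
      (LINT \<xi>|lborel. fourier_L2 f \<xi> * \<phi> \<xi>) = (LINT x|lborel. of_real (f x) * fourier \<phi> x)"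
    unfolding fourier_L2_def by auto
qed

text \<open>The transform of an L2 function is known only through test integrals, so concrete
  formulas for it enter through this criterion. Real test functions suffice because real and
  imaginary parts can be tested separately.\<close>

lemma fourier_L2_unique:
  assumes f: "f \<in> L2" and F: "F \<in> L2"
    and tst: "\<And>\<phi>. \<phi> \<in> Cc_infty UNIV \<Longrightarrow>
      (LINT \<xi>|lborel. F \<xi> * of_real (\<phi> \<xi>)) = (LINT x|lborel. of_real (f x) * fourier (\<lambda>x. of_real (\<phi> x)) x)"
  shows "AE \<xi> in lborel. fourier_L2 f \<xi> = F \<xi>"
proof -
  have "AE \<xi> in lborel. fourier_L2 f \<xi> - F \<xi> = 0"
  proof (rule fundamental_lemma_complex)
    show "(\<lambda>\<xi>. fourier_L2 f \<xi> - F \<xi>) \<in> L2" by (intro L2.diff_mem fourier_L2_mem f F)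
    fix \<phi> :: "R3 \<Rightarrow> real" assume p: "\<phi> \<in> Cc_infty UNIV"
    have pl: "(\<lambda>x. complex_of_real (\<phi> x)) \<in> L2" by (rule of_real_L2[OF Cc_L2[OF p]])
    show "(LINT x|lborel. (fourier_L2 f x - F x) * complex_of_real (\<phi> x)) = 0"
      using fourier_L2_schwartz[OF f Cc_schwartz[OF p]] tst[OF p]
        L2_mult_integrable[OF fourier_L2_mem[OF f] pl] L2_mult_integrable[OF F pl]
      by (simp add: left_diff_distrib)
  qed
  then show ?thesis by eventually_elim simp
qed

lemma fourier_L2_trunc:
  assumes f: "f \<in> L2"
  shows "(\<lambda>n. norm_L2 (\<lambda>\<xi>. fourier (trunc n (\<lambda>x. of_real (f x))) \<xi> - fourier_L2 f \<xi>)) \<longlonglongrightarrow> 0"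
proof -
  let ?f = "\<lambda>x. complex_of_real (f x)"
  obtain F where F: "F \<in> L2" "\<And>\<phi>. integrable lborel \<phi> \<Longrightarrow> \<phi> \<in> L2 \<Longrightarrow>
    (LINT \<xi>|lborel. F \<xi> * \<phi> \<xi>) = (LINT x|lborel. of_real (f x) * fourier \<phi> x)"
    "(\<lambda>n. norm_L2 (\<lambda>\<xi>. fourier (trunc n ?f) \<xi> - F \<xi>)) \<longlonglongrightarrow> 0"
    using fourier_L2_ex[OF f] by blast
  have e: "AE \<xi> in lborel. fourier_L2 f \<xi> = F \<xi>"
    by (rule fourier_L2_unique[OF f F(1) F(2)]) (auto intro: schwartz_integrable_L2 Cc_schwartz)
  have m[measurable]: "fourier_L2 f \<in> borel_measurable borel" "F \<in> borel_measurable borel"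
    "fourier (trunc n ?f) \<in> borel_measurable borel" for n
    using L2_measurable[OF fourier_L2_mem[OF f]] L2_measurable[OF F(1)]
      fourier_measurable[OF trunc_integrable[OF of_real_L2[OF f]]] by auto
  have "norm_L2 (\<lambda>\<xi>. fourier (trunc n ?f) \<xi> - F \<xi>) = norm_L2 (\<lambda>\<xi>. fourier (trunc n ?f) \<xi> - fourier_L2 f \<xi>)" for n
    using e by (intro norm_L2_cong_AE) auto
  then show ?thesis using F(3) by simp
qed

lemma norm_fourier_L2_le:
  assumes f: "f \<in> L2" shows "norm_L2 (fourier_L2 f) \<le> norm_L2 f"
proof -
  let ?f = "\<lambda>x. complex_of_real (f x)"
  have fc: "?f \<in> L2" by (rule of_real_L2[OF f])
  note t = trunc_integrable[OF fc] trunc_L2[OF fc]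
  have "(\<lambda>n. norm_L2 (fourier (trunc n ?f))) \<longlonglongrightarrow> norm_L2 (fourier_L2 f)"
    by (rule tendsto_norm_L2[OF fourier_L2_bound(1)[OF t] fourier_L2_mem[OF f] fourier_L2_trunc[OF f]])
  moreover have "(\<lambda>n. norm_L2 (trunc n ?f)) \<longlonglongrightarrow> norm_L2 ?f"
    by (rule tendsto_norm_L2[OF t(2) fc trunc_tendsto[OF fc]])
  ultimately have "norm_L2 (fourier_L2 f) \<le> norm_L2 ?f"
    by (rule LIMSEQ_le) (use fourier_L2_bound(2)[OF t] in auto)
  then show ?thesis by simp
qed

lemma fourier_L2_eq_fourier:
  assumes f: "f \<in> L2" "integrable lborel f"
  shows "AE \<xi> in lborel. fourier_L2 f \<xi> = fourier (\<lambda>x. of_real (f x)) \<xi>"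
proof (rule fourier_L2_unique[OF f(1)])
  have i: "integrable lborel (\<lambda>x. complex_of_real (f x))" using f by simp
  show "fourier (\<lambda>x. complex_of_real (f x)) \<in> L2" by (rule fourier_L2_bound[OF i of_real_L2[OF f(1)]])
  fix \<phi> :: "R3 \<Rightarrow> real" assume p: "\<phi> \<in> Cc_infty UNIV"
  show "(LINT \<xi>|lborel. fourier (\<lambda>x. of_real (f x)) \<xi> * of_real (\<phi> \<xi>)) = (LINT x|lborel. of_real (f x) * fourier (\<lambda>x. of_real (\<phi> x)) x)"
    by (rule fourier_multiplication[OF i schwartz_integrable_L2(1)[OF Cc_schwartz[OF p]]])
qed

lemma fourier_L2_Cc:
  fixes f :: "R3 \<Rightarrow> real"
  shows "f \<in> Cc_infty U \<Longrightarrow> AE \<xi> in lborel. fourier_L2 f \<xi> = fourier (\<lambda>x. of_real (f x)) \<xi>"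
  by (intro fourier_L2_eq_fourier Cc_L2 Cc_integrable)

lemma fourier_L2_lin:
  assumes f: "f \<in> L2" and g: "g \<in> L2"
  shows "AE \<xi> in lborel. fourier_L2 (\<lambda>x. f x + c * g x) \<xi> = fourier_L2 f \<xi> + of_real c * fourier_L2 g \<xi>"
proof (rule fourier_L2_unique)
  show "(\<lambda>x. f x + c * g x) \<in> L2" using L2_lin[OF f g, of c] by simp
  show F: "(\<lambda>\<xi>. fourier_L2 f \<xi> + of_real c * fourier_L2 g \<xi>) \<in> L2"
    using L2_lin[OF fourier_L2_mem[OF f] fourier_L2_mem[OF g], of c] by (simp add: scaleR_conv_of_real)
  fix \<phi> :: "R3 \<Rightarrow> real" assume p: "\<phi> \<in> Cc_infty UNIV"
  let ?p = "\<lambda>x. complex_of_real (\<phi> x)"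
  have pl: "?p \<in> L2" by (rule of_real_L2[OF Cc_L2[OF p]])
  note s = Cc_schwartz[OF p]
  have fp: "fourier ?p \<in> L2" by (rule fourier_L2_bound[OF schwartz_integrable_L2[OF s]])
  note i = L2_mult_integrable[OF fourier_L2_mem[OF f] pl] L2_mult_integrable[OF fourier_L2_mem[OF g] pl]
    L2_mult_integrable[OF of_real_L2[OF f] fp] L2_mult_integrable[OF of_real_L2[OF g] fp]
  have "(LINT \<xi>|lborel. (fourier_L2 f \<xi> + of_real c * fourier_L2 g \<xi>) * ?p \<xi>)
    = (LINT \<xi>|lborel. fourier_L2 f \<xi> * ?p \<xi>) + of_real c * (LINT \<xi>|lborel. fourier_L2 g \<xi> * ?p \<xi>)"
    using i by (simp add: ring_distribs mult.assoc)
  also have "\<dots> = (LINT x|lborel. of_real (f x) * fourier ?p x) + of_real c * (LINT x|lborel. of_real (g x) * fourier ?p x)"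
    using fourier_L2_schwartz[OF f s] fourier_L2_schwartz[OF g s] by simp
  also have "\<dots> = (LINT x|lborel. of_real (f x + c * g x) * fourier ?p x)"
    using i by (simp add: ring_distribs mult.assoc)
  finally show "(LINT \<xi>|lborel. (fourier_L2 f \<xi> + of_real c * fourier_L2 g \<xi>) * ?p \<xi>)
    = (LINT x|lborel. of_real (f x + c * g x) * fourier ?p x)" .
qed

lemma fourier_L2_diff:
  assumes "f \<in> L2" "g \<in> L2"
  shows "AE \<xi> in lborel. fourier_L2 (\<lambda>x. f x - g x) \<xi> = fourier_L2 f \<xi> - fourier_L2 g \<xi>"
  using fourier_L2_lin[OF assms, of "-1"] by simp

lemma fourier_L2_cong:
  assumes f: "f \<in> L2" "g \<in> L2" and e: "AE x in lborel. f x = g x"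
  shows "AE \<xi> in lborel. fourier_L2 f \<xi> = fourier_L2 g \<xi>"
proof (rule fourier_L2_unique[OF f(1) fourier_L2_mem[OF f(2)]])
  fix \<phi> :: "R3 \<Rightarrow> real" assume p: "\<phi> \<in> Cc_infty UNIV"
  have [measurable]: "f \<in> borel_measurable borel" "g \<in> borel_measurable borel" using L2_measurable f by auto
  have [measurable]: "fourier (\<lambda>x. complex_of_real (\<phi> x)) \<in> borel_measurable borel"
    by (intro fourier_measurable schwartz_integrable_L2 Cc_schwartz[OF p])
  show "(LINT \<xi>|lborel. fourier_L2 g \<xi> * of_real (\<phi> \<xi>)) = (LINT x|lborel. of_real (f x) * fourier (\<lambda>x. of_real (\<phi> x)) x)"
    unfolding fourier_L2_schwartz[OF f(2) Cc_schwartz[OF p]]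
    by (intro integral_cong_AE) (use e in \<open>auto elim: eventually_mono\<close>)
qed

lemma fourier_L2_tendsto:
  assumes f: "\<And>n. F n \<in> L2" "f \<in> L2" "(\<lambda>n. norm_L2 (\<lambda>x. F n x - f x)) \<longlonglongrightarrow> 0"
  shows "(\<lambda>n. norm_L2 (\<lambda>\<xi>. fourier_L2 (F n) \<xi> - fourier_L2 f \<xi>)) \<longlonglongrightarrow> 0"
proof (rule tendsto_sandwich[OF _ _ tendsto_const f(3)])
  have "norm_L2 (\<lambda>\<xi>. fourier_L2 (F n) \<xi> - fourier_L2 f \<xi>) \<le> norm_L2 (\<lambda>x. F n x - f x)" for n
  proof -
    have m[measurable]: "g \<in> L2 \<Longrightarrow> fourier_L2 g \<in> borel_measurable borel" for g
      using L2_measurable[OF fourier_L2_mem] by simp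
    have d: "(\<lambda>x. F n x - f x) \<in> L2" by (intro L2.diff_mem f)
    have "norm_L2 (\<lambda>\<xi>. fourier_L2 (F n) \<xi> - fourier_L2 f \<xi>) = norm_L2 (fourier_L2 (\<lambda>x. F n x - f x))"
      using fourier_L2_diff[OF f(1)[of n] f(2)] f d by (intro norm_L2_cong_AE) (auto elim: eventually_mono)
    then show ?thesis using norm_fourier_L2_le[OF d] by simp
  qed
  then show "\<forall>\<^sub>F n in sequentially. norm_L2 (\<lambda>\<xi>. fourier_L2 (F n) \<xi> - fourier_L2 f \<xi>) \<le> norm_L2 (\<lambda>x. F n x - f x)"
    by (intro always_eventually allI)
qed (auto intro!: always_eventually)

section \<open>Parseval's identity\<close>

text \<open>The substitution y = x - sqrt t w moves t from the kernel into the argument of g, so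
  that C times the heat kernel at time 1 dominates for all t.\<close>

lemma heat_convolution_tendsto:
  fixes g :: "R3 \<Rightarrow> complex"
  assumes c: "continuous_on UNIV g" and C: "\<And>x. norm (g x) \<le> C"
  shows "(\<lambda>n. LINT y|lborel. g y * of_real (heat (1 / real (Suc n)) (x - y))) \<longlonglongrightarrow> g x"
    and "t > 0 \<Longrightarrow> norm (LINT y|lborel. g y * of_real (heat t (x - y))) \<le> C"
proof -
  have [measurable]: "g \<in> borel_measurable borel" using c by (rule borel_measurable_continuous_onI)
  have C0: "C \<ge> 0" using C[of 0] norm_ge_zero order_trans by blast
  have eq: "(LINT y|lborel. g y * of_real (heat t (x - y))) = (LINT w|lborel. g (x - sqrt t *\<^sub>R w) * of_real (heat 1 w))"
    if t: "t > 0" for t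
  proof -
    have "(LINT y|lborel. g y * of_real (heat t (x - y)))
      = (sqrt t ^ 3) *\<^sub>R (LINT w|lborel. g (x - sqrt t *\<^sub>R w) * of_real (heat t (sqrt t *\<^sub>R w)))"
      using lborel_affine_integral[of "\<lambda>y. g y * of_real (heat t (x - y))" "- sqrt t" x] t by simp
    also have "\<dots> = (LINT w|lborel. g (x - sqrt t *\<^sub>R w) * of_real (sqrt t ^ 3 * heat t (sqrt t *\<^sub>R w)))"
      unfolding integral_scaleR_right[symmetric]
      by (intro Bochner_Integration.integral_cong refl) (simp add: scaleR_conv_of_real mult_ac)
    finally show ?thesis unfolding heat_scale[OF t] .
  qed
  have h1: "integrable lborel (\<lambda>w. C * heat 1 w)" using heat_integrable[of 1] by simp
  have bd: "norm (g (x - sqrt t *\<^sub>R w) * of_real (heat 1 w)) \<le> C * heat 1 w" for t w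
    using mult_right_mono[OF C[of "x - sqrt t *\<^sub>R w"], of "heat 1 w"] heat_nonneg[of 1 w] by (simp add: norm_mult)
  show "(\<lambda>n. LINT y|lborel. g y * of_real (heat (1 / real (Suc n)) (x - y))) \<longlonglongrightarrow> g x"
  proof -
    have "(\<lambda>n. LINT w|lborel. g (x - sqrt (1 / real (Suc n)) *\<^sub>R w) * of_real (heat 1 w)) \<longlonglongrightarrow> (LINT w|lborel. g x * of_real (heat 1 w))"
    proof (rule integral_dominated_convergence[OF _ _ h1])
      show "AE w in lborel. (\<lambda>n. g (x - sqrt (1 / real (Suc n)) *\<^sub>R w) * of_real (heat 1 w)) \<longlonglongrightarrow> g x * of_real (heat 1 w)"
      proof (intro always_eventually allI tendsto_mult tendsto_const)
        fix w
        have "(\<lambda>n. x - sqrt (1 / real (Suc n)) *\<^sub>R w) \<longlonglongrightarrow> x - sqrt 0 *\<^sub>R w"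
          by (intro tendsto_intros LIMSEQ_Suc[OF lim_1_over_n])
        then have "(\<lambda>n. x - sqrt (1 / real (Suc n)) *\<^sub>R w) \<longlonglongrightarrow> x" by simp
        then show "(\<lambda>n. g (x - sqrt (1 / real (Suc n)) *\<^sub>R w)) \<longlonglongrightarrow> g x"
          using c by (auto simp: continuous_on_eq_continuous_at intro: isCont_tendsto_compose)
      qed
    qed (use bd in auto)
    moreover have "(LINT w|lborel. g x * of_real (heat 1 w)) = g x"
      using heat_integral[of 1] by (simp add: integral_complex_of_real)
    moreover have "(LINT y|lborel. g y * of_real (heat (1 / real (Suc n)) (x - y)))
        = (LINT w|lborel. g (x - sqrt (1 / real (Suc n)) *\<^sub>R w) * of_real (heat 1 w))" for n
      by (rule eq) simp
    ultimately show ?thesis by (simp only:)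
  qed
  show "norm (LINT y|lborel. g y * of_real (heat t (x - y))) \<le> C" if t: "t > 0"
  proof -
    have "norm (LINT w|lborel. g (x - sqrt t *\<^sub>R w) * of_real (heat 1 w)) \<le> (LINT w|lborel. C * heat 1 w)"
    proof (rule Bochner_Integration.integral_norm_bound_integral[OF _ h1])
      show "integrable lborel (\<lambda>w. g (x - sqrt t *\<^sub>R w) * complex_of_real (heat 1 w))"
        by (rule Bochner_Integration.integrable_bound[OF h1])
           (use bd[of t] in \<open>auto intro!: always_eventually order_trans[OF bd abs_ge_self]\<close>)
    qed (rule bd)
    then show ?thesis unfolding eq[OF t] using heat_integral[of 1] by simp
  qed
qed

text \<open>Both sides of \<open>gaussian_parseval\<close> have limits as \<epsilon> tends to 0: the
  left side by domination with the product of the transforms, the right side because heat averages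
  of a bounded continuous g converge pointwise. This explains the asymmetry between f and g.\<close>

lemma parseval_continuous:
  fixes f g :: "R3 \<Rightarrow> complex"
  assumes f: "integrable lborel f" "f \<in> L2" and g: "integrable lborel g" "g \<in> L2"
    and c: "continuous_on UNIV g" and C: "\<And>x. norm (g x) \<le> C"
  shows "(LINT \<xi>|lborel. fourier f \<xi> * cnj (fourier g \<xi>)) = (LINT x|lborel. f x * cnj (g x))"
proof (rule LIMSEQ_unique)
  have [measurable]: "f \<in> borel_measurable borel" "g \<in> borel_measurable borel"
    "fourier f \<in> borel_measurable borel" "fourier g \<in> borel_measurable borel"
    using f g fourier_measurable by auto
  have C0: "C \<ge> 0" using C[of 0] norm_ge_zero order_trans by blast
  let ?L = "\<lambda>n. LINT \<xi>|lborel. of_real (exp (- (1 / real (Suc n)) * (norm \<xi>)\<^sup>2)) * (fourier f \<xi> * cnj (fourier g \<xi>))"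
  show "?L \<longlonglongrightarrow> (LINT \<xi>|lborel. fourier f \<xi> * cnj (fourier g \<xi>))"
  proof (rule integral_dominated_convergence[where w="\<lambda>\<xi>. norm (fourier f \<xi>) * norm (fourier g \<xi>)"])
    show "integrable lborel (\<lambda>\<xi>. norm (fourier f \<xi>) * norm (fourier g \<xi>))"
      by (intro L2_mult_integrable_norm fourier_L2_bound f g)
    show "AE \<xi> in lborel. (\<lambda>n. of_real (exp (- (1 / real (Suc n)) * (norm \<xi>)\<^sup>2)) * (fourier f \<xi> * cnj (fourier g \<xi>))) \<longlonglongrightarrow> fourier f \<xi> * cnj (fourier g \<xi>)"
    proof (intro always_eventually allI)
      fix \<xi> :: R3
      have "(\<lambda>n. complex_of_real (exp (- (1 / real (Suc n)) * (norm \<xi>)\<^sup>2)) * (fourier f \<xi> * cnj (fourier g \<xi>)))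
        \<longlonglongrightarrow> of_real (exp (- 0 * (norm \<xi>)\<^sup>2)) * (fourier f \<xi> * cnj (fourier g \<xi>))"
        by (intro tendsto_intros LIMSEQ_Suc[OF lim_1_over_n])
      then show "(\<lambda>n. complex_of_real (exp (- (1 / real (Suc n)) * (norm \<xi>)\<^sup>2)) * (fourier f \<xi> * cnj (fourier g \<xi>))) \<longlonglongrightarrow> fourier f \<xi> * cnj (fourier g \<xi>)"
        by simp
    qed
    show "AE \<xi> in lborel. norm (of_real (exp (- (1 / real (Suc n)) * (norm \<xi>)\<^sup>2)) * (fourier f \<xi> * cnj (fourier g \<xi>)))
      \<le> norm (fourier f \<xi>) * norm (fourier g \<xi>)" for n
      by (intro always_eventually allI) (auto simp: norm_mult intro!: mult_left_le_one_le)
  qed measurable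
  have cg: "continuous_on UNIV (\<lambda>x. cnj (g x))" by (intro continuous_intros c)
  have Cg: "norm (cnj (g x)) \<le> C" for x using C by simp
  have L: "?L n = (LINT x|lborel. f x * (LINT y|lborel. cnj (g y) * of_real (heat (1 / real (Suc n)) (x - y))))" for n
  proof -
    have t: "1 / real (Suc n) > 0" by simp
    have fn: "integrable lborel (\<lambda>x. norm (f x) * C)" using f(1) by auto
    have i: "integrable lborel (\<lambda>p. f (fst p) * cnj (g (snd p)) * of_real (heat (1 / real (Suc n)) (fst p - snd p)))"
    proof (rule Bochner_Integration.integrable_bound[OF heat_weighted_integrable(1)[OF fn t]])
      show "(\<lambda>p. f (fst p) * cnj (g (snd p)) * complex_of_real (heat (1 / real (Suc n)) (fst p - snd p))) \<in> borel_measurable lborel"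
        unfolding lborel_prod[symmetric] by measurable
      show "AE p in lborel. norm (f (fst p) * cnj (g (snd p)) * complex_of_real (heat (1 / real (Suc n)) (fst p - snd p)))
         \<le> norm (norm (f (fst p)) * C * heat (1 / real (Suc n)) (fst p - snd p))"
        by (intro always_eventually allI) (auto simp: norm_mult abs_mult C0 intro!: mult_right_mono mult_left_mono C)
    qed
    show ?thesis
      unfolding gaussian_parseval[OF f(1) g(1) t] lborel_integral_fst[OF i, symmetric]
      by (simp add: mult.assoc)
  qed
  show "?L \<longlonglongrightarrow> (LINT x|lborel. f x * cnj (g x))"
    unfolding L
  proof (rule integral_dominated_convergence[where w="\<lambda>x. norm (f x) * C"])
    show "integrable lborel (\<lambda>x. norm (f x) * C)" using f(1) by auto
    show "AE x in lborel. (\<lambda>n. f x * (LINT y|lborel. cnj (g y) * of_real (heat (1 / real (Suc n)) (x - y)))) \<longlonglongrightarrow> f x * cnj (g x)"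
      by (intro always_eventually allI tendsto_mult tendsto_const heat_convolution_tendsto(1)[OF cg Cg])
    show "AE x in lborel. norm (f x * (LINT y|lborel. cnj (g y) * of_real (heat (1 / real (Suc n)) (x - y)))) \<le> norm (f x) * C" for n
      unfolding norm_mult
      by (intro always_eventually allI mult_left_mono heat_convolution_tendsto(2)[OF cg Cg]) auto
    have "(\<lambda>x. LINT y|lborel. cnj (g y) * complex_of_real (heat (1 / real (Suc n)) (x - y))) \<in> borel_measurable borel" for n
      by (rule lborel.borel_measurable_lebesgue_integral) measurable
    then show "(\<lambda>x. f x * (LINT y|lborel. cnj (g y) * of_real (heat (1 / real (Suc n)) (x - y)))) \<in> borel_measurable lborel" for n
      by measurable
  qed measurable
qed

lemma parseval_Cc:
  fixes f g :: "R3 \<Rightarrow> real"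
  assumes f: "f \<in> L2" and g: "g \<in> Cc_infty U"
  shows "(LINT \<xi>|lborel. fourier_L2 f \<xi> * cnj (fourier (\<lambda>x. of_real (g x)) \<xi>)) = of_real (LINT x|lborel. f x * g x)"
proof (rule LIMSEQ_unique)
  let ?f = "\<lambda>x. complex_of_real (f x)" and ?g = "\<lambda>x. complex_of_real (g x)"
  have fc: "?f \<in> L2" by (rule of_real_L2[OF f])
  note t = trunc_integrable[OF fc] trunc_L2[OF fc]
  have gi: "integrable lborel ?g" "?g \<in> L2" by (rule schwartz_integrable_L2[OF Cc_schwartz[OF g]])+
  obtain C where C: "\<And>x. norm (g x) \<le> C" using Cc_bounded[OF g] by metis
  have gc: "continuous_on UNIV ?g" by (intro continuous_intros Cc_continuous[OF g])
  have Fg: "(\<lambda>\<xi>. cnj (fourier ?g \<xi>)) \<in> L2"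
    using fourier_L2_bound(1)[OF gi] by (auto simp: L2_def)
  show "(\<lambda>n. LINT \<xi>|lborel. fourier (trunc n ?f) \<xi> * cnj (fourier ?g \<xi>)) \<longlonglongrightarrow> (LINT \<xi>|lborel. fourier_L2 f \<xi> * cnj (fourier ?g \<xi>))"
    by (rule tendsto_L2_mult[OF fourier_L2_bound(1)[OF t] fourier_L2_mem[OF f] fourier_L2_trunc[OF f] Fg Fg norm_L2_self_diff_tendsto])
  have "(\<lambda>n. LINT x|lborel. trunc n ?f x * ?g x) \<longlonglongrightarrow> (LINT x|lborel. ?f x * ?g x)"
    by (rule tendsto_L2_mult[OF t(2) fc trunc_tendsto[OF fc] gi(2) gi(2) norm_L2_self_diff_tendsto])
  moreover have "(LINT x|lborel. trunc n ?f x * ?g x) = (LINT \<xi>|lborel. fourier (trunc n ?f) \<xi> * cnj (fourier ?g \<xi>))" for n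
    using parseval_continuous[OF t gi gc, of C n] C by simp
  moreover have "(LINT x|lborel. ?f x * ?g x) = of_real (LINT x|lborel. f x * g x)"
    by (simp flip: integral_complex_of_real)
  ultimately show "(\<lambda>n. LINT \<xi>|lborel. fourier (trunc n ?f) \<xi> * cnj (fourier ?g \<xi>)) \<longlonglongrightarrow> of_real (LINT x|lborel. f x * g x)"
    by simp
qed

lemma L2_complete_sub: "L2.complete_sub (L2 :: (R3 \<Rightarrow> 'b::euclidean_space) set)"
  unfolding L2.complete_sub_def
proof (intro conjI allI impI ballI)
  show "(L2 :: (R3 \<Rightarrow> 'b) set) \<noteq> {}" by (auto simp: L2_def intro!: exI[of _ "\<lambda>x. 0"])
  fix w :: "nat \<Rightarrow> R3 \<Rightarrow> 'b"
  assume w: "(\<forall>n. w n \<in> L2) \<and> (\<forall>e>0. \<exists>N. \<forall>m\<ge>N. \<forall>n\<ge>N. inner_L2 (\<lambda>x. w m x - w n x) (\<lambda>x. w m x - w n x) < e)"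
  have "\<exists>N. \<forall>m\<ge>N. \<forall>n\<ge>N. norm_L2 (\<lambda>x. w m x - w n x) < e" if e: "e > 0" for e
  proof -
    have "e\<^sup>2 > 0" using e by simp
    then obtain N where N: "\<And>m n. m \<ge> N \<Longrightarrow> n \<ge> N \<Longrightarrow> inner_L2 (\<lambda>x. w m x - w n x) (\<lambda>x. w m x - w n x) < e\<^sup>2" using w by blast
    have "norm_L2 (\<lambda>x. w m x - w n x) < e" if "m \<ge> N" "n \<ge> N" for m n
      unfolding norm_L2_eq using real_sqrt_less_mono[OF N[OF that]] e by simp
    then show ?thesis by blast
  qed
  then obtain g where g: "g \<in> L2" "(\<lambda>n. norm_L2 (\<lambda>x. w n x - g x)) \<longlonglongrightarrow> 0"
    using L2_complete[of w] w by blast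
  have "(\<lambda>n. (norm_L2 (\<lambda>x. w n x - g x))\<^sup>2) \<longlonglongrightarrow> 0\<^sup>2" by (intro tendsto_intros g)
  then show "\<exists>v\<in>L2. (\<lambda>n. inner_L2 (\<lambda>x. w n x - v x) (\<lambda>x. w n x - v x)) \<longlonglongrightarrow> 0"
    using g(1) w by (intro bexI[OF _ g(1)]) (simp add: norm_L2_eq L2.pos L2.diff_mem)
qed (auto intro: L2_lin)

text \<open>The residual of the orthogonal projection onto the closure of the test functions is
  orthogonal to all of them, hence zero almost everywhere by the fundamental lemma.\<close>

lemma Cc_dense_L2:
  fixes f :: "R3 \<Rightarrow> real"
  assumes f: "f \<in> L2" and e: "e > 0"
  shows "\<exists>\<phi>\<in>Cc_infty UNIV. norm_L2 (\<lambda>x. \<phi> x - f x) < e"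
proof -
  let ?D = "Cc_infty UNIV :: (R3 \<Rightarrow> real) set"
  have D: "?D \<subseteq> L2" by (auto intro: Cc_L2)
  have c: "L2.complete_sub (L2.closure_in L2 ?D)"
    by (rule L2.complete_closure_in[OF L2_complete_sub D]) (auto intro: Cc_zero Cc_add Cc_linear[OF _ bounded_linear_mult_right])
  obtain w where w: "w \<in> L2.closure_in L2 ?D" "\<And>v. v \<in> L2.closure_in L2 ?D \<Longrightarrow> inner_L2 (\<lambda>x. f x - w x) v = 0"
    using L2.projection[OF c f] by blast
  have wL: "w \<in> L2" using w(1) by (simp add: L2.closure_in_def)
  have d: "(\<lambda>x. f x - w x) \<in> L2" by (intro L2.diff_mem f wL)
  have ae: "AE x in lborel. f x - w x = 0"
  proof (rule fundamental_lemma_L2[OF d])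
    fix \<phi> :: "R3 \<Rightarrow> real" assume p: "\<phi> \<in> Cc_infty UNIV"
    have "inner_L2 (\<lambda>x. \<phi> x - \<phi> x) (\<lambda>x. \<phi> x - \<phi> x) = 0" by (simp add: inner_L2_def)
    then have "\<phi> \<in> L2.closure_in L2 ?D" using p D by (force simp: L2.closure_in_def)
    then have "inner_L2 (\<lambda>x. f x - w x) \<phi> = 0" by (rule w(2))
    then show "(LINT x|lborel. \<phi> x * (f x - w x)) = 0" by (simp add: inner_L2_def mult.commute)
  qed
  obtain \<phi> where p: "\<phi> \<in> ?D" "norm_L2 (\<lambda>x. \<phi> x - w x) < e"
    using w(1) e unfolding L2.closure_in_iff_sqrt[OF order_refl D] norm_L2_eq by blast
  have [measurable]: "\<phi> \<in> borel_measurable borel" "f \<in> borel_measurable borel" "w \<in> borel_measurable borel"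
    using L2_measurable[OF Cc_L2[OF p(1)]] L2_measurable[OF f] L2_measurable[OF wL] by auto
  have "norm_L2 (\<lambda>x. \<phi> x - f x) = norm_L2 (\<lambda>x. \<phi> x - w x)"
    by (intro norm_L2_cong_AE) (use ae in \<open>auto elim: eventually_mono\<close>)
  then show ?thesis using p by (intro bexI[of _ \<phi>]) simp_all
qed

lemma Cc_approx_L2:
  fixes f :: "R3 \<Rightarrow> real"
  assumes f: "f \<in> L2"
  obtains \<phi> where "\<And>n. \<phi> n \<in> Cc_infty UNIV" "(\<lambda>n::nat. norm_L2 (\<lambda>x. \<phi> n x - f x)) \<longlonglongrightarrow> 0"
proof -
  have "\<forall>n. \<exists>\<phi>\<in>Cc_infty UNIV. norm_L2 (\<lambda>x. \<phi> x - f x) < 1 / real (Suc n)"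
    using Cc_dense_L2[OF f] by auto
  then obtain \<phi> where p: "\<And>n. \<phi> n \<in> Cc_infty UNIV" "\<And>n. norm_L2 (\<lambda>x. \<phi> n x - f x) < 1 / real (Suc n)" by metis
  have "(\<lambda>n. norm_L2 (\<lambda>x. \<phi> n x - f x)) \<longlonglongrightarrow> 0"
    by (rule tendsto_sandwich[OF _ _ tendsto_const LIMSEQ_Suc[OF lim_1_over_n]])
       (use p(2) in \<open>auto intro!: always_eventually less_imp_le\<close>)
  with p(1) show ?thesis by (rule that)
qed

lemma cnj_L2: "f \<in> L2 \<Longrightarrow> (\<lambda>x. cnj (f x)) \<in> L2"
  unfolding L2_def by auto

lemma norm_L2_cnj_diff: "norm_L2 (\<lambda>x. cnj (f x) - cnj (g x)) = norm_L2 (\<lambda>x. f x - g x)"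
  by (simp add: norm_L2_def flip: complex_cnj_diff)

theorem parseval:
  assumes f: "f \<in> L2" and g: "g \<in> L2"
  shows "(LINT \<xi>|lborel. fourier_L2 f \<xi> * cnj (fourier_L2 g \<xi>)) = of_real (LINT x|lborel. f x * g x)"
proof -
  obtain \<phi> where p: "\<And>n. \<phi> n \<in> Cc_infty UNIV" "(\<lambda>n::nat. norm_L2 (\<lambda>x. \<phi> n x - g x)) \<longlonglongrightarrow> 0"
    using Cc_approx_L2[OF g] by metis
  have pL: "\<phi> n \<in> L2" for n by (rule Cc_L2[OF p(1)])
  have [measurable]: "fourier_L2 h \<in> borel_measurable borel" if "h \<in> L2" for h
    using L2_measurable[OF fourier_L2_mem[OF that]] by simp
  have "(\<lambda>n. LINT \<xi>|lborel. fourier_L2 f \<xi> * cnj (fourier_L2 (\<phi> n) \<xi>)) \<longlonglongrightarrow> (LINT \<xi>|lborel. fourier_L2 f \<xi> * cnj (fourier_L2 g \<xi>))"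
    by (intro tendsto_L2_mult fourier_L2_mem f norm_L2_self_diff_tendsto cnj_L2 pL g)
       (simp only: norm_L2_cnj_diff fourier_L2_tendsto[OF pL g p(2)])
  moreover have "(LINT \<xi>|lborel. fourier_L2 f \<xi> * cnj (fourier_L2 (\<phi> n) \<xi>)) = of_real (LINT x|lborel. f x * \<phi> n x)" for n
  proof -
    have [measurable]: "fourier (\<lambda>x. complex_of_real (\<phi> n x)) \<in> borel_measurable borel"
      by (intro fourier_measurable schwartz_integrable_L2 Cc_schwartz[OF p(1)])
    have "(LINT \<xi>|lborel. fourier_L2 f \<xi> * cnj (fourier_L2 (\<phi> n) \<xi>)) = (LINT \<xi>|lborel. fourier_L2 f \<xi> * cnj (fourier (\<lambda>x. of_real (\<phi> n x)) \<xi>))"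
      by (intro integral_cong_AE) (use f pL fourier_L2_Cc[OF p(1)[of n]] in \<open>auto elim: eventually_mono\<close>)
    then show ?thesis using parseval_Cc[OF f p(1)[of n]] by simp
  qed
  moreover have "(\<lambda>n. complex_of_real (LINT x|lborel. f x * \<phi> n x)) \<longlonglongrightarrow> of_real (LINT x|lborel. f x * g x)"
    by (intro tendsto_of_real tendsto_L2_mult f pL g norm_L2_self_diff_tendsto p(2))
  ultimately show ?thesis using LIMSEQ_unique by force
qed

corollary norm_fourier_L2:
  assumes f: "f \<in> L2" shows "norm_L2 (fourier_L2 f) = norm_L2 f"
proof -
  have "complex_of_real ((norm_L2 (fourier_L2 f))\<^sup>2) = (LINT \<xi>|lborel. fourier_L2 f \<xi> * cnj (fourier_L2 f \<xi>))"
    unfolding norm_L2_square integral_complex_of_real[symmetric]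
    by (intro Bochner_Integration.integral_cong refl) (simp only: complex_norm_square)
  also have "\<dots> = complex_of_real ((norm_L2 f)\<^sup>2)"
    unfolding parseval[OF f f] norm_L2_square by (simp add: power2_eq_square)
  finally have "(norm_L2 (fourier_L2 f))\<^sup>2 = (norm_L2 f)\<^sup>2" using of_real_eq_iff by blast
  then show ?thesis by (simp add: power2_eq_iff_nonneg)
qed

section \<open>Sobolev spaces, weak derivatives and the fractional pairing\<close>

section \<open>Sobolev spaces\<close>

text \<open>A Fourier multiplier kept on the transform side. Sobolev norms, the fractional energy
  and the top-order norm are all L2 norms of \<open>fmult\<close> for different real weights, so one
  set of lemmas serves them all.\<close>

definition fmult :: "(R3 \<Rightarrow> real) \<Rightarrow> (R3 \<Rightarrow> real) \<Rightarrow> R3 \<Rightarrow> complex" where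
  "fmult m f \<xi> = m \<xi> *\<^sub>R fourier_L2 f \<xi>"

abbreviation bessel :: "real \<Rightarrow> R3 \<Rightarrow> real" where
  "bessel r \<xi> \<equiv> (1 + (norm \<xi>)\<^sup>2) powr (r / 2)"

lemma fourier_L2_measurable [measurable]: "f \<in> L2 \<Longrightarrow> fourier_L2 f \<in> borel_measurable borel"
  using L2_measurable[OF fourier_L2_mem] by simp

lemma fmult_measurable:
  assumes f: "f \<in> L2" and m[measurable]: "m \<in> borel_measurable borel"
  shows "fmult m f \<in> borel_measurable borel"
proof -
  have [measurable]: "fourier_L2 f \<in> borel_measurable borel" using f by measurable
  show ?thesis unfolding fmult_def[abs_def] by measurable
qed

lemma bessel_measurable [measurable]: "bessel r \<in> borel_measurable borel"
  by measurable

lemma sobolev_iff: "f \<in> sobolev r \<longleftrightarrow> f \<in> L2 \<and> fmult (bessel r) f \<in> L2"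
  by (simp add: sobolev_def fmult_def[abs_def])

lemma sobolev_L2: "f \<in> sobolev r \<Longrightarrow> f \<in> L2"
  by (simp add: sobolev_iff)

lemma sobolev_norm_eq: "sobolev_norm r f = norm_L2 (fmult (bessel r) f)"
proof -
  have "(norm (fmult (bessel r) f \<xi>))\<^sup>2 = (1 + (norm \<xi>)\<^sup>2) powr r * (norm (fourier_L2 f \<xi>))\<^sup>2" for \<xi>
  proof -
    have "(bessel r \<xi>)\<^sup>2 = (1 + (norm \<xi>)\<^sup>2) powr r" by (simp add: power2_eq_square flip: powr_add)
    then show ?thesis by (simp add: fmult_def power_mult_distrib)
  qed
  then show ?thesis by (simp add: sobolev_norm_def norm_L2_def)
qed

lemma fmult_lin:
  assumes "f \<in> L2" "g \<in> L2"
  shows "AE \<xi> in lborel. fmult m (\<lambda>x. f x + c * g x) \<xi> = fmult m f \<xi> + c *\<^sub>R fmult m g \<xi>"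
  using fourier_L2_lin[OF assms, of c]
  by eventually_elim (simp add: fmult_def scaleR_conv_of_real algebra_simps)

lemma fmult_diff:
  assumes "f \<in> L2" "g \<in> L2"
  shows "AE \<xi> in lborel. fmult m (\<lambda>x. f x - g x) \<xi> = fmult m f \<xi> - fmult m g \<xi>"
  using fmult_lin[OF assms, of m "-1"] by simp

lemma fmult_cong:
  assumes "f \<in> L2" "g \<in> L2" "AE x in lborel. f x = g x"
  shows "AE \<xi> in lborel. fmult m f \<xi> = fmult m g \<xi>"
  using fourier_L2_cong[OF assms] by eventually_elim (simp add: fmult_def)

lemma fmult_bound:
  assumes f: "f \<in> sobolev r" and m: "m \<in> borel_measurable borel" and le: "\<And>\<xi>. \<bar>m \<xi>\<bar> \<le> C * bessel r \<xi>" and C: "C \<ge> 0"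
  shows "fmult m f \<in> L2" and "norm_L2 (fmult m f) \<le> C * sobolev_norm r f"
proof -
  have n: "norm (fmult m f \<xi>) \<le> C * norm (fmult (bessel r) f \<xi>)" for \<xi>
    using mult_right_mono[OF le[of \<xi>], of "norm (fourier_L2 f \<xi>)"] by (simp add: fmult_def mult.assoc)
  have ml: "fmult m f \<in> borel_measurable lborel" using fmult_measurable[OF sobolev_L2[OF f] m] by simp
  have w: "fmult (bessel r) f \<in> L2" using f by (simp add: sobolev_iff)
  show "fmult m f \<in> L2" by (rule L2_mono[OF ml w n])
  show "norm_L2 (fmult m f) \<le> C * sobolev_norm r f"
    unfolding sobolev_norm_eq by (rule norm_L2_mono[OF ml w n C])
qed

lemma norm_L2_fmult_diff:
  assumes "f \<in> L2" "g \<in> L2" and m: "m \<in> borel_measurable borel"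
  shows "norm_L2 (fmult m (\<lambda>x. f x - g x)) = norm_L2 (\<lambda>\<xi>. fmult m f \<xi> - fmult m g \<xi>)"
proof -
  have [measurable]: "fmult m f \<in> borel_measurable borel" "fmult m g \<in> borel_measurable borel"
    using fmult_measurable assms by auto
  have "fmult m (\<lambda>x. f x - g x) \<in> borel_measurable borel"
    by (rule fmult_measurable[OF L2.diff_mem[OF assms(1,2)] m])
  then show ?thesis using fmult_diff[OF assms(1,2), of m] by (intro norm_L2_cong_AE) auto
qed

lemma bessel_ge_1: "r \<ge> 0 \<Longrightarrow> 1 \<le> bessel r \<xi>"
  by (rule ge_one_powr_ge_zero) auto

lemma norm_powr_le_bessel: "0 \<le> a \<Longrightarrow> a \<le> r \<Longrightarrow> norm \<xi> powr a \<le> bessel r \<xi>"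
proof -
  assume a: "0 \<le> a" "a \<le> r"
  have "norm \<xi> powr a = ((norm \<xi>)\<^sup>2) powr (a / 2)"
  proof (cases "\<xi> = 0")
    case False
    then have "(norm \<xi>)\<^sup>2 = norm \<xi> powr 2" by (simp add: powr_numeral)
    then have "((norm \<xi>)\<^sup>2) powr (a / 2) = (norm \<xi> powr 2) powr (a / 2)" by (simp only:)
    also have "\<dots> = norm \<xi> powr (2 * (a / 2))" by (simp only: powr_powr)
    finally show ?thesis by simp
  next
    case True then show ?thesis by simp
  qed
  also have "\<dots> \<le> (1 + (norm \<xi>)\<^sup>2) powr (a / 2)" using a by (intro powr_mono2) auto
  also have "\<dots> \<le> bessel r \<xi>" using a by (intro powr_mono) auto
  finally show ?thesis .
qed

lemma norm_L2_le_sobolev: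
  assumes f: "f \<in> sobolev r" and r: "r \<ge> 0"
  shows "norm_L2 f \<le> sobolev_norm r f"
proof -
  have "norm_L2 (fmult (\<lambda>\<xi>. 1) f) \<le> 1 * sobolev_norm r f"
    using bessel_ge_1[OF r] by (intro fmult_bound[OF f]) auto
  then show ?thesis using norm_fourier_L2[OF sobolev_L2[OF f]] by (simp add: fmult_def[abs_def])
qed

lemma sobolev_mono:
  assumes f: "f \<in> sobolev r" and t: "t \<le> r"
  shows "f \<in> sobolev t" and "sobolev_norm t f \<le> sobolev_norm r f"
proof -
  have le: "\<bar>bessel t \<xi>\<bar> \<le> 1 * bessel r \<xi>" for \<xi> using t by (simp add: powr_mono)
  show "f \<in> sobolev t" using fmult_bound(1)[OF f bessel_measurable le] sobolev_L2[OF f] by (simp add: sobolev_iff)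
  show "sobolev_norm t f \<le> sobolev_norm r f"
    using fmult_bound(2)[OF f bessel_measurable le] by (simp add: sobolev_norm_eq[of t])
qed

lemma sobolev_lin:
  assumes f: "f \<in> sobolev r" and g: "g \<in> sobolev r"
  shows "(\<lambda>x. f x + c * g x) \<in> sobolev r"
proof -
  have L: "(\<lambda>x. f x + c * g x) \<in> L2" using L2_lin[OF sobolev_L2[OF f] sobolev_L2[OF g], of c] by simp
  have e: "AE \<xi> in lborel. fmult (bessel r) f \<xi> + c *\<^sub>R fmult (bessel r) g \<xi> = fmult (bessel r) (\<lambda>x. f x + c * g x) \<xi>"
    using fmult_lin[OF sobolev_L2[OF f] sobolev_L2[OF g], of "bessel r" c] by eventually_elim simp
  have "fmult (bessel r) (\<lambda>x. f x + c * g x) \<in> L2"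
    by (rule L2_cong_AE[OF L2_lin _ e]) (use f g fmult_measurable[OF L] in \<open>auto simp: sobolev_iff\<close>)
  then show ?thesis using L by (simp add: sobolev_iff)
qed

definition inner_fmult :: "(R3 \<Rightarrow> real) \<Rightarrow> (R3 \<Rightarrow> real) \<Rightarrow> (R3 \<Rightarrow> real) \<Rightarrow> real" where
  "inner_fmult m f g = inner_L2 (fmult m f) (fmult m g)"

lemma inner_L2_cong_AE:
  assumes "f \<in> borel_measurable lborel" "f' \<in> borel_measurable lborel" "g \<in> borel_measurable lborel" "g' \<in> borel_measurable lborel"
    and "AE x in lborel. f x = f' x" "AE x in lborel. g x = g' x"
  shows "inner_L2 f g = inner_L2 f' g'"
proof -
  note assms(1-4)[measurable]
  have "AE x in lborel. f x \<bullet> g x = f' x \<bullet> g' x" using assms(5,6) by eventually_elim simp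
  then show ?thesis unfolding inner_L2_def by (intro integral_cong_AE) auto
qed

lemma semi_inner_fmult:
  assumes lin: "\<And>f g c. f \<in> Y \<Longrightarrow> g \<in> Y \<Longrightarrow> (\<lambda>x. f x + c * g x) \<in> Y"
    and Y: "\<And>f. f \<in> Y \<Longrightarrow> f \<in> L2 \<and> fmult m f \<in> L2" and m: "m \<in> borel_measurable borel"
  shows "semi_inner Y (inner_fmult m)"
proof
  fix u v w :: "R3 \<Rightarrow> real" and c :: real
  show "u \<in> Y \<Longrightarrow> v \<in> Y \<Longrightarrow> (\<lambda>x. u x + c *\<^sub>R v x) \<in> Y" using lin by simp
  show "inner_fmult m u v = inner_fmult m v u" by (simp add: inner_fmult_def inner_L2_def inner_commute)
  show "0 \<le> inner_fmult m u u" if "u \<in> Y" using Y[OF that] by (simp add: inner_fmult_def L2.pos)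
  show "inner_fmult m (\<lambda>x. u x + c *\<^sub>R v x) w = inner_fmult m u w + c * inner_fmult m v w" if "u \<in> Y" "v \<in> Y" "w \<in> Y"
  proof -
    have uv: "u \<in> L2" "v \<in> L2" "w \<in> L2" "fmult m u \<in> L2" "fmult m v \<in> L2" "fmult m w \<in> L2" using Y that by auto
    have L: "(\<lambda>x. u x + c * v x) \<in> L2" using L2_lin[OF uv(1,2), of c] by simp
    have "inner_fmult m (\<lambda>x. u x + c * v x) w = inner_L2 (\<lambda>\<xi>. fmult m u \<xi> + c *\<^sub>R fmult m v \<xi>) (fmult m w)"
      unfolding inner_fmult_def
      using fmult_measurable[OF L m] L2_measurable[OF L2_lin[OF uv(4,5), of c]] L2_measurable[OF uv(6)] fmult_lin[OF uv(1,2), of m c]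
      by (intro inner_L2_cong_AE) auto
    then show ?thesis using L2.bil[OF uv(4,5,6), of c] by (simp add: inner_fmult_def)
  qed
qed

interpretation sob: semi_inner "sobolev r" "inner_fmult (bessel r)" for r
proof (rule semi_inner_fmult)
  show "f \<in> sobolev r \<Longrightarrow> g \<in> sobolev r \<Longrightarrow> (\<lambda>x. f x + c * g x) \<in> sobolev r" for f g c
    by (rule sobolev_lin)
qed (auto simp: sobolev_iff)

lemma sobolev_norm_inner: "sobolev_norm r f = sqrt (inner_fmult (bessel r) f f)"
  by (simp add: sobolev_norm_eq norm_L2_eq inner_fmult_def)

lemma sobolev_norm_minus_commute:
  "f \<in> sobolev r \<Longrightarrow> g \<in> sobolev r \<Longrightarrow> sobolev_norm r (\<lambda>x. f x - g x) = sobolev_norm r (\<lambda>x. g x - f x)"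
  unfolding sobolev_norm_inner using sob.diff_commute[of f r g] by simp

lemma sobolev_norm_nonneg [simp]: "0 \<le> sobolev_norm r f"
  by (simp add: sobolev_norm_eq)

lemma sobolev_norm_triangle_diff:
  "f \<in> sobolev r \<Longrightarrow> g \<in> sobolev r \<Longrightarrow> h \<in> sobolev r \<Longrightarrow>
    sobolev_norm r (\<lambda>x. f x - h x) \<le> sobolev_norm r (\<lambda>x. f x - g x) + sobolev_norm r (\<lambda>x. g x - h x)"
  unfolding sobolev_norm_inner by (rule sob.triangle_diff)

text \<open>There are two L2 limits, v for the functions and G for the weighted transforms, and the
  point is that G is the weighted transform of v. Dividing G by the weight, which is at least 1,
  yields H as an L2 limit of the unweighted transforms; these also converge to the transform of v,
  so the two agree.\<close>

lemma sobolev_complete: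
  assumes u: "\<And>n. u n \<in> sobolev r" and r: "r \<ge> 0"
    and cau: "\<And>e. e > 0 \<Longrightarrow> \<exists>N. \<forall>m\<ge>N. \<forall>n\<ge>N. sobolev_norm r (\<lambda>x. u m x - u n x) < e"
  shows "\<exists>v\<in>sobolev r. (\<lambda>n. sobolev_norm r (\<lambda>x. u n x - v x)) \<longlonglongrightarrow> 0"
proof -
  have uL: "u n \<in> L2" for n using u sobolev_L2 by blast
  have "\<exists>v\<in>L2. (\<lambda>n. norm_L2 (\<lambda>x. u n x - v x)) \<longlonglongrightarrow> 0"
  proof (rule L2_complete[OF uL])
    fix e :: real assume "e > 0"
    then obtain N where N: "\<And>m n. m \<ge> N \<Longrightarrow> n \<ge> N \<Longrightarrow> sobolev_norm r (\<lambda>x. u m x - u n x) < e" using cau by blast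
    then show "\<exists>N. \<forall>m\<ge>N. \<forall>n\<ge>N. norm_L2 (\<lambda>x. u m x - u n x) < e"
      using norm_L2_le_sobolev[OF sob.diff_mem[OF u u] r] by (meson le_less_trans)
  qed
  then obtain v where v: "v \<in> L2" "(\<lambda>n. norm_L2 (\<lambda>x. u n x - v x)) \<longlonglongrightarrow> 0" by blast
  have wL: "fmult (bessel r) (u n) \<in> L2" for n using u by (simp add: sobolev_iff)
  have "\<exists>G\<in>L2. (\<lambda>n. norm_L2 (\<lambda>x. fmult (bessel r) (u n) x - G x)) \<longlonglongrightarrow> 0"
  proof (rule L2_complete[OF wL])
    fix e :: real assume "e > 0"
    from cau[OF this] show "\<exists>N. \<forall>m\<ge>N. \<forall>n\<ge>N. norm_L2 (\<lambda>x. fmult (bessel r) (u m) x - fmult (bessel r) (u n) x) < e"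
      unfolding sobolev_norm_eq norm_L2_fmult_diff[OF uL uL bessel_measurable] .
  qed
  then obtain G where G: "G \<in> L2" "(\<lambda>n. norm_L2 (\<lambda>x. fmult (bessel r) (u n) x - G x)) \<longlonglongrightarrow> 0" by blast
  define H where "H = (\<lambda>\<xi>. inverse (bessel r \<xi>) *\<^sub>R G \<xi>)"
  have [measurable]: "G \<in> borel_measurable borel" using L2_measurable[OF G(1)] by simp
  have Hm[measurable]: "H \<in> borel_measurable borel" unfolding H_def by measurable
  have inv: "\<bar>inverse (bessel r \<xi>)\<bar> \<le> 1" for \<xi>
  proof -
    have "inverse (bessel r \<xi>) \<le> 1" using bessel_ge_1[OF r, of \<xi>] by (intro inverse_le_1_iff[THEN iffD2]) auto
    then show ?thesis by simp
  qed
  have pos: "bessel r \<xi> > 0" for \<xi> using bessel_ge_1[OF r, of \<xi>] by linarith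
  have HL: "H \<in> L2"
  proof (rule L2_mono[OF _ G(1), where C=1])
    show "norm (H \<xi>) \<le> 1 * norm (G \<xi>)" for \<xi>
      using mult_right_mono[OF inv[of \<xi>], of "norm (G \<xi>)"] unfolding H_def norm_scaleR by simp
  qed simp
  have "(\<lambda>n. norm_L2 (\<lambda>\<xi>. fourier_L2 (u n) \<xi> - H \<xi>)) \<longlonglongrightarrow> 0"
  proof (rule tendsto_sandwich[OF _ _ tendsto_const G(2)])
    have "norm_L2 (\<lambda>\<xi>. fourier_L2 (u n) \<xi> - H \<xi>) \<le> 1 * norm_L2 (\<lambda>x. fmult (bessel r) (u n) x - G x)" for n
    proof (rule norm_L2_mono)
      have [measurable]: "fourier_L2 (u n) \<in> borel_measurable borel" using uL by measurable
      show "(\<lambda>\<xi>. fourier_L2 (u n) \<xi> - H \<xi>) \<in> borel_measurable lborel" by measurable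
      show "(\<lambda>x. fmult (bessel r) (u n) x - G x) \<in> L2" by (intro L2.diff_mem wL G)
      fix \<xi>
      have "fourier_L2 (u n) \<xi> - H \<xi> = inverse (bessel r \<xi>) *\<^sub>R (fmult (bessel r) (u n) \<xi> - G \<xi>)"
        using pos[of \<xi>] unfolding fmult_def H_def scaleR_diff_right scaleR_scaleR by simp
      then have "norm (fourier_L2 (u n) \<xi> - H \<xi>) = \<bar>inverse (bessel r \<xi>)\<bar> * norm (fmult (bessel r) (u n) \<xi> - G \<xi>)"
        by (simp only: norm_scaleR)
      then show "norm (fourier_L2 (u n) \<xi> - H \<xi>) \<le> 1 * norm (fmult (bessel r) (u n) \<xi> - G \<xi>)"
        using mult_right_mono[OF inv[of \<xi>], of "norm (fmult (bessel r) (u n) \<xi> - G \<xi>)"] by simp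
    qed simp
    then show "\<forall>\<^sub>F n in sequentially. norm_L2 (\<lambda>\<xi>. fourier_L2 (u n) \<xi> - H \<xi>) \<le> norm_L2 (\<lambda>x. fmult (bessel r) (u n) x - G x)" by simp
  qed (auto intro!: always_eventually)
  moreover have vh: "(\<lambda>n. norm_L2 (\<lambda>\<xi>. fourier_L2 (u n) \<xi> - fourier_L2 v \<xi>)) \<longlonglongrightarrow> 0"
    by (rule fourier_L2_tendsto[OF uL v])
  ultimately have "norm_L2 (\<lambda>\<xi>. fourier_L2 v \<xi> - H \<xi>) = 0"
  proof -
    assume h: "(\<lambda>n. norm_L2 (\<lambda>\<xi>. fourier_L2 (u n) \<xi> - H \<xi>)) \<longlonglongrightarrow> 0"
    have "(\<lambda>n. norm_L2 (\<lambda>\<xi>. fourier_L2 (u n) \<xi> - fourier_L2 v \<xi>) + norm_L2 (\<lambda>\<xi>. fourier_L2 (u n) \<xi> - H \<xi>)) \<longlonglongrightarrow> 0 + 0"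
      by (intro tendsto_add vh h)
    moreover have "norm_L2 (\<lambda>\<xi>. fourier_L2 v \<xi> - H \<xi>) \<le> norm_L2 (\<lambda>\<xi>. fourier_L2 (u n) \<xi> - fourier_L2 v \<xi>) + norm_L2 (\<lambda>\<xi>. fourier_L2 (u n) \<xi> - H \<xi>)" for n
      using norm_L2_triangle_diff[OF fourier_L2_mem[OF v(1)] fourier_L2_mem[OF uL[of n]] HL]
        norm_L2_minus_commute[of "fourier_L2 v" "fourier_L2 (u n)"] by simp
    ultimately have "norm_L2 (\<lambda>\<xi>. fourier_L2 v \<xi> - H \<xi>) \<le> 0"
      by (intro LIMSEQ_le_const[of _ 0]) auto
    then show ?thesis using norm_L2_nonneg by (metis order_antisym)
  qed
  then have "AE \<xi> in lborel. fourier_L2 v \<xi> - H \<xi> = 0"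
    by (intro norm_L2_zero_AE L2.diff_mem fourier_L2_mem v HL)
  then have e: "AE \<xi> in lborel. G \<xi> = fmult (bessel r) v \<xi>"
  proof eventually_elim
    case (elim \<xi>)
    then have "fmult (bessel r) v \<xi> = bessel r \<xi> *\<^sub>R H \<xi>" by (simp add: fmult_def)
    then show ?case using pos[of \<xi>] unfolding H_def scaleR_scaleR by simp
  qed
  have mv[measurable]: "fmult (bessel r) v \<in> borel_measurable borel" by (rule fmult_measurable[OF v(1) bessel_measurable])
  have vw: "fmult (bessel r) v \<in> L2" by (rule L2_cong_AE[OF G(1) _ e]) simp
  have vS: "v \<in> sobolev r" using v(1) vw by (simp add: sobolev_iff)
  have "sobolev_norm r (\<lambda>x. u n x - v x) = norm_L2 (\<lambda>x. fmult (bessel r) (u n) x - G x)" for n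
  proof -
    have [measurable]: "fmult (bessel r) (u n) \<in> borel_measurable borel" by (rule fmult_measurable[OF uL bessel_measurable])
    show ?thesis unfolding sobolev_norm_eq norm_L2_fmult_diff[OF uL v(1) bessel_measurable]
      using e by (intro norm_L2_cong_AE) auto
  qed
  then show ?thesis using vS G(2) by (intro bexI[OF _ vS]) simp
qed

lemma fourier_partial:
  fixes \<phi> :: "R3 \<Rightarrow> real"
  assumes p: "\<phi> \<in> Cc_infty U"
  shows "fourier (\<lambda>x. of_real (partial j \<phi> x)) \<xi> = \<i> * of_real (\<xi> $ j) * fourier (\<lambda>x. of_real (\<phi> x)) \<xi>"
proof -
  let ?k = "\<lambda>x. cis (- (x \<bullet> \<xi>))"
  have der: "(?k has_derivative (\<lambda>h. of_real (- (h \<bullet> \<xi>)) * (\<i> * cis (- (x \<bullet> \<xi>))))) (at x)" for x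
  proof -
    have "((\<lambda>x. - (x \<bullet> \<xi>)) has_derivative (\<lambda>h. - (h \<bullet> \<xi>))) (at x)" by (auto intro!: derivative_eq_intros)
    from has_derivative_cis[OF this] show ?thesis by (simp add: scaleR_conv_of_real)
  qed
  have pk: "partial j ?k = (\<lambda>x. - \<i> * of_real (\<xi> $ j) * cis (- (x \<bullet> \<xi>)))"
    using partial_eq[OF der] by (auto simp: fun_eq_iff inner_axis' mult_ac)
  have "(LINT x|lborel. partial j \<phi> x *\<^sub>R ?k x) = - (LINT x|lborel. \<phi> x *\<^sub>R partial j ?k x)"
  proof (rule integration_by_parts[OF Cc_UNIV[OF p]])
    show "continuous_on UNIV (partial j ?k)" unfolding pk by (intro continuous_intros)
  qed (use der in \<open>auto simp: differentiable_def\<close>)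
  also have "\<dots> = \<i> * of_real (\<xi> $ j) * (LINT x|lborel. of_real (\<phi> x) * ?k x)"
  proof -
    have "(LINT x|lborel. \<phi> x *\<^sub>R partial j ?k x) = (LINT x|lborel. (- \<i> * of_real (\<xi> $ j)) * (of_real (\<phi> x) * ?k x))"
      unfolding pk by (intro Bochner_Integration.integral_cong refl) (simp add: scaleR_conv_of_real)
    then show ?thesis by simp
  qed
  finally show ?thesis by (simp add: fourier_def scaleR_conv_of_real)
qed

lemma fourier_L2_partial_Cc:
  fixes \<phi> :: "R3 \<Rightarrow> real"
  assumes p: "\<phi> \<in> Cc_infty U"
  shows "AE \<xi> in lborel. fourier_L2 (partial j \<phi>) \<xi> = \<i> * of_real (\<xi> $ j) * fourier_L2 \<phi> \<xi>"
  using fourier_L2_Cc[OF p] fourier_L2_Cc[OF Cc_partial[OF p, of j]]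
  by eventually_elim (simp add: fourier_partial[OF p])

text \<open>The weight of order 2 is the symbol of the identity minus the Laplacian, so the weighted
  transform of \<phi> is the transform of another test function \<psi>. Order 2 covers all later
  uses, as 1 + s and 2 s stay below 2.\<close>

lemma Cc_sobolev:
  fixes \<phi> :: "R3 \<Rightarrow> real"
  assumes p: "\<phi> \<in> Cc_infty U" and r: "r \<le> 2"
  shows "\<phi> \<in> sobolev r"
proof -
  have "fmult (bessel 2) \<phi> \<in> L2"
  proof -
    define \<psi> where "\<psi> = (\<lambda>x. \<phi> x - (\<Sum>j\<in>UNIV. partial j (partial j \<phi>) x))"
    have pp: "\<psi> \<in> Cc_infty U" unfolding \<psi>_def by (intro Cc_diff Cc_sum Cc_partial p)
    have sumC: "(\<lambda>x. \<Sum>j\<in>(UNIV::3 set). partial j (partial j \<phi>) x) \<in> Cc_infty U" by (intro Cc_sum Cc_partial p)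
    have i: "integrable lborel (\<lambda>x. complex_of_real (f x))" if "f \<in> Cc_infty U" for f :: "R3 \<Rightarrow> real"
      using Cc_integrable[OF that] by simp
    have F: "fourier (\<lambda>x. of_real (\<psi> x)) \<xi> = bessel 2 \<xi> *\<^sub>R fourier (\<lambda>x. of_real (\<phi> x)) \<xi>" for \<xi>
    proof -
      have s: "fourier (\<lambda>x. of_real (\<Sum>j\<in>J. partial j (partial j \<phi>) x)) \<xi> = (\<Sum>j\<in>J. fourier (\<lambda>x. of_real (partial j (partial j \<phi>) x)) \<xi>)" for J
      proof (induction J rule: infinite_finite_induct)
        case (insert j J)
        have "(\<lambda>x. \<Sum>j\<in>J. partial j (partial j \<phi>) x) \<in> Cc_infty U" by (intro Cc_sum Cc_partial p)
        from fourier_add[OF i[OF Cc_partial[OF Cc_partial[OF p, of j], of j]] i[OF this], of \<xi>]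
        show ?case using insert by simp
      qed (simp_all add: fourier_def)
      have "fourier (\<lambda>x. of_real (\<psi> x)) \<xi> = fourier (\<lambda>x. of_real (\<phi> x)) \<xi> - (\<Sum>j\<in>UNIV. fourier (\<lambda>x. of_real (partial j (partial j \<phi>) x)) \<xi>)"
        unfolding \<psi>_def of_real_diff fourier_diff[OF i[OF p] i[OF sumC]] s ..
      also have "(\<Sum>j\<in>UNIV. fourier (\<lambda>x. of_real (partial j (partial j \<phi>) x)) \<xi>) = (\<Sum>j\<in>UNIV. - of_real ((\<xi> $ j)\<^sup>2) * fourier (\<lambda>x. of_real (\<phi> x)) \<xi>)"
        unfolding fourier_partial[OF Cc_partial[OF p]] fourier_partial[OF p]
        by (intro sum.cong refl) (simp add: power2_eq_square algebra_simps)
      also have "\<dots> = - of_real ((norm \<xi>)\<^sup>2) * fourier (\<lambda>x. of_real (\<phi> x)) \<xi>"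
      proof -
        have n: "(norm \<xi>)\<^sup>2 = (\<Sum>j\<in>UNIV. (\<xi> $ j)\<^sup>2)"
          unfolding power2_norm_eq_inner by (simp add: inner_vec_def power2_eq_square)
        show ?thesis unfolding n of_real_sum by (simp only: sum_distrib_right sum_negf[symmetric] mult_minus_left)
      qed
      finally show ?thesis by (simp add: scaleR_conv_of_real algebra_simps)
    qed
    have L: "fourier (\<lambda>x. complex_of_real (\<psi> x)) \<in> L2"
      by (rule fourier_L2_bound(1)[OF i[OF pp] of_real_L2[OF Cc_L2[OF pp]]])
    show ?thesis
    proof (rule L2_cong_AE[OF L])
      show "fmult (bessel 2) \<phi> \<in> borel_measurable lborel"
        unfolding measurable_lborel2 by (rule fmult_measurable[OF Cc_L2[OF p] bessel_measurable])
      show "AE x in lborel. fourier (\<lambda>x. complex_of_real (\<psi> x)) x = fmult (bessel 2) \<phi> x"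
        using fourier_L2_Cc[OF p] by eventually_elim (simp add: F fmult_def)
    qed
  qed
  then have "\<phi> \<in> sobolev 2" using Cc_L2[OF p] by (simp add: sobolev_iff)
  then show ?thesis by (rule sobolev_mono(1)[OF _ r])
qed

text \<open>Links the concrete definition to the abstract closure, from which linearity and
  completeness are inherited.\<close>

lemma sobolev_tilde_eq_closure:
  assumes r: "r \<le> 2"
  shows "sobolev_tilde r \<Omega> = semi_inner.closure_in (inner_fmult (bessel r)) (sobolev r) (Cc_infty \<Omega>)"
proof -
  have D: "Cc_infty \<Omega> \<subseteq> sobolev r" using Cc_sobolev r by blast
  show ?thesis
  proof (intro set_eqI)
    fix f
    have "(\<exists>\<phi>\<in>Cc_infty \<Omega>. sobolev_norm r (\<lambda>x. f x - \<phi> x) < e) \<longleftrightarrow> (\<exists>\<phi>\<in>Cc_infty \<Omega>. sobolev_norm r (\<lambda>x. \<phi> x - f x) < e)"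
      if "f \<in> sobolev r" for e
      using that D sobolev_norm_minus_commute[of f r] by (metis subsetD)
    then show "f \<in> sobolev_tilde r \<Omega> \<longleftrightarrow> f \<in> semi_inner.closure_in (inner_fmult (bessel r)) (sobolev r) (Cc_infty \<Omega>)"
      unfolding sob.closure_in_iff_sqrt[OF order_refl D] sobolev_tilde_def sobolev_norm_inner[symmetric] by auto
  qed
qed

lemma sobolev_tilde_sobolev: "f \<in> sobolev_tilde r \<Omega> \<Longrightarrow> f \<in> sobolev r"
  by (simp add: sobolev_tilde_def)

lemma sobolev_tilde_L2: "f \<in> sobolev_tilde r \<Omega> \<Longrightarrow> f \<in> L2"
  by (rule sobolev_L2[OF sobolev_tilde_sobolev])

lemma sobolev_tilde_UNIV: "f \<in> sobolev_tilde r \<Omega> \<Longrightarrow> f \<in> sobolev_tilde r UNIV"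
  unfolding sobolev_tilde_def using Cc_UNIV by blast

lemma sobolev_complete_sub:
  assumes r: "r \<ge> 0"
  shows "semi_inner.complete_sub (sobolev r) (inner_fmult (bessel r)) (sobolev r)"
  unfolding sob.complete_sub_def
proof (intro conjI allI impI ballI)
  show "sobolev r \<noteq> {}"
  proof -
    have z: "(\<lambda>x. 0 :: real) \<in> L2" by (rule Cc_L2[OF Cc_zero])
    have "norm_L2 (fourier_L2 (\<lambda>x. 0)) = 0" using norm_fourier_L2[OF z] by (simp add: norm_L2_def)
    then have "AE \<xi> in lborel. fourier_L2 (\<lambda>x. 0) \<xi> = 0" by (rule norm_L2_zero_AE[OF fourier_L2_mem[OF z]])
    then have e: "AE \<xi> in lborel. 0 = fmult (bessel r) (\<lambda>x. 0) \<xi>" by eventually_elim (simp add: fmult_def)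
    have "fmult (bessel r) (\<lambda>x. 0) \<in> L2"
    proof (rule L2_cong_AE[OF Cc_L2[OF Cc_zero] _ e])
      show "fmult (bessel r) (\<lambda>x. 0) \<in> borel_measurable lborel"
        by (subst measurable_lborel2) (rule fmult_measurable[OF z bessel_measurable])
    qed
    then show ?thesis using z by (auto simp: sobolev_iff)
  qed
  fix w :: "nat \<Rightarrow> R3 \<Rightarrow> real"
  assume w: "(\<forall>n. w n \<in> sobolev r) \<and> (\<forall>e>0. \<exists>N. \<forall>m\<ge>N. \<forall>n\<ge>N.
    inner_fmult (bessel r) (\<lambda>x. w m x - w n x) (\<lambda>x. w m x - w n x) < e)"
  have "\<exists>N. \<forall>m\<ge>N. \<forall>n\<ge>N. sobolev_norm r (\<lambda>x. w m x - w n x) < e" if e: "e > 0" for e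
  proof -
    have "e\<^sup>2 > 0" using e by simp
    then obtain N where N: "\<And>m n. m \<ge> N \<Longrightarrow> n \<ge> N \<Longrightarrow>
      inner_fmult (bessel r) (\<lambda>x. w m x - w n x) (\<lambda>x. w m x - w n x) < e\<^sup>2" using w by blast
    have "sobolev_norm r (\<lambda>x. w m x - w n x) < e" if "m \<ge> N" "n \<ge> N" for m n
      unfolding sobolev_norm_inner using real_sqrt_less_mono[OF N[OF that]] e by simp
    then show ?thesis by blast
  qed
  then obtain v where v: "v \<in> sobolev r" "(\<lambda>n. sobolev_norm r (\<lambda>x. w n x - v x)) \<longlonglongrightarrow> 0"
    using sobolev_complete[of w r] w r by blast
  have "(\<lambda>n. (sobolev_norm r (\<lambda>x. w n x - v x))\<^sup>2) \<longlonglongrightarrow> 0\<^sup>2" by (intro tendsto_intros v)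
  then show "\<exists>v\<in>sobolev r. (\<lambda>n. inner_fmult (bessel r) (\<lambda>x. w n x - v x) (\<lambda>x. w n x - v x)) \<longlonglongrightarrow> 0"
    using v(1) w by (intro bexI[OF _ v(1)]) (simp add: sobolev_norm_inner sob.pos sob.diff_mem)
qed (auto intro: sobolev_lin)

lemma sobolev_tilde_complete:
  assumes r: "0 \<le> r" "r \<le> 2"
  shows "semi_inner.complete_sub (sobolev r) (inner_fmult (bessel r)) (sobolev_tilde r \<Omega>)"
  unfolding sobolev_tilde_eq_closure[OF r(2)]
proof (rule sob.complete_closure_in[OF sobolev_complete_sub[OF r(1)]])
  show "Cc_infty \<Omega> \<subseteq> sobolev r" using Cc_sobolev r by blast
  show "Cc_infty \<Omega> \<noteq> ({} :: (R3 \<Rightarrow> real) set)" using Cc_zero by blast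
qed (intro Cc_add Cc_scale)

lemma sobolev_tilde_lin:
  assumes r: "0 \<le> r" "r \<le> 2" and f: "f \<in> sobolev_tilde r \<Omega>" "g \<in> sobolev_tilde r \<Omega>"
  shows "(\<lambda>x. f x + c * g x) \<in> sobolev_tilde r \<Omega>"
  using sobolev_tilde_complete[OF r, of \<Omega>] f unfolding sob.complete_sub_def by auto

lemma Cc_sobolev_tilde:
  assumes r: "r \<le> 2" and p: "\<phi> \<in> Cc_infty \<Omega>"
  shows "\<phi> \<in> sobolev_tilde r \<Omega>"
proof -
  have "sobolev_norm r (\<lambda>x. \<phi> x - \<phi> x) = 0"
    using sob.expand_diff[of \<phi> r \<phi>] Cc_sobolev[OF p r] by (simp add: sobolev_norm_inner)
  then show ?thesis unfolding sobolev_tilde_def using p Cc_sobolev[OF p r] by force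
qed

lemma sobolev_tilde_seq:
  assumes r: "r \<le> 2" and f: "f \<in> sobolev_tilde r \<Omega>"
  obtains \<phi> where "\<And>n. \<phi> n \<in> Cc_infty \<Omega>" "(\<lambda>n::nat. sobolev_norm r (\<lambda>x. \<phi> n x - f x)) \<longlonglongrightarrow> 0"
proof -
  have "\<forall>n. \<exists>\<phi>\<in>Cc_infty \<Omega>. sobolev_norm r (\<lambda>x. f x - \<phi> x) < 1 / real (Suc n)"
    using f by (auto simp: sobolev_tilde_def)
  then obtain \<phi> where p: "\<And>n. \<phi> n \<in> Cc_infty \<Omega>" "\<And>n. sobolev_norm r (\<lambda>x. f x - \<phi> n x) < 1 / real (Suc n)" by metis
  have "(\<lambda>n. sobolev_norm r (\<lambda>x. \<phi> n x - f x)) \<longlonglongrightarrow> 0"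
    by (rule tendsto_sandwich[OF _ _ tendsto_const LIMSEQ_Suc[OF lim_1_over_n]])
       (use p(2) sobolev_norm_minus_commute[OF Cc_sobolev[OF p(1) r] sobolev_tilde_sobolev[OF f]]
         in \<open>auto intro!: always_eventually less_imp_le\<close>)
  with p(1) show ?thesis by (rule that)
qed

lemma AE_eq_of_fourier_L2_eq:
  assumes f: "f \<in> L2" "g \<in> L2" and e: "AE \<xi> in lborel. fourier_L2 f \<xi> = fourier_L2 g \<xi>"
  shows "AE x in lborel. f x = g x"
proof -
  have d: "(\<lambda>x. f x - g x) \<in> L2" by (intro L2.diff_mem f)
  have "norm_L2 (fourier_L2 (\<lambda>x. f x - g x)) = norm_L2 (\<lambda>\<xi>::R3. 0 :: complex)"
    using fourier_L2_diff[OF f] e L2_measurable[OF fourier_L2_mem[OF d]] by (intro norm_L2_cong_AE) auto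
  then have "norm_L2 (\<lambda>x. f x - g x) = 0" using norm_fourier_L2[OF d] by (simp add: norm_L2_def)
  then have "AE x in lborel. f x - g x = 0" by (rule norm_L2_zero_AE[OF d])
  then show ?thesis by eventually_elim simp
qed

section \<open>Weak derivatives\<close>

lemma partial_diff:
  assumes "f differentiable (at x)" "g differentiable (at x)"
  shows "partial j (\<lambda>x. f x - g x) x = partial j f x - partial j g x"
  using partial_eq[OF has_derivative_diff[OF assms[THEN has_derivative_frechet]]] by (simp add: partial_def)

lemma nth_le_bessel: "1 \<le> r \<Longrightarrow> \<bar>\<xi> $ j\<bar> \<le> 1 * bessel r \<xi>"
  using norm_powr_le_bessel[of 1 r \<xi>] component_le_norm_cart[of \<xi> j] by simp

lemma nth_measurable [measurable]: "(\<lambda>x::R3. x $ j) \<in> borel_measurable borel"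
  by (intro borel_measurable_continuous_onI continuous_intros)

text \<open>For an approximation by test functions the classical derivatives are Cauchy in L2 by
  Plancherel. Their limit inherits the integration by parts identity and at the same time the symbol
  i \<xi>_j; the latter carries over to whichever function \<open>SOME\<close> selects.\<close>

lemma weak_partial_ex:
  assumes r: "1 \<le> r" "r \<le> 2" and u: "u \<in> sobolev_tilde r UNIV"
  shows "\<exists>g\<in>L2. (\<forall>\<psi>\<in>Cc_infty UNIV. (LINT x|lborel. g x * \<psi> x) = - (LINT x|lborel. u x * partial j \<psi> x))
    \<and> (AE \<xi> in lborel. fourier_L2 g \<xi> = \<i> * of_real (\<xi> $ j) * fourier_L2 u \<xi>)"
proof -
  obtain \<phi> where p: "\<And>n. \<phi> n \<in> Cc_infty UNIV" "(\<lambda>n::nat. sobolev_norm r (\<lambda>x. \<phi> n x - u x)) \<longlonglongrightarrow> 0"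
    by (rule sobolev_tilde_seq[OF r(2) u]) blast
  let ?m = "\<lambda>\<xi>::R3. \<xi> $ j"
  have uS: "u \<in> sobolev r" and uL: "u \<in> L2" using u sobolev_tilde_sobolev sobolev_tilde_L2 by auto
  have pS: "\<phi> n \<in> sobolev r" and pL: "\<phi> n \<in> L2" and dL: "partial j (\<phi> n) \<in> L2" for n
    using Cc_sobolev[OF p(1) r(2)] Cc_L2[OF p(1)] Cc_L2[OF Cc_partial[OF p(1)]] by auto
  have bound: "norm_L2 (fmult ?m f) \<le> sobolev_norm r f" if "f \<in> sobolev r" for f
    using fmult_bound(2)[OF that nth_measurable nth_le_bessel[OF r(1)]] by simp
  have nrm: "norm_L2 (partial j \<psi>) \<le> sobolev_norm r \<psi>" if \<psi>: "\<psi> \<in> Cc_infty UNIV" for \<psi>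
  proof -
    have L: "\<psi> \<in> L2" "partial j \<psi> \<in> L2" using Cc_L2[OF \<psi>] Cc_L2[OF Cc_partial[OF \<psi>]] by auto
    have "norm_L2 (partial j \<psi>) = norm_L2 (fourier_L2 (partial j \<psi>))" using norm_fourier_L2[OF L(2)] by simp
    also have "\<dots> = norm_L2 (\<lambda>\<xi>. \<i> * fmult ?m \<psi> \<xi>)"
    proof (rule norm_L2_cong_AE)
      have [measurable]: "fmult ?m \<psi> \<in> borel_measurable borel" by (rule fmult_measurable[OF L(1) nth_measurable])
      show "(\<lambda>\<xi>. \<i> * fmult ?m \<psi> \<xi>) \<in> borel_measurable lborel" by measurable
      show "AE \<xi> in lborel. fourier_L2 (partial j \<psi>) \<xi> = \<i> * fmult ?m \<psi> \<xi>"
        using fourier_L2_partial_Cc[OF \<psi>, of j] by eventually_elim (simp add: fmult_def scaleR_conv_of_real)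
    qed (use L2_measurable[OF fourier_L2_mem[OF L(2)]] in simp)
    also have "\<dots> = norm_L2 (fmult ?m \<psi>)" by (simp add: norm_L2_def norm_mult)
    also have "\<dots> \<le> sobolev_norm r \<psi>" by (rule bound[OF Cc_sobolev[OF \<psi> r(2)]])
    finally show ?thesis .
  qed
  have "\<exists>g\<in>L2. (\<lambda>n. norm_L2 (\<lambda>x. partial j (\<phi> n) x - g x)) \<longlonglongrightarrow> 0"
  proof (rule L2_complete[OF dL])
    fix e :: real assume e: "e > 0"
    obtain N where N: "\<And>n. n \<ge> N \<Longrightarrow> sobolev_norm r (\<lambda>x. \<phi> n x - u x) < e / 2"
      using LIMSEQ_D[OF p(2), of "e / 2"] e by auto
    have "norm_L2 (\<lambda>x. partial j (\<phi> m) x - partial j (\<phi> n) x) < e" if "m \<ge> N" "n \<ge> N" for m n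
    proof -
      have "partial j (\<lambda>x. \<phi> m x - \<phi> n x) = (\<lambda>x. partial j (\<phi> m) x - partial j (\<phi> n) x)"
        by (intro ext partial_diff smoothD[OF Cc_smooth[OF p(1)]])
      then have "norm_L2 (\<lambda>x. partial j (\<phi> m) x - partial j (\<phi> n) x) \<le> sobolev_norm r (\<lambda>x. \<phi> m x - \<phi> n x)"
        using nrm[OF Cc_diff[OF p(1)[of m] p(1)[of n]]] by (simp only:)
      also have "\<dots> \<le> sobolev_norm r (\<lambda>x. \<phi> m x - u x) + sobolev_norm r (\<lambda>x. u x - \<phi> n x)"
        by (rule sobolev_norm_triangle_diff[OF pS uS pS])
      also have "\<dots> < e" using N[OF that(1)] N[OF that(2)] sobolev_norm_minus_commute[OF uS pS[of n]] by simp
      finally show ?thesis .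
    qed
    then show "\<exists>N. \<forall>m\<ge>N. \<forall>n\<ge>N. norm_L2 (\<lambda>x. partial j (\<phi> m) x - partial j (\<phi> n) x) < e" by blast
  qed
  then obtain g where g: "g \<in> L2" "(\<lambda>n. norm_L2 (\<lambda>x. partial j (\<phi> n) x - g x)) \<longlonglongrightarrow> 0" by blast
  have pu: "(\<lambda>n. norm_L2 (\<lambda>x. \<phi> n x - u x)) \<longlonglongrightarrow> 0"
    by (rule tendsto_sandwich[OF _ _ tendsto_const p(2)])
       (use norm_L2_le_sobolev[OF sob.diff_mem[OF pS uS]] r in \<open>auto intro!: always_eventually\<close>)
  have spec: "(LINT x|lborel. g x * \<psi> x) = - (LINT x|lborel. u x * partial j \<psi> x)" if \<psi>: "\<psi> \<in> Cc_infty UNIV" for \<psi>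
  proof (rule LIMSEQ_unique)
    show "(\<lambda>n. LINT x|lborel. partial j (\<phi> n) x * \<psi> x) \<longlonglongrightarrow> (LINT x|lborel. g x * \<psi> x)"
      by (rule tendsto_L2_mult[OF dL g Cc_L2[OF \<psi>] Cc_L2[OF \<psi>] norm_L2_self_diff_tendsto])
    have "(\<lambda>n. - (LINT x|lborel. \<phi> n x * partial j \<psi> x)) \<longlonglongrightarrow> - (LINT x|lborel. u x * partial j \<psi> x)"
      by (intro tendsto_minus tendsto_L2_mult pL uL pu Cc_L2[OF Cc_partial[OF \<psi>]] norm_L2_self_diff_tendsto)
    moreover have "(LINT x|lborel. partial j (\<phi> n) x * \<psi> x) = - (LINT x|lborel. \<phi> n x * partial j \<psi> x)" for n
      using integration_by_parts[OF p(1)[of n] open_UNIV smoothD[OF Cc_smooth[OF \<psi>]] Cc_continuous[OF Cc_partial[OF \<psi>]]] by simp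
    ultimately show "(\<lambda>n. LINT x|lborel. partial j (\<phi> n) x * \<psi> x) \<longlonglongrightarrow> - (LINT x|lborel. u x * partial j \<psi> x)" by simp
  qed
  have fmL: "fmult ?m u \<in> L2" by (rule fmult_bound(1)[OF uS nth_measurable nth_le_bessel[OF r(1)]]) simp
  have iL: "(\<lambda>\<xi>. \<i> * fmult ?m u \<xi>) \<in> L2"
    using fmL by (intro L2_mono[OF _ fmL, where C=1]) (auto simp: norm_mult dest: L2_measurable)
  have "norm_L2 (\<lambda>\<xi>. fourier_L2 g \<xi> - \<i> * fmult ?m u \<xi>) \<le> 0"
  proof (rule LIMSEQ_le_const)
    show "(\<lambda>n. norm_L2 (\<lambda>\<xi>. fourier_L2 (partial j (\<phi> n)) \<xi> - fourier_L2 g \<xi>) + sobolev_norm r (\<lambda>x. \<phi> n x - u x)) \<longlonglongrightarrow> 0"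
      using tendsto_add[OF fourier_L2_tendsto[OF dL g] p(2)] by simp
    have "norm_L2 (\<lambda>\<xi>. fourier_L2 g \<xi> - \<i> * fmult ?m u \<xi>)
      \<le> norm_L2 (\<lambda>\<xi>. fourier_L2 (partial j (\<phi> n)) \<xi> - fourier_L2 g \<xi>) + sobolev_norm r (\<lambda>x. \<phi> n x - u x)" for n
    proof -
      have "norm_L2 (\<lambda>\<xi>. fourier_L2 (partial j (\<phi> n)) \<xi> - \<i> * fmult ?m u \<xi>) = norm_L2 (\<lambda>\<xi>. fmult ?m (\<phi> n) \<xi> - fmult ?m u \<xi>)"
      proof -
        have [measurable]: "fmult ?m (\<phi> n) \<in> borel_measurable borel" by (rule fmult_measurable[OF pL nth_measurable])
        have [measurable]: "fmult ?m u \<in> borel_measurable borel" by (rule fmult_measurable[OF uL nth_measurable])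
        have [measurable]: "fourier_L2 (partial j (\<phi> n)) \<in> borel_measurable borel" using dL by measurable
        have "norm_L2 (\<lambda>\<xi>. fourier_L2 (partial j (\<phi> n)) \<xi> - \<i> * fmult ?m u \<xi>) = norm_L2 (\<lambda>\<xi>. \<i> * (fmult ?m (\<phi> n) \<xi> - fmult ?m u \<xi>))"
        proof (rule norm_L2_cong_AE)
          show "AE \<xi> in lborel. fourier_L2 (partial j (\<phi> n)) \<xi> - \<i> * fmult ?m u \<xi> = \<i> * (fmult ?m (\<phi> n) \<xi> - fmult ?m u \<xi>)"
            using fourier_L2_partial_Cc[OF p(1)[of n], of j]
            by eventually_elim (simp add: fmult_def scaleR_conv_of_real algebra_simps)
        qed measurable
        then show ?thesis by (simp add: norm_L2_def norm_mult)
      qed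
      also have "\<dots> \<le> sobolev_norm r (\<lambda>x. \<phi> n x - u x)"
        using bound[OF sob.diff_mem[OF pS uS]] norm_L2_fmult_diff[OF pL uL nth_measurable] by simp
      finally show ?thesis
        using norm_L2_triangle_diff[OF fourier_L2_mem[OF g(1)] fourier_L2_mem[OF dL[of n]] iL]
          norm_L2_minus_commute[of "fourier_L2 g" "fourier_L2 (partial j (\<phi> n))"] by simp
    qed
    then show "\<exists>N. \<forall>n\<ge>N. norm_L2 (\<lambda>\<xi>. fourier_L2 g \<xi> - \<i> * fmult ?m u \<xi>)
      \<le> norm_L2 (\<lambda>\<xi>. fourier_L2 (partial j (\<phi> n)) \<xi> - fourier_L2 g \<xi>) + sobolev_norm r (\<lambda>x. \<phi> n x - u x)" by blast
  qed
  then have "norm_L2 (\<lambda>\<xi>. fourier_L2 g \<xi> - \<i> * fmult ?m u \<xi>) = 0" using norm_L2_nonneg by (metis order_antisym)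
  then have "AE \<xi> in lborel. fourier_L2 g \<xi> - \<i> * fmult ?m u \<xi> = 0"
    by (intro norm_L2_zero_AE L2.diff_mem fourier_L2_mem g iL)
  then have "AE \<xi> in lborel. fourier_L2 g \<xi> = \<i> * of_real (\<xi> $ j) * fourier_L2 u \<xi>"
    by eventually_elim (simp add: fmult_def scaleR_conv_of_real)
  then show ?thesis using g(1) spec by blast
qed

lemma weak_partial_unique:
  fixes g h :: "R3 \<Rightarrow> real"
  assumes g: "g \<in> L2" "h \<in> L2"
    and s: "\<And>\<psi>. \<psi> \<in> Cc_infty UNIV \<Longrightarrow> (LINT x|lborel. g x * \<psi> x) = (LINT x|lborel. h x * \<psi> x)"
  shows "AE x in lborel. g x = h x"
proof -
  have "AE x in lborel. g x - h x = 0"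
  proof (rule fundamental_lemma_L2[OF L2.diff_mem[OF g]])
    fix \<psi> :: "R3 \<Rightarrow> real" assume p: "\<psi> \<in> Cc_infty UNIV"
    show "(LINT x|lborel. \<psi> x * (g x - h x)) = 0"
      using s[OF p] L2_mult_integrable[OF g(1) Cc_L2[OF p]] L2_mult_integrable[OF g(2) Cc_L2[OF p]]
      by (simp add: right_diff_distrib mult.commute)
  qed
  then show ?thesis by eventually_elim simp
qed

lemma weak_partial_spec:
  assumes r: "1 \<le> r" "r \<le> 2" and u: "u \<in> sobolev_tilde r UNIV"
  shows weak_partial_L2: "weak_partial j u \<in> L2"
    and weak_partial_test: "\<psi> \<in> Cc_infty UNIV \<Longrightarrow> (LINT x|lborel. weak_partial j u x * \<psi> x) = - (LINT x|lborel. u x * partial j \<psi> x)"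
    and fourier_weak_partial: "AE \<xi> in lborel. fourier_L2 (weak_partial j u) \<xi> = \<i> * of_real (\<xi> $ j) * fourier_L2 u \<xi>"
proof -
  obtain g where g: "g \<in> L2" "\<And>\<psi>. \<psi> \<in> Cc_infty UNIV \<Longrightarrow> (LINT x|lborel. g x * \<psi> x) = - (LINT x|lborel. u x * partial j \<psi> x)"
    "AE \<xi> in lborel. fourier_L2 g \<xi> = \<i> * of_real (\<xi> $ j) * fourier_L2 u \<xi>"
    using weak_partial_ex[OF assms, of j] by blast
  then have "\<exists>g. g \<in> L2 \<and> (\<forall>\<phi>\<in>Cc_infty UNIV. (LINT x|lborel. g x * \<phi> x) = - (LINT x|lborel. u x * partial j \<phi> x))" by blast
  from someI_ex[OF this]
  have w: "weak_partial j u \<in> L2"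
    "\<And>\<psi>. \<psi> \<in> Cc_infty UNIV \<Longrightarrow> (LINT x|lborel. weak_partial j u x * \<psi> x) = - (LINT x|lborel. u x * partial j \<psi> x)"
    unfolding weak_partial_def by auto
  then show "weak_partial j u \<in> L2"
    "\<psi> \<in> Cc_infty UNIV \<Longrightarrow> (LINT x|lborel. weak_partial j u x * \<psi> x) = - (LINT x|lborel. u x * partial j \<psi> x)" by auto
  have "AE x in lborel. weak_partial j u x = g x" by (rule weak_partial_unique[OF w(1) g(1)]) (simp add: w(2) g(2))
  from fourier_L2_cong[OF w(1) g(1) this] g(3)
  show "AE \<xi> in lborel. fourier_L2 (weak_partial j u) \<xi> = \<i> * of_real (\<xi> $ j) * fourier_L2 u \<xi>"
    by eventually_elim simp
qed

lemma weak_partial_Cc: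
  assumes p: "\<phi> \<in> Cc_infty U"
  shows "AE x in lborel. weak_partial j \<phi> x = partial j \<phi> x"
proof -
  have t: "\<phi> \<in> sobolev_tilde 1 UNIV" by (rule Cc_sobolev_tilde[OF _ Cc_UNIV[OF p]]) simp
  show ?thesis
  proof (rule weak_partial_unique[OF weak_partial_L2[OF _ _ t] Cc_L2[OF Cc_partial[OF p]]])
    fix \<psi> :: "R3 \<Rightarrow> real" assume q: "\<psi> \<in> Cc_infty UNIV"
    show "(LINT x|lborel. weak_partial j \<phi> x * \<psi> x) = (LINT x|lborel. partial j \<phi> x * \<psi> x)"
      using weak_partial_test[OF _ _ t q, of j]
        integration_by_parts[OF Cc_UNIV[OF p] open_UNIV smoothD[OF Cc_smooth[OF q]] Cc_continuous[OF Cc_partial[OF q]], of j] by simp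
  qed simp_all
qed

lemma weak_partial_lin:
  assumes r: "1 \<le> r" "r \<le> 2" and u: "u \<in> sobolev_tilde r UNIV" and v: "v \<in> sobolev_tilde r UNIV"
  shows "AE x in lborel. weak_partial j (\<lambda>x. u x + c * v x) x = weak_partial j u x + c * weak_partial j v x"
proof -
  have r0: "0 \<le> r" using r by simp
  have w: "(\<lambda>x. u x + c * v x) \<in> sobolev_tilde r UNIV" by (rule sobolev_tilde_lin[OF r0 r(2) u v])
  note wu = weak_partial_L2[OF r u, of j] and wv = weak_partial_L2[OF r v, of j] and ww = weak_partial_L2[OF r w, of j]
  have L: "(\<lambda>x. weak_partial j u x + c * weak_partial j v x) \<in> L2" using L2_lin[OF wu wv, of c] by simp
  show ?thesis
  proof (rule AE_eq_of_fourier_L2_eq[OF ww L])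
    show "AE \<xi> in lborel. fourier_L2 (weak_partial j (\<lambda>x. u x + c * v x)) \<xi> = fourier_L2 (\<lambda>x. weak_partial j u x + c * weak_partial j v x) \<xi>"
      using fourier_weak_partial[OF r w, of j] fourier_weak_partial[OF r u, of j] fourier_weak_partial[OF r v, of j]
        fourier_L2_lin[OF wu wv, of c] fourier_L2_lin[OF sobolev_tilde_L2[OF u] sobolev_tilde_L2[OF v], of c]
      by eventually_elim (simp add: algebra_simps)
  qed
qed

lemma weak_partial_sobolev:
  assumes r: "1 \<le> r" "r \<le> 2" and u: "u \<in> sobolev_tilde r UNIV"
  shows "weak_partial j u \<in> sobolev (r - 1)"
    and "sobolev_norm (r - 1) (weak_partial j u) \<le> sobolev_norm r u"
proof -
  let ?m = "\<lambda>\<xi>::R3. bessel (r - 1) \<xi> * \<xi> $ j"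
  have uS: "u \<in> sobolev r" and uL: "u \<in> L2" using u sobolev_tilde_sobolev sobolev_tilde_L2 by auto
  have wL: "weak_partial j u \<in> L2" by (rule weak_partial_L2[OF r u])
  have m: "?m \<in> borel_measurable borel" by measurable
  have le: "\<bar>?m \<xi>\<bar> \<le> 1 * bessel r \<xi>" for \<xi>
  proof -
    have "\<bar>?m \<xi>\<bar> = bessel (r - 1) \<xi> * \<bar>\<xi> $ j\<bar>" by (simp add: abs_mult)
    also have "\<dots> \<le> bessel (r - 1) \<xi> * bessel 1 \<xi>" using nth_le_bessel[of 1 \<xi> j] by (intro mult_left_mono) auto
    also have "\<dots> = bessel r \<xi>" by (simp flip: powr_add add: field_simps)
    finally show ?thesis by simp
  qed
  have fm: "fmult ?m u \<in> L2" "norm_L2 (fmult ?m u) \<le> 1 * sobolev_norm r u"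
    using fmult_bound[OF uS m le] by auto
  have e: "AE \<xi> in lborel. \<i> * fmult ?m u \<xi> = fmult (bessel (r - 1)) (weak_partial j u) \<xi>"
    using fourier_weak_partial[OF r u, of j] by eventually_elim (simp add: fmult_def scaleR_conv_of_real mult_ac)
  have iL: "(\<lambda>\<xi>. \<i> * fmult ?m u \<xi>) \<in> L2"
    using fm by (intro L2_mono[OF _ fm(1), where C=1]) (auto simp: norm_mult dest: L2_measurable)
  have ml: "fmult (bessel (r - 1)) (weak_partial j u) \<in> borel_measurable lborel"
    using fmult_measurable[OF wL bessel_measurable] by simp
  show "weak_partial j u \<in> sobolev (r - 1)" using L2_cong_AE[OF iL ml e] wL by (simp add: sobolev_iff)
  have "sobolev_norm (r - 1) (weak_partial j u) = norm_L2 (\<lambda>\<xi>. \<i> * fmult ?m u \<xi>)"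
    unfolding sobolev_norm_eq using norm_L2_cong_AE[OF L2_measurable[OF iL] ml e] by simp
  then show "sobolev_norm (r - 1) (weak_partial j u) \<le> sobolev_norm r u" using fm(2) by (simp add: norm_L2_def norm_mult)
qed

text \<open>\<open>pairing\<close> is defined through approximating test functions, so it must be
  known that the derivative is again a limit of test functions, not merely an element of H^(r -
  1).\<close>

lemma weak_partial_tilde:
  assumes r: "1 \<le> r" "r \<le> 2" and u: "u \<in> sobolev_tilde r UNIV"
  shows "weak_partial j u \<in> sobolev_tilde (r - 1) UNIV"
proof -
  have "\<exists>\<psi>\<in>Cc_infty UNIV. sobolev_norm (r - 1) (\<lambda>x. weak_partial j u x - \<psi> x) < e" if e: "e > 0" for e
  proof -
    obtain \<phi> where p: "\<phi> \<in> Cc_infty UNIV" "sobolev_norm r (\<lambda>x. u x - \<phi> x) < e" using u e by (auto simp: sobolev_tilde_def)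
    have pt: "\<phi> \<in> sobolev_tilde r UNIV" by (rule Cc_sobolev_tilde[OF r(2) p(1)])
    have d: "(\<lambda>x. u x - \<phi> x) \<in> sobolev_tilde r UNIV" using sobolev_tilde_lin[OF _ r(2) u pt, of "-1"] r by simp
    have ae: "AE x in lborel. weak_partial j (\<lambda>x. u x - \<phi> x) x = weak_partial j u x - partial j \<phi> x"
      using weak_partial_lin[OF r u pt, of j "-1"] weak_partial_Cc[OF p(1), of j] by eventually_elim simp
    have L: "weak_partial j (\<lambda>x. u x - \<phi> x) \<in> L2" "(\<lambda>x. weak_partial j u x - partial j \<phi> x) \<in> L2"
      using weak_partial_L2[OF r d] L2.diff_mem[OF weak_partial_L2[OF r u] Cc_L2[OF Cc_partial[OF p(1)]]] by auto
    have "sobolev_norm (r - 1) (\<lambda>x. weak_partial j u x - partial j \<phi> x) = sobolev_norm (r - 1) (weak_partial j (\<lambda>x. u x - \<phi> x))"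
      unfolding sobolev_norm_eq using fmult_cong[OF L ae, of "bessel (r - 1)"] fmult_measurable[OF L(1) bessel_measurable] fmult_measurable[OF L(2) bessel_measurable]
      by (intro norm_L2_cong_AE) auto
    also have "\<dots> \<le> sobolev_norm r (\<lambda>x. u x - \<phi> x)" by (rule weak_partial_sobolev(2)[OF r d])
    finally show ?thesis using p(2) Cc_partial[OF p(1)] by (intro bexI[of _ "partial j \<phi>"]) auto
  qed
  then show ?thesis using weak_partial_sobolev(1)[OF assms] by (auto simp: sobolev_tilde_def)
qed

section \<open>The pairing\<close>

lemma fourier_reflect: "fourier (\<lambda>x. of_real (\<phi> x)) (- \<xi>) = cnj (fourier (\<lambda>x. of_real (\<phi> x)) \<xi>)"
  unfolding cnj_fourier by (simp add: fourier_def)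

lemma inv_fourier_real: "inv_fourier (\<lambda>x. of_real (\<phi> x)) \<xi> = cnj (fourier (\<lambda>x. of_real (\<phi> x)) \<xi>)"
  unfolding cnj_fourier by (simp add: inv_fourier_def inner_commute)

lemma norm_powr_measurable [measurable]: "(\<lambda>\<xi>::R3. norm \<xi> powr s) \<in> borel_measurable borel"
  by measurable

lemma fmult_powr_mem:
  assumes "0 \<le> s" "w \<in> sobolev s"
  shows "fmult (\<lambda>\<xi>. norm \<xi> powr s) w \<in> L2" and "norm_L2 (fmult (\<lambda>\<xi>. norm \<xi> powr s) w) \<le> sobolev_norm s w"
proof -
  have le: "\<bar>norm \<xi> powr s\<bar> \<le> 1 * bessel s \<xi>" for \<xi> :: R3 using norm_powr_le_bessel[of s s \<xi>] assms(1) by simp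
  show "fmult (\<lambda>\<xi>. norm \<xi> powr s) w \<in> L2" "norm_L2 (fmult (\<lambda>\<xi>. norm \<xi> powr s) w) \<le> sobolev_norm s w"
    using fmult_bound[OF assms(2) norm_powr_measurable le] by auto
qed

lemma fmult_powr_tendsto:
  assumes s: "0 \<le> s" and F: "\<And>n. F n \<in> sobolev s" "f \<in> sobolev s" "(\<lambda>n. sobolev_norm s (\<lambda>x. F n x - f x)) \<longlonglongrightarrow> 0"
  shows "(\<lambda>n. norm_L2 (\<lambda>\<xi>. fmult (\<lambda>\<xi>. norm \<xi> powr s) (F n) \<xi> - fmult (\<lambda>\<xi>. norm \<xi> powr s) f \<xi>)) \<longlonglongrightarrow> 0"
proof (rule tendsto_sandwich[OF _ _ tendsto_const F(3)])
  have "norm_L2 (\<lambda>\<xi>. fmult (\<lambda>\<xi>. norm \<xi> powr s) (F n) \<xi> - fmult (\<lambda>\<xi>. norm \<xi> powr s) f \<xi>) \<le> sobolev_norm s (\<lambda>x. F n x - f x)" for n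
    using fmult_powr_mem(2)[OF s sob.diff_mem[OF F(1)[of n] F(2)]]
      norm_L2_fmult_diff[OF sobolev_L2[OF F(1)[of n]] sobolev_L2[OF F(2)] norm_powr_measurable] by simp
  then show "\<forall>\<^sub>F n in sequentially. norm_L2 (\<lambda>\<xi>. fmult (\<lambda>\<xi>. norm \<xi> powr s) (F n) \<xi> - fmult (\<lambda>\<xi>. norm \<xi> powr s) f \<xi>) \<le> sobolev_norm s (\<lambda>x. F n x - f x)"
    by (intro always_eventually allI)
qed (auto intro!: always_eventually)

text \<open>Real functions have transforms whose value at -\<xi> is the conjugate of that at \<xi>,
  and the weight is even. Reflection therefore conjugates the integrand while preserving the
  integral.\<close>

lemma frac_form_Cc_real:
  fixes \<phi> \<psi> :: "R3 \<Rightarrow> real"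
  assumes p: "\<phi> \<in> Cc_infty UNIV" and q: "\<psi> \<in> Cc_infty UNIV"
  shows "Im (LINT \<xi>|lborel. fmult (\<lambda>\<xi>. norm \<xi> powr s) \<phi> \<xi> * cnj (fmult (\<lambda>\<xi>. norm \<xi> powr s) \<psi> \<xi>)) = 0"
proof -
  let ?F = "fourier (\<lambda>x. complex_of_real (\<phi> x))" and ?G = "fourier (\<lambda>x. complex_of_real (\<psi> x))"
  let ?H = "\<lambda>\<xi>. (norm \<xi> powr s *\<^sub>R ?F \<xi>) * cnj (norm \<xi> powr s *\<^sub>R ?G \<xi>)"
  have [measurable]: "?F \<in> borel_measurable borel" "?G \<in> borel_measurable borel"
    by (intro fourier_measurable schwartz_integrable_L2 Cc_schwartz[OF p] Cc_schwartz[OF q])+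
  have [measurable]: "fmult (\<lambda>\<xi>. norm \<xi> powr s) \<phi> \<in> borel_measurable borel" "fmult (\<lambda>\<xi>. norm \<xi> powr s) \<psi> \<in> borel_measurable borel"
    by (rule fmult_measurable[OF Cc_L2[OF p] norm_powr_measurable], rule fmult_measurable[OF Cc_L2[OF q] norm_powr_measurable])
  have "(LINT \<xi>|lborel. fmult (\<lambda>\<xi>. norm \<xi> powr s) \<phi> \<xi> * cnj (fmult (\<lambda>\<xi>. norm \<xi> powr s) \<psi> \<xi>)) = (LINT \<xi>|lborel. ?H \<xi>)"
  proof (intro integral_cong_AE)
    show "AE \<xi> in lborel. fmult (\<lambda>\<xi>. norm \<xi> powr s) \<phi> \<xi> * cnj (fmult (\<lambda>\<xi>. norm \<xi> powr s) \<psi> \<xi>) = ?H \<xi>"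
      using fourier_L2_Cc[OF p] fourier_L2_Cc[OF q] by eventually_elim (simp add: fmult_def)
  qed measurable
  moreover have "(LINT \<xi>|lborel. ?H \<xi>) = (LINT \<xi>|lborel. ?H (0 - \<xi>))"
    by (rule integral_reflect[symmetric]) measurable
  moreover have "?H (0 - \<xi>) = cnj (?H \<xi>)" for \<xi> by (simp add: fourier_reflect)
  ultimately have "(LINT \<xi>|lborel. fmult (\<lambda>\<xi>. norm \<xi> powr s) \<phi> \<xi> * cnj (fmult (\<lambda>\<xi>. norm \<xi> powr s) \<psi> \<xi>))
    = cnj (LINT \<xi>|lborel. fmult (\<lambda>\<xi>. norm \<xi> powr s) \<phi> \<xi> * cnj (fmult (\<lambda>\<xi>. norm \<xi> powr s) \<psi> \<xi>))"
    by (metis (no_types, lifting) Bochner_Integration.integral_cong Bochner_Integration.integral_cnj)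
  from arg_cong[OF this, of Im] show ?thesis unfolding cnj.simps by simp
qed

lemma frac_form_real:
  assumes s: "0 \<le> s" "s \<le> 2" and w: "w \<in> sobolev_tilde s UNIV" and v: "v \<in> sobolev_tilde s UNIV"
  shows "(LINT \<xi>|lborel. fmult (\<lambda>\<xi>. norm \<xi> powr s) w \<xi> * cnj (fmult (\<lambda>\<xi>. norm \<xi> powr s) v \<xi>))
    = of_real (inner_fmult (\<lambda>\<xi>. norm \<xi> powr s) w v)"
proof -
  let ?m = "fmult (\<lambda>\<xi>::R3. norm \<xi> powr s)"
  obtain \<phi> where p: "\<And>n. \<phi> n \<in> Cc_infty UNIV" "(\<lambda>n::nat. sobolev_norm s (\<lambda>x. \<phi> n x - w x)) \<longlonglongrightarrow> 0"
    by (rule sobolev_tilde_seq[OF s(2) w]) blast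
  obtain \<psi> where q: "\<And>n. \<psi> n \<in> Cc_infty UNIV" "(\<lambda>n::nat. sobolev_norm s (\<lambda>x. \<psi> n x - v x)) \<longlonglongrightarrow> 0"
    by (rule sobolev_tilde_seq[OF s(2) v]) blast
  note wS = sobolev_tilde_sobolev[OF w] and vS = sobolev_tilde_sobolev[OF v]
  note pS = Cc_sobolev[OF p(1) s(2)] and qS = Cc_sobolev[OF q(1) s(2)]
  have "(\<lambda>n. LINT \<xi>|lborel. ?m (\<phi> n) \<xi> * cnj (?m (\<psi> n) \<xi>)) \<longlonglongrightarrow> (LINT \<xi>|lborel. ?m w \<xi> * cnj (?m v \<xi>))"
  proof (rule tendsto_L2_mult)
    show "(\<lambda>n. norm_L2 (\<lambda>x. ?m (\<phi> n) x - ?m w x)) \<longlonglongrightarrow> 0" by (rule fmult_powr_tendsto[OF s(1) pS wS p(2)])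
    show "(\<lambda>n. norm_L2 (\<lambda>x. cnj (?m (\<psi> n) x) - cnj (?m v x))) \<longlonglongrightarrow> 0"
      unfolding norm_L2_cnj_diff by (rule fmult_powr_tendsto[OF s(1) qS vS q(2)])
  qed (intro cnj_L2 fmult_powr_mem s wS vS pS qS)+
  from tendsto_Im[OF this] have im: "Im (LINT \<xi>|lborel. ?m w \<xi> * cnj (?m v \<xi>)) = 0"
    by (simp add: frac_form_Cc_real[OF p(1) q(1)] LIMSEQ_const_iff)
  have "integrable lborel (\<lambda>\<xi>. ?m w \<xi> * cnj (?m v \<xi>))"
    by (intro L2_mult_integrable cnj_L2 fmult_powr_mem s wS vS)
  from Bochner_Integration.integral_Re[OF this]
  have "Re (LINT \<xi>|lborel. ?m w \<xi> * cnj (?m v \<xi>)) = inner_fmult (\<lambda>\<xi>. norm \<xi> powr s) w v"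
    unfolding inner_fmult_def inner_L2_def by (simp add: inner_complex_def)
  then show ?thesis using im by (simp add: complex_eq_iff)
qed

lemma frac_laplacian_test:
  assumes s: "0 \<le> s" "s \<le> 2" and w: "w \<in> L2" and p: "\<phi> \<in> Cc_infty UNIV"
  shows "frac_laplacian s w (\<lambda>x. of_real (\<phi> x))
    = (LINT \<xi>|lborel. fmult (\<lambda>\<xi>. norm \<xi> powr s) w \<xi> * cnj (fmult (\<lambda>\<xi>. norm \<xi> powr s) \<phi> \<xi>))"
proof -
  have [measurable]: "fourier (\<lambda>x. complex_of_real (\<phi> x)) \<in> borel_measurable borel"
    by (intro fourier_measurable schwartz_integrable_L2 Cc_schwartz[OF p])
  have [measurable]: "fourier_L2 w \<in> borel_measurable borel" using w by measurable
  have [measurable]: "fmult (\<lambda>\<xi>. norm \<xi> powr s) \<phi> \<in> borel_measurable borel" "fmult (\<lambda>\<xi>. norm \<xi> powr s) w \<in> borel_measurable borel"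
    by (rule fmult_measurable[OF Cc_L2[OF p] norm_powr_measurable], rule fmult_measurable[OF w norm_powr_measurable])
  have "frac_laplacian s w (\<lambda>x. of_real (\<phi> x))
    = (LINT \<xi>|lborel. of_real (norm \<xi> powr (2 * s)) * fourier_L2 w \<xi> * cnj (fourier (\<lambda>x. of_real (\<phi> x)) \<xi>))"
    by (simp add: frac_laplacian_def inv_fourier_distr_def distr_of_def inv_fourier_real[abs_def])
  also have "\<dots> = (LINT \<xi>|lborel. fmult (\<lambda>\<xi>. norm \<xi> powr s) w \<xi> * cnj (fmult (\<lambda>\<xi>. norm \<xi> powr s) \<phi> \<xi>))"
  proof (intro integral_cong_AE)
    have sq: "norm \<xi> powr (2 * s) = norm \<xi> powr s * norm \<xi> powr s" for \<xi> :: R3 by (simp flip: powr_add)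
    show "AE \<xi> in lborel. of_real (norm \<xi> powr (2 * s)) * fourier_L2 w \<xi> * cnj (fourier (\<lambda>x. of_real (\<phi> x)) \<xi>)
      = fmult (\<lambda>\<xi>. norm \<xi> powr s) w \<xi> * cnj (fmult (\<lambda>\<xi>. norm \<xi> powr s) \<phi> \<xi>)"
      using fourier_L2_Cc[OF p] by eventually_elim (simp add: fmult_def scaleR_conv_of_real sq)
  qed measurable
  finally show ?thesis .
qed

text \<open>For the \<open>THE\<close> in \<open>pairing\<close>, existence comes from continuity of
  the form, uniqueness from the presence of at least one sequence of test functions approximating v.
  The limit is real by \<open>frac_form_real\<close>, and the weight |\<xi>|^(2s) is shared equally
  between the two factors.\<close>

lemma pairing_frac_laplacian:
  assumes s: "0 \<le> s" "s \<le> 2" and w: "w \<in> sobolev_tilde s UNIV" and v: "v \<in> sobolev_tilde s UNIV"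
  shows "pairing s (frac_laplacian s w) v = inner_fmult (\<lambda>\<xi>. norm \<xi> powr s) w v"
proof -
  let ?m = "fmult (\<lambda>\<xi>::R3. norm \<xi> powr s)"
  note wS = sobolev_tilde_sobolev[OF w] and vS = sobolev_tilde_sobolev[OF v]
  have lim: "(\<lambda>n. frac_laplacian s w (\<lambda>x. of_real (\<psi> n x))) \<longlonglongrightarrow> of_real (inner_fmult (\<lambda>\<xi>. norm \<xi> powr s) w v)"
    if q: "\<And>n. \<psi> n \<in> Cc_infty UNIV" "(\<lambda>n::nat. sobolev_norm s (\<lambda>x. \<psi> n x - v x)) \<longlonglongrightarrow> 0" for \<psi>
  proof -
    note qS = Cc_sobolev[OF q(1) s(2)]
    have "(\<lambda>n. LINT \<xi>|lborel. ?m w \<xi> * cnj (?m (\<psi> n) \<xi>)) \<longlonglongrightarrow> (LINT \<xi>|lborel. ?m w \<xi> * cnj (?m v \<xi>))"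
    proof (rule tendsto_L2_mult)
      show "(\<lambda>n. norm_L2 (\<lambda>x. cnj (?m (\<psi> n) x) - cnj (?m v x))) \<longlonglongrightarrow> 0"
        unfolding norm_L2_cnj_diff by (rule fmult_powr_tendsto[OF s(1) qS vS q(2)])
      show "(\<lambda>n. norm_L2 (\<lambda>x. ?m w x - ?m w x)) \<longlonglongrightarrow> 0" by (rule norm_L2_self_diff_tendsto)
    qed (intro cnj_L2 fmult_powr_mem s wS vS qS)+
    then show ?thesis
      unfolding frac_form_real[OF s w v] frac_laplacian_test[OF s sobolev_L2[OF wS] q(1)] .
  qed
  obtain \<psi> where q: "\<And>n. \<psi> n \<in> Cc_infty UNIV" "(\<lambda>n::nat. sobolev_norm s (\<lambda>x. \<psi> n x - v x)) \<longlonglongrightarrow> 0"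
    by (rule sobolev_tilde_seq[OF s(2) v]) blast
  show ?thesis unfolding pairing_def
  proof (rule the_equality)
    fix c assume c: "\<forall>\<phi>. (\<forall>n. \<phi> n \<in> Cc_infty UNIV) \<and> (\<lambda>n. sobolev_norm s (\<lambda>x. \<phi> n x - v x)) \<longlonglongrightarrow> 0
      \<longrightarrow> (\<lambda>n::nat. frac_laplacian s w (\<lambda>x. of_real (\<phi> n x))) \<longlonglongrightarrow> of_real c"
    then have "(\<lambda>n::nat. frac_laplacian s w (\<lambda>x. of_real (\<psi> n x))) \<longlonglongrightarrow> of_real c" using q by blast
    from LIMSEQ_unique[OF this lim[OF q]] show "c = inner_fmult (\<lambda>\<xi>. norm \<xi> powr s) w v" by simp
  qed (use lim in blast)
qed

section \<open>The Lame form: symbol, coercivity and the Dirichlet problem\<close>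

section \<open>The energy form\<close>

text \<open>Korn's identity on the Fourier side: the product of symmetric gradients is the full
  gradient product plus one more divergence product. With the factor m0 / 2 and the term from l0
  this yields the coefficients m0 and l0 + m0, which is where the condition l0 + m0 \<ge> 0
  belongs.\<close>

lemma lame_symbol:
  fixes \<xi> :: R3 and a b :: "3 \<Rightarrow> complex"
  shows "(\<Sum>i\<in>UNIV. \<Sum>j\<in>UNIV. (of_real (\<xi> $ j) * a i + of_real (\<xi> $ i) * a j) \<bullet> (of_real (\<xi> $ j) * b i + of_real (\<xi> $ i) * b j))
    = 2 * (norm \<xi>)\<^sup>2 * (\<Sum>i\<in>UNIV. a i \<bullet> b i)
      + 2 * ((\<Sum>j\<in>UNIV. of_real (\<xi> $ j) * a j) \<bullet> (\<Sum>j\<in>UNIV. of_real (\<xi> $ j) * b j))"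
proof -
  have n: "(norm \<xi>)\<^sup>2 = (\<xi> $ 1)\<^sup>2 + (\<xi> $ 2)\<^sup>2 + (\<xi> $ 3)\<^sup>2"
    unfolding power2_norm_eq_inner by (simp add: inner_vec_def sum_3 power2_eq_square)
  show ?thesis unfolding n sum_3 inner_complex_def
    by (simp add: power2_eq_square algebra_simps)
qed

lemma div_times_i: "(\<i> * z) \<bullet> (\<i> * w) = z \<bullet> w"
  by (simp add: inner_complex_def)

definition weight_form :: "(R3 \<Rightarrow> real) \<Rightarrow> (R3 \<Rightarrow> real) \<Rightarrow> (R3 \<Rightarrow> real) \<Rightarrow> real" where
  "weight_form L f g = (LINT x|lborel. L x * (f x * g x))"

definition weight_ok :: "(R3 \<Rightarrow> real) \<Rightarrow> bool" where
  "weight_ok L \<longleftrightarrow> L \<in> borel_measurable borel \<and> (\<exists>C. \<forall>x. \<bar>L x\<bar> \<le> C)"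

lemma weight_mult_L2:
  assumes L: "weight_ok L" and f: "f \<in> L2" shows "(\<lambda>x. L x * f x) \<in> L2"
proof -
  obtain C where C: "\<And>x. \<bar>L x\<bar> \<le> C" using L by (auto simp: weight_ok_def)
  have [measurable]: "L \<in> borel_measurable borel" "f \<in> borel_measurable borel"
    using L L2_measurable[OF f] by (auto simp: weight_ok_def)
  show ?thesis
    by (rule L2_mono[OF _ f, where C=C]) (auto simp: abs_mult intro!: mult_right_mono C)
qed

lemma weight_integrable:
  assumes L: "weight_ok L" and f: "f \<in> L2" and g: "g \<in> L2"
  shows "integrable lborel (\<lambda>x. L x * (f x * g x))"
  using L2_mult_integrable[OF weight_mult_L2[OF L f] g] by (simp add: mult.assoc)

lemma weight_form_lin:
  assumes L: "weight_ok L" and f: "f \<in> L2" "g \<in> L2" "h \<in> L2"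
  shows "weight_form L (\<lambda>x. f x + c * g x) h = weight_form L f h + c * weight_form L g h"
proof -
  have "(LINT x|lborel. L x * ((f x + c * g x) * h x)) = (LINT x|lborel. L x * (f x * h x) + c * (L x * (g x * h x)))"
    by (intro Bochner_Integration.integral_cong refl) (simp add: algebra_simps)
  then show ?thesis using weight_integrable[OF L f(1,3)] weight_integrable[OF L f(2,3)] by (simp add: weight_form_def)
qed

lemma weight_form_sym: "weight_form L f g = weight_form L g f"
  by (simp add: weight_form_def mult.commute)

lemma weight_form_cong:
  assumes L: "weight_ok L" and f: "f \<in> L2" "f' \<in> L2" "g \<in> L2" "g' \<in> L2"
    and e: "AE x in lborel. f x = f' x" "AE x in lborel. g x = g' x"
  shows "weight_form L f g = weight_form L f' g'"
proof -
  have [measurable]: "L \<in> borel_measurable borel" using L by (simp add: weight_ok_def)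
  have [measurable]: "f \<in> borel_measurable borel" "f' \<in> borel_measurable borel" "g \<in> borel_measurable borel" "g' \<in> borel_measurable borel"
    using L2_measurable f by auto
  have "AE x in lborel. L x * (f x * g x) = L x * (f' x * g' x)" using e by eventually_elim simp
  then show ?thesis unfolding weight_form_def by (intro integral_cong_AE) auto
qed

lemma weight_form_bound:
  assumes L: "weight_ok L" and C: "\<And>x. \<bar>L x\<bar> \<le> C" and f: "f \<in> L2" "g \<in> L2"
  shows "\<bar>weight_form L f g\<bar> \<le> C * (norm_L2 f * norm_L2 g)"
proof -
  have C0: "C \<ge> 0" using C[of 0] by linarith
  have [measurable]: "L \<in> borel_measurable borel" "f \<in> borel_measurable borel"
    using L L2_measurable[OF f(1)] by (auto simp: weight_ok_def)
  have "\<bar>weight_form L f g\<bar> = norm (LINT x|lborel. (L x * f x) * g x)" by (simp add: weight_form_def mult.assoc)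
  also have "\<dots> \<le> norm_L2 (\<lambda>x. L x * f x) * norm_L2 g" by (rule L2_mult_bound[OF weight_mult_L2[OF L f(1)] f(2)])
  also have "norm_L2 (\<lambda>x. L x * f x) \<le> C * norm_L2 f"
    by (rule norm_L2_mono[OF _ f(1)]) (auto simp: abs_mult C0 intro!: mult_right_mono C)
  finally show ?thesis by (simp add: mult_right_mono mult.assoc)
qed

lemma weight_form_nonneg: "(\<And>x. L x \<ge> 0) \<Longrightarrow> weight_form L f f \<ge> 0"
  unfolding weight_form_def by (intro integral_nonneg_AE) auto

lemma weight_ok_C1:
  assumes "bounded \<Omega>" "open \<Omega>" "l \<in> C1_closure \<Omega>"
  shows "weight_ok (\<lambda>x. indicator \<Omega> x * l x)"
proof -
  have c: "continuous_on (closure \<Omega>) l" using assms by (simp add: C1_closure_def)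
  have K: "compact (closure \<Omega>)" using assms by (simp add: compact_closure)
  obtain C where C: "C > 0" "\<And>x. x \<in> closure \<Omega> \<Longrightarrow> \<bar>l x\<bar> \<le> C"
    using compact_imp_bounded[OF compact_continuous_image[OF c K]] by (auto simp: bounded_pos)
  have "\<bar>indicator \<Omega> x * l x\<bar> \<le> C" for x
    using C(1) C(2)[of x] closure_subset[of \<Omega>] by (auto simp: indicator_def)
  moreover have "(\<lambda>x. indicator \<Omega> x *\<^sub>R l x) \<in> borel_measurable borel"
    using assms(2) continuous_on_subset[OF c closure_subset]
    by (intro borel_measurable_continuous_on_indicator) auto
  ultimately show ?thesis by (auto simp: weight_ok_def)
qed

abbreviation energy :: "real \<Rightarrow> (R3 \<Rightarrow> real) \<Rightarrow> (R3 \<Rightarrow> real) \<Rightarrow> real" where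
  "energy s \<equiv> inner_fmult (\<lambda>\<xi>. norm \<xi> powr s)"

lemma energy_semi_inner: "0 \<le> s \<Longrightarrow> semi_inner (sobolev s) (energy s)"
  using fmult_powr_mem(1)[of s] sobolev_L2 by (intro semi_inner_fmult sobolev_lin norm_powr_measurable conjI) auto

lemma energy_lin:
  assumes "0 \<le> s" "f \<in> sobolev s" "g \<in> sobolev s" "h \<in> sobolev s"
  shows "energy s (\<lambda>x. f x + c * g x) h = energy s f h + c * energy s g h"
  using semi_inner.bil[OF energy_semi_inner[OF assms(1)] assms(2-4), of c] by simp

lemma energy_sym: "energy s f g = energy s g f"
  by (simp add: inner_fmult_def inner_L2_def inner_commute)

lemma energy_cong:
  assumes f: "f \<in> L2" "f' \<in> L2" "g \<in> L2" "g' \<in> L2"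
    and e: "AE x in lborel. f x = f' x" "AE x in lborel. g x = g' x"
  shows "energy s f g = energy s f' g'"
  unfolding inner_fmult_def
  using fmult_measurable[OF _ norm_powr_measurable] f fmult_cong[OF f(1,2) e(1)] fmult_cong[OF f(3,4) e(2)]
  by (intro inner_L2_cong_AE) auto

lemma energy_bound:
  assumes "0 \<le> s" "f \<in> sobolev s"
  shows "\<bar>energy s f f\<bar> \<le> (sobolev_norm s f)\<^sup>2"
proof -
  have "energy s f f = (norm_L2 (fmult (\<lambda>\<xi>. norm \<xi> powr s) f))\<^sup>2"
    unfolding norm_L2_eq inner_fmult_def using fmult_powr_mem(1)[OF assms] by (simp add: L2.pos)
  then show ?thesis using power_mono[OF fmult_powr_mem(2)[OF assms], of 2] by simp
qed

locale lame =
  fixes \<Omega> :: "R3 set" and s l0 m0 :: real and l m :: "R3 \<Rightarrow> real"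
  assumes open_\<Omega>: "open \<Omega>" and bounded_\<Omega>: "bounded \<Omega>"
    and s: "0 < s" "s < 1" and m0: "m0 > 0" and lm0: "l0 + m0 \<ge> 0"
    and l: "l \<in> C1_closure \<Omega>" and m: "m \<in> C1_closure \<Omega>"
    and l_nonneg: "x \<in> \<Omega> \<Longrightarrow> l x \<ge> 0" and m_nonneg: "x \<in> \<Omega> \<Longrightarrow> m x \<ge> 0"
begin

text \<open>X, the closure of the test fields in H^(1+s), contains V and all test fields used as
  data. On it the selected weak derivatives and the pairings are under control, so the form is
  bilinear there.\<close>

abbreviation "X \<equiv> sobolev_tilde_vec (1 + s) UNIV"
abbreviation "V \<equiv> sobolev_tilde_vec (1 + s) \<Omega>"
abbreviation "B \<equiv> lame_form \<Omega> s l0 m0 l m"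
abbreviation "wl \<equiv> \<lambda>x. indicator \<Omega> x * l x"
abbreviation "wm \<equiv> \<lambda>x. indicator \<Omega> x * m x"

lemma r_bounds: "1 \<le> 1 + s" "1 + s \<le> 2" "0 \<le> 1 + s" "0 \<le> s" "s \<le> 2"
  using s by auto

lemma wl: "weight_ok wl" and wm: "weight_ok wm"
  using weight_ok_C1[OF bounded_\<Omega> open_\<Omega>] l m by auto

lemma wl_nonneg: "0 \<le> wl x" and wm_nonneg: "0 \<le> wm x"
  using l_nonneg m_nonneg by (auto simp: indicator_def)

lemma X_comp: "u \<in> X \<Longrightarrow> (\<lambda>x. u x $ i) \<in> sobolev_tilde (1 + s) UNIV"
  by (simp add: sobolev_tilde_vec_def)

lemma V_sub_X: "V \<subseteq> X"
  by (auto simp: sobolev_tilde_vec_def intro: sobolev_tilde_UNIV)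

lemma X_lin: "u \<in> X \<Longrightarrow> v \<in> X \<Longrightarrow> (\<lambda>x. u x + c *\<^sub>R v x) \<in> X"
  using sobolev_tilde_lin[OF r_bounds(3,2)] by (auto simp: sobolev_tilde_vec_def)

lemma V_lin: "u \<in> V \<Longrightarrow> v \<in> V \<Longrightarrow> (\<lambda>x. u x + c *\<^sub>R v x) \<in> V"
  using sobolev_tilde_lin[OF r_bounds(3,2)] by (auto simp: sobolev_tilde_vec_def)

lemma wp_tilde: "u \<in> X \<Longrightarrow> weak_partial j (\<lambda>x. u x $ i) \<in> sobolev_tilde s UNIV"
  using weak_partial_tilde[OF r_bounds(1,2) X_comp] by simp

lemma tilde_add: "f \<in> sobolev_tilde s U \<Longrightarrow> g \<in> sobolev_tilde s U \<Longrightarrow> (\<lambda>x. f x + g x) \<in> sobolev_tilde s U"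
  using sobolev_tilde_lin[OF r_bounds(4,5), of f U g 1] by simp

lemma divergence_3: "divergence u = (\<lambda>x. weak_partial 1 (\<lambda>y. u y $ 1) x + weak_partial 2 (\<lambda>y. u y $ 2) x + weak_partial 3 (\<lambda>y. u y $ 3) x)"
  by (simp add: divergence_def sum_3 fun_eq_iff)

lemma sym_grad_2: "sym_grad u i j = (\<lambda>x. weak_partial j (\<lambda>y. u y $ i) x + weak_partial i (\<lambda>y. u y $ j) x)"
  by (simp add: sym_grad_def fun_eq_iff)

lemma div_tilde: "u \<in> X \<Longrightarrow> divergence u \<in> sobolev_tilde s UNIV"
  unfolding divergence_3 by (intro tilde_add wp_tilde)

lemma sg_tilde: "u \<in> X \<Longrightarrow> sym_grad u i j \<in> sobolev_tilde s UNIV"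
  unfolding sym_grad_2 by (intro tilde_add wp_tilde)

lemma wp_lin:
  assumes "u \<in> X" "v \<in> X"
  shows "AE x in lborel. weak_partial j (\<lambda>y. (u y + c *\<^sub>R v y) $ i) x = weak_partial j (\<lambda>y. u y $ i) x + c * weak_partial j (\<lambda>y. v y $ i) x"
  using weak_partial_lin[OF r_bounds(1,2) X_comp[OF assms(1)] X_comp[OF assms(2)]] by simp

lemma div_lin:
  assumes "u \<in> X" "v \<in> X"
  shows "AE x in lborel. divergence (\<lambda>y. u y + c *\<^sub>R v y) x = divergence u x + c * divergence v x"
  using wp_lin[OF assms, of 1 c 1] wp_lin[OF assms, of 2 c 2] wp_lin[OF assms, of 3 c 3]
  unfolding divergence_3 by eventually_elim (simp add: algebra_simps)

lemma sg_lin: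
  assumes "u \<in> X" "v \<in> X"
  shows "AE x in lborel. sym_grad (\<lambda>y. u y + c *\<^sub>R v y) i j x = sym_grad u i j x + c * sym_grad v i j x"
  using wp_lin[OF assms, of j c i] wp_lin[OF assms, of i c j]
  unfolding sym_grad_2 by eventually_elim (simp add: algebra_simps)

lemma div_L2: "u \<in> X \<Longrightarrow> divergence u \<in> L2" and sg_L2: "u \<in> X \<Longrightarrow> sym_grad u i j \<in> L2"
  using sobolev_tilde_L2[OF div_tilde] sobolev_tilde_L2[OF sg_tilde] by auto

lemma B_eq:
  assumes u: "u \<in> X" and v: "v \<in> X"
  shows "B u v = l0 * energy s (divergence u) (divergence v) + weight_form wl (divergence u) (divergence v)
    + 1 / 2 * (\<Sum>i\<in>UNIV. \<Sum>j\<in>UNIV. m0 * energy s (sym_grad u i j) (sym_grad v i j) + weight_form wm (sym_grad u i j) (sym_grad v i j))"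
  unfolding lame_form_def pairing_frac_laplacian[OF r_bounds(4,5) div_tilde[OF u] div_tilde[OF v]]
    pairing_frac_laplacian[OF r_bounds(4,5) sg_tilde[OF u] sg_tilde[OF v]]
  by (simp add: weight_form_def set_lebesgue_integral_def mult.assoc)

lemma energy_comp_lin:
  assumes A: "AE x in lborel. a x = b x + c * d x" and m: "a \<in> L2" "b \<in> sobolev_tilde s UNIV" "d \<in> sobolev_tilde s UNIV" "e \<in> sobolev_tilde s UNIV"
  shows "energy s a e = energy s b e + c * energy s d e"
proof -
  note S = sobolev_tilde_sobolev[OF m(2)] sobolev_tilde_sobolev[OF m(3)] sobolev_tilde_sobolev[OF m(4)]
  have "energy s a e = energy s (\<lambda>x. b x + c * d x) e"
    using sobolev_lin[OF S(1,2), of c] A m S by (intro energy_cong) (auto simp: sobolev_L2)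
  then show ?thesis using energy_lin[OF r_bounds(4) S] by simp
qed

lemma weight_comp_lin:
  assumes A: "AE x in lborel. a x = b x + c * d x" and m: "a \<in> L2" "b \<in> L2" "d \<in> L2" "e \<in> L2" and L: "weight_ok L"
  shows "weight_form L a e = weight_form L b e + c * weight_form L d e"
proof -
  have "weight_form L a e = weight_form L (\<lambda>x. b x + c * d x) e"
    using L2_lin[OF m(2,3), of c] A m by (intro weight_form_cong[OF L]) auto
  then show ?thesis using weight_form_lin[OF L m(2-4)] by simp
qed

lemma B_sym: "u \<in> X \<Longrightarrow> v \<in> X \<Longrightarrow> B u v = B v u"
  by (simp add: B_eq energy_sym[of s "divergence u"] energy_sym[of s "sym_grad u _ _"]
      weight_form_sym[of _ "divergence u"] weight_form_sym[of _ "sym_grad u _ _"])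

lemma B_bil:
  assumes u: "u \<in> X" and v: "v \<in> X" and w: "w \<in> X"
  shows "B (\<lambda>x. u x + c *\<^sub>R v x) w = B u w + c * B v w"
proof -
  note x = X_lin[OF u v, of c]
  note ed = energy_comp_lin[OF div_lin[OF u v, of c] div_L2[OF x] div_tilde[OF u] div_tilde[OF v] div_tilde[OF w]]
  note wd = weight_comp_lin[OF div_lin[OF u v, of c] div_L2[OF x] div_L2[OF u] div_L2[OF v] div_L2[OF w] wl]
  note es = energy_comp_lin[OF sg_lin[OF u v, of c] sg_L2[OF x] sg_tilde[OF u] sg_tilde[OF v] sg_tilde[OF w]]
  note ws = weight_comp_lin[OF sg_lin[OF u v, of c] sg_L2[OF x] sg_L2[OF u] sg_L2[OF v] sg_L2[OF w] wm]
  show ?thesis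
    unfolding B_eq[OF x w] B_eq[OF u w] B_eq[OF v w] ed wd es ws
    by (simp add: sum.distrib sum_distrib_left algebra_simps)
qed

lemma fourier_div:
  assumes u: "u \<in> X"
  shows "AE \<xi> in lborel. fourier_L2 (divergence u) \<xi> = \<i> * (\<Sum>j\<in>UNIV. of_real (\<xi> $ j) * fourier_L2 (\<lambda>x. u x $ j) \<xi>)"
proof -
  note f = fourier_weak_partial[OF r_bounds(1,2) X_comp[OF u]]
  note L = weak_partial_L2[OF r_bounds(1,2) X_comp[OF u]]
  have L12: "(\<lambda>x. weak_partial 1 (\<lambda>y. u y $ 1) x + weak_partial 2 (\<lambda>y. u y $ 2) x) \<in> L2" by (intro L2.add_mem L)
  show ?thesis
    using f[of 1 1] f[of 2 2] f[of 3 3] fourier_L2_lin[OF L[of 1 1] L[of 2 2], of 1] fourier_L2_lin[OF L12 L[of 3 3], of 1]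
    unfolding divergence_3 sum_3 by eventually_elim (simp add: algebra_simps)
qed

lemma fourier_sg:
  assumes u: "u \<in> X"
  shows "AE \<xi> in lborel. fourier_L2 (sym_grad u i j) \<xi> = \<i> * (of_real (\<xi> $ j) * fourier_L2 (\<lambda>x. u x $ i) \<xi> + of_real (\<xi> $ i) * fourier_L2 (\<lambda>x. u x $ j) \<xi>)"
proof -
  note f = fourier_weak_partial[OF r_bounds(1,2) X_comp[OF u]]
  note L = weak_partial_L2[OF r_bounds(1,2) X_comp[OF u]]
  show ?thesis
    using f[of j i] f[of i j] fourier_L2_lin[OF L[of j i] L[of i j], of 1]
    unfolding sym_grad_2 by eventually_elim (simp add: algebra_simps)
qed

text \<open>Integrand of the constant-coefficient form, with matrix |\<xi>|^(2s) (m0 |\<xi>|^2 I +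
  (l0 + m0) \<xi> \<xi>^T). The factors i from the derivatives cancel in the real inner
  product.\<close>

definition symbol_density :: "(R3 \<Rightarrow> R3) \<Rightarrow> (R3 \<Rightarrow> R3) \<Rightarrow> R3 \<Rightarrow> real" where
  "symbol_density u v \<xi> = norm \<xi> powr (2 * s) *
    (m0 * (norm \<xi>)\<^sup>2 * (\<Sum>i\<in>UNIV. fourier_L2 (\<lambda>x. u x $ i) \<xi> \<bullet> fourier_L2 (\<lambda>x. v x $ i) \<xi>)
     + (l0 + m0) * ((\<Sum>j\<in>UNIV. of_real (\<xi> $ j) * fourier_L2 (\<lambda>x. u x $ j) \<xi>) \<bullet> (\<Sum>j\<in>UNIV. of_real (\<xi> $ j) * fourier_L2 (\<lambda>x. v x $ j) \<xi>)))"

text \<open>Divergence and shear terms are integrable separately; \<open>lame_symbol\<close> merges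
  them pointwise into one density. The merged form is what both coercivity and the cofactor
  computation act on.\<close>

lemma principal_part:
  assumes u: "u \<in> X" and v: "v \<in> X"
  shows "integrable lborel (symbol_density u v)"
    and "l0 * energy s (divergence u) (divergence v) + 1 / 2 * (\<Sum>i\<in>UNIV. \<Sum>j\<in>UNIV. m0 * energy s (sym_grad u i j) (sym_grad v i j))
      = (LINT \<xi>|lborel. symbol_density u v \<xi>)"
proof -
  let ?f = "fmult (\<lambda>\<xi>::R3. norm \<xi> powr s)"
  let ?d = "\<lambda>\<xi>. ?f (divergence u) \<xi> \<bullet> ?f (divergence v) \<xi>"
  let ?g = "\<lambda>i j \<xi>. ?f (sym_grad u i j) \<xi> \<bullet> ?f (sym_grad v i j) \<xi>"
  have fm: "?f (divergence w) \<in> L2" "?f (sym_grad w i j) \<in> L2" if "w \<in> X" for w i j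
    using fmult_powr_mem(1)[OF r_bounds(4) sobolev_tilde_sobolev[OF div_tilde[OF that]]]
      fmult_powr_mem(1)[OF r_bounds(4) sobolev_tilde_sobolev[OF sg_tilde[OF that]]] by auto
  have di: "integrable lborel ?d" by (intro L2_inner_integrable fm u v)
  have gi: "integrable lborel (?g i j)" for i j by (intro L2_inner_integrable fm u v)
  let ?S = "\<lambda>\<xi>. l0 * ?d \<xi> + 1 / 2 * (\<Sum>i\<in>UNIV. \<Sum>j\<in>UNIV. m0 * ?g i j \<xi>)"
  have Si: "integrable lborel ?S"
    by (intro Bochner_Integration.integrable_add integrable_mult_right Bochner_Integration.integrable_sum di gi)
  have "AE \<xi> in lborel. \<forall>i\<in>(UNIV::3 set). \<forall>j\<in>(UNIV::3 set).
      ?g i j \<xi> = norm \<xi> powr (2 * s) * ((of_real (\<xi> $ j) * fourier_L2 (\<lambda>x. u x $ i) \<xi> + of_real (\<xi> $ i) * fourier_L2 (\<lambda>x. u x $ j) \<xi>)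
        \<bullet> (of_real (\<xi> $ j) * fourier_L2 (\<lambda>x. v x $ i) \<xi> + of_real (\<xi> $ i) * fourier_L2 (\<lambda>x. v x $ j) \<xi>))"
  proof (intro AE_finite_allI finite)
    fix i j :: 3
    show "AE \<xi> in lborel. ?g i j \<xi> = norm \<xi> powr (2 * s) * ((of_real (\<xi> $ j) * fourier_L2 (\<lambda>x. u x $ i) \<xi> + of_real (\<xi> $ i) * fourier_L2 (\<lambda>x. u x $ j) \<xi>)
        \<bullet> (of_real (\<xi> $ j) * fourier_L2 (\<lambda>x. v x $ i) \<xi> + of_real (\<xi> $ i) * fourier_L2 (\<lambda>x. v x $ j) \<xi>))"
      using fourier_sg[OF u, of i j] fourier_sg[OF v, of i j]
    proof eventually_elim
      case (elim \<xi>)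
      have "norm \<xi> powr (2 * s) = norm \<xi> powr s * norm \<xi> powr s" by (simp flip: powr_add)
      then show ?case unfolding fmult_def elim inner_scaleR_left inner_scaleR_right div_times_i by simp
    qed
  qed
  then have e: "AE \<xi> in lborel. ?S \<xi> = symbol_density u v \<xi>"
    using fourier_div[OF u] fourier_div[OF v]
  proof eventually_elim
    case (elim \<xi>)
    have p: "norm \<xi> powr (2 * s) = norm \<xi> powr s * norm \<xi> powr s" by (simp flip: powr_add)
    let ?a = "\<lambda>i. fourier_L2 (\<lambda>x. u x $ i) \<xi>" and ?b = "\<lambda>i. fourier_L2 (\<lambda>x. v x $ i) \<xi>"
    let ?D = "(\<Sum>j\<in>UNIV. of_real (\<xi> $ j) * ?a j) \<bullet> (\<Sum>j\<in>UNIV. of_real (\<xi> $ j) * ?b j)"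
    let ?G = "\<lambda>i j. (of_real (\<xi> $ j) * ?a i + of_real (\<xi> $ i) * ?a j) \<bullet> (of_real (\<xi> $ j) * ?b i + of_real (\<xi> $ i) * ?b j)"
    have d: "?d \<xi> = norm \<xi> powr (2 * s) * ?D"
      unfolding fmult_def elim(2,3) inner_scaleR_left inner_scaleR_right div_times_i p by simp
    have "?S \<xi> = l0 * (norm \<xi> powr (2 * s) * ?D) + 1 / 2 * (\<Sum>i\<in>UNIV. \<Sum>j\<in>UNIV. m0 * (norm \<xi> powr (2 * s) * ?G i j))"
      unfolding d using elim(1) by simp
    also have "(\<Sum>i\<in>UNIV. \<Sum>j\<in>UNIV. m0 * (norm \<xi> powr (2 * s) * ?G i j)) = m0 * norm \<xi> powr (2 * s) * (\<Sum>i\<in>UNIV. \<Sum>j\<in>UNIV. ?G i j)"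
      by (simp add: sum_distrib_left mult.assoc)
    also have "(\<Sum>i\<in>UNIV. \<Sum>j\<in>UNIV. ?G i j) = 2 * (norm \<xi>)\<^sup>2 * (\<Sum>i\<in>UNIV. ?a i \<bullet> ?b i) + 2 * ?D"
      by (rule lame_symbol)
    finally show ?case by (simp add: symbol_density_def algebra_simps)
  qed
  have m: "symbol_density u v \<in> borel_measurable lborel"
  proof -
    have [measurable]: "fourier_L2 (\<lambda>x. u x $ i) \<in> borel_measurable borel" "fourier_L2 (\<lambda>x. v x $ i) \<in> borel_measurable borel" for i
      using sobolev_tilde_L2[OF X_comp[OF u]] sobolev_tilde_L2[OF X_comp[OF v]] by measurable
    show ?thesis unfolding symbol_density_def[abs_def] by measurable
  qed
  show "integrable lborel (symbol_density u v)" by (rule integrable_cong_AE_imp[OF Si m]) (use e in \<open>auto elim: eventually_mono\<close>)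
  have "(LINT \<xi>|lborel. symbol_density u v \<xi>) = (LINT \<xi>|lborel. ?S \<xi>)"
    by (rule integral_cong_AE[OF m borel_measurable_integrable[OF Si]]) (use e in \<open>auto elim: eventually_mono\<close>)
  also have "\<dots> = l0 * (LINT \<xi>|lborel. ?d \<xi>) + 1 / 2 * (\<Sum>i\<in>UNIV. \<Sum>j\<in>UNIV. m0 * (LINT \<xi>|lborel. ?g i j \<xi>))"
    using di gi by (simp add: Bochner_Integration.integral_sum Bochner_Integration.integrable_sum)
  finally show "l0 * energy s (divergence u) (divergence v) + 1 / 2 * (\<Sum>i\<in>UNIV. \<Sum>j\<in>UNIV. m0 * energy s (sym_grad u i j) (sym_grad v i j))
      = (LINT \<xi>|lborel. symbol_density u v \<xi>)"
    by (simp add: inner_fmult_def inner_L2_def)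
qed

lemma B_principal:
  assumes u: "u \<in> X" and v: "v \<in> X"
  shows "B u v = (LINT \<xi>|lborel. symbol_density u v \<xi>) + weight_form wl (divergence u) (divergence v)
    + 1 / 2 * (\<Sum>i\<in>UNIV. \<Sum>j\<in>UNIV. weight_form wm (sym_grad u i j) (sym_grad v i j))"
  unfolding B_eq[OF u v] principal_part(2)[OF u v, symmetric] by (simp add: sum.distrib algebra_simps)

definition top_norm :: "(R3 \<Rightarrow> real) \<Rightarrow> real" where
  "top_norm f = norm_L2 (fmult (\<lambda>\<xi>. norm \<xi> powr (1 + s)) f)"

text \<open>The squared divergence carries the factor l0 + m0 \<ge> 0 and the coefficients on
  \<Omega> are nonnegative, so both contributions may be dropped. What remains is homogeneous of
  order 1 + s and degenerates at low frequencies, which is the reason for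
  \<open>poincare_L2\<close>.\<close>

lemma B_coercive:
  assumes u: "u \<in> X"
  shows "m0 * (\<Sum>i\<in>UNIV. (top_norm (\<lambda>x. u x $ i))\<^sup>2) \<le> B u u"
proof -
  let ?a = "\<lambda>i. fmult (\<lambda>\<xi>. norm \<xi> powr (1 + s)) (\<lambda>x. u x $ i)"
  have aL: "?a i \<in> L2" for i by (rule fmult_powr_mem(1)[OF r_bounds(3) sobolev_tilde_sobolev[OF X_comp[OF u]]])
  have "m0 * (\<Sum>i\<in>UNIV. (top_norm (\<lambda>x. u x $ i))\<^sup>2) = (LINT \<xi>|lborel. m0 * (\<Sum>i\<in>UNIV. (norm (?a i \<xi>))\<^sup>2))"
    unfolding top_norm_def norm_L2_square using L2_integrable[OF aL]
    by (simp add: Bochner_Integration.integral_sum Bochner_Integration.integrable_sum)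
  also have "\<dots> \<le> (LINT \<xi>|lborel. symbol_density u u \<xi>)"
  proof (rule integral_mono[OF _ principal_part(1)[OF u u]])
    show "integrable lborel (\<lambda>\<xi>. m0 * (\<Sum>i\<in>UNIV. (norm (?a i \<xi>))\<^sup>2))"
      by (intro integrable_mult_right Bochner_Integration.integrable_sum L2_integrable aL)
    fix \<xi> :: R3
    have p: "(norm \<xi> powr (1 + s))\<^sup>2 = norm \<xi> powr (2 * s) * (norm \<xi>)\<^sup>2"
    proof -
      have a: "norm \<xi> powr (1 + s) = norm \<xi> * norm \<xi> powr s" by (simp add: powr_add)
      have b: "norm \<xi> powr (2 * s) = norm \<xi> powr s * norm \<xi> powr s" by (simp flip: powr_add)
      show ?thesis unfolding a b by (simp add: power2_eq_square)
    qed
    have "m0 * (\<Sum>i\<in>UNIV. (norm (?a i \<xi>))\<^sup>2) = norm \<xi> powr (2 * s) * (m0 * (norm \<xi>)\<^sup>2 * (\<Sum>i\<in>UNIV. fourier_L2 (\<lambda>x. u x $ i) \<xi> \<bullet> fourier_L2 (\<lambda>x. u x $ i) \<xi>))"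
      by (simp add: fmult_def power_mult_distrib p power2_norm_eq_inner[symmetric] sum_distrib_left mult_ac)
    also have "\<dots> \<le> symbol_density u u \<xi>"
      unfolding symbol_density_def using lm0 by (intro mult_left_mono) auto
    finally show "m0 * (\<Sum>i\<in>UNIV. (norm (?a i \<xi>))\<^sup>2) \<le> symbol_density u u \<xi>" .
  qed
  also have "\<dots> \<le> B u u"
    unfolding B_principal[OF u u]
    using weight_form_nonneg[of wl "divergence u", OF wl_nonneg]
      sum_nonneg[of UNIV "\<lambda>i. \<Sum>j\<in>UNIV. weight_form wm (sym_grad u i j) (sym_grad u i j)"]
      weight_form_nonneg[of wm, OF wm_nonneg] by (simp add: sum_nonneg)
  finally show ?thesis .
qed

end

section \<open>Solvability in the space of fields supported in the domain\<close>

section \<open>Poincare inequality and existence of weak solutions\<close>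

lemma sobolev_tilde_zero_outside:
  assumes r: "0 \<le> r" "r \<le> 2" and U: "open \<Omega>" and f: "f \<in> sobolev_tilde r \<Omega>"
  shows "AE x in lborel. x \<notin> \<Omega> \<longrightarrow> f x = 0"
proof -
  obtain \<phi> where p: "\<And>n. \<phi> n \<in> Cc_infty \<Omega>" "(\<lambda>n::nat. sobolev_norm r (\<lambda>x. \<phi> n x - f x)) \<longlonglongrightarrow> 0"
    by (rule sobolev_tilde_seq[OF r(2) f]) blast
  note fS = sobolev_tilde_sobolev[OF f]
  note pS = Cc_sobolev[OF p(1) r(2)]
  have fL: "f \<in> L2" by (rule sobolev_L2[OF fS])
  let ?h = "\<lambda>x. indicator (- \<Omega>) x *\<^sub>R f x"
  have [measurable]: "\<Omega> \<in> sets borel" using U by simp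
  have [measurable]: "f \<in> borel_measurable borel" using L2_measurable[OF fL] by simp
  have hm: "?h \<in> borel_measurable lborel" by measurable
  have hL: "?h \<in> L2" by (rule L2_mono[OF hm fL, where C=1]) (auto simp: indicator_def)
  have le: "norm_L2 ?h \<le> sobolev_norm r (\<lambda>x. \<phi> n x - f x)" for n
  proof -
    have z: "\<phi> n x = 0" if "x \<notin> \<Omega>" for x
    proof (rule Cc_not_support[of x "\<phi> n"])
      show "x \<notin> closure {x. \<phi> n x \<noteq> 0}" using that p(1)[of n] by (auto simp: Cc_infty_def)
    qed
    have "norm_L2 ?h \<le> 1 * norm_L2 (\<lambda>x. \<phi> n x - f x)"
      by (rule norm_L2_mono[OF hm sobolev_L2[OF sob.diff_mem[OF pS fS]]]) (auto simp: indicator_def z)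
    also have "\<dots> \<le> sobolev_norm r (\<lambda>x. \<phi> n x - f x)"
      using norm_L2_le_sobolev[OF sob.diff_mem[OF pS fS] r(1)] by simp
    finally show ?thesis .
  qed
  have "norm_L2 ?h \<le> 0" by (rule LIMSEQ_le_const[OF p(2)]) (use le in blast)
  then have "norm_L2 ?h = 0" using norm_L2_nonneg[of ?h] by linarith
  from norm_L2_zero_AE[OF hL this] show ?thesis by eventually_elim (auto simp: indicator_def split: if_splits)
qed

lemma L2_compact_support_integrable:
  fixes f :: "R3 \<Rightarrow> real"
  assumes f: "f \<in> L2" and z: "AE x in lborel. x \<notin> cball 0 R \<longrightarrow> f x = 0"
  shows "integrable lborel f" and "(LINT x|lborel. \<bar>f x\<bar>) \<le> norm_L2 (indicat_real (cball (0::R3) R)) * norm_L2 f"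
proof -
  have [measurable]: "f \<in> borel_measurable borel" using L2_measurable[OF f] by simp
  have e: "AE x in lborel. f x = indicator (cball 0 R) x *\<^sub>R f x" using z by eventually_elim (auto simp: indicator_def)
  show i: "integrable lborel f"
    by (rule integrable_cong_AE_imp[OF integrable_indicator_L2[OF f, of R]]) (use e in \<open>auto elim: eventually_mono\<close>)
  have kL: "indicat_real (cball (0::R3) R) \<in> L2"
  proof -
    have "integrable lborel (\<lambda>x::R3. indicator (cball 0 R) x *\<^sub>R (1::real))" by (intro borel_integrable_compact) auto
    moreover have "(\<lambda>x::R3. (norm (indicat_real (cball 0 R) x))\<^sup>2) = (\<lambda>x. indicator (cball 0 R) x *\<^sub>R 1)"
      by (auto simp: indicator_def)
    ultimately show ?thesis by (simp add: L2_def)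
  qed
  have "(LINT x|lborel. \<bar>f x\<bar>) = (LINT x|lborel. norm (indicat_real (cball 0 R) x) * norm (f x))"
    by (intro integral_cong_AE) (use e in \<open>auto elim!: eventually_mono simp: indicator_def split: if_splits\<close>)
  also have "\<dots> \<le> norm_L2 (indicat_real (cball (0::R3) R)) * norm_L2 f" by (rule L2_cauchy_schwarz[OF kL f])
  finally show "(LINT x|lborel. \<bar>f x\<bar>) \<le> norm_L2 (indicat_real (cball (0::R3) R)) * norm_L2 f" .
qed

context lame begin

text \<open>Frequencies are split at |\<xi>| = \<epsilon>. Below, compact support bounds the
  transform pointwise by A times the L2 norm, and the small ball contributes at most half of the
  squared norm, which is absorbed. Above, the weight |\<xi>|^(1+s) is bounded below.\<close>

lemma poincare_L2:
  "\<exists>C\<ge>0. \<forall>f\<in>sobolev_tilde (1 + s) \<Omega>. (norm_L2 f)\<^sup>2 \<le> C * (top_norm f)\<^sup>2"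
proof -
  obtain R where R: "\<Omega> \<subseteq> cball 0 R" using bounded_\<Omega> by (auto simp: bounded_iff subset_eq)
  define A where "A = fc * norm_L2 (indicat_real (cball (0::R3) R))"
  have A0: "A \<ge> 0" by (simp add: A_def)
  define v where "v = unit_ball_vol (real DIM(R3))"
  have v0: "v \<ge> 0" by (simp add: v_def unit_ball_vol_nonneg)
  \<comment> \<open>The ball of radius \<epsilon> has volume v \<epsilon>^3 \<le> v \<epsilon>, so
    A^2 times that volume is at most 1/2. The summand 1 in the denominator keeps \<epsilon> between
    0 and 1 even if A vanishes.\<close>
  define \<epsilon> where "\<epsilon> = 1 / (2 * A\<^sup>2 * v + 1)"
  have d: "2 * A\<^sup>2 * v + 1 > 0" using v0 by (intro add_nonneg_pos) auto
  have e: "\<epsilon> > 0" "\<epsilon> \<le> 1" unfolding \<epsilon>_def using d v0 by (auto simp: field_simps)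
  define M where "M = measure lborel (cball (0::R3) \<epsilon>)"
  have M: "A\<^sup>2 * M \<le> 1 / 2"
  proof -
    have "M = v * \<epsilon> ^ 3" unfolding M_def v_def using content_cball[of \<epsilon> "0::R3"] e by simp
    also have "\<dots> \<le> v * \<epsilon>" using e v0 power_decreasing[of 1 3 \<epsilon>] by (intro mult_left_mono) auto
    finally have "A\<^sup>2 * M \<le> A\<^sup>2 * (v * \<epsilon>)" by (intro mult_left_mono) auto
    also have "\<dots> = (A\<^sup>2 * v) / (2 * (A\<^sup>2 * v) + 1)" by (simp add: \<epsilon>_def mult.assoc)
    also have "\<dots> \<le> 1 / 2" using d by (simp add: divide_le_eq mult.assoc)
    finally show ?thesis .
  qed
  \<comment> \<open>With this K the product K |\<xi>|^(2 (1 + s)) is at least 1 outside the ball of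
    radius \<epsilon>.\<close>
  define K where "K = \<epsilon> powr (- 2 * (1 + s))"
  have K0: "K \<ge> 0" by (simp add: K_def)
  have "(norm_L2 f)\<^sup>2 \<le> 2 * K * (top_norm f)\<^sup>2" if f: "f \<in> sobolev_tilde (1 + s) \<Omega>" for f
  proof -
    have fL: "f \<in> L2" by (rule sobolev_tilde_L2[OF f])
    have z: "AE x in lborel. x \<notin> cball 0 R \<longrightarrow> f x = 0"
      using sobolev_tilde_zero_outside[OF r_bounds(3,2) open_\<Omega> f] by eventually_elim (use R in auto)
    note I = L2_compact_support_integrable[OF fL z]
    have Ic: "integrable lborel (\<lambda>x. complex_of_real (f x))" using I(1) by simp
    have bd: "norm (fourier (\<lambda>x. of_real (f x)) \<xi>) \<le> A * norm_L2 f" for \<xi>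
    proof -
      have "norm (fourier (\<lambda>x. of_real (f x)) \<xi>) \<le> fc * (LINT x|lborel. \<bar>f x\<bar>)" using fourier_norm_le[OF Ic] by simp
      also have "\<dots> \<le> fc * (norm_L2 (indicat_real (cball (0::R3) R)) * norm_L2 f)" using I(2) by (intro mult_left_mono) auto
      finally show ?thesis by (simp add: A_def mult.assoc)
    qed
    let ?t = "fmult (\<lambda>\<xi>. norm \<xi> powr (1 + s)) f"
    have tL: "?t \<in> L2" by (rule fmult_powr_mem(1)[OF r_bounds(3) sobolev_tilde_sobolev[OF f]])
    let ?w = "\<lambda>\<xi>::R3. indicator (cball 0 \<epsilon>) \<xi> *\<^sub>R (A * norm_L2 f)\<^sup>2 + K * (norm (?t \<xi>))\<^sup>2"
    have wi1: "integrable lborel (\<lambda>\<xi>::R3. indicator (cball 0 \<epsilon>) \<xi> *\<^sub>R (A * norm_L2 f)\<^sup>2)"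
      by (intro borel_integrable_compact) auto
    have wi2: "integrable lborel (\<lambda>\<xi>. K * (norm (?t \<xi>))\<^sup>2)" using L2_integrable[OF tL] by simp
    have "(norm_L2 f)\<^sup>2 = (LINT \<xi>|lborel. (norm (fourier_L2 f \<xi>))\<^sup>2)"
      using norm_fourier_L2[OF fL] norm_L2_square[of "fourier_L2 f"] by simp
    also have "\<dots> \<le> (LINT \<xi>|lborel. ?w \<xi>)"
    proof (rule integral_mono_AE)
      show "AE \<xi> in lborel. (norm (fourier_L2 f \<xi>))\<^sup>2 \<le> ?w \<xi>"
        using fourier_L2_eq_fourier[OF fL I(1)]
      proof eventually_elim
        case (elim \<xi>)
        show ?case
        proof (cases "\<xi> \<in> cball 0 \<epsilon>")
          case True
          have "(norm (fourier_L2 f \<xi>))\<^sup>2 \<le> (A * norm_L2 f)\<^sup>2" unfolding elim by (intro power_mono bd) simp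
          then show ?thesis using True K0 by (simp add: add_increasing2)
        next
          case False
          then have n: "norm \<xi> > \<epsilon>" by simp
          have "1 \<le> K * (norm \<xi> powr (1 + s))\<^sup>2"
          proof -
            have "(norm \<xi> powr (1 + s))\<^sup>2 = norm \<xi> powr (2 * (1 + s))" by (simp add: power2_eq_square flip: powr_add)
            moreover have "\<epsilon> powr (2 * (1 + s)) \<le> norm \<xi> powr (2 * (1 + s))" using n e s by (intro powr_mono2) auto
            moreover have "\<epsilon> powr (- 2 * (1 + s)) * \<epsilon> powr (2 * (1 + s)) = 1" using e by (simp flip: powr_add)
            ultimately show ?thesis unfolding K_def by (metis mult_left_mono powr_ge_zero)
          qed
          from mult_right_mono[OF this, of "(norm (fourier_L2 f \<xi>))\<^sup>2"]
          show ?thesis using False by (simp add: fmult_def power_mult_distrib mult.assoc)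
        qed
      qed
    qed (use wi1 wi2 L2_integrable[OF fourier_L2_mem[OF fL]] in auto)
    also have "\<dots> = M * (A * norm_L2 f)\<^sup>2 + K * (top_norm f)\<^sup>2"
    proof -
      have "(LINT \<xi>|lborel. indicator (cball (0::R3) \<epsilon>) \<xi> *\<^sub>R (A * norm_L2 f)\<^sup>2) = M * (A * norm_L2 f)\<^sup>2"
      proof -
        have "(LINT \<xi>|lborel. indicat_real (cball (0::R3) \<epsilon>) \<xi>) = M" by (simp add: M_def)
        then show ?thesis by (simp only: real_scaleR_def integral_mult_left_zero)
      qed
      then show ?thesis using wi1 wi2 by (simp add: top_norm_def norm_L2_square)
    qed
    also have "M * (A * norm_L2 f)\<^sup>2 = (A\<^sup>2 * M) * (norm_L2 f)\<^sup>2" by (simp add: power_mult_distrib)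
    also have "\<dots> \<le> 1 / 2 * (norm_L2 f)\<^sup>2" using M by (intro mult_right_mono) auto
    finally show ?thesis by simp
  qed
  then show ?thesis using K0 by (intro exI[of _ "2 * K"]) auto
qed

lemma sobolev_norm_le_top:
  assumes f: "f \<in> sobolev (1 + s)"
  shows "(sobolev_norm (1 + s) f)\<^sup>2 \<le> 4 * ((norm_L2 f)\<^sup>2 + (top_norm f)\<^sup>2)"
proof -
  let ?t = "fmult (\<lambda>\<xi>. norm \<xi> powr (1 + s)) f"
  have fL: "f \<in> L2" by (rule sobolev_L2[OF f])
  have tL: "?t \<in> L2" by (rule fmult_powr_mem(1)[OF r_bounds(3) f])
  note i = L2_integrable[OF fourier_L2_mem[OF fL]] L2_integrable[OF tL]
  have "(sobolev_norm (1 + s) f)\<^sup>2 = (LINT \<xi>|lborel. (norm (fmult (bessel (1 + s)) f \<xi>))\<^sup>2)"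
    by (simp add: sobolev_norm_eq norm_L2_square)
  also have "\<dots> \<le> (LINT \<xi>|lborel. 4 * ((norm (fourier_L2 f \<xi>))\<^sup>2 + (norm (?t \<xi>))\<^sup>2))"
  proof (rule integral_mono)
    show "integrable lborel (\<lambda>\<xi>. (norm (fmult (bessel (1 + s)) f \<xi>))\<^sup>2)" using f by (simp add: sobolev_iff L2_integrable)
    fix \<xi> :: R3
    have b: "(bessel (1 + s) \<xi>)\<^sup>2 = (1 + (norm \<xi>)\<^sup>2) powr (1 + s)" by (simp add: power2_eq_square flip: powr_add)
    have n: "(norm \<xi> powr (1 + s))\<^sup>2 = ((norm \<xi>)\<^sup>2) powr (1 + s)"
      by (simp add: power2_eq_square powr_mult)
    \<comment> \<open>The constant 4 is 2^2: with a = |\<xi>|^2 the sum 1 + a is at most twice the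
      larger of 1 and a, and the exponent 1 + s is at most 2.\<close>
    have "(1 + (norm \<xi>)\<^sup>2) powr (1 + s) \<le> 4 * (1 + ((norm \<xi>)\<^sup>2) powr (1 + s))"
    proof (cases "(norm \<xi>)\<^sup>2 \<le> 1")
      case True
      have "(1 + (norm \<xi>)\<^sup>2) powr (1 + s) \<le> 2 powr (1 + s)" using True s by (intro powr_mono2) auto
      also have "\<dots> \<le> 2 powr 2" using s by (intro powr_mono) auto
      finally have "(1 + (norm \<xi>)\<^sup>2) powr (1 + s) \<le> 4" by simp
      also have "4 \<le> 4 * (1 + ((norm \<xi>)\<^sup>2) powr (1 + s))" by simp
      finally show ?thesis .
    next
      case False
      have "(1 + (norm \<xi>)\<^sup>2) powr (1 + s) \<le> (2 * (norm \<xi>)\<^sup>2) powr (1 + s)" using False s by (intro powr_mono2) auto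
      also have "\<dots> = 2 powr (1 + s) * ((norm \<xi>)\<^sup>2) powr (1 + s)" by (simp add: powr_mult)
      also have "2 powr (1 + s) \<le> 2 powr 2" using s by (intro powr_mono) auto
      finally show ?thesis by (simp add: mult_right_mono)
    qed
    from mult_right_mono[OF this, of "(norm (fourier_L2 f \<xi>))\<^sup>2"]
    show "(norm (fmult (bessel (1 + s)) f \<xi>))\<^sup>2 \<le> 4 * ((norm (fourier_L2 f \<xi>))\<^sup>2 + (norm (?t \<xi>))\<^sup>2)"
      unfolding fmult_def norm_scaleR power_mult_distrib power2_abs b n by (simp add: algebra_simps)
  qed (use i in simp)
  also have "\<dots> = 4 * ((norm_L2 f)\<^sup>2 + (top_norm f)\<^sup>2)"
    using i norm_fourier_L2[OF fL] norm_L2_square[of "fourier_L2 f"] by (simp add: top_norm_def norm_L2_square)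
  finally show ?thesis .
qed

lemma V_norm_equiv:
  obtains P where "P > 0" "\<And>f. f \<in> sobolev_tilde (1 + s) \<Omega> \<Longrightarrow> (sobolev_norm (1 + s) f)\<^sup>2 \<le> P * (top_norm f)\<^sup>2"
proof -
  obtain C where C: "C \<ge> 0" "\<And>f. f \<in> sobolev_tilde (1 + s) \<Omega> \<Longrightarrow> (norm_L2 f)\<^sup>2 \<le> C * (top_norm f)\<^sup>2"
    using poincare_L2 by blast
  have "(sobolev_norm (1 + s) f)\<^sup>2 \<le> (4 * (C + 1)) * (top_norm f)\<^sup>2" if "f \<in> sobolev_tilde (1 + s) \<Omega>" for f
    using sobolev_norm_le_top[OF sobolev_tilde_sobolev[OF that]] C(2)[OF that] by (simp add: algebra_simps)
  then show ?thesis using C(1) by (intro that[of "4 * (C + 1)"]) auto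
qed

sublocale BX: semi_inner X B
proof
  show "u \<in> X \<Longrightarrow> v \<in> X \<Longrightarrow> (\<lambda>x. u x + c *\<^sub>R v x) \<in> X" for u v c by (rule X_lin)
  show "u \<in> X \<Longrightarrow> v \<in> X \<Longrightarrow> B u v = B v u" for u v by (rule B_sym)
  show "u \<in> X \<Longrightarrow> v \<in> X \<Longrightarrow> w \<in> X \<Longrightarrow> B (\<lambda>x. u x + c *\<^sub>R v x) w = B u w + c * B v w" for u v w c by (rule B_bil)
  show "0 \<le> B u u" if "u \<in> X" for u
    using B_coercive[OF that] m0 by (meson less_imp_le mult_nonneg_nonneg order_trans sum_nonneg zero_le_power2)
qed

text \<open>It involves s only and none of the coefficients, so it is a common norm in which the
  forms of two different operators can be estimated together.\<close>

definition total_norm :: "(R3 \<Rightarrow> R3) \<Rightarrow> real" where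
  "total_norm u = (\<Sum>i\<in>UNIV. sobolev_norm (1 + s) (\<lambda>x. u x $ i))"

lemma comp_le_total: "sobolev_norm (1 + s) (\<lambda>x. u x $ i) \<le> total_norm u"
  unfolding total_norm_def by (intro member_le_sum) auto

lemma total_norm_nonneg: "0 \<le> total_norm u"
  unfolding total_norm_def by (intro sum_nonneg) auto

lemma sobolev_norm_triangle:
  "f \<in> sobolev s \<Longrightarrow> g \<in> sobolev s \<Longrightarrow> sobolev_norm s (\<lambda>x. f x + g x) \<le> sobolev_norm s f + sobolev_norm s g"
  unfolding sobolev_norm_inner by (rule sob.triangle)

lemma wp_norm_le: "u \<in> X \<Longrightarrow> sobolev_norm s (weak_partial j (\<lambda>x. u x $ i)) \<le> sobolev_norm (1 + s) (\<lambda>x. u x $ i)"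
  using weak_partial_sobolev(2)[OF r_bounds(1,2) X_comp] by simp

lemma div_norm_le:
  assumes u: "u \<in> X" shows "sobolev_norm s (divergence u) \<le> 2 * total_norm u"
proof -
  note S = sobolev_tilde_sobolev[OF wp_tilde[OF u]]
  have S12: "(\<lambda>x. weak_partial 1 (\<lambda>y. u y $ 1) x + weak_partial 2 (\<lambda>y. u y $ 2) x) \<in> sobolev s"
    by (intro sob.add_mem S)
  have "sobolev_norm s (divergence u) \<le> total_norm u"
    unfolding divergence_3 total_norm_def sum_3
    by (intro order_trans[OF sobolev_norm_triangle[OF S12 S]] add_mono order_trans[OF sobolev_norm_triangle[OF S S]] wp_norm_le u)
  then show ?thesis using total_norm_nonneg[of u] by linarith
qed

lemma sg_norm_le:
  assumes u: "u \<in> X" shows "sobolev_norm s (sym_grad u i j) \<le> 2 * total_norm u"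
proof -
  note S = sobolev_tilde_sobolev[OF wp_tilde[OF u]]
  show ?thesis
    using sobolev_norm_triangle[OF S[of j i] S[of i j]] wp_norm_le[OF u, of j i] wp_norm_le[OF u, of i j]
      comp_le_total[of u i] comp_le_total[of u j]
    unfolding sym_grad_2 by linarith
qed

lemma B_bounded:
  obtains K where "K \<ge> 0" "\<And>u. u \<in> X \<Longrightarrow> B u u \<le> K * (total_norm u)\<^sup>2"
proof -
  obtain C1 where C1: "\<And>x. \<bar>wl x\<bar> \<le> C1" using wl unfolding weight_ok_def by auto
  obtain C2 where C2: "\<And>x. \<bar>wm x\<bar> \<le> C2" using wm unfolding weight_ok_def by auto
  have C0: "C1 \<ge> 0" "C2 \<ge> 0" using order_trans[OF abs_ge_zero C1[of 0]] order_trans[OF abs_ge_zero C2[of 0]] by auto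
  \<comment> \<open>The divergence and each entry of the symmetric gradient have norm at most 2
    \<open>total_norm\<close>, whence the factors 4; 9 counts the pairs of indices.\<close>
  define K where "K = \<bar>l0\<bar> * 4 + C1 * 4 + 1 / 2 * (9 * (m0 * 4 + C2 * 4))"
  have "B u u \<le> K * (total_norm u)\<^sup>2" if u: "u \<in> X" for u
  proof -
    let ?N = "(total_norm u)\<^sup>2"
    have sq: "t\<^sup>2 \<le> 4 * ?N" if "0 \<le> t" "t \<le> 2 * total_norm u" for t
      using power_mono[OF that(2,1), of 2] by (simp add: power_mult_distrib)
    have gen: "\<bar>energy s a a\<bar> \<le> 4 * ?N" "norm_L2 a * norm_L2 a \<le> 4 * ?N"
      if a: "a \<in> sobolev s" "sobolev_norm s a \<le> 2 * total_norm u" for a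
    proof -
      show "\<bar>energy s a a\<bar> \<le> 4 * ?N" using energy_bound[OF r_bounds(4) a(1)] sq[OF sobolev_norm_nonneg a(2)] by linarith
      show "norm_L2 a * norm_L2 a \<le> 4 * ?N"
        using sq[OF norm_L2_nonneg order_trans[OF norm_L2_le_sobolev[OF a(1) r_bounds(4)] a(2)]] by (simp add: power2_eq_square)
    qed
    note dS = sobolev_tilde_sobolev[OF div_tilde[OF u]] and gS = sobolev_tilde_sobolev[OF sg_tilde[OF u]]
    note d = gen[OF dS div_norm_le[OF u]] and g = gen[OF gS sg_norm_le[OF u]]
    have 1: "l0 * energy s (divergence u) (divergence u) \<le> \<bar>l0\<bar> * (4 * ?N)"
    proof -
      have "l0 * energy s (divergence u) (divergence u) \<le> \<bar>l0\<bar> * \<bar>energy s (divergence u) (divergence u)\<bar>"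
        by (metis abs_ge_self abs_mult)
      also have "\<dots> \<le> \<bar>l0\<bar> * (4 * ?N)" using d(1) by (intro mult_left_mono) auto
      finally show ?thesis .
    qed
    have 2: "weight_form wl (divergence u) (divergence u) \<le> C1 * (4 * ?N)"
      using weight_form_bound[OF wl C1 div_L2[OF u] div_L2[OF u]] mult_left_mono[OF d(2) C0(1)] by linarith
    have 3: "m0 * energy s (sym_grad u i j) (sym_grad u i j) + weight_form wm (sym_grad u i j) (sym_grad u i j) \<le> (m0 * 4 + C2 * 4) * ?N" for i j
    proof -
      have "m0 * energy s (sym_grad u i j) (sym_grad u i j) \<le> m0 * (4 * ?N)" using g(1)[of i j] m0 by (intro mult_left_mono) auto
      moreover have "weight_form wm (sym_grad u i j) (sym_grad u i j) \<le> C2 * (4 * ?N)"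
        using weight_form_bound[OF wm C2 sg_L2[OF u] sg_L2[OF u], of i j i j] mult_left_mono[OF g(2)[of i j] C0(2)] by linarith
      ultimately show ?thesis by (simp add: algebra_simps)
    qed
    have "(\<Sum>i\<in>UNIV. \<Sum>j\<in>UNIV. m0 * energy s (sym_grad u i j) (sym_grad u i j) + weight_form wm (sym_grad u i j) (sym_grad u i j))
      \<le> (\<Sum>i\<in>(UNIV::3 set). \<Sum>j\<in>(UNIV::3 set). (m0 * 4 + C2 * 4) * ?N)" by (intro sum_mono 3)
    also have "\<dots> = 9 * ((m0 * 4 + C2 * 4) * ?N)" by simp
    finally show ?thesis unfolding B_eq[OF u u] K_def using 1 2 by (simp add: algebra_simps)
  qed
  moreover have "K \<ge> 0" unfolding K_def using C0 m0 by simp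
  ultimately show ?thesis by (rule that[rotated])
qed

lemma sobolev_tilde_Cauchy_limit:
  assumes u: "\<And>n. u n \<in> sobolev_tilde (1 + s) \<Omega>"
    and cau: "\<And>e. e > 0 \<Longrightarrow> \<exists>N. \<forall>m\<ge>N. \<forall>n\<ge>N. (sobolev_norm (1 + s) (\<lambda>x. u m x - u n x))\<^sup>2 < e"
  shows "\<exists>v\<in>sobolev_tilde (1 + s) \<Omega>. (\<lambda>n. sobolev_norm (1 + s) (\<lambda>x. u n x - v x)) \<longlonglongrightarrow> 0"
proof -
  have S: "u n \<in> sobolev (1 + s)" for n by (rule sobolev_tilde_sobolev[OF u])
  have sq: "inner_fmult (bessel (1 + s)) f f = (sobolev_norm (1 + s) f)\<^sup>2" if "f \<in> sobolev (1 + s)" for f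
    using sob.pos[OF that] by (simp add: sobolev_norm_inner)
  have "\<exists>v\<in>sobolev_tilde (1 + s) \<Omega>. (\<lambda>n. inner_fmult (bessel (1 + s)) (\<lambda>x. u n x - v x) (\<lambda>x. u n x - v x)) \<longlonglongrightarrow> 0"
    using sobolev_tilde_complete[OF r_bounds(3,2), of \<Omega>] u cau
    unfolding sob.complete_sub_def by (simp add: sq[OF sob.diff_mem[OF S S]])
  then obtain v where v: "v \<in> sobolev_tilde (1 + s) \<Omega>" "(\<lambda>n. inner_fmult (bessel (1 + s)) (\<lambda>x. u n x - v x) (\<lambda>x. u n x - v x)) \<longlonglongrightarrow> 0" by blast
  from tendsto_real_sqrt[OF v(2)] show ?thesis by (intro bexI[OF _ v(1)]) (simp add: sobolev_norm_inner)
qed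

text \<open>By coercivity and the Poincare inequality a B-Cauchy sequence is Cauchy in H^(1+s) in
  each component. The limits are taken component by component, reassembled, and
  \<open>B_bounded\<close> turns Sobolev convergence back into convergence for B.\<close>

lemma V_complete: "BX.complete_sub V"
  unfolding BX.complete_sub_def
proof (intro conjI allI impI ballI)
  show "V \<subseteq> X" by (rule V_sub_X)
  have "(\<lambda>x. 0) \<in> V" using Cc_sobolev_tilde[OF r_bounds(2) Cc_zero] by (simp add: sobolev_tilde_vec_def)
  then show "V \<noteq> {}" by blast
  show "u \<in> V \<Longrightarrow> v \<in> V \<Longrightarrow> (\<lambda>x. u x + c *\<^sub>R v x) \<in> V" for u v c by (rule V_lin)
  fix w :: "nat \<Rightarrow> R3 \<Rightarrow> R3"
  assume w: "(\<forall>n. w n \<in> V) \<and> (\<forall>e>0. \<exists>N. \<forall>m\<ge>N. \<forall>n\<ge>N. B (\<lambda>x. w m x - w n x) (\<lambda>x. w m x - w n x) < e)"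
  obtain P where P: "P > 0" "\<And>f. f \<in> sobolev_tilde (1 + s) \<Omega> \<Longrightarrow> (sobolev_norm (1 + s) f)\<^sup>2 \<le> P * (top_norm f)\<^sup>2"
    by (rule V_norm_equiv) blast
  have wV: "w n \<in> V" for n using w by blast
  have wc: "(\<lambda>x. w n x $ i) \<in> sobolev_tilde (1 + s) \<Omega>" for n i using wV by (simp add: sobolev_tilde_vec_def)
  have dV: "(\<lambda>x. w m x - w n x) \<in> V" for m n using V_lin[OF wV[of m] wV[of n], of "-1"] by simp
  have key: "(sobolev_norm (1 + s) (\<lambda>x. w m x $ i - w n x $ i))\<^sup>2 \<le> P / m0 * B (\<lambda>x. w m x - w n x) (\<lambda>x. w m x - w n x)" for m n i
  proof -
    let ?d = "\<lambda>x. w m x - w n x"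
    have c: "(\<lambda>x. ?d x $ i) \<in> sobolev_tilde (1 + s) \<Omega>" using dV by (simp add: sobolev_tilde_vec_def)
    have "(top_norm (\<lambda>x. ?d x $ i))\<^sup>2 \<le> (\<Sum>i\<in>UNIV. (top_norm (\<lambda>x. ?d x $ i))\<^sup>2)" by (intro member_le_sum) auto
    also have "\<dots> \<le> B ?d ?d / m0" using B_coercive[of ?d] dV V_sub_X m0 by (simp add: field_simps subset_eq)
    finally have "P * (top_norm (\<lambda>x. ?d x $ i))\<^sup>2 \<le> P * (B ?d ?d / m0)" using P(1) by (intro mult_left_mono) auto
    then show ?thesis using P(2)[OF c] by simp
  qed
  have "\<exists>v\<in>sobolev_tilde (1 + s) \<Omega>. (\<lambda>n. sobolev_norm (1 + s) (\<lambda>x. w n x $ i - v x)) \<longlonglongrightarrow> 0" for i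
  proof (rule sobolev_tilde_Cauchy_limit[OF wc])
    fix e :: real assume "e > 0"
    then have "e * m0 / P > 0" using P m0 by simp
    then obtain N where N: "\<And>m n. m \<ge> N \<Longrightarrow> n \<ge> N \<Longrightarrow> B (\<lambda>x. w m x - w n x) (\<lambda>x. w m x - w n x) < e * m0 / P" using w by blast
    have "(sobolev_norm (1 + s) (\<lambda>x. w m x $ i - w n x $ i))\<^sup>2 < e" if "m \<ge> N" "n \<ge> N" for m n
    proof -
      have "P / m0 * B (\<lambda>x. w m x - w n x) (\<lambda>x. w m x - w n x) < P / m0 * (e * m0 / P)"
        using N[OF that] P m0 by (intro mult_strict_left_mono) auto
      then show ?thesis using key[of m i n] P m0 by simp
    qed
    then show "\<exists>N. \<forall>m\<ge>N. \<forall>n\<ge>N. (sobolev_norm (1 + s) (\<lambda>x. w m x $ i - w n x $ i))\<^sup>2 < e" by blast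
  qed
  then have "\<forall>i. \<exists>v. v \<in> sobolev_tilde (1 + s) \<Omega> \<and> (\<lambda>n. sobolev_norm (1 + s) (\<lambda>x. w n x $ i - v x)) \<longlonglongrightarrow> 0" by blast
  from choice[OF this] obtain v where v: "\<And>i. v i \<in> sobolev_tilde (1 + s) \<Omega>"
    "\<And>i. (\<lambda>n. sobolev_norm (1 + s) (\<lambda>x. w n x $ i - v i x)) \<longlonglongrightarrow> 0" by blast
  define z where "z = (\<lambda>x. \<chi> i. v i x)"
  have zV: "z \<in> V" using v(1) by (simp add: z_def sobolev_tilde_vec_def)
  have "(\<lambda>n. total_norm (\<lambda>x. w n x - z x)) \<longlonglongrightarrow> (\<Sum>i\<in>(UNIV::3 set). 0)"
    unfolding total_norm_def by (intro tendsto_sum) (use v(2) in \<open>simp add: z_def\<close>)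
  then have tn: "(\<lambda>n. total_norm (\<lambda>x. w n x - z x)) \<longlonglongrightarrow> 0" by simp
  obtain K where K: "K \<ge> 0" "\<And>u. u \<in> X \<Longrightarrow> B u u \<le> K * (total_norm u)\<^sup>2" by (rule B_bounded) blast
  have dX: "(\<lambda>x. w n x - z x) \<in> X" for n using wV[of n] zV V_sub_X by (intro BX.diff_mem) auto
  have "(\<lambda>n. B (\<lambda>x. w n x - z x) (\<lambda>x. w n x - z x)) \<longlonglongrightarrow> 0"
  proof (rule tendsto_sandwich[OF _ _ tendsto_const])
    show "(\<lambda>n. K * (total_norm (\<lambda>x. w n x - z x))\<^sup>2) \<longlonglongrightarrow> 0"
      using tendsto_mult_left[OF tendsto_power[OF tn, of 2], of K] by simp
    show "\<forall>\<^sub>F n in sequentially. B (\<lambda>x. w n x - z x) (\<lambda>x. w n x - z x) \<le> K * (total_norm (\<lambda>x. w n x - z x))\<^sup>2"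
      using K(2)[OF dX] by simp
    show "\<forall>\<^sub>F n in sequentially. 0 \<le> B (\<lambda>x. w n x - z x) (\<lambda>x. w n x - z x)" using BX.pos[OF dX] by simp
  qed
  then show "\<exists>v\<in>V. (\<lambda>n. B (\<lambda>x. w n x - v x) (\<lambda>x. w n x - v x)) \<longlonglongrightarrow> 0" using zV by blast
qed

text \<open>Dirichlet principle: g minus its B-orthogonal projection on V is orthogonal to V and
  differs from g by an element of V.\<close>

lemma weak_solution_exists:
  assumes g: "g \<in> X"
  shows "\<exists>u. weak_solution \<Omega> s l0 m0 l m g u"
proof -
  obtain w where w: "w \<in> V" "\<And>v. v \<in> V \<Longrightarrow> B (\<lambda>x. g x - w x) v = 0"
    using BX.projection[OF V_complete g] by blast
  have wX: "w \<in> X" using w V_sub_X by auto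
  have "(\<lambda>x. g x - w x) \<in> X" by (rule BX.diff_mem[OF g wX])
  then have "(\<lambda>x. g x - w x) \<in> sobolev_vec (1 + s)"
    by (auto simp: sobolev_tilde_vec_def sobolev_vec_def intro: sobolev_tilde_sobolev)
  moreover have "(\<lambda>x. (g x - w x) - g x) \<in> V"
    using V_lin[OF V_lin[OF w(1) w(1), of "-1"] w(1), of "-1"] by simp
  ultimately show ?thesis using w(2) unfolding weak_solution_def by (intro exI[of _ "\<lambda>x. g x - w x"]) auto
qed

lemma weak_solution_X:
  assumes g: "g \<in> X" and u: "weak_solution \<Omega> s l0 m0 l m g u"
  shows "u \<in> X" and "(\<lambda>x. u x - g x) \<in> V" and "\<And>v. v \<in> V \<Longrightarrow> B u v = 0"
proof -
  show d: "(\<lambda>x. u x - g x) \<in> V" and "\<And>v. v \<in> V \<Longrightarrow> B u v = 0" using u by (auto simp: weak_solution_def)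
  have "(\<lambda>x. (u x - g x) + g x) \<in> X" using d V_sub_X by (intro BX.add_mem g) auto
  then show "u \<in> X" by simp
qed

end

section \<open>The nonlocal kernel and unique continuation\<close>

section \<open>The fractional Laplacian away from the support\<close>

lemma integrable_has_integral_nonneg:
  fixes f :: "real \<Rightarrow> real"
  assumes m: "f \<in> borel_measurable borel" and S: "S \<in> sets borel" and nn: "\<And>x. 0 \<le> f x" and I: "(f has_integral I) S"
  shows "integrable lborel (\<lambda>x. indicator S x * f x)"
proof (rule integrableI_nonneg)
  note m[measurable] S[measurable]
  have "((\<lambda>x. if x \<in> S then f x else 0) has_integral I) UNIV" using I by (simp add: has_integral_restrict_UNIV)
  also have "(\<lambda>x. if x \<in> S then f x else 0) = (\<lambda>x. indicator S x * f x)" by (auto simp: indicator_def)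
  finally have "(\<integral>\<^sup>+ x. ennreal (indicator S x * f x) \<partial>lborel) = ennreal I"
    using nn by (intro nn_integral_has_integral_lborel) auto
  then show "(\<integral>\<^sup>+ x. ennreal (indicator S x * f x) \<partial>lborel) < \<infinity>" by simp
qed (use m S nn in auto)

text \<open>The fractional power is subordinated to the heat semigroup:
  \<open>|\<xi>|\<^sup>2\<^sup>s = c \<integral> (1 - exp (- t |\<xi>|\<^sup>2)) t\<^sup>-\<^sup>1\<^sup>-\<^sup>s dt\<close> over \<open>t > 0\<close>. Off the support only the heat kernels
  contribute, and their integral is a multiple of \<open>|x|\<^sup>-\<^sup>3\<^sup>-\<^sup>2\<^sup>s\<close>.\<close>

definition jump :: "real \<Rightarrow> real \<Rightarrow> real" where
  "jump s t = indicator {0<..} t * t powr (- 1 - s)"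

lemma jump_measurable [measurable]: "jump s \<in> borel_measurable borel"
  unfolding jump_def by measurable

lemma jump_nonneg: "0 \<le> jump s t"
  by (simp add: jump_def)

text \<open>The measure t^(-1-s) dt is homogeneous of degree -s. This produces both powers needed:
  |\<xi>|^(2s) from the exponential and |z|^(-2s) from the heat kernel.\<close>

lemma jump_scale:
  assumes a: "a > 0" and m: "\<phi> \<in> borel_measurable borel" and i: "integrable lborel (\<lambda>t. jump s t * \<phi> t)"
  shows "integrable lborel (\<lambda>t. jump s t * \<phi> (t / a))"
    and "(LINT t|lborel. jump s t * \<phi> (t / a)) = a powr (- s) * (LINT t|lborel. jump s t * \<phi> t)"
proof -
  let ?H = "\<lambda>t. jump s t * \<phi> (t / a)"
  have e: "?H (0 + a * t) = a powr (- 1 - s) * (jump s t * \<phi> t)" for t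
    using a by (simp add: jump_def powr_mult indicator_def zero_less_mult_iff)
  have "integrable lborel (\<lambda>t. ?H (0 + a * t))" unfolding e using i by simp
  then show "integrable lborel ?H" using lborel_integrable_real_affine_iff[of a ?H 0] a by simp
  have "(LINT t|lborel. ?H t) = a * (LINT t|lborel. ?H (0 + a * t))"
    using lborel_integral_real_affine[of a ?H 0] a by simp
  also have "\<dots> = (a * a powr (- 1 - s)) * (LINT t|lborel. jump s t * \<phi> t)" unfolding e by simp
  also have "a * a powr (- 1 - s) = a powr (- s)" using a by (simp add: powr_mult_base)
  finally show "(LINT t|lborel. ?H t) = a powr (- s) * (LINT t|lborel. jump s t * \<phi> t)" .
qed

text \<open>A common shape of majorant: near 0 a factor t gained from the integrand improves
  t^(-1-s) to t^(-s), integrable since s < 1; at infinity t^(-1-s) is integrable since s >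
  0.\<close>

lemma integrable_power_bounds:
  assumes s: "0 < s" "s < 1"
  shows "integrable lborel (\<lambda>t::real. indicator {0..1} t * t powr (- s) + indicator {1..} t * t powr (- 1 - s))"
proof (rule Bochner_Integration.integrable_add)
  show "integrable lborel (\<lambda>t::real. indicator {0..1} t * t powr (- s))"
    using s by (intro integrable_has_integral_nonneg[OF _ _ _ has_integral_powr_from_0[of "- s" 1]]) auto
  show "integrable lborel (\<lambda>t::real. indicator {1..} t * t powr (- 1 - s))"
    using s by (intro integrable_has_integral_nonneg[OF _ _ _ has_integral_powr_to_inf[of "- 1 - s" 1]]) auto
qed

lemma jump_exp_integrable:
  assumes s: "0 < s" "s < 1"
  shows "integrable lborel (\<lambda>t. jump s t * (1 - exp (- t)))"
proof (rule Bochner_Integration.integrable_bound[OF integrable_power_bounds[OF s]])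
  show "(\<lambda>t. jump s t * (1 - exp (- t))) \<in> borel_measurable lborel" by measurable
  have "norm (jump s t * (1 - exp (- t))) \<le> indicator {0..1} t * t powr (- s) + indicator {1..} t * t powr (- 1 - s)" for t
  proof (cases "t > 0")
    case True
    have e: "0 \<le> 1 - exp (- t)" "1 - exp (- t) \<le> t" "1 - exp (- t) \<le> 1"
      using True exp_ge_add_one_self[of "- t"] by auto
    have n: "norm (jump s t * (1 - exp (- t))) = t powr (- 1 - s) * (1 - exp (- t))"
      using True e(1) by (simp add: jump_def abs_mult)
    show ?thesis
    proof (cases "t \<le> 1")
      case True2: True
      have "t powr (- 1 - s) * (1 - exp (- t)) \<le> t powr (- 1 - s) * t" by (intro mult_left_mono e) simp
      also have "\<dots> = t powr (- s)" using True by (simp add: powr_mult_base mult.commute)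
      also have "\<dots> \<le> indicator {0..1} t * t powr (- s) + indicator {1..} t * t powr (- 1 - s)"
        using True True2 by (simp add: indicator_def)
      finally show ?thesis unfolding n .
    next
      case False
      have "t powr (- 1 - s) * (1 - exp (- t)) \<le> t powr (- 1 - s) * 1" by (intro mult_left_mono e) simp
      then show ?thesis using n False by (simp add: indicator_def)
    qed
  qed (simp add: jump_def)
  then show "AE t in lborel. norm (jump s t * (1 - exp (- t))) \<le> norm (indicator {0..1} t * t powr (- s) + indicator {1..} t * t powr (- 1 - s))"
    unfolding real_norm_def by (intro always_eventually allI order_trans[OF _ abs_ge_self]) auto
qed

lemma jump_positive_integral:
  assumes i: "integrable lborel (\<lambda>t. jump s t * \<phi> t)" and p: "\<And>t. t > 0 \<Longrightarrow> \<phi> t > 0"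
  shows "(LINT t|lborel. jump s t * \<phi> t) > 0"
proof -
  have nn: "0 \<le> jump s t * \<phi> t" for t using p[of t] by (auto simp: jump_def indicator_def)
  have "(LINT t|lborel. jump s t * \<phi> t) \<noteq> 0"
  proof
    assume "(LINT t|lborel. jump s t * \<phi> t) = 0"
    then have "AE t in lborel. jump s t * \<phi> t = 0" using i nn by (subst (asm) integral_nonneg_eq_0_iff_AE) auto
    then have "AE t in lborel. t \<notin> {0<..<1::real}"
    proof eventually_elim
      case (elim t)
      then show ?case using p[of t] by (auto simp: jump_def indicator_def)
    qed
    then have "emeasure lborel {0<..<1::real} = 0"
      by (subst (asm) AE_iff_measurable[of "{0<..<1::real}"]) auto
    then show False by simp
  qed
  moreover have "0 \<le> (LINT t|lborel. jump s t * \<phi> t)" using nn by (intro integral_nonneg_AE) auto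
  ultimately show ?thesis by simp
qed

text \<open>Away from z = 0 the heat kernel is flat at t = 0, which outweighs both its normalisation
  and the singularity of \<open>jump\<close>; for t \<ge> 1 it is bounded by 1.\<close>

lemma jump_heat_integrable:
  fixes z :: R3
  assumes s: "0 < s" "s < 1" and z: "z \<noteq> 0"
  shows "integrable lborel (\<lambda>t. jump s t * heat t z)"
proof -
  \<comment> \<open>\<open>flat_bound\<close> with m = 3 at u = 4 t / |z|^2 gives exp (- 1 / u)
    \<le> 5^5 u^5 = C t^5. For t \<le> 1 the normalisation costs at most t^(-3), by the crude bound
    t \<le> sqrt (4 pi t), so the kernel is at most C t^2.\<close>
  define C where "C = real ((3 + 2) ^ (3 + 2)) * (4 / (norm z)\<^sup>2) ^ 5"
  have zp: "(norm z)\<^sup>2 > 0" using z by simp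
  have C0: "C \<ge> 0" unfolding C_def by simp
  have [measurable]: "(\<lambda>t. heat t z) \<in> borel_measurable borel" unfolding heat_def by measurable
  have wb: "integrable lborel (\<lambda>t::real. C * (indicator {0..1} t * t powr (- s)) + indicator {1..} t * t powr (- 1 - s))"
  proof (rule Bochner_Integration.integrable_add)
    show "integrable lborel (\<lambda>t::real. C * (indicator {0..1} t * t powr (- s)))"
      using s by (intro integrable_mult_right integrable_has_integral_nonneg[OF _ _ _ has_integral_powr_from_0[of "- s" 1]]) auto
    show "integrable lborel (\<lambda>t::real. indicator {1..} t * t powr (- 1 - s))"
      using s by (intro integrable_has_integral_nonneg[OF _ _ _ has_integral_powr_to_inf[of "- 1 - s" 1]]) auto
  qed
  show ?thesis
  proof (rule Bochner_Integration.integrable_bound[OF wb])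
    show "(\<lambda>t. jump s t * heat t z) \<in> borel_measurable lborel" by measurable
    have "norm (jump s t * heat t z) \<le> C * (indicator {0..1} t * t powr (- s)) + indicator {1..} t * t powr (- 1 - s)" for t
    proof (cases "t > 0")
      case True
      have n: "norm (jump s t * heat t z) = t powr (- 1 - s) * heat t z"
        using True heat_nonneg[OF True, of z] by (simp add: jump_def abs_mult)
      show ?thesis
      proof (cases "t \<le> 1")
        case True2: True
        define u where "u = 4 * t / (norm z)\<^sup>2"
        have u: "u > 0" using True zp by (simp add: u_def)
        have "exp (- 1 / u) / u ^ 3 \<le> real ((3 + 2) ^ (3 + 2)) * u\<^sup>2"
          using flat_bound[of 3 u] u by (simp add: flat_def abs_if split: if_splits)
        then have "exp (- 1 / u) \<le> real ((3 + 2) ^ (3 + 2)) * u ^ 5"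
          using u by (simp add: divide_le_eq mult.assoc flip: power_add)
        also have "\<dots> = C * t ^ 5" by (simp add: C_def u_def power_mult_distrib power_divide)
        finally have ex: "exp (- (norm z)\<^sup>2 / (4 * t)) \<le> C * t ^ 5"
          using True zp by (simp add: u_def field_simps)
        have sq: "t \<le> sqrt (4 * pi * t)"
        proof (rule real_le_rsqrt)
          have "t * t \<le> 1 * t" using True True2 by (intro mult_right_mono) auto
          also have "\<dots> \<le> (4 * pi) * t" using True pi_ge_two by (intro mult_right_mono) auto
          finally show "t\<^sup>2 \<le> 4 * pi * t" by (simp add: power2_eq_square)
        qed
        have "heat t z \<le> C * t ^ 5 / t ^ 3"
          unfolding heat_def using ex sq True C0 by (intro frac_le power_mono zero_less_power) auto
        also have "\<dots> = C * t\<^sup>2" using True by (simp add: field_simps flip: power_add)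
        also have "\<dots> \<le> C * t" using True True2 C0 by (intro mult_left_mono) (auto simp: power2_eq_square mult_left_le)
        finally have "t powr (- 1 - s) * heat t z \<le> t powr (- 1 - s) * (C * t)" by (intro mult_left_mono) auto
        also have "\<dots> = C * t powr (- s)" using True by (simp add: powr_mult_base mult.commute mult.left_commute)
        also have "\<dots> \<le> C * (indicator {0..1} t * t powr (- s)) + indicator {1..} t * t powr (- 1 - s)"
          using True True2 by (simp add: indicator_def)
        finally show ?thesis unfolding n .
      next
        case False
        have "1 \<le> sqrt (4 * pi * t)"
        proof -
          have "1 * 1 \<le> (4 * pi) * t" using False pi_ge_two by (intro mult_mono) auto
          then show ?thesis by simp
        qed
        then have "1 \<le> sqrt (4 * pi * t) ^ 3" by (rule one_le_power)
        moreover have "exp (- (norm z)\<^sup>2 / (4 * t)) \<le> 1" using True by (simp add: divide_nonpos_pos)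
        ultimately have "heat t z \<le> 1 / 1" unfolding heat_def by (intro frac_le) auto
        then have "t powr (- 1 - s) * heat t z \<le> t powr (- 1 - s) * 1" by (intro mult_left_mono) auto
        then show ?thesis using n False by (simp add: indicator_def)
      qed
    qed (simp add: jump_def indicator_def)
    then show "AE t in lborel. norm (jump s t * heat t z) \<le> norm (C * (indicator {0..1} t * t powr (- s)) + indicator {1..} t * t powr (- 1 - s))"
      unfolding real_norm_def by (intro always_eventually allI order_trans[OF _ abs_ge_self]) auto
  qed
qed

text \<open>The heat kernel at (t, z) is |z|^(-3) times its value at time t / |z|^2 and unit
  distance, and the change of time contributes |z|^(-2s). The unit vector e only fixes the constant,
  since the kernel depends on the norm alone.\<close>

lemma jump_heat_power:
  fixes z e :: R3
  assumes s: "0 < s" "s < 1" and z: "z \<noteq> 0" and e: "norm e = 1"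
  shows "(LINT t|lborel. jump s t * heat t z) = norm z powr (- 3 - 2 * s) * (LINT t|lborel. jump s t * heat t e)"
proof -
  define a where "a = (norm z)\<^sup>2"
  have a: "a > 0" using z by (simp add: a_def)
  have h: "heat t z = norm z powr (- 3) * heat (t / a) e" if "t > 0" for t
  proof -
    have 1: "sqrt (4 * pi * t) = norm z * sqrt (4 * pi * (t / a))"
      by (simp add: a_def real_sqrt_divide real_sqrt_mult z)
    have 2: "norm z powr (- 3) = 1 / norm z ^ 3" using z by (simp add: powr_minus_divide powr_realpow[of "norm z" 3, simplified])
    have 3: "- (norm z)\<^sup>2 / (4 * t) = - (norm e)\<^sup>2 / (4 * (t / a))" using a that e by (simp add: a_def)
    show ?thesis unfolding heat_def 1 2 3 by (simp add: power_mult_distrib)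
  qed
  have en: "e \<noteq> 0" using e by auto
  have [measurable]: "(\<lambda>t. heat t e) \<in> borel_measurable borel" unfolding heat_def by measurable
  have "(LINT t|lborel. jump s t * heat t z) = (LINT t|lborel. norm z powr (- 3) * (jump s t * heat (t / a) e))"
    by (intro Bochner_Integration.integral_cong refl) (auto simp: jump_def indicator_def h)
  also have "\<dots> = norm z powr (- 3) * (a powr (- s) * (LINT t|lborel. jump s t * heat t e))"
    using jump_scale(2)[OF a _ jump_heat_integrable[OF s en]] by simp
  also have "a powr (- s) = norm z powr (- 2 * s)"
  proof -
    have "a = norm z powr 2" using z by (simp add: a_def powr_numeral)
    then have "a powr (- s) = (norm z powr 2) powr (- s)" by (simp only:)
    then show ?thesis by (simp only: powr_powr) simp
  qed
  also have "norm z powr (- 3) * (norm z powr (- 2 * s) * (LINT t|lborel. jump s t * heat t e))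
    = norm z powr (- 3 - 2 * s) * (LINT t|lborel. jump s t * heat t e)"
    using powr_add[of "norm z" "- 3" "- 2 * s"] by (simp add: mult.assoc)
  finally show ?thesis .
qed

lemma heat_mono_norm: "t > 0 \<Longrightarrow> norm z \<ge> norm e \<Longrightarrow> heat t z \<le> heat t e"
  unfolding heat_def by (intro divide_right_mono) (auto simp: divide_right_mono power_mono)

text \<open>Subordination applied under the integral sign: |\<xi>|^(2s) is written as an integral of
  1 - exp (- t |\<xi>|^2), \<open>gaussian_parseval\<close> converts each exponential into a heat
  kernel between f and G, and the time integral of these kernels is the Riesz kernel. Positive
  separation of the supports justifies both exchanges of integrals and lets the constant term drop
  out.\<close>

lemma frac_laplacian_off_support:
  fixes f G :: "R3 \<Rightarrow> real"
  assumes s: "0 < s" "s < 1" and f: "integrable lborel f" "f \<in> L2" and G: "G \<in> Cc_infty UNIV"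
    and d: "d > 0" and sep: "\<And>x y. f x \<noteq> 0 \<Longrightarrow> G y \<noteq> 0 \<Longrightarrow> d \<le> norm (x - y)"
    and zero: "(LINT \<xi>|lborel. norm \<xi> powr (2 * s) * (fourier_L2 f \<xi> \<bullet> fourier_L2 G \<xi>)) = 0"
  shows "(LINT p|lborel. f (fst p) * G (snd p) * norm (fst p - snd p) powr (- 3 - 2 * s)) = 0"
proof -
  let ?F = "fourier (\<lambda>x. complex_of_real (f x))" and ?G = "fourier (\<lambda>x. complex_of_real (G x))"
  have fi: "integrable lborel (\<lambda>x. complex_of_real (f x))" using f by simp
  have gi: "integrable lborel (\<lambda>x. complex_of_real (G x))" "(\<lambda>x. complex_of_real (G x)) \<in> L2"
    by (rule schwartz_integrable_L2[OF Cc_schwartz[OF G]])+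
  have GI: "integrable lborel G" by (rule Cc_integrable[OF G])
  have [measurable]: "?F \<in> borel_measurable borel" "?G \<in> borel_measurable borel"
    by (intro fourier_measurable fi gi)+
  have [measurable]: "f \<in> borel_measurable borel" "G \<in> borel_measurable borel" using f GI by auto
  have [measurable]: "fourier_L2 f \<in> borel_measurable borel" "fourier_L2 G \<in> borel_measurable borel"
    using f(2) Cc_L2[OF G] by measurable
  define q where "q = (\<lambda>\<xi>. ?F \<xi> \<bullet> ?G \<xi>)"
  have [measurable]: "q \<in> borel_measurable borel" unfolding q_def by measurable
  have FL: "?F \<in> L2" "?G \<in> L2" using fourier_L2_bound(1) fi of_real_L2[OF f(2)] gi by auto
  have qi: "integrable lborel q" unfolding q_def by (rule L2_inner_integrable[OF FL])
  have pq0: "(LINT \<xi>|lborel. norm \<xi> powr (2 * s) * q \<xi>) = 0"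
  proof -
    have "(LINT \<xi>|lborel. norm \<xi> powr (2 * s) * q \<xi>) = (LINT \<xi>|lborel. norm \<xi> powr (2 * s) * (fourier_L2 f \<xi> \<bullet> fourier_L2 G \<xi>))"
    proof (intro integral_cong_AE)
      show "AE \<xi> in lborel. norm \<xi> powr (2 * s) * q \<xi> = norm \<xi> powr (2 * s) * (fourier_L2 f \<xi> \<bullet> fourier_L2 G \<xi>)"
        using fourier_L2_eq_fourier[OF f(2,1)] fourier_L2_Cc[OF G] by eventually_elim (simp add: q_def)
    qed measurable
    then show ?thesis using zero by simp
  qed
  have pqi: "integrable lborel (\<lambda>\<xi>. norm \<xi> powr (2 * s) * q \<xi>)"
  proof -
    have GS: "G \<in> sobolev (2 * s)" by (rule Cc_sobolev[OF G]) (use s in simp)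
    have fm: "fmult (\<lambda>\<xi>. norm \<xi> powr (2 * s)) G \<in> L2" using fmult_powr_mem(1)[OF _ GS] s by simp
    have "integrable lborel (\<lambda>\<xi>. ?F \<xi> \<bullet> fmult (\<lambda>\<xi>. norm \<xi> powr (2 * s)) G \<xi>)" by (rule L2_inner_integrable[OF FL(1) fm])
    then show ?thesis
    proof (rule integrable_cong_AE_imp)
      show "AE \<xi> in lborel. ?F \<xi> \<bullet> fmult (\<lambda>\<xi>. norm \<xi> powr (2 * s)) G \<xi> = norm \<xi> powr (2 * s) * q \<xi>"
        using fourier_L2_Cc[OF G] by eventually_elim (simp add: q_def fmult_def)
    qed measurable
  qed
  have disj: "f x * G x = 0" for x using sep[of x x] d by auto
  \<comment> \<open>By Parseval, since f and G have disjoint supports. This removes the contribution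
    of the constant 1 in 1 - exp (- t |\<xi>|^2).\<close>
  have q0: "(LINT \<xi>|lborel. q \<xi>) = 0"
  proof -
    obtain C where C: "\<And>x. norm (G x) \<le> C" using Cc_bounded[OF G] by metis
    have "(LINT \<xi>|lborel. ?F \<xi> * cnj (?G \<xi>)) = (LINT x|lborel. of_real (f x) * cnj (of_real (G x)))"
      by (rule parseval_continuous[OF fi of_real_L2[OF f(2)] gi, of C])
         (use C in \<open>auto intro!: continuous_intros Cc_continuous[OF G]\<close>)
    also have "\<dots> = 0" by (simp add: disj flip: of_real_mult)
    finally have z: "(LINT \<xi>|lborel. ?F \<xi> * cnj (?G \<xi>)) = 0" .
    have "(LINT \<xi>|lborel. Re (?F \<xi> * cnj (?G \<xi>))) = Re (LINT \<xi>|lborel. ?F \<xi> * cnj (?G \<xi>))"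
      by (intro Bochner_Integration.integral_Re L2_mult_integrable FL cnj_L2)
    then show ?thesis unfolding z q_def inner_complex_def by simp
  qed
  let ?P = "\<lambda>t p. f (fst p) * G (snd p) * heat t (fst p - snd p)"
  have ht: "(LINT \<xi>|lborel. exp (- t * (norm \<xi>)\<^sup>2) * q \<xi>) = (LINT p|lborel. ?P t p)" if t: "t > 0" for t
  proof -
    have i: "integrable lborel (\<lambda>\<xi>. complex_of_real (exp (- t * (norm \<xi>)\<^sup>2)) * (?F \<xi> * cnj (?G \<xi>)))"
    proof (rule Bochner_Integration.integrable_bound[OF L2_mult_integrable[OF FL(1) cnj_L2[OF FL(2)]]])
      show "AE \<xi> in lborel. norm (complex_of_real (exp (- t * (norm \<xi>)\<^sup>2)) * (?F \<xi> * cnj (?G \<xi>))) \<le> norm (?F \<xi> * cnj (?G \<xi>))"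
        using t by (intro always_eventually allI) (auto simp: norm_mult intro!: mult_left_le_one_le)
    qed measurable
    have "(LINT \<xi>|lborel. Re (complex_of_real (exp (- t * (norm \<xi>)\<^sup>2)) * (?F \<xi> * cnj (?G \<xi>))))
      = Re (LINT \<xi>|lborel. complex_of_real (exp (- t * (norm \<xi>)\<^sup>2)) * (?F \<xi> * cnj (?G \<xi>)))"
      by (rule Bochner_Integration.integral_Re[OF i])
    also have "(LINT \<xi>|lborel. complex_of_real (exp (- t * (norm \<xi>)\<^sup>2)) * (?F \<xi> * cnj (?G \<xi>)))
      = (LINT p|lborel. complex_of_real (?P t p))"
      unfolding gaussian_parseval[OF fi gi(1) t] by (intro Bochner_Integration.integral_cong refl) simp
    also have "\<dots> = complex_of_real (LINT p|lborel. ?P t p)" by (rule integral_complex_of_real)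
    finally show ?thesis by (simp add: q_def inner_complex_def)
  qed
  define c where "c = (LINT t|lborel. jump s t * (1 - exp (- t)))"
  have c1: "integrable lborel (\<lambda>t. jump s t * (1 - exp (- (t * a))))"
    "(LINT t|lborel. jump s t * (1 - exp (- (t * a)))) = c * a powr s" if a: "a \<ge> 0" for a
  proof -
    have "integrable lborel (\<lambda>t. jump s t * (1 - exp (- (t * a)))) \<and> (LINT t|lborel. jump s t * (1 - exp (- (t * a)))) = c * a powr s"
    proof (cases "a = 0")
      case False
      then have a': "inverse a > 0" using a by simp
      have m: "(\<lambda>t::real. 1 - exp (- t)) \<in> borel_measurable borel" by measurable
      have ip: "inverse a powr (- s) = a powr s" using a False by (simp add: powr_minus inverse_powr)
      show ?thesis using jump_scale[OF a' m jump_exp_integrable[OF s]] by (simp add: c_def ip divide_inverse)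
    qed simp
    then show "integrable lborel (\<lambda>t. jump s t * (1 - exp (- (t * a))))"
      "(LINT t|lborel. jump s t * (1 - exp (- (t * a)))) = c * a powr s" by auto
  qed
  \<comment> \<open>Integration in t gives c |\<xi>|^(2s) q, integration in \<xi> gives minus
    \<open>jump\<close> times the heat form. Absolute integrability rests on that of |\<xi>|^(2s) q,
    which holds because G is a test function.\<close>
  define N where "N = (\<lambda>r. jump s (snd r) * (1 - exp (- (snd r * (norm (fst r))\<^sup>2))) * q (fst r))"
  have nsq: "((norm \<xi>)\<^sup>2) powr s = norm \<xi> powr (2 * s)" for \<xi> :: R3
  proof (cases "\<xi> = 0")
    case False
    then have "((norm \<xi>)\<^sup>2) powr s = (norm \<xi> powr 2) powr s" by (simp add: powr_numeral del: powr_powr)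
    then show ?thesis by (simp only: powr_powr)
  qed simp
  have enn: "0 \<le> jump s t * (1 - exp (- (t * (norm \<xi>)\<^sup>2)))" for t and \<xi> :: R3
    by (auto simp: jump_def indicator_def)
  have Ni: "integrable lborel N"
  proof (rule lborel_Fubini_integrable)
    show "N \<in> borel_measurable lborel" unfolding N_def lborel_prod[symmetric] by measurable
    have "(LINT t|lborel. norm (N (\<xi>, t))) = c * (norm \<xi> powr (2 * s) * \<bar>q \<xi>\<bar>)" for \<xi>
    proof -
      have "(LINT t|lborel. norm (N (\<xi>, t))) = (LINT t|lborel. jump s t * (1 - exp (- (t * (norm \<xi>)\<^sup>2))) * \<bar>q \<xi>\<bar>)"
      proof (intro Bochner_Integration.integral_cong refl)
        fix t
        have "norm (N (\<xi>, t)) = \<bar>jump s t * (1 - exp (- (t * (norm \<xi>)\<^sup>2)))\<bar> * \<bar>q \<xi>\<bar>"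
          by (simp only: N_def fst_conv snd_conv real_norm_def abs_mult)
        also have "\<bar>jump s t * (1 - exp (- (t * (norm \<xi>)\<^sup>2)))\<bar> = jump s t * (1 - exp (- (t * (norm \<xi>)\<^sup>2)))"
          by (rule abs_of_nonneg[OF enn])
        finally show "norm (N (\<xi>, t)) = jump s t * (1 - exp (- (t * (norm \<xi>)\<^sup>2))) * \<bar>q \<xi>\<bar>" .
      qed
      then show ?thesis using c1(2)[of "(norm \<xi>)\<^sup>2"] by (simp add: nsq)
    qed
    moreover have "integrable lborel (\<lambda>\<xi>. c * (norm \<xi> powr (2 * s) * \<bar>q \<xi>\<bar>))"
      using integrable_abs[OF pqi] by (intro integrable_mult_right) (simp add: abs_mult)
    ultimately show "integrable lborel (\<lambda>\<xi>. LINT t|lborel. norm (N (\<xi>, t)))" by simp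
    show "AE \<xi> in lborel. integrable lborel (\<lambda>t. N (\<xi>, t))"
      using c1(1)[of "(norm \<xi>)\<^sup>2" for \<xi> :: R3] by (auto simp: N_def)
  qed
  have "0 = (LINT \<xi>|lborel. LINT t|lborel. N (\<xi>, t))"
  proof -
    have "(LINT t|lborel. N (\<xi>, t)) = c * (norm \<xi> powr (2 * s) * q \<xi>)" for \<xi>
      unfolding N_def using c1(2)[of "(norm \<xi>)\<^sup>2"] by (simp add: nsq)
    then show ?thesis using pq0 by simp
  qed
  also have "\<dots> = (LINT t|lborel. LINT \<xi>|lborel. N (\<xi>, t))"
    unfolding lborel_integral_fst[OF Ni] lborel_integral_snd[OF Ni] ..
  also have "\<dots> = (LINT t|lborel. - (jump s t * (LINT p|lborel. ?P t p)))"
  proof (intro Bochner_Integration.integral_cong refl)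
    fix t :: real
    show "(LINT \<xi>|lborel. N (\<xi>, t)) = - (jump s t * (LINT p|lborel. ?P t p))"
    proof (cases "t > 0")
      case True
      have ei: "integrable lborel (\<lambda>\<xi>. exp (- t * (norm \<xi>)\<^sup>2) * q \<xi>)"
      proof (rule Bochner_Integration.integrable_bound[OF qi])
        show "AE \<xi> in lborel. norm (exp (- t * (norm \<xi>)\<^sup>2) * q \<xi>) \<le> norm (q \<xi>)"
          using True by (intro always_eventually allI) (auto simp: abs_mult intro!: mult_left_le_one_le)
      qed measurable
      have "(LINT \<xi>|lborel. N (\<xi>, t)) = (LINT \<xi>|lborel. jump s t * (q \<xi> - exp (- t * (norm \<xi>)\<^sup>2) * q \<xi>))"
        by (intro Bochner_Integration.integral_cong refl) (simp add: N_def algebra_simps)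
      also have "\<dots> = jump s t * ((LINT \<xi>|lborel. q \<xi>) - (LINT \<xi>|lborel. exp (- t * (norm \<xi>)\<^sup>2) * q \<xi>))"
        using qi ei by simp
      finally show ?thesis unfolding q0 ht[OF True] by simp
    qed (simp add: N_def jump_def)
  qed
  finally have J: "(LINT t|lborel. jump s t * (LINT p|lborel. ?P t p)) = 0" by simp
  obtain e :: R3 where e: "norm e = 1" using vector_choose_size[of 1] by auto
  have en: "e \<noteq> 0" using e by auto
  have den: "d *\<^sub>R e \<noteq> 0" using d en by simp
  \<comment> \<open>A second exchange, between t and the pair (x, y). Where f and G are both
    nonzero, |x - y| is at least d, so the kernel is dominated by its value at the fixed vector d e,
    which is integrable against \<open>jump\<close>.\<close>
  define M where "M = (\<lambda>r. ?P (snd r) (fst r) * jump s (snd r))"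
  have fg: "integrable lborel (\<lambda>p. f (fst p) * G (snd p))" by (rule integrable_tensor[OF f(1) GI])
  have [measurable]: "(\<lambda>(t, z). heat t z) \<in> borel_measurable (borel \<Otimes>\<^sub>M borel)" unfolding heat_def by measurable
  have sepz: "norm (d *\<^sub>R e) \<le> norm (fst p - snd p)" if "f (fst p) * G (snd p) \<noteq> 0" for p
    using sep[of "fst p" "snd p"] that e d by auto
  have Mi: "integrable lborel M"
  proof (rule Bochner_Integration.integrable_bound[OF integrable_tensor[OF fg jump_heat_integrable[OF s den]]])
    show "M \<in> borel_measurable lborel" unfolding M_def lborel_prod[symmetric] heat_def by measurable
    show "AE r in lborel. norm (M r) \<le> norm ((f (fst (fst r)) * G (snd (fst r))) * (jump s (snd r) * heat (snd r) (d *\<^sub>R e)))"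
    proof (intro always_eventually allI)
      fix r :: "(R3 \<times> R3) \<times> real"
      show "norm (M r) \<le> norm ((f (fst (fst r)) * G (snd (fst r))) * (jump s (snd r) * heat (snd r) (d *\<^sub>R e)))"
      proof (cases "snd r > 0 \<and> f (fst (fst r)) * G (snd (fst r)) \<noteq> 0")
        case True
        then have t: "snd r > 0" by simp
        have "heat (snd r) (fst (fst r) - snd (fst r)) \<le> heat (snd r) (d *\<^sub>R e)"
          using True sepz[of "fst r"] by (intro heat_mono_norm) auto
        then have "\<bar>heat (snd r) (fst (fst r) - snd (fst r))\<bar> \<le> \<bar>heat (snd r) (d *\<^sub>R e)\<bar>"
          using heat_nonneg[OF t, of "fst (fst r) - snd (fst r)"] by linarith
        then have "(\<bar>f (fst (fst r)) * G (snd (fst r))\<bar> * jump s (snd r)) * \<bar>heat (snd r) (fst (fst r) - snd (fst r))\<bar>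
          \<le> (\<bar>f (fst (fst r)) * G (snd (fst r))\<bar> * jump s (snd r)) * \<bar>heat (snd r) (d *\<^sub>R e)\<bar>"
          by (intro mult_left_mono mult_nonneg_nonneg jump_nonneg) auto
        then show ?thesis using jump_nonneg[of s "snd r"] by (simp add: M_def abs_mult mult_ac)
      next
        case False
        then have "M r = 0" by (auto simp: M_def jump_def indicator_def)
        then show ?thesis by simp
      qed
    qed
  qed
  define \<kappa> where "\<kappa> = (LINT t|lborel. jump s t * heat t e)"
  have \<kappa>: "\<kappa> > 0" unfolding \<kappa>_def
    by (rule jump_positive_integral[OF jump_heat_integrable[OF s en]]) (simp add: heat_def)
  have "0 = (LINT t|lborel. LINT p|lborel. M (p, t))" using J by (simp add: M_def mult.commute)
  also have "\<dots> = (LINT p|lborel. LINT t|lborel. M (p, t))"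
    unfolding lborel_integral_fst[OF Mi] lborel_integral_snd[OF Mi] ..
  also have "\<dots> = (LINT p|lborel. \<kappa> * (f (fst p) * G (snd p) * norm (fst p - snd p) powr (- 3 - 2 * s)))"
  proof (intro Bochner_Integration.integral_cong refl)
    fix p :: "R3 \<times> R3"
    show "(LINT t|lborel. M (p, t)) = \<kappa> * (f (fst p) * G (snd p) * norm (fst p - snd p) powr (- 3 - 2 * s))"
    proof (cases "f (fst p) * G (snd p) = 0")
      case False
      then have z: "fst p - snd p \<noteq> 0" using sepz[OF False] e d by auto
      have "(LINT t|lborel. M (p, t)) = (LINT t|lborel. (f (fst p) * G (snd p)) * (jump s t * heat t (fst p - snd p)))"
        by (intro Bochner_Integration.integral_cong refl) (simp add: M_def mult_ac)
      also have "\<dots> = (f (fst p) * G (snd p)) * (norm (fst p - snd p) powr (- 3 - 2 * s) * \<kappa>)"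
        unfolding \<kappa>_def jump_heat_power[OF s z e, symmetric] by simp
      finally show ?thesis by (simp add: mult_ac)
    next
      case True
      have "(LINT t|lborel. M (p, t)) = 0" unfolding M_def using True by auto
      then show ?thesis using True by simp
    qed
  qed
  finally show ?thesis using \<kappa> by simp
qed

section \<open>Unique continuation\<close>

definition mon :: "(3 \<Rightarrow> nat) \<Rightarrow> R3 \<Rightarrow> real" where
  "mon n z = (z $ 1) ^ n 1 * (z $ 2) ^ n 2 * (z $ 3) ^ n 3"

text \<open>The span of these kernels contains the powers of the norm and is closed under
  differentiation away from 0: a derivative shifts one exponent of the monomial and may raise
  \<beta> by 2.\<close>

definition riesz :: "(3 \<Rightarrow> nat) \<Rightarrow> real \<Rightarrow> R3 \<Rightarrow> real" where
  "riesz n \<beta> z = mon n z * norm z powr (- \<beta>)"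

lemma mon_zero [simp]: "mon (\<lambda>_. 0) z = 1"
  by (simp add: mon_def)

lemma mon_Suc: "mon (n(j := Suc (n j))) z = mon n z * z $ j"
  using exhaust_3[of j] by (auto simp: mon_def)

lemma mon_has_derivative:
  "(mon n has_derivative (\<lambda>h. \<Sum>j\<in>UNIV. real (n j) * mon (n(j := n j - 1)) z * h $ j)) (at z)"
proof -
  have c: "((\<lambda>z::R3. z $ i) has_derivative (\<lambda>h. h $ i)) (at z)" for i
    by (rule bounded_linear_imp_has_derivative[OF bounded_linear_nth])
  have p: "((\<lambda>z::R3. (z $ i) ^ k) has_derivative (\<lambda>h. real k * (z $ i) ^ (k - 1) * h $ i)) (at z)" for i k
    using has_derivative_power[OF c[of i], of k] by (simp add: mult_ac)
  have d: "((\<lambda>z. (z $ 1) ^ n 1 * (z $ 2) ^ n 2 * (z $ 3) ^ n 3) has_derivative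
    (\<lambda>h. ((z $ 1) ^ n 1 * (z $ 2) ^ n 2) * (real (n 3) * (z $ 3) ^ (n 3 - 1) * h $ 3)
      + ((z $ 1) ^ n 1 * (real (n 2) * (z $ 2) ^ (n 2 - 1) * h $ 2) + (real (n 1) * (z $ 1) ^ (n 1 - 1) * h $ 1) * (z $ 2) ^ n 2) * (z $ 3) ^ n 3)) (at z)"
    by (intro has_derivative_mult p)
  show ?thesis
    unfolding mon_def[abs_def] by (rule has_derivative_eq_rhs[OF d]) (simp add: sum_3 fun_eq_iff algebra_simps)
qed

lemma norm_powr_has_derivative:
  fixes z :: R3
  assumes z: "z \<noteq> 0"
  shows "((\<lambda>z. norm z powr (- \<beta>)) has_derivative (\<lambda>h. - \<beta> * norm z powr (- (\<beta> + 2)) * (z \<bullet> h))) (at z)"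
proof -
  have n: "(norm has_derivative (\<lambda>h. h \<bullet> sgn z)) (at z)" using has_derivative_norm[OF z] .
  have "((\<lambda>t. t powr (- \<beta>)) has_real_derivative (- \<beta> * norm z powr (- \<beta> - 1))) (at (norm z))"
    using has_real_derivative_powr[of "norm z" "- \<beta>"] z by simp
  then have "((\<lambda>t. t powr (- \<beta>)) has_derivative (\<lambda>h. - \<beta> * norm z powr (- \<beta> - 1) * h)) (at (norm z))"
    unfolding has_field_derivative_def by (rule has_derivative_eq_rhs) auto
  from has_derivative_compose[OF n this]
  have "((\<lambda>z. norm z powr (- \<beta>)) has_derivative (\<lambda>h. - \<beta> * norm z powr (- \<beta> - 1) * (h \<bullet> sgn z))) (at z)" .
  moreover have "- \<beta> * norm z powr (- \<beta> - 1) * (h \<bullet> sgn z) = - \<beta> * norm z powr (- (\<beta> + 2)) * (z \<bullet> h)" for h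
  proof -
    have "norm z powr (- \<beta> - 1) = norm z powr (1 + - (\<beta> + 2))"
      by (rule arg_cong[of _ _ "\<lambda>t. norm z powr t"]) simp
    then have "norm z powr (- \<beta> - 1) = norm z powr (- (\<beta> + 2)) * norm z"
      using powr_mult_base[of "norm z" "- (\<beta> + 2)"] by (simp only: norm_ge_zero mult.commute)
    then show ?thesis using z by (simp add: sgn_div_norm inner_commute)
  qed
  ultimately show ?thesis by (simp only:)
qed

lemma riesz_has_derivative:
  assumes z: "z \<noteq> 0"
  shows "(riesz n \<beta> has_derivative (\<lambda>h. mon n z * (- \<beta> * norm z powr (- (\<beta> + 2)) * (z \<bullet> h))
    + (\<Sum>j\<in>UNIV. real (n j) * mon (n(j := n j - 1)) z * h $ j) * norm z powr (- \<beta>))) (at z)"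
  unfolding riesz_def[abs_def] by (rule has_derivative_mult[OF mon_has_derivative norm_powr_has_derivative[OF z]])

lemma partial_riesz:
  assumes z: "z \<noteq> 0"
  shows "partial j (riesz n \<beta>) z = real (n j) * riesz (n(j := n j - 1)) \<beta> z - \<beta> * riesz (n(j := Suc (n j))) (\<beta> + 2) z"
proof -
  have "(\<Sum>i\<in>UNIV. real (n i) * mon (n(i := n i - 1)) z * axis j 1 $ i) = real (n j) * mon (n(j := n j - 1)) z"
    by (simp add: axis_def if_distrib[of "\<lambda>t. _ * t"] cong: if_cong)
  then show ?thesis
    unfolding partial_eq[OF riesz_has_derivative[OF z]] by (simp add: riesz_def mon_Suc inner_axis algebra_simps)
qed

lemma mon_continuous: "continuous_on S (mon n)"
  unfolding mon_def[abs_def] by (intro continuous_intros)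

lemma riesz_continuous: "continuous_on (- {0}) (riesz n \<beta>)"
  unfolding riesz_def[abs_def] by (intro continuous_intros mon_continuous) auto

lemma riesz_measurable [measurable]: "riesz n \<beta> \<in> borel_measurable borel"
proof -
  have [measurable]: "mon n \<in> borel_measurable borel" by (intro borel_measurable_continuous_onI mon_continuous)
  show ?thesis unfolding riesz_def[abs_def] by measurable
qed

definition laplacian :: "(R3 \<Rightarrow> real) \<Rightarrow> R3 \<Rightarrow> real" where
  "laplacian \<psi> x = (\<Sum>j\<in>UNIV. partial j (partial j \<psi>) x)"

lemma Cc_laplacian: "\<psi> \<in> Cc_infty U \<Longrightarrow> laplacian \<psi> \<in> Cc_infty U"
  unfolding laplacian_def[abs_def] by (intro Cc_sum Cc_partial)

text \<open>Vanishing off \<Omega> is required at every point, not almost everywhere, so that f x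
  and \<psi> y can both be nonzero only when x \<noteq> y and the singularity of the kernel is never
  met.\<close>

locale supported =
  fixes f :: "R3 \<Rightarrow> real" and \<Omega> W :: "R3 set"
  assumes fi: "integrable lborel f" and fz: "x \<notin> \<Omega> \<Longrightarrow> f x = 0"
    and bounded_\<Omega>: "bounded \<Omega>" and open_W: "open W" and W: "W \<subseteq> - closure \<Omega>"
begin

definition kform :: "(R3 \<Rightarrow> real) \<Rightarrow> (R3 \<Rightarrow> real) \<Rightarrow> real" where
  "kform \<psi> k = (LINT p|lborel. f (fst p) * \<psi> (snd p) * k (fst p - snd p))"

text \<open>Differences between the closure of \<Omega> and the support of \<psi> form a compact set
  that avoids 0, and the kernel is bounded there.\<close>

lemma kform_integrable:
  assumes \<psi>: "\<psi> \<in> Cc_infty W" and k: "continuous_on (- {0}) k" "k \<in> borel_measurable borel"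
  shows "integrable lborel (\<lambda>p. f (fst p) * \<psi> (snd p) * k (fst p - snd p))"
proof -
  have [measurable]: "f \<in> borel_measurable borel" "\<psi> \<in> borel_measurable borel" "k \<in> borel_measurable borel"
    using fi k Cc_integrable[OF \<psi>] by auto
  let ?K1 = "closure \<Omega>" and ?K2 = "closure {x. \<psi> x \<noteq> 0}"
  have K: "compact ?K1" "compact ?K2" "?K2 \<subseteq> W" using bounded_\<Omega> \<psi> by (auto simp: compact_closure Cc_infty_def)
  let ?D = "(\<lambda>p. fst p - snd p) ` (?K1 \<times> ?K2)"
  have D: "compact ?D" by (intro compact_continuous_image compact_Times K continuous_intros)
  have D0: "?D \<subseteq> - {0}" using K(3) W by auto
  have "bounded (k ` ?D)"
    by (rule compact_imp_bounded[OF compact_continuous_image[OF continuous_on_subset[OF k(1) D0] D]])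
  then obtain M where M0: "M > 0" "\<forall>x\<in>k ` ?D. norm x \<le> M" unfolding bounded_pos by blast
  have M: "M > 0" "\<And>z. z \<in> ?D \<Longrightarrow> \<bar>k z\<bar> \<le> M"
    using M0(1) bspec[OF M0(2) imageI] unfolding real_norm_def by blast+
  show ?thesis
  proof (rule Bochner_Integration.integrable_bound)
    show "integrable lborel (\<lambda>p. M * (f (fst p) * \<psi> (snd p)))"
      using integrable_tensor[OF fi Cc_integrable[OF \<psi>]] by simp
    show "(\<lambda>p. f (fst p) * \<psi> (snd p) * k (fst p - snd p)) \<in> borel_measurable lborel"
      unfolding lborel_prod[symmetric] by measurable
    show "AE p in lborel. norm (f (fst p) * \<psi> (snd p) * k (fst p - snd p)) \<le> norm (M * (f (fst p) * \<psi> (snd p)))"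
    proof (intro always_eventually allI)
      fix p :: "R3 \<times> R3"
      show "norm (f (fst p) * \<psi> (snd p) * k (fst p - snd p)) \<le> norm (M * (f (fst p) * \<psi> (snd p)))"
      proof (cases "f (fst p) = 0 \<or> \<psi> (snd p) = 0")
        case False
        have "fst p \<in> \<Omega>" "snd p \<in> {x. \<psi> x \<noteq> 0}" using False fz[of "fst p"] by auto
        then have "fst p \<in> ?K1" "snd p \<in> ?K2" by (auto intro: subsetD[OF closure_subset] simp del: mem_Collect_eq)
        then have "fst p - snd p \<in> ?D" by (intro image_eqI[of _ _ p]) (auto simp: mem_Times_iff)
        then have "\<bar>k (fst p - snd p)\<bar> \<le> M" by (rule M(2))
        from mult_left_mono[OF this, of "\<bar>f (fst p) * \<psi> (snd p)\<bar>"] M(1)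
        show ?thesis by (simp add: abs_mult mult_ac)
      qed auto
    qed
  qed
qed

lemma ne_of_support: "\<psi> \<in> Cc_infty W \<Longrightarrow> f x \<noteq> 0 \<Longrightarrow> \<psi> y \<noteq> 0 \<Longrightarrow> x - y \<noteq> 0"
proof
  assume a: "\<psi> \<in> Cc_infty W" "f x \<noteq> 0" "\<psi> y \<noteq> 0" "x - y = 0"
  have "x \<in> \<Omega>" using a(2) fz by blast
  moreover have "y \<in> W" using a(1,3) Cc_not_support[of y \<psi>] by (auto simp: Cc_infty_def)
  ultimately show False using a(4) W closure_subset[of \<Omega>] by auto
qed

lemma kform_cong:
  assumes \<psi>: "\<psi> \<in> Cc_infty W" and e: "\<And>z. z \<noteq> 0 \<Longrightarrow> k z = k' z"
  shows "kform \<psi> k = kform \<psi> k'"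
  unfolding kform_def
proof (intro Bochner_Integration.integral_cong refl)
  fix p :: "R3 \<times> R3"
  show "f (fst p) * \<psi> (snd p) * k (fst p - snd p) = f (fst p) * \<psi> (snd p) * k' (fst p - snd p)"
    using e[OF ne_of_support[OF \<psi>, of "fst p" "snd p"]] by auto
qed

lemma kform_riesz_lin:
  assumes \<psi>: "\<psi> \<in> Cc_infty W"
  shows "kform \<psi> (\<lambda>z. a * riesz n \<beta> z + b * riesz m \<gamma> z) = a * kform \<psi> (riesz n \<beta>) + b * kform \<psi> (riesz m \<gamma>)"
proof -
  note i = kform_integrable[OF \<psi> riesz_continuous riesz_measurable]
  have "kform \<psi> (\<lambda>z. a * riesz n \<beta> z + b * riesz m \<gamma> z)
    = (LINT p|lborel. a * (f (fst p) * \<psi> (snd p) * riesz n \<beta> (fst p - snd p)) + b * (f (fst p) * \<psi> (snd p) * riesz m \<gamma> (fst p - snd p)))"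
    unfolding kform_def by (intro Bochner_Integration.integral_cong refl) (simp add: algebra_simps)
  then show ?thesis using i[of n \<beta>] i[of m \<gamma>] by (simp add: kform_def)
qed

text \<open>Two minus signs cancel, one from integration by parts in y and one from the chain rule
  for x - y, so a derivative of \<psi> becomes the same derivative of the kernel.\<close>

lemma kform_partial:
  assumes \<psi>: "\<psi> \<in> Cc_infty W"
  shows "kform (partial j \<psi>) (riesz n \<beta>)
    = real (n j) * kform \<psi> (riesz (n(j := n j - 1)) \<beta>) - \<beta> * kform \<psi> (riesz (n(j := Suc (n j))) (\<beta> + 2))"
proof -
  define k' where "k' = (\<lambda>z. real (n j) * riesz (n(j := n j - 1)) \<beta> z + (- \<beta>) * riesz (n(j := Suc (n j))) (\<beta> + 2) z)"
  have k'c: "continuous_on (- {0}) k'" unfolding k'_def by (intro continuous_intros riesz_continuous)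
  have k'm: "k' \<in> borel_measurable borel" unfolding k'_def by measurable
  have "(LINT y|lborel. f x * partial j \<psi> y * riesz n \<beta> (x - y)) = (LINT y|lborel. f x * \<psi> y * k' (x - y))" for x
  proof (cases "f x = 0")
    case False
    then have x: "x \<in> \<Omega>" using fz by blast
    have ne: "x - y \<noteq> 0" if "y \<in> W" for y using that x W closure_subset[of \<Omega>] by auto
    have der: "((\<lambda>y. riesz n \<beta> (x - y)) has_derivative (\<lambda>h. frechet_derivative (riesz n \<beta>) (at (x - y)) (- h))) (at y)"
      if y: "y \<in> W" for y
    proof -
      have d: "((\<lambda>y. x - y) has_derivative (\<lambda>h. - h)) (at y)" by (auto intro!: derivative_eq_intros)
      have "riesz n \<beta> differentiable (at (x - y))" using riesz_has_derivative[OF ne[OF y]] by (auto simp: differentiable_def)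
      from has_derivative_compose[OF d has_derivative_frechet[OF this]] show ?thesis .
    qed
    have p: "partial j (\<lambda>y. riesz n \<beta> (x - y)) y = - k' (x - y)" if y: "y \<in> W" for y
    proof -
      have "riesz n \<beta> differentiable (at (x - y))" using riesz_has_derivative[OF ne[OF y]] by (auto simp: differentiable_def)
      then have "linear (frechet_derivative (riesz n \<beta>) (at (x - y)))" by (rule linear_frechet_derivative)
      then have "partial j (\<lambda>y. riesz n \<beta> (x - y)) y = - partial j (riesz n \<beta>) (x - y)"
        unfolding partial_eq[OF der[OF y]] by (simp add: partial_def linear_neg)
      then show ?thesis using partial_riesz[OF ne[OF y], of j n \<beta>] by (simp add: k'_def)
    qed
    have kc: "continuous_on W (\<lambda>y. - k' (x - y))"
      using ne by (intro continuous_intros continuous_on_compose2[OF k'c]) auto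
    have "(LINT y|lborel. partial j \<psi> y *\<^sub>R riesz n \<beta> (x - y)) = - (LINT y|lborel. \<psi> y *\<^sub>R partial j (\<lambda>y. riesz n \<beta> (x - y)) y)"
    proof (rule integration_by_parts[OF \<psi> open_W])
      show "(\<lambda>y. riesz n \<beta> (x - y)) differentiable (at y)" if "y \<in> W" for y
        using der[OF that] by (auto simp: differentiable_def)
      show "continuous_on W (partial j (\<lambda>y. riesz n \<beta> (x - y)))"
        by (rule continuous_on_cong[THEN iffD2, OF refl _ kc]) (rule p)
    qed
    also have "\<dots> = - (LINT y|lborel. \<psi> y * (- k' (x - y)))"
    proof (intro arg_cong[of _ _ uminus] Bochner_Integration.integral_cong refl)
      fix y
      show "\<psi> y *\<^sub>R partial j (\<lambda>y. riesz n \<beta> (x - y)) y = \<psi> y * (- k' (x - y))"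
      proof (cases "y \<in> W")
        case False
        then have "\<psi> y = 0" using \<psi> Cc_not_support[of y \<psi>] by (auto simp: Cc_infty_def)
        then show ?thesis by simp
      qed (simp add: p)
    qed
    finally show ?thesis by (simp add: mult.assoc)
  qed simp
  then have "kform (partial j \<psi>) (riesz n \<beta>) = kform \<psi> k'"
    unfolding kform_def
    using lborel_integral_fst[OF kform_integrable[OF Cc_partial[OF \<psi>, of j] riesz_continuous riesz_measurable, of n \<beta>]]
      lborel_integral_fst[OF kform_integrable[OF \<psi> k'c k'm]] by simp
  then show ?thesis unfolding k'_def kform_riesz_lin[OF \<psi>] by simp
qed

lemma kform_sum:
  assumes "\<And>i. i \<in> I \<Longrightarrow> g i \<in> Cc_infty W"
  shows "kform (\<lambda>x. \<Sum>i\<in>I. g i x) (riesz n \<beta>) = (\<Sum>i\<in>I. kform (g i) (riesz n \<beta>))"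
proof -
  have "kform (\<lambda>x. \<Sum>i\<in>I. g i x) (riesz n \<beta>) = (LINT p|lborel. (\<Sum>i\<in>I. f (fst p) * g i (snd p) * riesz n \<beta> (fst p - snd p)))"
    unfolding kform_def by (simp add: sum_distrib_left sum_distrib_right)
  then show ?thesis unfolding kform_def
    using kform_integrable[OF assms riesz_continuous riesz_measurable] by (simp add: Bochner_Integration.integral_sum)
qed

text \<open>In dimension three the Laplacian of |z|^(-\<beta>) is \<beta> (\<beta> - 1)
  |z|^(-\<beta> - 2), because \<beta> (\<beta> + 2) - 3 \<beta> = \<beta> (\<beta> - 1).\<close>

lemma kform_laplacian:
  assumes \<psi>: "\<psi> \<in> Cc_infty W"
  shows "kform (laplacian \<psi>) (riesz (\<lambda>_. 0) \<beta>) = \<beta> * (\<beta> - 1) * kform \<psi> (riesz (\<lambda>_. 0) (\<beta> + 2))"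
proof -
  let ?z = "\<lambda>_::3. 0::nat"
  note P = Cc_partial[OF \<psi>]
  let ?T = "\<lambda>j. kform \<psi> (riesz (?z(j := Suc (Suc 0))) (\<beta> + 4))"
  have one: "kform (partial j (partial j \<psi>)) (riesz ?z \<beta>) = - \<beta> * (kform \<psi> (riesz ?z (\<beta> + 2)) - (\<beta> + 2) * ?T j)" for j
  proof -
    have u: "?z(j := 0) = ?z" "(\<beta> + 2) + 2 = \<beta> + 4" by auto
    show ?thesis using kform_partial[OF P, of j j ?z \<beta>] kform_partial[OF \<psi>, of j "?z(j := Suc 0)" "\<beta> + 2"]
      by (simp add: u algebra_simps)
  qed
  have T: "(\<Sum>j\<in>UNIV. ?T j) = kform \<psi> (riesz ?z (\<beta> + 2))"
  proof -
    have "(\<Sum>j\<in>UNIV. ?T j) = kform \<psi> (\<lambda>z. \<Sum>j\<in>UNIV. riesz (?z(j := Suc (Suc 0))) (\<beta> + 4) z)"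
      unfolding kform_def using kform_integrable[OF \<psi> riesz_continuous riesz_measurable]
      by (simp add: sum_distrib_left Bochner_Integration.integral_sum)
    also have "\<dots> = kform \<psi> (riesz ?z (\<beta> + 2))"
    proof (rule kform_cong[OF \<psi>])
      fix z :: R3 assume z: "z \<noteq> 0"
      have m: "mon (?z(j := Suc (Suc 0))) z = (z $ j)\<^sup>2" for j
        using exhaust_3[of j] by (auto simp: mon_def power2_eq_square)
      have n: "(norm z)\<^sup>2 = (\<Sum>j\<in>UNIV. (z $ j)\<^sup>2)"
        unfolding power2_norm_eq_inner by (simp add: inner_vec_def power2_eq_square)
      have "norm z powr (- (\<beta> + 2)) = norm z powr 2 * norm z powr (- (\<beta> + 4))"
        unfolding powr_add[symmetric] by (rule arg_cong[of _ _ "\<lambda>t. norm z powr t"]) simp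
      also have "norm z powr 2 = (norm z)\<^sup>2" using z by (simp add: powr_numeral)
      finally show "(\<Sum>j\<in>UNIV. riesz (?z(j := Suc (Suc 0))) (\<beta> + 4) z) = riesz ?z (\<beta> + 2) z"
        unfolding riesz_def m by (simp add: n sum_distrib_right)
    qed
    finally show ?thesis .
  qed
  have "kform (laplacian \<psi>) (riesz ?z \<beta>) = (\<Sum>j\<in>UNIV. kform (partial j (partial j \<psi>)) (riesz ?z \<beta>))"
    unfolding laplacian_def[abs_def] by (rule kform_sum) (intro Cc_partial \<psi>)
  also have "\<dots> = - \<beta> * (3 * kform \<psi> (riesz ?z (\<beta> + 2)) - (\<beta> + 2) * (\<Sum>j\<in>UNIV. ?T j))"
    unfolding one by (simp add: sum_3 algebra_simps)
  finally show ?thesis unfolding T by (simp add: algebra_simps)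
qed

text \<open>Differentiating \<psi> raises the degree of the monomial by one and \<beta> by 2, at the
  price of a term of lower degree with the old exponent. The parameter k, counting extra Laplacians,
  is what brings that lower term within reach of the induction hypothesis. The condition b > 1 keeps
  all factors \<beta> and \<beta> (\<beta> - 1) nonzero.\<close>

lemma kform_riesz_zero:
  assumes b: "b > 1" and start: "\<And>\<psi>. \<psi> \<in> Cc_infty W \<Longrightarrow> kform \<psi> (riesz (\<lambda>_. 0) b) = 0"
  shows "\<psi> \<in> Cc_infty W \<Longrightarrow> kform \<psi> (riesz n (b + 2 * real (n 1 + n 2 + n 3) + 2 * real k)) = 0"
proof (induction "n 1 + n 2 + n 3" arbitrary: n k \<psi> rule: less_induct)
  case less
  have zero: "kform \<psi> (riesz (\<lambda>_. 0) (b + 2 * real k)) = 0" if "\<psi> \<in> Cc_infty W" for \<psi> k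
    using that
  proof (induction k arbitrary: \<psi>)
    case (Suc k)
    have "(b + 2 * real k) * (b + 2 * real k - 1) * kform \<psi> (riesz (\<lambda>_. 0) (b + 2 * real k + 2)) = 0"
      using kform_laplacian[OF Suc.prems, of "b + 2 * real k"] Suc.IH[OF Cc_laplacian[OF Suc.prems]] by simp
    moreover have "(b + 2 * real k) * (b + 2 * real k - 1) \<noteq> 0" using b by (auto simp: add_pos_nonneg)
    ultimately have "kform \<psi> (riesz (\<lambda>_. 0) (b + 2 * real k + 2)) = 0" by simp
    moreover have "b + 2 * real k + 2 = b + 2 * real (Suc k)" by simp
    ultimately show ?case by (simp only:)
  qed (simp add: start)
  show ?case
  proof (cases "n 1 + n 2 + n 3 = 0")
    case True
    then have "n = (\<lambda>_. 0)" using exhaust_3 by (auto simp: fun_eq_iff) (metis)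
    then show ?thesis using zero[OF less.prems, of k] by simp
  next
    case False
    then obtain j where j: "n j > 0" by auto
    define m where "m = n(j := n j - 1)"
    have nm: "n = m(j := Suc (m j))" using j by (auto simp: m_def)
    have sz: "n 1 + n 2 + n 3 = Suc (m 1 + m 2 + m 3)" using exhaust_3[of j] j by (auto simp: m_def)
    let ?\<beta> = "b + 2 * real (m 1 + m 2 + m 3) + 2 * real k"
    have "kform (partial j \<psi>) (riesz m ?\<beta>) = 0"
      using less.hyps[of m "partial j \<psi>" k] sz Cc_partial[OF less.prems] by simp
    moreover have "real (m j) * kform \<psi> (riesz (m(j := m j - 1)) ?\<beta>) = 0"
    proof (cases "m j = 0")
      case False
      \<comment> \<open>The exponent of m stays while the degree drops by one; in the indexing by
        degree and k this means one more Laplacian, hence Suc k.\<close>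
      let ?l = "m(j := m j - 1)"
      have sl: "m 1 + m 2 + m 3 = Suc (?l 1 + ?l 2 + ?l 3)" using exhaust_3[of j] False by auto
      have "?\<beta> = b + 2 * real (?l 1 + ?l 2 + ?l 3) + 2 * real (Suc k)" unfolding sl by simp
      moreover have "kform \<psi> (riesz ?l (b + 2 * real (?l 1 + ?l 2 + ?l 3) + 2 * real (Suc k))) = 0"
        using less.prems by (intro less.hyps) (use sl sz in linarith)+
      ultimately show ?thesis by (simp only: mult_zero_right)
    qed simp
    ultimately have "?\<beta> * kform \<psi> (riesz n (?\<beta> + 2)) = 0"
      using kform_partial[OF less.prems, of j m ?\<beta>, folded nm] by linarith
    then have "kform \<psi> (riesz n (?\<beta> + 2)) = 0" using b by (simp add: add_pos_nonneg)
    moreover have "?\<beta> + 2 = b + 2 * real (n 1 + n 2 + n 3) + 2 * real k" unfolding sz by simp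
    ultimately show ?thesis by (simp only:)
  qed
qed

text \<open>Each potential vanishes for almost every y in a box inside W, and there are only
  countably many exponents n, so one y serves them all. The bump makes the potential integrable on
  the whole space, as the fundamental lemma demands.\<close>

lemma AE_zero_at_point:
  assumes W0: "W \<noteq> {}" and z: "\<And>n \<psi>. \<psi> \<in> Cc_infty W \<Longrightarrow> kform \<psi> (riesz n (c n)) = 0"
  shows "\<exists>y\<in>W. \<forall>n. (LINT x|lborel. f x * riesz n (c n) (x - y)) = 0"
proof -
  obtain y0 where "y0 \<in> W" using W0 by auto
  then obtain a b where ab: "y0 \<in> box a b" "cbox a b \<subseteq> W" using open_W open_contains_cbox by meson
  let ?u = "bump a b"
  have u: "?u \<in> Cc_infty W" by (rule bump_Cc[OF ab(2)])
  let ?F = "\<lambda>n y. LINT x|lborel. f x * riesz n (c n) (x - y)"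
  have [measurable]: "f \<in> borel_measurable borel" using fi by auto
  have [measurable]: "?u \<in> borel_measurable borel" using Cc_integrable[OF u] by auto
  have "AE y in lborel. ?u y * ?F n y = 0" for n
  proof -
    have i: "integrable lborel (\<lambda>p. f (fst p) * ?u (snd p) * riesz n (c n) (fst p - snd p))"
      by (rule kform_integrable[OF u riesz_continuous riesz_measurable])
    have e: "(LINT x|lborel. f x * ?u y * riesz n (c n) (x - y)) = ?u y * ?F n y" for y
    proof -
      have "(LINT x|lborel. f x * ?u y * riesz n (c n) (x - y)) = (LINT x|lborel. ?u y * (f x * riesz n (c n) (x - y)))"
        by (intro Bochner_Integration.integral_cong refl) simp
      then show ?thesis by simp
    qed
    have ui: "integrable lborel (\<lambda>y. ?u y * ?F n y)"
    proof -
      have "integrable lborel (\<lambda>p. f (snd p) * ?u (fst p) * riesz n (c n) (snd p - fst p))"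
        using lborel_swap_integrable[OF i] by simp
      then have "integrable lborel (\<lambda>y. LINT x|lborel. f x * ?u y * riesz n (c n) (x - y))"
        using lborel_pair.integrable_fst'[of "\<lambda>p. f (snd p) * ?u (fst p) * riesz n (c n) (snd p - fst p)"]
        unfolding lborel_prod by simp
      then show ?thesis unfolding e .
    qed
    show ?thesis
    proof (rule fundamental_lemma)
      show "(\<lambda>y. ?u y * ?F n y) \<in> borel_measurable lborel" using ui by auto
      show "integrable lborel (\<lambda>x. indicator (cball 0 R) x *\<^sub>R (?u x * ?F n x))" for R
        using integrable_mult_indicator[OF _ ui, of "cball 0 R"] by simp
      fix \<phi> :: "R3 \<Rightarrow> real" assume p: "\<phi> \<in> Cc_infty UNIV"
      have pu: "(\<lambda>x. \<phi> x * ?u x) \<in> Cc_infty W" by (rule Cc_mult_left[OF u Cc_smooth[OF p]])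
      note ip = kform_integrable[OF pu riesz_continuous riesz_measurable, of n "c n"]
      have "0 = kform (\<lambda>x. \<phi> x * ?u x) (riesz n (c n))" using z[OF pu] by simp
      also have "\<dots> = (LINT y|lborel. LINT x|lborel. f x * (\<phi> y * ?u y) * riesz n (c n) (x - y))"
        unfolding kform_def lborel_integral_snd[OF ip, symmetric] by simp
      also have "\<dots> = (LINT y|lborel. \<phi> y * (?u y * ?F n y))"
      proof (intro Bochner_Integration.integral_cong refl)
        fix y
        have "(LINT x|lborel. f x * (\<phi> y * ?u y) * riesz n (c n) (x - y)) = (LINT x|lborel. (\<phi> y * ?u y) * (f x * riesz n (c n) (x - y)))"
          by (intro Bochner_Integration.integral_cong refl) simp
        then show "(LINT x|lborel. f x * (\<phi> y * ?u y) * riesz n (c n) (x - y)) = \<phi> y * (?u y * ?F n y)" by simp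
      qed
      finally show "(LINT x|lborel. \<phi> x * (?u x * ?F n x)) = 0" by simp
    qed
  qed
  then have ae: "AE y in lborel. \<forall>n. ?u y * ?F n y = 0" unfolding AE_all_countable by blast
  have "\<exists>y\<in>box a b. \<forall>n. ?u y * ?F n y = 0"
  proof (rule ccontr)
    assume "\<not> ?thesis"
    then have "AE y in lborel. y \<notin> box a b" by (intro eventually_mono[OF ae]) blast
    then have "emeasure lborel (box a b) = 0" by (subst (asm) AE_iff_measurable[of "box a b"]) auto
    moreover have "emeasure lborel (box a b) = ennreal (\<Prod>i\<in>Basis. (b - a) \<bullet> i)"
      using ab(1) by (intro emeasure_lborel_box) (auto simp: mem_box intro: less_imp_le order.strict_trans)
    moreover have "(\<Prod>i\<in>Basis. (b - a) \<bullet> i) > 0"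
      using ab(1) by (intro prod_pos) (auto simp: mem_box inner_diff_left intro: order.strict_trans)
    ultimately show False by (metis ennreal_eq_0_iff linorder_not_le)
  qed
  then obtain y where y: "y \<in> box a b" "\<And>n. ?u y * ?F n y = 0" by blast
  have "y \<in> W" using y(1) ab(2) box_subset_cbox by blast
  moreover have "?u y \<noteq> 0" using y(1) bump_nonzero_iff by blast
  ultimately show ?thesis using y(2) by (intro bexI[of _ y]) auto
qed


lemma linear_nth_sum: "linear p \<Longrightarrow> p y = (\<Sum>j\<in>UNIV. p (axis j 1) * y $ j)" for p :: "R3 \<Rightarrow> real"
proof -
  assume p: "linear p"
  have "p y = p (\<Sum>j\<in>UNIV. (y $ j) *\<^sub>R axis j 1)" using basis_expansion[of y] by (simp add: scalar_mult_eq_scaleR)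
  also have "\<dots> = (\<Sum>j\<in>UNIV. p (axis j 1) * y $ j)" by (simp add: linear_sum[OF p] linear_scale[OF p] mult.commute)
  finally show "p y = (\<Sum>j\<in>UNIV. p (axis j 1) * y $ j)" .
qed

text \<open>Under the inversion \<open>z \<mapsto> z / |z|\<^sup>2\<close> the derivatives of a Riesz kernel become all monomials, so
  that the Weierstrass theorem applies.\<close>

lemma zero_of_riesz_moments:
  assumes y: "y \<in> W" and z: "\<And>n. (LINT x|lborel. f x * riesz n (b + 2 * real (n 1 + n 2 + n 3)) (x - y)) = 0"
  shows "AE x in lborel. f x = 0"
proof -
  define K where "K = closure \<Omega>"
  define inv where "inv = (\<lambda>x::R3. (x - y) /\<^sub>R (norm (x - y))\<^sup>2)"
  define w where "w = (\<lambda>x. norm (x - y) powr (- b))"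
  have K: "compact K" using bounded_\<Omega> by (simp add: K_def compact_closure)
  have yK: "y \<notin> K" using y W by (auto simp: K_def)
  have inv_c: "continuous_on K inv" unfolding inv_def using yK by (intro continuous_intros) auto
  have w_c: "continuous_on K w" unfolding w_def using yK by (intro continuous_intros) auto
  have fK: "f x = 0" if "x \<notin> K" for x using that fz[of x] closure_subset[of \<Omega>] by (auto simp: K_def)
  have [measurable]: "f \<in> borel_measurable borel" using fi by auto
  have int: "integrable lborel (\<lambda>x. f x * g x)" if g: "continuous_on K g" for g
  proof -
    have "bounded (g ` K)" by (rule compact_imp_bounded[OF compact_continuous_image[OF g K]])
    then obtain M where M: "\<forall>x\<in>g ` K. norm x \<le> M" unfolding bounded_pos by blast
    have m: "(\<lambda>x. indicator K x *\<^sub>R g x) \<in> borel_measurable borel"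
      using K g by (intro borel_measurable_continuous_on_indicator) (auto simp: compact_imp_closed)
    have e: "f x * g x = f x * (indicator K x *\<^sub>R g x)" for x using fK[of x] by (auto simp: indicator_def)
    show ?thesis
    proof (rule Bochner_Integration.integrable_bound)
      show "integrable lborel (\<lambda>x. M * f x)" using fi by simp
      show "(\<lambda>x. f x * g x) \<in> borel_measurable lborel" unfolding e using m by measurable
      show "AE x in lborel. norm (f x * g x) \<le> norm (M * f x)"
      proof (intro always_eventually allI)
        fix x
        show "norm (f x * g x) \<le> norm (M * f x)"
        proof (cases "x \<in> K")
          case True
          then have "\<bar>g x\<bar> \<le> M" using M by simp
          then have "\<bar>f x\<bar> * \<bar>g x\<bar> \<le> \<bar>f x\<bar> * \<bar>M\<bar>" by (intro mult_left_mono) auto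
          then show ?thesis by (simp add: abs_mult mult.commute)
        qed (simp add: fK)
      qed
    qed
  qed
  \<comment> \<open>Functions g for which w g is annihilated by f together with all monomials in
    \<open>inv\<close>. Asking for every n at once makes N stable under multiplication by the
    coordinates of \<open>inv\<close>, so that an induction over polynomials can start from the
    constant 1.\<close>
  define N where "N = {g. continuous_on K g \<and> (\<forall>n. (LINT x|lborel. f x * (w x * g x * mon n (inv x))) = 0)}"
  have mon_c: "continuous_on K (\<lambda>x. mon n (inv x))" for n
    by (rule continuous_on_compose2[OF mon_continuous[of UNIV] inv_c]) auto
  have intN: "integrable lborel (\<lambda>x. f x * (w x * g x * mon n (inv x)))" if "continuous_on K g" for g n
    using that by (intro int continuous_intros w_c mon_c)
  \<comment> \<open>The exponent b + 2 (n 1 + n 2 + n 3) supplies one factor |z|^(-2) for each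
    factor of the monomial. This turns the monomial in z into the same monomial in
    \<open>inv\<close>, with the weight w = |z|^(-b) left over.\<close>
  have one: "(\<lambda>_. 1) \<in> N"
  proof -
    have e: "f x * (w x * 1 * mon n (inv x)) = f x * riesz n (b + 2 * real (n 1 + n 2 + n 3)) (x - y)" for n x
    proof (cases "x = y")
      case True then show ?thesis using fK[OF yK] by simp
    next
      case False
      have i: "inv x $ i = (x - y) $ i * norm (x - y) powr (- 2)" for i
        using False by (simp add: inv_def powr_minus powr_numeral field_simps)
      have p: "(norm (x - y) powr (- 2)) ^ k = norm (x - y) powr (- 2 * real k)" for k
        using False by (simp add: powr_power mult.commute)
      have "mon n (inv x) = mon n (x - y) * (norm (x - y) powr (- 2 * real (n 1)) * norm (x - y) powr (- 2 * real (n 2)) * norm (x - y) powr (- 2 * real (n 3)))"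
        unfolding mon_def i power_mult_distrib p by (simp only: mult_ac)
      also have "\<dots> = mon n (x - y) * norm (x - y) powr (- 2 * real (n 1 + n 2 + n 3))"
        unfolding powr_add[symmetric] by (simp add: algebra_simps)
      finally have "w x * mon n (inv x) = mon n (x - y) * (norm (x - y) powr (- b) * norm (x - y) powr (- 2 * real (n 1 + n 2 + n 3)))"
        by (simp add: w_def)
      also have "\<dots> = riesz n (b + 2 * real (n 1 + n 2 + n 3)) (x - y)"
        unfolding powr_add[symmetric] riesz_def by (simp add: algebra_simps)
      finally show ?thesis by simp
    qed
    show ?thesis unfolding N_def mem_Collect_eq e using z by simp
  qed
  have lin: "(\<lambda>x. g x + h x) \<in> N" if "g \<in> N" "h \<in> N" for g h
  proof -
    have c: "continuous_on K g" "continuous_on K h" using that by (auto simp: N_def)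
    have "(LINT x|lborel. f x * (w x * (g x + h x) * mon n (inv x)))
      = (LINT x|lborel. f x * (w x * g x * mon n (inv x)) + f x * (w x * h x * mon n (inv x)))" for n
      by (intro Bochner_Integration.integral_cong refl) (simp add: algebra_simps)
    then show ?thesis using that intN[OF c(1)] intN[OF c(2)] by (auto simp: N_def intro: continuous_intros)
  qed
  have scale: "(\<lambda>x. a * g x) \<in> N" if "g \<in> N" for g a
  proof -
    have "(LINT x|lborel. f x * (w x * (a * g x) * mon n (inv x))) = (LINT x|lborel. a * (f x * (w x * g x * mon n (inv x))))" for n
      by (intro Bochner_Integration.integral_cong refl) (simp add: algebra_simps)
    then show ?thesis using that by (auto simp: N_def intro: continuous_intros)
  qed
  have coord: "(\<lambda>x. inv x $ j * g x) \<in> N" if "g \<in> N" for g j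
  proof -
    have "(LINT x|lborel. f x * (w x * (inv x $ j * g x) * mon n (inv x))) = (LINT x|lborel. f x * (w x * g x * mon (n(j := Suc (n j))) (inv x)))" for n
      unfolding mon_Suc by (intro Bochner_Integration.integral_cong refl) simp
    then show ?thesis using that inv_c by (auto simp: N_def intro!: continuous_intros)
  qed
  have poly: "\<forall>g\<in>N. (\<lambda>x. p (inv x) * g x) \<in> N" if "real_polynomial_function p" for p
    using that
  proof induction
    case (linear p)
    have p: "p v = (\<Sum>j\<in>UNIV. p (axis j 1) * v $ j)" for v
      by (rule linear_nth_sum) (rule bounded_linear.linear[OF linear])
    show ?case
    proof
      fix g assume g: "g \<in> N"
      have "(\<lambda>x. p (axis 1 1) * (inv x $ 1 * g x) + p (axis 2 1) * (inv x $ 2 * g x) + p (axis 3 1) * (inv x $ 3 * g x)) \<in> N"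
        by (intro lin scale coord g)
      moreover have "p (inv x) * g x = p (axis 1 1) * (inv x $ 1 * g x) + p (axis 2 1) * (inv x $ 2 * g x) + p (axis 3 1) * (inv x $ 3 * g x)" for x
        by (subst p) (simp add: sum_3 algebra_simps)
      ultimately show "(\<lambda>x. p (inv x) * g x) \<in> N" by simp
    qed
  next
    case (const c)
    then show ?case using scale by blast
  next
    case (add p q)
    show ?case
    proof
      fix g assume "g \<in> N"
      then have "(\<lambda>x. p (inv x) * g x + q (inv x) * g x) \<in> N" using add by (intro lin) auto
      then show "(\<lambda>x. (p (inv x) + q (inv x)) * g x) \<in> N" by (simp add: algebra_simps)
    qed
  next
    case (mult p q)
    show ?case
    proof
      fix g assume "g \<in> N"
      then have q: "(\<lambda>x. q (inv x) * g x) \<in> N" using mult by blast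
      from bspec[OF mult(3) q] have "(\<lambda>x. p (inv x) * (q (inv x) * g x)) \<in> N" .
      then show "(\<lambda>x. p (inv x) * q (inv x) * g x) \<in> N" by (simp add: mult.assoc)
    qed
  qed
  have zero: "(LINT x|lborel. f x * (w x * p (inv x))) = 0" if "real_polynomial_function p" for p
  proof -
    have "(\<lambda>x. p (inv x) * 1) \<in> N" using bspec[OF poly[OF that] one] .
    then have "(LINT x|lborel. f x * (w x * (p (inv x) * 1) * mon (\<lambda>_. 0) (inv x))) = 0" unfolding N_def mem_Collect_eq by blast
    then show ?thesis by simp
  qed
  have test: "(LINT x|lborel. \<phi> x * (f x * w x)) = 0" if \<phi>: "\<phi> \<in> Cc_infty UNIV" for \<phi> :: "R3 \<Rightarrow> real"
  proof -
    \<comment> \<open>Inversion is an involution, so h composed with \<open>inv\<close> gives back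
      \<phi> on K; h is continuous on the image because that avoids 0.\<close>
    define h where "h = (\<lambda>v::R3. \<phi> (y + v /\<^sub>R (norm v)\<^sup>2))"
    have inv0: "inv x \<noteq> 0" if "x \<in> K" for x using that yK by (auto simp: inv_def)
    have hi: "h (inv x) = \<phi> x" if "x \<in> K" for x
    proof -
      have xy: "x \<noteq> y" using that yK by auto
      then have n: "norm (inv x) = inverse (norm (x - y))" by (simp add: inv_def power2_eq_square)
      have "inv x /\<^sub>R (norm (inv x))\<^sup>2 = x - y" unfolding n using xy by (simp add: inv_def power_inverse)
      then have "y + inv x /\<^sub>R (norm (inv x))\<^sup>2 = x" by simp
      then show ?thesis by (simp add: h_def)
    qed
    have hc: "continuous_on (inv ` K) h"
      unfolding h_def using inv0 by (intro continuous_on_compose2[OF Cc_continuous[OF \<phi>]] continuous_intros) auto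
    have invK: "compact (inv ` K)" by (rule compact_continuous_image[OF inv_c K])
    have Ii: "integrable lborel (\<lambda>x. f x * w x)" by (rule int[OF w_c])
    have small: "\<bar>LINT x|lborel. \<phi> x * (f x * w x)\<bar> \<le> e * (LINT x|lborel. \<bar>f x * w x\<bar>)" if e: "e > 0" for e
    proof -
      \<comment> \<open>Weierstrass approximation of h on the compact image of K. Polynomials in
        \<open>inv\<close> contribute nothing by \<open>zero\<close>, so only the approximation
        error remains.\<close>
      obtain p where p: "real_polynomial_function p" "\<And>v. v \<in> inv ` K \<Longrightarrow> \<bar>h v - p v\<bar> < e"
        using Stone_Weierstrass_real_polynomial_function[OF invK hc e] by blast
      have pc: "continuous_on K (\<lambda>x. p (inv x))"
      proof (rule continuous_on_compose2[OF _ inv_c])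
        show "continuous_on UNIV p"
          using p(1) by (intro continuous_on_polymonial_function) (simp add: real_polynomial_function_eq)
      qed simp
      have i1: "integrable lborel (\<lambda>x. f x * (w x * \<phi> x))"
        using Cc_continuous[OF \<phi>] by (intro int continuous_intros w_c) (auto intro: continuous_on_subset)
      have i2: "integrable lborel (\<lambda>x. f x * (w x * p (inv x)))" by (intro int continuous_intros w_c pc)
      have "(LINT x|lborel. \<phi> x * (f x * w x)) = (LINT x|lborel. f x * (w x * \<phi> x)) - (LINT x|lborel. f x * (w x * p (inv x)))"
        unfolding zero[OF p(1)] by (simp add: mult_ac)
      also have "\<dots> = (LINT x|lborel. f x * (w x * \<phi> x) - f x * (w x * p (inv x)))"
        by (rule Bochner_Integration.integral_diff[OF i1 i2, symmetric])
      finally have eq: "(LINT x|lborel. \<phi> x * (f x * w x)) = \<dots>" .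
      have "\<bar>\<dots>\<bar> \<le> (LINT x|lborel. e * \<bar>f x * w x\<bar>)"
        unfolding real_norm_def[symmetric]
      proof (rule Bochner_Integration.integral_norm_bound_integral)
        show "integrable lborel (\<lambda>x. f x * (w x * \<phi> x) - f x * (w x * p (inv x)))" using i1 i2 by simp
        show "integrable lborel (\<lambda>x. e * norm (f x * w x))" using Ii by simp
        fix x
        show "norm (f x * (w x * \<phi> x) - f x * (w x * p (inv x))) \<le> e * norm (f x * w x)"
        proof (cases "x \<in> K")
          case True
          have d: "\<bar>\<phi> x - p (inv x)\<bar> \<le> e" using p(2)[of "inv x"] hi[OF True] True by auto
          have "f x * (w x * \<phi> x) - f x * (w x * p (inv x)) = (\<phi> x - p (inv x)) * (f x * w x)" by (simp add: algebra_simps)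
          then show ?thesis using mult_right_mono[OF d abs_ge_zero[of "f x * w x"]] by (simp add: abs_mult)
        qed (simp add: fK)
      qed
      then show ?thesis unfolding eq by simp
    qed
    show ?thesis
    proof (rule ccontr)
      let ?I = "LINT x|lborel. \<bar>f x * w x\<bar>"
      assume n: "(LINT x|lborel. \<phi> x * (f x * w x)) \<noteq> 0"
      have I0: "?I \<ge> 0" by (intro integral_nonneg_AE) auto
      define a where "a = \<bar>LINT x|lborel. \<phi> x * (f x * w x)\<bar>"
      define J where "J = ?I"
      have a: "a > 0" and J: "J \<ge> 0" using n I0 by (auto simp: a_def J_def)
      \<comment> \<open>With this tolerance the estimate would give a \<le> a / 2; the summand 1
        allows for J = 0.\<close>
      have "a / (2 * (J + 1)) > 0" using a J by (intro divide_pos_pos) auto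
      from small[OF this] have "a \<le> a / (2 * (J + 1)) * J" unfolding a_def[symmetric] J_def[symmetric] .
      moreover have "a / (2 * (J + 1)) * J = a / 2 * (J / (J + 1))" by simp
      moreover have "a / 2 * (J / (J + 1)) \<le> a / 2 * 1" using a J by (intro mult_left_mono) auto
      ultimately show False using a by linarith
    qed
  qed
  have "AE x in lborel. f x * w x = 0"
  proof (rule fundamental_lemma[OF _ _ test])
    have i: "integrable lborel (\<lambda>x. f x * w x)" by (rule int[OF w_c])
    show "(\<lambda>x. f x * w x) \<in> borel_measurable lborel" using i by auto
    show "integrable lborel (\<lambda>x. indicator (cball 0 R) x *\<^sub>R (f x * w x))" for R
      using integrable_mult_indicator[OF _ i, of "cball 0 R"] by simp
  qed
  then show ?thesis
  proof eventually_elim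
    case (elim x)
    show ?case
    proof (cases "x \<in> K")
      case True
      then have "w x \<noteq> 0" using yK by (auto simp: w_def)
      then show ?thesis using elim by simp
    qed (simp add: fK)
  qed
qed

text \<open>The two Laplacians only raise the exponent from b to b + 4, with the factor b (b - 1) (b
  + 2) (b + 1), which is nonzero. The moment argument then starts from exponent b + 4. The double
  Laplacian is what the cofactor column leaves behind.\<close>

theorem unique_continuation:
  assumes W0: "W \<noteq> {}" and b: "b > 1"
    and z: "\<And>\<psi>. \<psi> \<in> Cc_infty W \<Longrightarrow> kform (laplacian (laplacian \<psi>)) (riesz (\<lambda>_. 0) b) = 0"
  shows "AE x in lborel. f x = 0"
proof -
  have "kform \<psi> (riesz (\<lambda>_. 0) (b + 2 + 2)) = 0" if p: "\<psi> \<in> Cc_infty W" for \<psi>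
  proof -
    have "b * (b - 1) * ((b + 2) * (b + 2 - 1) * kform \<psi> (riesz (\<lambda>_. 0) (b + 2 + 2))) = 0"
      using z[OF p] unfolding kform_laplacian[OF Cc_laplacian[OF p]] kform_laplacian[OF p] .
    then show ?thesis using b by (simp only: mult_eq_0_iff) auto
  qed
  from kform_riesz_zero[OF _ this, where k=0] b
  have "kform \<psi> (riesz n (b + 2 + 2 + 2 * real (n 1 + n 2 + n 3))) = 0" if "\<psi> \<in> Cc_infty W" for \<psi> n
    using that by simp
  from AE_zero_at_point[OF W0 this] zero_of_riesz_moments show ?thesis by blast
qed

end

section \<open>Runge approximation and recovery of the coefficients\<close>

section \<open>Density of solutions\<close>

lemma Cc_vec:
  assumes "\<And>i. \<phi> i \<in> Cc_infty U"
  shows "(\<lambda>x. (\<chi> i. \<phi> i x) :: R3) \<in> Cc_infty U"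
proof -
  have e: "(\<chi> i. \<phi> i x) = (\<Sum>i\<in>UNIV. \<phi> i x *\<^sub>R (axis i 1 :: R3))" for x
    by (simp add: vec_eq_iff axis_def sum_3) (use exhaust_3 in auto)
  show ?thesis unfolding e by (intro Cc_sum Cc_linear[OF assms bounded_linear_scaleR_left])
qed

lemma Cc_comp: "(g :: R3 \<Rightarrow> R3) \<in> Cc_infty U \<Longrightarrow> (\<lambda>x. g x $ i) \<in> Cc_infty U"
  by (rule Cc_linear[OF _ bounded_linear_vec_nth])

lemma weak_partial_Cc_zero_off:
  assumes g: "g \<in> Cc_infty W" and W: "W \<inter> \<Omega> = {}"
  shows "AE x in lborel. x \<in> \<Omega> \<longrightarrow> weak_partial j g x = 0"
  using weak_partial_Cc[OF g, of j]
proof eventually_elim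
  case (elim x)
  show ?case
  proof
    assume "x \<in> \<Omega>"
    then have "x \<notin> closure {x. g x \<noteq> 0}" using g W by (auto simp: Cc_infty_def)
    then show "weak_partial j g x = 0" unfolding elim by (rule partial_zero_off_support)
  qed
qed

text \<open>The part of the form that carries the variable coefficients. Two operators with the same
  principal part differ exactly by this, and it ignores fields supported off \<Omega>.\<close>

definition local_form :: "R3 set \<Rightarrow> (R3 \<Rightarrow> real) \<Rightarrow> (R3 \<Rightarrow> real) \<Rightarrow> (R3 \<Rightarrow> R3) \<Rightarrow> (R3 \<Rightarrow> R3) \<Rightarrow> real" where
  "local_form \<Omega> l m u v = weight_form (\<lambda>x. indicator \<Omega> x * l x) (divergence u) (divergence v)
    + 1 / 2 * (\<Sum>i\<in>UNIV. \<Sum>j\<in>UNIV. weight_form (\<lambda>x. indicator \<Omega> x * m x) (sym_grad u i j) (sym_grad v i j))"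

lemma weight_form_zero_off:
  assumes "AE x in lborel. x \<in> \<Omega> \<longrightarrow> g x = 0"
  shows "weight_form (\<lambda>x. indicator \<Omega> x * l x) f g = 0"
  unfolding weight_form_def
  by (rule integral_eq_zero_AE) (use assms in \<open>auto elim!: eventually_mono simp: indicator_def\<close>)

lemma local_form_zero_off:
  assumes g: "g \<in> Cc_infty W" and W: "W \<inter> \<Omega> = {}"
  shows "local_form \<Omega> l m u g = 0"
proof -
  note z = weak_partial_Cc_zero_off[OF Cc_comp[OF g] W]
  have "AE x in lborel. x \<in> \<Omega> \<longrightarrow> divergence g x = 0"
    using z[of 1 1] z[of 2 2] z[of 3 3] unfolding divergence_def sum_3 by eventually_elim auto
  moreover have "AE x in lborel. x \<in> \<Omega> \<longrightarrow> sym_grad g i j x = 0" for i j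
    using z[of i j] z[of j i] unfolding sym_grad_def by eventually_elim auto
  ultimately show ?thesis by (simp add: local_form_def weight_form_zero_off)
qed

text \<open>A column of the cofactor matrix of the principal symbol: it turns the Lame symbol into a
  scalar multiple of \<open>|\<xi>|\<^sup>4\<close>.\<close>

lemma lame_cofactor:
  fixes \<xi> :: R3 and a :: "3 \<Rightarrow> complex" and p :: complex and l0 m0 :: real and i :: 3
  defines "c \<equiv> \<lambda>k. (l0 + m0) * (\<xi> $ k * \<xi> $ i) - (l0 + 2 * m0) * (if k = i then (norm \<xi>)\<^sup>2 else 0)"
  shows "m0 * (norm \<xi>)\<^sup>2 * (\<Sum>k\<in>UNIV. a k \<bullet> (c k *\<^sub>R p))
      + (l0 + m0) * ((\<Sum>j\<in>UNIV. of_real (\<xi> $ j) * a j) \<bullet> (\<Sum>j\<in>UNIV. of_real (\<xi> $ j) * (c j *\<^sub>R p)))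
    = - (m0 * (l0 + 2 * m0)) * (a i \<bullet> (((norm \<xi>)\<^sup>2 * (norm \<xi>)\<^sup>2) *\<^sub>R p))"
proof -
  define N where "N = (norm \<xi>)\<^sup>2"
  define S where "S = (\<Sum>j\<in>UNIV. of_real (\<xi> $ j) * a j)"
  have n: "N = (\<Sum>j\<in>UNIV. \<xi> $ j * \<xi> $ j)"
    unfolding N_def power2_norm_eq_inner by (simp add: inner_vec_def)
  have d: "(\<Sum>k\<in>UNIV. x k * (if k = i then N else 0)) = x i * N" for x :: "3 \<Rightarrow> real"
    by (simp add: if_distrib[of "\<lambda>t. _ * t"] cong: if_cong)
  have c: "c k = (l0 + m0) * (\<xi> $ k * \<xi> $ i) - (l0 + 2 * m0) * (if k = i then N else 0)" for k
    by (simp add: c_def N_def)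
  have 1: "(\<Sum>j\<in>UNIV. of_real (\<xi> $ j) * (c j *\<^sub>R p)) = (- m0 * (N * \<xi> $ i)) *\<^sub>R p"
  proof -
    have "(\<Sum>j\<in>UNIV. of_real (\<xi> $ j) * (c j *\<^sub>R p)) = (\<Sum>j\<in>UNIV. \<xi> $ j * c j) *\<^sub>R p"
      by (simp add: scaleR_sum_left scaleR_conv_of_real mult.assoc sum_distrib_right)
    also have "(\<Sum>j\<in>UNIV. \<xi> $ j * c j)
        = (l0 + m0) * \<xi> $ i * (\<Sum>j\<in>UNIV. \<xi> $ j * \<xi> $ j) - (l0 + 2 * m0) * (\<Sum>j\<in>UNIV. \<xi> $ j * (if j = i then N else 0))"
      unfolding c by (simp add: sum_distrib_left right_diff_distrib sum_subtractf mult_ac)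
    also have "\<dots> = - m0 * (N * \<xi> $ i)" unfolding d n[symmetric] by (simp add: algebra_simps)
    finally show ?thesis .
  qed
  have 2: "(\<Sum>k\<in>UNIV. a k \<bullet> (c k *\<^sub>R p)) = (l0 + m0) * \<xi> $ i * (S \<bullet> p) - (l0 + 2 * m0) * (N * (a i \<bullet> p))"
  proof -
    have "(\<Sum>k\<in>UNIV. a k \<bullet> (c k *\<^sub>R p))
      = (l0 + m0) * \<xi> $ i * (\<Sum>k\<in>UNIV. \<xi> $ k * (a k \<bullet> p)) - (l0 + 2 * m0) * (\<Sum>k\<in>UNIV. (a k \<bullet> p) * (if k = i then N else 0))"
      unfolding c inner_scaleR_right sum_distrib_left sum_subtractf[symmetric]
      by (intro sum.cong refl) (simp add: algebra_simps)
    also have "(\<Sum>k\<in>UNIV. \<xi> $ k * (a k \<bullet> p)) = S \<bullet> p"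
      unfolding S_def inner_sum_left by (simp flip: scaleR_conv_of_real)
    finally show ?thesis unfolding d by (simp add: mult.commute)
  qed
  \<comment> \<open>The terms containing S, that is \<xi> \<bullet> a, cancel between the two
    summands; only the component a i survives.\<close>
  show ?thesis unfolding 1 2 N_def[symmetric] S_def[symmetric] by (simp add: algebra_simps)
qed

lemma fourier_L2_partial_partial:
  assumes \<psi>: "(\<psi> :: R3 \<Rightarrow> real) \<in> Cc_infty U"
  shows "AE \<xi> in lborel. fourier_L2 (partial k (partial i \<psi>)) \<xi> = - (\<xi> $ k * \<xi> $ i) *\<^sub>R fourier_L2 \<psi> \<xi>"
  using fourier_L2_partial_Cc[OF \<psi>, of i] fourier_L2_partial_Cc[OF Cc_partial[OF \<psi>, of i], of k]
  by eventually_elim (simp add: scaleR_conv_of_real algebra_simps)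

lemma fourier_L2_laplacian:
  assumes \<psi>: "\<psi> \<in> Cc_infty U"
  shows "AE \<xi> in lborel. fourier_L2 (laplacian \<psi>) \<xi> = - (norm \<xi>)\<^sup>2 *\<^sub>R fourier_L2 \<psi> \<xi>"
proof -
  let ?d = "\<lambda>j. partial j (partial j \<psi>)"
  have L: "?d j \<in> L2" for j by (rule Cc_L2[OF Cc_partial[OF Cc_partial[OF \<psi>]]])
  have L12: "(\<lambda>x. ?d 1 x + ?d 2 x) \<in> L2" by (intro L2.add_mem L)
  have l: "laplacian \<psi> = (\<lambda>x. ?d 1 x + ?d 2 x + ?d 3 x)" by (simp add: laplacian_def fun_eq_iff sum_3)
  have n: "(norm \<xi>)\<^sup>2 = \<xi> $ 1 * \<xi> $ 1 + \<xi> $ 2 * \<xi> $ 2 + \<xi> $ 3 * \<xi> $ 3" for \<xi> :: R3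
    unfolding power2_norm_eq_inner by (simp add: inner_vec_def sum_3)
  note f = fourier_L2_partial_partial[OF \<psi>]
  show ?thesis
    using f[of 1 1] f[of 2 2] f[of 3 3] fourier_L2_lin[OF L[of 1] L[of 2], of 1] fourier_L2_lin[OF L12 L[of 3], of 1]
    unfolding l n by eventually_elim (simp add: algebra_simps)
qed

context lame
begin

lemma Cc_X: "g \<in> Cc_infty U \<Longrightarrow> g \<in> X" and Cc_V: "g \<in> Cc_infty \<Omega> \<Longrightarrow> g \<in> V"
  using Cc_sobolev_tilde[OF r_bounds(2) Cc_UNIV[OF Cc_comp]] Cc_sobolev_tilde[OF r_bounds(2) Cc_comp]
  unfolding sobolev_tilde_vec_def by blast+

lemma B_local:
  "u \<in> X \<Longrightarrow> v \<in> X \<Longrightarrow> B u v = (LINT \<xi>|lborel. symbol_density u v \<xi>) + local_form \<Omega> l m u v"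
  by (simp add: B_principal local_form_def)

text \<open>A field g supported in W sees only the constant-coefficient part of B. Choosing g as a
  cofactor column applied to a scalar \<psi> leaves a scalar identity for the component i, with the
  factor m0 (l0 + 2 m0), nonzero because l0 + 2 m0 \<ge> m0 > 0. The kernel representation and
  \<open>unique_continuation\<close> finish the argument.\<close>

lemma annihilator_zero:
  assumes W: "open W" "W \<noteq> {}" "W \<subseteq> - closure \<Omega>"
    and \<phi>: "\<phi> \<in> V" and ann: "\<And>g. g \<in> Cc_infty W \<Longrightarrow> B \<phi> g = 0"
  shows "AE x in lborel. \<phi> x $ i = 0"
proof -
  have \<phi>X: "\<phi> \<in> X" using \<phi> V_sub_X by auto
  have W\<Omega>: "W \<inter> \<Omega> = {}" using W(3) closure_subset[of \<Omega>] by auto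
  let ?a = "\<lambda>k. fourier_L2 (\<lambda>x. \<phi> x $ k)"
  have key: "(LINT \<xi>|lborel. norm \<xi> powr (2 * s) * (?a i \<xi> \<bullet> fourier_L2 (laplacian (laplacian \<psi>)) \<xi>)) = 0"
    if \<psi>: "\<psi> \<in> Cc_infty W" for \<psi>
  proof -
    \<comment> \<open>Signs are opposite to those of the cofactor column since second derivatives
      and the Laplacian have symbols -\<xi>_k \<xi>_i and -|\<xi>|^2.\<close>
    define G where "G = (\<lambda>k x. (l0 + 2 * m0) *\<^sub>R (if k = i then laplacian \<psi> x else 0) - (l0 + m0) *\<^sub>R partial k (partial i \<psi>) x)"
    have Lc: "(\<lambda>x. if k = i then laplacian \<psi> x else 0) \<in> Cc_infty W" for k
      using Cc_laplacian[OF \<psi>] Cc_zero by (cases "k = i") auto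
    have Gc: "G k \<in> Cc_infty W" for k unfolding G_def by (intro Cc_diff Cc_scale Cc_partial \<psi> Lc)
    define g where "g = (\<lambda>x. (\<chi> k. G k x) :: R3)"
    have g: "g \<in> Cc_infty W" unfolding g_def by (rule Cc_vec[OF Gc])
    have F: "AE \<xi> in lborel. fourier_L2 (\<lambda>x. g x $ k) \<xi>
      = ((l0 + m0) * (\<xi> $ k * \<xi> $ i) - (l0 + 2 * m0) * (if k = i then (norm \<xi>)\<^sup>2 else 0)) *\<^sub>R fourier_L2 \<psi> \<xi>" for k
    proof -
      have P: "partial k (partial i \<psi>) \<in> L2" by (rule Cc_L2[OF Cc_partial[OF Cc_partial[OF \<psi>]]])
      have Z: "(\<lambda>x. 0 :: real) \<in> L2" by (rule Cc_L2[OF Cc_zero])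
      have LL: "laplacian \<psi> \<in> L2" by (rule Cc_L2[OF Cc_laplacian[OF \<psi>]])
      have S: "(\<lambda>x. - (l0 + m0) * partial k (partial i \<psi>) x) \<in> L2" using L2_lin[OF Z P, of "- (l0 + m0)"] by simp
      have z: "AE \<xi> in lborel. fourier_L2 (\<lambda>x. 0) \<xi> = 0"
        using fourier_L2_Cc[OF Cc_zero] by (simp add: fourier_def)
      have e: "(\<lambda>x. g x $ k) = (\<lambda>x. - (l0 + m0) * partial k (partial i \<psi>) x + (if k = i then l0 + 2 * m0 else 0) * laplacian \<psi> x)"
        by (simp add: g_def G_def fun_eq_iff algebra_simps)
      show ?thesis unfolding e
        using fourier_L2_lin[OF S LL, of "if k = i then l0 + 2 * m0 else 0"] fourier_L2_lin[OF Z P, of "- (l0 + m0)"]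
          fourier_L2_partial_partial[OF \<psi>, of k i] fourier_L2_laplacian[OF \<psi>] z
        by eventually_elim (auto simp: scaleR_conv_of_real algebra_simps)
    qed
    have "AE \<xi> in lborel. \<forall>k\<in>(UNIV::3 set). fourier_L2 (\<lambda>x. g x $ k) \<xi>
      = ((l0 + m0) * (\<xi> $ k * \<xi> $ i) - (l0 + 2 * m0) * (if k = i then (norm \<xi>)\<^sup>2 else 0)) *\<^sub>R fourier_L2 \<psi> \<xi>"
      by (intro AE_finite_allI finite F)
    then have ae: "AE \<xi> in lborel. symbol_density \<phi> g \<xi>
      = - (m0 * (l0 + 2 * m0)) * (norm \<xi> powr (2 * s) * (?a i \<xi> \<bullet> fourier_L2 (laplacian (laplacian \<psi>)) \<xi>))"
      using fourier_L2_laplacian[OF \<psi>] fourier_L2_laplacian[OF Cc_laplacian[OF \<psi>]]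
    proof eventually_elim
      case (elim \<xi>)
      have "fourier_L2 (laplacian (laplacian \<psi>)) \<xi> = ((norm \<xi>)\<^sup>2 * (norm \<xi>)\<^sup>2) *\<^sub>R fourier_L2 \<psi> \<xi>"
        unfolding elim(3) elim(2) by simp
      moreover have "symbol_density \<phi> g \<xi> = norm \<xi> powr (2 * s) *
        (- (m0 * (l0 + 2 * m0)) * (?a i \<xi> \<bullet> (((norm \<xi>)\<^sup>2 * (norm \<xi>)\<^sup>2) *\<^sub>R fourier_L2 \<psi> \<xi>)))"
        by (simp only: symbol_density_def bspec[OF elim(1) UNIV_I] lame_cofactor)
      ultimately show ?case by simp
    qed
    have [measurable]: "?a i \<in> borel_measurable borel" "fourier_L2 (laplacian (laplacian \<psi>)) \<in> borel_measurable borel"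
      using sobolev_tilde_L2[OF X_comp[OF \<phi>X]] Cc_L2[OF Cc_laplacian[OF Cc_laplacian[OF \<psi>]]] by measurable
    have "0 = (LINT \<xi>|lborel. symbol_density \<phi> g \<xi>)"
      using ann[OF g] B_local[OF \<phi>X Cc_X[OF g]] local_form_zero_off[OF g W\<Omega>] by simp
    also have "\<dots> = (LINT \<xi>|lborel. - (m0 * (l0 + 2 * m0)) * (norm \<xi> powr (2 * s) * (?a i \<xi> \<bullet> fourier_L2 (laplacian (laplacian \<psi>)) \<xi>)))"
      using principal_part(1)[OF \<phi>X Cc_X[OF g]] ae by (intro integral_cong_AE) auto
    finally show ?thesis using m0 lm0 by simp
  qed
  \<comment> \<open>A representative of the component that vanishes at every point outside \<Omega>,
    as the locale \<open>supported\<close> asks; it has the same transform almost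
    everywhere.\<close>
  define f where "f = (\<lambda>x. indicator \<Omega> x * \<phi> x $ i)"
  have c: "(\<lambda>x. \<phi> x $ i) \<in> sobolev_tilde (1 + s) \<Omega>" using \<phi> by (simp add: sobolev_tilde_vec_def)
  have fe: "AE x in lborel. f x = \<phi> x $ i"
    using sobolev_tilde_zero_outside[OF r_bounds(3,2) open_\<Omega> c] by eventually_elim (auto simp: f_def indicator_def)
  have cL: "(\<lambda>x. \<phi> x $ i) \<in> L2" by (rule sobolev_tilde_L2[OF c])
  have [measurable]: "(\<lambda>x. \<phi> x $ i) \<in> borel_measurable borel" "\<Omega> \<in> sets borel" using L2_measurable[OF cL] open_\<Omega> by auto
  have fL: "f \<in> L2"
    by (rule L2_mono[OF _ cL, where C=1]) (auto simp: f_def indicator_def)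
  obtain R where R: "\<Omega> \<subseteq> cball 0 R" using bounded_subset_ballD[OF bounded_\<Omega>, of 0] ball_subset_cball by blast
  have fi: "integrable lborel f"
    by (rule L2_compact_support_integrable[OF fL, of R]) (intro always_eventually, use R in \<open>force simp: f_def indicator_def\<close>)
  note W_props = W
  interpret supported f \<Omega> W
    by unfold_locales (use fi bounded_\<Omega> W in \<open>auto simp: f_def\<close>)
  have "AE x in lborel. f x = 0"
  proof (rule unique_continuation[OF W_props(2), of "3 + 2 * s"])
    show "3 + 2 * s > 1" using s by simp
    fix \<psi> :: "R3 \<Rightarrow> real" assume \<psi>: "\<psi> \<in> Cc_infty W"
    let ?G = "laplacian (laplacian \<psi>)"
    have G: "?G \<in> Cc_infty W" by (intro Cc_laplacian \<psi>)
    have "compact (closure {x. ?G x \<noteq> 0})" "closure \<Omega> \<inter> closure {x. ?G x \<noteq> 0} = {}"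
      using G W_props(3) by (auto simp: Cc_infty_def)
    \<comment> \<open>A compact set and a disjoint closed set have positive distance; this is the
      separation that the kernel formula needs.\<close>
    then obtain d where d: "d > 0" "\<And>x y. x \<in> closure \<Omega> \<Longrightarrow> y \<in> closure {x. ?G x \<noteq> 0} \<Longrightarrow> d \<le> dist x y"
      using separate_compact_closed[of "closure {x. ?G x \<noteq> 0}" "closure \<Omega>"] by (metis closed_closure dist_commute inf_commute)
    have z: "(LINT \<xi>|lborel. norm \<xi> powr (2 * s) * (fourier_L2 f \<xi> \<bullet> fourier_L2 ?G \<xi>)) = 0"
    proof -
      have [measurable]: "?a i \<in> borel_measurable borel" "fourier_L2 f \<in> borel_measurable borel" "fourier_L2 ?G \<in> borel_measurable borel"
        using cL fL Cc_L2[OF G] by measurable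
      have "(LINT \<xi>|lborel. norm \<xi> powr (2 * s) * (fourier_L2 f \<xi> \<bullet> fourier_L2 ?G \<xi>)) = (LINT \<xi>|lborel. norm \<xi> powr (2 * s) * (?a i \<xi> \<bullet> fourier_L2 ?G \<xi>))"
        using fourier_L2_cong[OF fL cL fe] by (intro integral_cong_AE) (auto elim!: eventually_mono)
      then show ?thesis using key[OF \<psi>] by simp
    qed
    have sep: "d \<le> norm (x - y)" if "f x \<noteq> 0" "?G y \<noteq> 0" for x y
    proof -
      have "x \<in> \<Omega>" using that(1) by (auto simp: f_def indicator_def split: if_splits)
      then have "x \<in> closure \<Omega>" by (rule subsetD[OF closure_subset])
      moreover have "y \<in> closure {x. ?G x \<noteq> 0}" using that(2) by (intro subsetD[OF closure_subset]) simp
      ultimately show ?thesis using d(2) by (simp add: dist_norm)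
    qed
    have "(LINT p|lborel. f (fst p) * ?G (snd p) * norm (fst p - snd p) powr (- 3 - 2 * s)) = 0"
      by (rule frac_laplacian_off_support[OF s fi fL Cc_UNIV[OF G] d(1) sep z])
    moreover have "- 3 - 2 * s = - (3 + 2 * s)" by simp
    ultimately show "kform ?G (riesz (\<lambda>_. 0) (3 + 2 * s)) = 0" by (simp only: kform_def riesz_def mon_zero mult_1)
  qed
  then show ?thesis using fe by eventually_elim simp
qed

text \<open>B refers to weak derivatives selected for the function at hand, so vanishing almost
  everywhere is passed to B through the Sobolev norms, which see only the transform.\<close>

lemma B_zero_of_AE_zero:
  assumes u: "u \<in> X" and z: "\<And>i. AE x in lborel. u x $ i = 0"
  shows "B u u = 0"
proof -
  have "sobolev_norm (1 + s) (\<lambda>x. u x $ i) = 0" for i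
  proof -
    have L: "(\<lambda>x. u x $ i) \<in> L2" by (rule sobolev_tilde_L2[OF X_comp[OF u]])
    have Z: "(\<lambda>x. 0 :: real) \<in> L2" by (rule Cc_L2[OF Cc_zero])
    have "AE \<xi> in lborel. fourier_L2 (\<lambda>x. u x $ i) \<xi> = 0"
      using fourier_L2_cong[OF L Z z] fourier_L2_Cc[OF Cc_zero] by eventually_elim (simp add: fourier_def)
    then have "(LINT \<xi>|lborel. (1 + (norm \<xi>)\<^sup>2) powr (1 + s) * (norm (fourier_L2 (\<lambda>x. u x $ i) \<xi>))\<^sup>2) = 0"
      by (intro integral_eq_zero_AE) (auto elim!: eventually_mono)
    then show ?thesis by (simp add: sobolev_norm_def)
  qed
  then have "total_norm u = 0" by (simp add: total_norm_def)
  moreover obtain K where "\<And>u. u \<in> X \<Longrightarrow> B u u \<le> K * (total_norm u)\<^sup>2" using B_bounded by blast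
  ultimately have "B u u \<le> 0" using u by fastforce
  then show ?thesis using BX.pos[OF u] by simp
qed

lemma weak_solutionI:
  assumes u: "u \<in> X" "(\<lambda>x. u x - g x) \<in> V" "\<And>v. v \<in> V \<Longrightarrow> B u v = 0"
  shows "weak_solution \<Omega> s l0 m0 l m g u"
  using sobolev_tilde_sobolev[OF X_comp[OF u(1)]] u(2,3) unfolding weak_solution_def sobolev_vec_def by blast

theorem runge:
  assumes W: "open W" "W \<noteq> {}" "W \<subseteq> - closure \<Omega>" and v: "v \<in> V" and e: "e > 0"
  shows "\<exists>g\<in>Cc_infty W. \<exists>u. weak_solution \<Omega> s l0 m0 l m g u \<and>
    sqrt (B (\<lambda>x. (u x - g x) - v x) (\<lambda>x. (u x - g x) - v x)) < e"
proof -
  define D where "D = {\<lambda>x. u x - g x | u g. g \<in> Cc_infty W \<and> weak_solution \<Omega> s l0 m0 l m g u}"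
  have DV: "D \<subseteq> V" using weak_solution_X(2)[OF Cc_X] by (auto simp: D_def)
  have D0: "D \<noteq> {}" using weak_solution_exists[OF Cc_X[OF Cc_zero]] Cc_zero unfolding D_def by blast
  have Dlin: "(\<lambda>x. d x + c *\<^sub>R d' x) \<in> D" if dd: "d \<in> D" "d' \<in> D" for d d' c
  proof -
    obtain u g u' g' where d: "d = (\<lambda>x. u x - g x)" "g \<in> Cc_infty W" "weak_solution \<Omega> s l0 m0 l m g u"
      and d': "d' = (\<lambda>x. u' x - g' x)" "g' \<in> Cc_infty W" "weak_solution \<Omega> s l0 m0 l m g' u'"
      using dd unfolding D_def by blast
    note u = weak_solution_X[OF Cc_X[OF d(2)] d(3)] and u' = weak_solution_X[OF Cc_X[OF d'(2)] d'(3)]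
    have e: "(\<lambda>x. d x + c *\<^sub>R d' x) = (\<lambda>x. (u x + c *\<^sub>R u' x) - (g x + c *\<^sub>R g' x))"
      by (simp add: d(1) d'(1) fun_eq_iff algebra_simps)
    have ws: "weak_solution \<Omega> s l0 m0 l m (\<lambda>x. g x + c *\<^sub>R g' x) (\<lambda>x. u x + c *\<^sub>R u' x)"
    proof (rule weak_solutionI)
      show "(\<lambda>x. u x + c *\<^sub>R u' x) \<in> X" by (rule X_lin[OF u(1) u'(1)])
      show "(\<lambda>x. (u x + c *\<^sub>R u' x) - (g x + c *\<^sub>R g' x)) \<in> V"
        unfolding e[symmetric] using dd DV by (intro V_lin) auto
      show "B (\<lambda>x. u x + c *\<^sub>R u' x) v = 0" if "v \<in> V" for v
        using u(3)[OF that] u'(3)[OF that] B_bil[OF u(1) u'(1), of v c] that V_sub_X by auto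
    qed
    have "(\<lambda>x. g x + c *\<^sub>R g' x) \<in> Cc_infty W" by (intro Cc_add Cc_scale d(2) d'(2))
    then show ?thesis unfolding D_def mem_Collect_eq
      by (intro exI[of _ "\<lambda>x. u x + c *\<^sub>R u' x"] exI[of _ "\<lambda>x. g x + c *\<^sub>R g' x"] conjI e ws)
  qed
  have DX: "D \<subseteq> X" using DV V_sub_X by blast
  define C where "C = BX.closure_in V D"
  have C: "BX.complete_sub C" unfolding C_def by (rule BX.complete_closure_in[OF V_complete DV D0 Dlin])
  have CV: "C \<subseteq> V" by (auto simp: C_def BX.closure_in_def)
  have vX: "v \<in> X" using v V_sub_X by blast
  obtain w where w: "w \<in> C" "\<And>d. d \<in> C \<Longrightarrow> B (\<lambda>x. v x - w x) d = 0"
    using BX.projection[OF C vX] by blast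
  have wX: "w \<in> X" using w(1) CV V_sub_X by blast
  let ?\<phi> = "\<lambda>x. v x - w x"
  have \<phi>V: "?\<phi> \<in> V" using V_lin[OF v, of w "-1"] w(1) CV by auto
  have \<phi>X: "?\<phi> \<in> X" using \<phi>V V_sub_X by blast
  have DC: "d \<in> C" if "d \<in> D" for d
  proof -
    have "B (\<lambda>x. d x - d x) (\<lambda>x. d x - d x) = 0" using BX.expand_diff[of d d] that DX by auto
    then have "\<forall>e>0. \<exists>d'\<in>D. B (\<lambda>x. d' x - d x) (\<lambda>x. d' x - d x) < e" using that by (intro allI impI bexI[of _ d]) auto
    then show ?thesis using that DV by (auto simp: C_def BX.closure_in_def)
  qed
  have "AE x in lborel. ?\<phi> x $ i = 0" for i
  proof (rule annihilator_zero[OF W \<phi>V])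
    fix g :: "R3 \<Rightarrow> R3" assume g: "g \<in> Cc_infty W"
    note gX = Cc_X[OF g]
    obtain u where u: "weak_solution \<Omega> s l0 m0 l m g u" using weak_solution_exists[OF gX] by blast
    note uX = weak_solution_X[OF gX u]
    have "(\<lambda>x. u x - g x) \<in> D" unfolding D_def using u g by blast
    then have "B ?\<phi> (\<lambda>x. u x - g x) = 0" using w(2) DC by blast
    \<comment> \<open>The residual is orthogonal to u - g by projection and to u because u is a weak
      solution and the residual lies in V. Hence it is orthogonal to the datum g itself.\<close>
    then show "B ?\<phi> g = 0" using BX.B_diff2[OF uX(1) gX \<phi>X] uX(3)[OF \<phi>V] B_sym[OF \<phi>X uX(1)] by simp
  qed
  then have z: "B ?\<phi> ?\<phi> = 0" by (rule B_zero_of_AE_zero[OF \<phi>X])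
  obtain d where d: "d \<in> D" "sqrt (B (\<lambda>x. d x - w x) (\<lambda>x. d x - w x)) < e"
    using w(1) e BX.closure_in_iff_sqrt[OF V_sub_X DX, of w] unfolding C_def by blast
  have dX: "d \<in> X" using d(1) DX by blast
  have "sqrt (B (\<lambda>x. d x - v x) (\<lambda>x. d x - v x)) < e"
  proof -
    have "sqrt (B (\<lambda>x. w x - v x) (\<lambda>x. w x - v x)) = 0" using BX.diff_commute[OF vX wX] z by simp
    then show ?thesis using BX.triangle_diff[OF dX wX vX] d(2) by linarith
  qed
  then show ?thesis using d(1) unfolding D_def by blast
qed

lemma total_norm_le_B:
  obtains c where "c \<ge> 0" "\<And>v. v \<in> V \<Longrightarrow> total_norm v \<le> c * sqrt (B v v)"
proof -
  obtain P where P: "P > 0" "\<And>f. f \<in> sobolev_tilde (1 + s) \<Omega> \<Longrightarrow> (sobolev_norm (1 + s) f)\<^sup>2 \<le> P * (top_norm f)\<^sup>2"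
    by (rule V_norm_equiv) blast
  have b: "sobolev_norm (1 + s) (\<lambda>x. v x $ i) \<le> sqrt (P / m0) * sqrt (B v v)" if v: "v \<in> V" for v i
  proof -
    have c: "(\<lambda>x. v x $ i) \<in> sobolev_tilde (1 + s) \<Omega>" using v by (simp add: sobolev_tilde_vec_def)
    have "(top_norm (\<lambda>x. v x $ i))\<^sup>2 \<le> (\<Sum>i\<in>UNIV. (top_norm (\<lambda>x. v x $ i))\<^sup>2)" by (intro member_le_sum) auto
    also have "\<dots> \<le> B v v / m0" using B_coercive[of v] v V_sub_X m0 by (simp add: field_simps subset_eq)
    finally have "P * (top_norm (\<lambda>x. v x $ i))\<^sup>2 \<le> P * (B v v / m0)" using P(1) by (intro mult_left_mono) auto
    then have "(sobolev_norm (1 + s) (\<lambda>x. v x $ i))\<^sup>2 \<le> P / m0 * B v v" using P(2)[OF c] by simp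
    then show ?thesis by (simp flip: real_sqrt_mult add: real_le_rsqrt)
  qed
  then have "total_norm v \<le> (3 * sqrt (P / m0)) * sqrt (B v v)" if "v \<in> V" for v
    using b[OF that, of 1] b[OF that, of 2] b[OF that, of 3] unfolding total_norm_def sum_3 mult.assoc by linarith
  then show ?thesis using P(1) m0 by (intro that[of "3 * sqrt (P / m0)"]) auto
qed

lemma B_le_total_norm:
  assumes u: "u \<in> X"
  obtains c where "c \<ge> 0" "\<And>v. v \<in> X \<Longrightarrow> \<bar>B u v\<bar> \<le> c * total_norm v"
proof -
  obtain K where K: "K \<ge> 0" "\<And>u. u \<in> X \<Longrightarrow> B u u \<le> K * (total_norm u)\<^sup>2" by (rule B_bounded) blast
  have "\<bar>B u v\<bar> \<le> (sqrt (B u u) * sqrt K) * total_norm v" if v: "v \<in> X" for v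
  proof -
    have "sqrt (B v v) \<le> sqrt (K * (total_norm v)\<^sup>2)" using K(2)[OF v] by simp
    also have "\<dots> = sqrt K * total_norm v" by (simp add: real_sqrt_mult total_norm_nonneg)
    finally have "sqrt (B u u) * sqrt (B v v) \<le> sqrt (B u u) * (sqrt K * total_norm v)"
      using BX.pos[OF u] by (intro mult_left_mono) auto
    then show ?thesis using BX.cauchy_schwarz_abs[OF u v] by (simp add: mult.assoc)
  qed
  then show ?thesis using K(1) BX.pos[OF u] by (intro that[of "sqrt (B u u) * sqrt K"]) auto
qed

text \<open>Runge density in the form in which it is applied: compatibility with differences and a
  bound in \<open>total_norm\<close> suffice to pass from the fields u - g to all of V. The bound is
  in a norm free of coefficients, so F may involve the form of another operator.\<close>

lemma functional_zero:
  assumes W: "open W" "W \<noteq> {}" "W \<subseteq> - closure \<Omega>"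
    and F: "\<And>u v. u \<in> V \<Longrightarrow> v \<in> V \<Longrightarrow> F (\<lambda>x. u x - v x) = F u - F v"
    and bd: "c \<ge> 0" "\<And>v. v \<in> V \<Longrightarrow> \<bar>F v\<bar> \<le> c * total_norm v"
    and z: "\<And>g u. g \<in> Cc_infty W \<Longrightarrow> weak_solution \<Omega> s l0 m0 l m g u \<Longrightarrow> F (\<lambda>x. u x - g x) = 0"
    and v: "v \<in> V"
  shows "F v = 0"
proof (rule ccontr)
  assume n: "F v \<noteq> 0"
  obtain k where k: "k \<ge> 0" "\<And>v. v \<in> V \<Longrightarrow> total_norm v \<le> k * sqrt (B v v)" by (rule total_norm_le_B) blast
  \<comment> \<open>An error this small in the energy norm changes F by less than |F v|, because c k
    / (c k + 1) < 1.\<close>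
  have e: "\<bar>F v\<bar> / (c * k + 1) > 0" using n bd(1) k(1) by (intro divide_pos_pos) (auto intro: add_nonneg_pos)
  obtain g u where g: "g \<in> Cc_infty W" "weak_solution \<Omega> s l0 m0 l m g u"
    and le: "sqrt (B (\<lambda>x. (u x - g x) - v x) (\<lambda>x. (u x - g x) - v x)) < \<bar>F v\<bar> / (c * k + 1)"
    using runge[OF W v e] by blast
  let ?d = "\<lambda>x. u x - g x"
  have d: "?d \<in> V" by (rule weak_solution_X(2)[OF Cc_X[OF g(1)] g(2)])
  have dv: "(\<lambda>x. ?d x - v x) \<in> V" using V_lin[OF d v, of "-1"] by simp
  have "\<bar>F v\<bar> = \<bar>F (\<lambda>x. ?d x - v x)\<bar>" using F[OF d v] z[OF g] by simp
  also have "\<dots> \<le> c * (k * sqrt (B (\<lambda>x. ?d x - v x) (\<lambda>x. ?d x - v x)))"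
    using bd(2)[OF dv] mult_left_mono[OF k(2)[OF dv] bd(1)] by linarith
  also have "\<dots> \<le> c * (k * (\<bar>F v\<bar> / (c * k + 1)))" using le bd(1) k(1) by (intro mult_left_mono) auto
  also have "\<dots> = \<bar>F v\<bar> * (c * k / (c * k + 1))" by simp
  also have "\<dots> < \<bar>F v\<bar> * 1"
    using n mult_nonneg_nonneg[OF bd(1) k(1)] by (intro mult_strict_left_mono) (auto simp: divide_less_eq)
  finally show False by simp
qed

text \<open>The solution selected by \<open>SOME\<close> may differ from u as a function. The
  difference lies in V and is orthogonal to V, hence null for B, and a null vector pairs to zero
  with any h.\<close>

lemma DN_map_eq:
  assumes g: "g \<in> X" and h: "h \<in> X" and u: "weak_solution \<Omega> s l0 m0 l m g u"
  shows "DN_map \<Omega> s l0 m0 l m g h = - B u h"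
proof -
  define u' where "u' = (SOME u. weak_solution \<Omega> s l0 m0 l m g u)"
  have u': "weak_solution \<Omega> s l0 m0 l m g u'" using someI[of "weak_solution \<Omega> s l0 m0 l m g", OF u] by (simp add: u'_def)
  note U = weak_solution_X[OF g u] and U' = weak_solution_X[OF g u']
  let ?w = "\<lambda>x. u' x - u x"
  have wV: "?w \<in> V" using V_lin[OF U'(2) U(2), of "-1"] by simp
  have wX: "?w \<in> X" using wV V_sub_X by blast
  have "B ?w ?w = 0" using BX.B_diff[OF U'(1) U(1) wX] U(3)[OF wV] U'(3)[OF wV] by simp
  then have "B ?w h = 0" by (rule BX.null_left[OF wX h])
  then show ?thesis using BX.B_diff[OF U'(1) U(1) h] by (simp add: DN_map_def u'_def)
qed

end

section \<open>Carre du champ\<close>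

text \<open>On test fields the selected weak derivatives agree almost everywhere with the classical
  ones, and the form becomes a single integral whose integrand can be rearranged pointwise.\<close>

lemma local_form_Cc:
  assumes l: "weight_ok (\<lambda>x. indicator \<Omega> x * l x)" and m: "weight_ok (\<lambda>x. indicator \<Omega> x * m x)"
    and u: "u \<in> Cc_infty U" and v: "v \<in> Cc_infty U"
  defines "d \<equiv> \<lambda>(u :: R3 \<Rightarrow> R3) x. \<Sum>j\<in>UNIV. partial j (\<lambda>y. u y $ j) x"
    and "g \<equiv> \<lambda>(u :: R3 \<Rightarrow> R3) i j x. partial j (\<lambda>y. u y $ i) x + partial i (\<lambda>y. u y $ j) x"
  shows "integrable lborel (\<lambda>x. indicator \<Omega> x * (l x * (d u x * d v x) + 1 / 2 * (\<Sum>i\<in>UNIV. \<Sum>j\<in>UNIV. m x * (g u i j x * g v i j x))))"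
    and "local_form \<Omega> l m u v
      = (LINT x|lborel. indicator \<Omega> x * (l x * (d u x * d v x) + 1 / 2 * (\<Sum>i\<in>UNIV. \<Sum>j\<in>UNIV. m x * (g u i j x * g v i j x))))"
proof -
  have pc: "partial j (\<lambda>y. w y $ i) \<in> Cc_infty U" if "w \<in> Cc_infty U" for w :: "R3 \<Rightarrow> R3" and i j
    by (rule Cc_partial[OF Cc_comp[OF that]])
  have dL: "d w \<in> L2" and gL: "g w i j \<in> L2" if "w \<in> Cc_infty U" for w i j
    unfolding d_def g_def by (rule Cc_L2[OF Cc_sum[OF pc[OF that]]], rule Cc_L2[OF Cc_add[OF pc[OF that] pc[OF that]]])
  note wp = weak_partial_Cc[OF Cc_comp]
  have dA: "AE x in lborel. divergence w x = d w x" if "w \<in> Cc_infty U" for w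
    using wp[OF that, of 1 1] wp[OF that, of 2 2] wp[OF that, of 3 3] unfolding divergence_def d_def sum_3 by eventually_elim simp
  have gA: "AE x in lborel. sym_grad w i j x = g w i j x" if "w \<in> Cc_infty U" for w i j
    using wp[OF that, of i j] wp[OF that, of j i] unfolding sym_grad_def g_def by eventually_elim simp
  have dm: "divergence w \<in> L2" and gm: "sym_grad w i j \<in> L2" if "w \<in> Cc_infty U" for w i j
  proof -
    have c: "(\<lambda>x. w x $ i) \<in> sobolev_tilde 1 UNIV" for i by (rule Cc_sobolev_tilde[OF _ Cc_UNIV[OF Cc_comp[OF that]]]) simp
    have wL: "weak_partial j (\<lambda>x. w x $ i) \<in> L2" for i j by (rule weak_partial_L2[OF _ _ c]) auto
    show "sym_grad w i j \<in> L2" unfolding sym_grad_def[abs_def] by (intro L2.add_mem wL)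
    have "(\<lambda>x. weak_partial 1 (\<lambda>x. w x $ 1) x + weak_partial 2 (\<lambda>x. w x $ 2) x + weak_partial 3 (\<lambda>x. w x $ 3) x) \<in> L2"
      by (intro L2.add_mem wL)
    then show "divergence w \<in> L2" unfolding divergence_def[abs_def] sum_3 .
  qed
  have 1: "weight_form (\<lambda>x. indicator \<Omega> x * l x) (divergence u) (divergence v) = weight_form (\<lambda>x. indicator \<Omega> x * l x) (d u) (d v)"
    by (rule weight_form_cong[OF l dm[OF u] dL[OF u] dm[OF v] dL[OF v] dA[OF u] dA[OF v]])
  have 2: "weight_form (\<lambda>x. indicator \<Omega> x * m x) (sym_grad u i j) (sym_grad v i j) = weight_form (\<lambda>x. indicator \<Omega> x * m x) (g u i j) (g v i j)" for i j
    by (rule weight_form_cong[OF m gm[OF u] gL[OF u] gm[OF v] gL[OF v] gA[OF u] gA[OF v]])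
  note i1 = weight_integrable[OF l dL[OF u] dL[OF v]] and i2 = weight_integrable[OF m gL[OF u] gL[OF v]]
  have e: "indicator \<Omega> x * (l x * (d u x * d v x) + 1 / 2 * (\<Sum>i\<in>UNIV. \<Sum>j\<in>UNIV. m x * (g u i j x * g v i j x)))
    = indicator \<Omega> x * l x * (d u x * d v x) + 1 / 2 * (\<Sum>i\<in>UNIV. \<Sum>j\<in>UNIV. indicator \<Omega> x * m x * (g u i j x * g v i j x))" for x
    by (simp add: indicator_def)
  show "integrable lborel (\<lambda>x. indicator \<Omega> x * (l x * (d u x * d v x) + 1 / 2 * (\<Sum>i\<in>UNIV. \<Sum>j\<in>UNIV. m x * (g u i j x * g v i j x))))"
    unfolding e by (intro Bochner_Integration.integrable_add integrable_mult_right Bochner_Integration.integrable_sum i1 i2)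
  show "local_form \<Omega> l m u v
      = (LINT x|lborel. indicator \<Omega> x * (l x * (d u x * d v x) + 1 / 2 * (\<Sum>i\<in>UNIV. \<Sum>j\<in>UNIV. m x * (g u i j x * g v i j x))))"
    unfolding e local_form_def 1 2 unfolding weight_form_def using i1 i2
    by (simp add: Bochner_Integration.integral_sum Bochner_Integration.integrable_sum)
qed

definition embed1 :: "(R3 \<Rightarrow> real) \<Rightarrow> R3 \<Rightarrow> R3" where
  "embed1 \<phi> x = (\<chi> k. if k = 1 then \<phi> x else 0)"

lemma Cc_embed1: "\<phi> \<in> Cc_infty U \<Longrightarrow> embed1 \<phi> \<in> Cc_infty U"
proof -
  assume p: "\<phi> \<in> Cc_infty U"
  have "(\<lambda>x. if k = 1 then \<phi> x else 0) \<in> Cc_infty U" for k :: 3 using p Cc_zero by (cases "k = 1") auto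
  then show ?thesis unfolding embed1_def[abs_def] by (rule Cc_vec)
qed

text \<open>Fields with only a first component suffice to separate the two coefficients: their
  divergence is the first partial derivative, and half the product of the symmetric gradients is the
  gradient product plus the product of first partial derivatives.\<close>

lemma local_form_embed1:
  assumes l: "weight_ok (\<lambda>x. indicator \<Omega> x * l x)" and m: "weight_ok (\<lambda>x. indicator \<Omega> x * m x)"
    and u: "\<phi> \<in> Cc_infty U" and v: "\<eta> \<in> Cc_infty U"
  defines "c \<equiv> \<lambda>x. indicator \<Omega> x * (l x * (partial 1 \<phi> x * partial 1 \<eta> x)
      + m x * ((\<Sum>j\<in>UNIV. partial j \<phi> x * partial j \<eta> x) + partial 1 \<phi> x * partial 1 \<eta> x))"
  shows "integrable lborel c" "local_form \<Omega> l m (embed1 \<phi>) (embed1 \<eta>) = (LINT x|lborel. c x)"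
proof -
  have p: "partial j (\<lambda>y. embed1 \<psi> y $ k) = (if k = 1 then partial j \<psi> else (\<lambda>x. 0))" for j k \<psi>
    by (simp add: embed1_def)
  have c: "c = (\<lambda>x. indicator \<Omega> x * (l x * ((\<Sum>j\<in>UNIV. partial j (\<lambda>y. embed1 \<phi> y $ j) x) * (\<Sum>j\<in>UNIV. partial j (\<lambda>y. embed1 \<eta> y $ j) x))
    + 1 / 2 * (\<Sum>i\<in>UNIV. \<Sum>j\<in>UNIV. m x * ((partial j (\<lambda>y. embed1 \<phi> y $ i) x + partial i (\<lambda>y. embed1 \<phi> y $ j) x)
        * (partial j (\<lambda>y. embed1 \<eta> y $ i) x + partial i (\<lambda>y. embed1 \<eta> y $ j) x)))))"
    unfolding c_def p sum_3 by (simp add: fun_eq_iff algebra_simps)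
  show "integrable lborel c" "local_form \<Omega> l m (embed1 \<phi>) (embed1 \<eta>) = (LINT x|lborel. c x)"
    unfolding c using local_form_Cc[OF l m Cc_embed1[OF u] Cc_embed1[OF v]] by auto
qed

text \<open>By Leibniz, the product of derivatives of \<phi> \<psi> and \<psi> is \<psi> \<phi>'
  \<psi>' + \<phi> \<psi>'^2, while half that of \<phi> and \<psi>^2 is \<psi> \<phi>' \<psi>'. The
  difference carries \<phi> as a plain factor, so the fundamental lemma in its continuous version
  gives a pointwise identity.\<close>

lemma carre_du_champ:
  assumes open_\<Omega>: "open \<Omega>" and l: "weight_ok (\<lambda>x. indicator \<Omega> x * l x)" "continuous_on \<Omega> l"
    and m: "weight_ok (\<lambda>x. indicator \<Omega> x * m x)" "continuous_on \<Omega> m"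
    and z: "\<And>\<phi> \<eta>. \<phi> \<in> Cc_infty \<Omega> \<Longrightarrow> \<eta> \<in> Cc_infty \<Omega> \<Longrightarrow> local_form \<Omega> l m (embed1 \<phi>) (embed1 \<eta>) = 0"
    and \<psi>: "\<psi> \<in> Cc_infty \<Omega>" and x0: "x0 \<in> \<Omega>"
  shows "l x0 * (partial 1 \<psi> x0)\<^sup>2 + m x0 * ((\<Sum>j\<in>UNIV. (partial j \<psi> x0)\<^sup>2) + (partial 1 \<psi> x0)\<^sup>2) = 0"
proof -
  let ?c = "\<lambda>x. l x * (partial 1 \<psi> x)\<^sup>2 + m x * ((\<Sum>j\<in>UNIV. (partial j \<psi> x)\<^sup>2) + (partial 1 \<psi> x)\<^sup>2)"
  have pc: "continuous_on \<Omega> (partial j \<psi>)" for j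
    by (rule Cc_continuous[OF Cc_partial[OF \<psi>]])
  have d\<psi>: "\<psi> differentiable (at x)" for x using smoothD[OF Cc_smooth[OF \<psi>]] .
  have "?c x0 = 0"
  proof (rule continuous_zero_of_integral_zero[OF open_\<Omega> _ _ x0])
    show "continuous_on \<Omega> ?c" by (intro continuous_intros l m pc)
    fix \<phi> :: "R3 \<Rightarrow> real" assume \<phi>: "\<phi> \<in> Cc_infty \<Omega>"
    have d\<phi>: "\<phi> differentiable (at x)" for x using smoothD[OF Cc_smooth[OF \<phi>]] .
    have a: "(\<lambda>x. \<phi> x * \<psi> x) \<in> Cc_infty \<Omega>" by (rule Cc_mult_right[OF \<phi> Cc_smooth[OF \<psi>]])
    have b: "(\<lambda>x. \<psi> x * \<psi> x) \<in> Cc_infty \<Omega>" by (rule Cc_mult_right[OF \<psi> Cc_smooth[OF \<psi>]])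
    have pa: "partial j (\<lambda>x. \<phi> x * \<psi> x) x = partial j \<phi> x * \<psi> x + \<phi> x * partial j \<psi> x" for j x
      by (rule partial_bilinear[OF bounded_bilinear_mult d\<phi> d\<psi>])
    have pb: "partial j (\<lambda>x. \<psi> x * \<psi> x) x = partial j \<psi> x * \<psi> x + \<psi> x * partial j \<psi> x" for j x
      by (rule partial_bilinear[OF bounded_bilinear_mult d\<psi> d\<psi>])
    note E1 = local_form_embed1[OF l(1) m(1) a \<psi>] and E2 = local_form_embed1[OF l(1) m(1) \<phi> b]
    have "(LINT x|lborel. \<phi> x * ?c x) = local_form \<Omega> l m (embed1 (\<lambda>x. \<phi> x * \<psi> x)) (embed1 \<psi>)
        - 1 / 2 * local_form \<Omega> l m (embed1 \<phi>) (embed1 (\<lambda>x. \<psi> x * \<psi> x))"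
      unfolding E1(2) E2(2) integral_mult_right_zero[symmetric] Bochner_Integration.integral_diff[OF E1(1) integrable_mult_right[OF E2(1)], symmetric]
    proof (intro Bochner_Integration.integral_cong refl)
      fix x
      have "\<phi> x = 0" if "x \<notin> \<Omega>" using \<phi> that Cc_not_support[of x \<phi>] by (auto simp: Cc_infty_def)
      then show "\<phi> x * ?c x = indicator \<Omega> x * (l x * (partial 1 (\<lambda>x. \<phi> x * \<psi> x) x * partial 1 \<psi> x)
          + m x * ((\<Sum>j\<in>UNIV. partial j (\<lambda>x. \<phi> x * \<psi> x) x * partial j \<psi> x) + partial 1 (\<lambda>x. \<phi> x * \<psi> x) x * partial 1 \<psi> x))
        - 1 / 2 * (indicator \<Omega> x * (l x * (partial 1 \<phi> x * partial 1 (\<lambda>x. \<psi> x * \<psi> x) x)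
          + m x * ((\<Sum>j\<in>UNIV. partial j \<phi> x * partial j (\<lambda>x. \<psi> x * \<psi> x) x) + partial 1 \<phi> x * partial 1 (\<lambda>x. \<psi> x * \<psi> x) x)))"
        unfolding pa pb sum_3 by (cases "x \<in> \<Omega>") (simp_all add: power2_eq_square algebra_simps)
    qed
    then show "(LINT x|lborel. \<phi> x * ?c x) = 0" using z[OF a \<psi>] z[OF \<phi> b] by simp
  qed
  then show ?thesis .
qed

text \<open>The test function (x_i - x0_i) bump has at x0 a gradient pointing along axis i. Axis 2
  is invisible to the divergence and isolates m; axis 1 then gives l + 2 m = 0.\<close>

lemma coefficients_zero:
  assumes open_\<Omega>: "open \<Omega>" and l: "weight_ok (\<lambda>x. indicator \<Omega> x * l x)" "continuous_on \<Omega> l"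
    and m: "weight_ok (\<lambda>x. indicator \<Omega> x * m x)" "continuous_on \<Omega> m"
    and z: "\<And>\<phi> \<eta>. \<phi> \<in> Cc_infty \<Omega> \<Longrightarrow> \<eta> \<in> Cc_infty \<Omega> \<Longrightarrow> local_form \<Omega> l m (embed1 \<phi>) (embed1 \<eta>) = 0"
    and x0: "x0 \<in> \<Omega>"
  shows "l x0 = 0" "m x0 = 0"
proof -
  obtain a b where ab: "x0 \<in> box a b" "cbox a b \<subseteq> \<Omega>" using open_\<Omega> x0 open_contains_cbox by meson
  let ?\<psi> = "\<lambda>i x. (x $ i - x0 $ i) * bump a b x"
  have s: "smooth (\<lambda>x::R3. x $ i - x0 $ i)" for i by (intro smooth_diff smooth_nth smooth_const)
  have \<psi>: "?\<psi> i \<in> Cc_infty \<Omega>" for i by (rule Cc_mult_left[OF bump_Cc[OF ab(2)] s])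
  have p: "partial j (?\<psi> i) x0 = (if i = j then bump a b x0 else 0)" for i j
  proof -
    have "partial j (?\<psi> i) x0 = partial j (\<lambda>x. x $ i - x0 $ i) x0 * bump a b x0 + (x0 $ i - x0 $ i) * partial j (bump a b) x0"
      by (rule partial_bilinear[OF bounded_bilinear_mult smoothD[OF s] smoothD[OF smooth_bump]])
    also have "partial j (\<lambda>x. x $ i - x0 $ i) x0 = partial j (\<lambda>x. x $ i) x0 - partial j (\<lambda>x. x0 $ i) x0"
      by (rule partial_diff[OF smoothD[OF smooth_nth] smoothD[OF smooth_const]])
    finally show ?thesis by (simp add: partial_nth axis_def)
  qed
  have b0: "bump a b x0 \<noteq> 0" using ab(1) bump_nonzero_iff by blast
  show m0: "m x0 = 0"
    using carre_du_champ[OF open_\<Omega> l m z \<psi>[of 2] x0] b0 unfolding p sum_3 by simp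
  show "l x0 = 0"
    using carre_du_champ[OF open_\<Omega> l m z \<psi>[of 1] x0] b0 m0 unfolding p sum_3 by simp
qed

section \<open>The integral identity\<close>

text \<open>Both operators share \<Omega>, s and the constants l0, m0, so the spaces X, V and
  \<open>total_norm\<close> are the same and the difference of the forms is purely local.\<close>

locale lame_pair = p: lame \<Omega> s l0 m0 l1 m1 + q: lame \<Omega> s l0 m0 l2 m2
  for \<Omega> :: "R3 set" and s l0 m0 :: real and l1 m1 l2 m2 :: "R3 \<Rightarrow> real"
begin

lemma B_diff_local:
  "u \<in> p.X \<Longrightarrow> v \<in> p.X \<Longrightarrow> p.B u v - q.B u v = local_form \<Omega> l1 m1 u v - local_form \<Omega> l2 m2 u v"
  by (simp add: p.B_local q.B_local)

text \<open>An Alessandrini identity followed by density in each slot. The difference T vanishes on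
  pairs (u - g, w - h) with u a solution for operator 1 and w for operator 2; the Runge property of
  operator 2 on W2 frees the second slot, that of operator 1 on W1 the other.\<close>

lemma integral_identity:
  assumes W1: "open W1" "W1 \<noteq> {}" "W1 \<subseteq> - closure \<Omega>" and W2: "open W2" "W2 \<noteq> {}" "W2 \<subseteq> - closure \<Omega>"
    and DN: "\<And>g h. g \<in> Cc_infty W1 \<Longrightarrow> h \<in> Cc_infty W2 \<Longrightarrow> DN_map \<Omega> s l0 m0 l1 m1 g h = DN_map \<Omega> s l0 m0 l2 m2 g h"
    and v: "v1 \<in> p.V" "v2 \<in> p.V"
  shows "p.B v1 v2 = q.B v1 v2"
proof -
  have off: "W \<inter> \<Omega> = {}" if "W \<subseteq> - closure \<Omega>" for W using that closure_subset[of \<Omega>] by auto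
  define T where "T = (\<lambda>u v. p.B u v - q.B u v)"
  have Tl: "T (\<lambda>x. u x - v x) w = T u w - T v w" and Tr: "T w (\<lambda>x. u x - v x) = T w u - T w v"
    if "u \<in> p.X" "v \<in> p.X" "w \<in> p.X" for u v w
    using p.BX.B_diff[OF that] q.BX.B_diff[OF that] p.BX.B_diff2[OF that] q.BX.B_diff2[OF that] by (auto simp: T_def)
  have Tsym: "T u v = T v u" if "u \<in> p.X" "v \<in> p.X" for u v
    using p.B_sym[OF that] q.B_sym[OF that] by (simp add: T_def)
  have Toff: "T u g = 0" if "u \<in> p.X" "g \<in> Cc_infty W" "W \<subseteq> - closure \<Omega>" for u g W
    using B_diff_local[OF that(1) p.Cc_X[OF that(2)]] local_form_zero_off[OF that(2) off[OF that(3)]] by (simp add: T_def)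
  have bound: "\<exists>c\<ge>0. \<forall>v\<in>p.V. \<bar>T u v\<bar> \<le> c * p.total_norm v" if u: "u \<in> p.X" for u
  proof -
    obtain c where c: "c \<ge> 0" "\<And>v. v \<in> p.X \<Longrightarrow> \<bar>p.B u v\<bar> \<le> c * p.total_norm v" by (rule p.B_le_total_norm[OF u]) blast
    obtain c' where c': "c' \<ge> 0" "\<And>v. v \<in> p.X \<Longrightarrow> \<bar>q.B u v\<bar> \<le> c' * p.total_norm v" by (rule q.B_le_total_norm[OF u]) blast
    have "\<bar>T u v\<bar> \<le> (c + c') * p.total_norm v" if "v \<in> p.V" for v
    proof -
      have "v \<in> p.X" using that p.V_sub_X by blast
      from c(2)[OF this] c'(2)[OF this] show ?thesis unfolding T_def distrib_right by linarith
    qed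
    then show ?thesis using c(1) c'(1) by (intro exI[of _ "c + c'"]) auto
  qed
  have core: "T (\<lambda>x. u x - g x) (\<lambda>x. w x - h x) = 0"
    if g: "g \<in> Cc_infty W1" "weak_solution \<Omega> s l0 m0 l1 m1 g u" and h: "h \<in> Cc_infty W2" "weak_solution \<Omega> s l0 m0 l2 m2 h w" for g u h w
  proof -
    note gX = p.Cc_X[OF g(1)] and hX = p.Cc_X[OF h(1)]
    note U = p.weak_solution_X[OF gX g(2)] and Wh = q.weak_solution_X[OF hX h(2)]
    obtain u' where u': "weak_solution \<Omega> s l0 m0 l2 m2 g u'" using q.weak_solution_exists[OF gX] by blast
    note U' = q.weak_solution_X[OF gX u']
    \<comment> \<open>With u' the solution of operator 2 for the same datum g, the chain is
      \<open>p.B u w\<close> = \<open>p.B u h\<close> = \<open>q.B u' h\<close> =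
      \<open>q.B u' w\<close> = \<open>q.B w u'\<close> = \<open>q.B w g\<close> =
      \<open>q.B w u\<close>. The equality between p and q is that of the Dirichlet-to-Neumann maps;
      the others trade a field for one with the same exterior datum, or use symmetry.\<close>
    have "p.B u w = p.B u h" using p.BX.B_diff2[OF Wh(1) hX U(1)] U(3)[OF Wh(2)] by simp
    moreover have "q.B w u = q.B w g" using q.BX.B_diff2[OF U(1) gX Wh(1)] Wh(3)[OF U(2)] by simp
    moreover have "q.B w u' = q.B w g" using q.BX.B_diff2[OF U'(1) gX Wh(1)] Wh(3)[OF U'(2)] by simp
    moreover have "q.B u' w = q.B u' h" using q.BX.B_diff2[OF Wh(1) hX U'(1)] U'(3)[OF Wh(2)] by simp
    moreover have "p.B u h = q.B u' h"
      using DN[OF g(1) h(1)] p.DN_map_eq[OF gX hX g(2)] q.DN_map_eq[OF gX hX u'] by simp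
    ultimately have T0: "T u w = 0" using q.B_sym[OF U(1) Wh(1)] q.B_sym[OF U'(1) Wh(1)] by (simp add: T_def)
    have dX: "(\<lambda>x. u x - g x) \<in> p.X" by (rule p.BX.diff_mem[OF U(1) gX])
    \<comment> \<open>Subtracting the data changes nothing, since g and h are supported off \<Omega>
      and T is local.\<close>
    have "T (\<lambda>x. u x - g x) (\<lambda>x. w x - h x) = T u w - T g w - T (\<lambda>x. u x - g x) h"
      using Tr[OF Wh(1) hX dX] Tl[OF U(1) gX Wh(1)] by simp
    then show ?thesis using T0 Tsym[OF gX Wh(1)] Toff[OF Wh(1) g(1) W1(3)] Toff[OF dX h(1) W2(3)] by simp
  qed
  have vX: "v1 \<in> p.X" "v2 \<in> p.X" using v p.V_sub_X by auto
  have step: "T (\<lambda>x. u x - g x) v2 = 0" if g: "g \<in> Cc_infty W1" "weak_solution \<Omega> s l0 m0 l1 m1 g u" for g u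
  proof -
    have dX: "(\<lambda>x. u x - g x) \<in> p.X"
      using p.weak_solution_X(2)[OF p.Cc_X[OF g(1)] g(2)] p.V_sub_X by blast
    obtain c where c: "c \<ge> 0" "\<forall>v\<in>p.V. \<bar>T (\<lambda>x. u x - g x) v\<bar> \<le> c * p.total_norm v" using bound[OF dX] by blast
    show ?thesis
    \<comment> \<open>Density of the operator 2 solutions for data in W2, with u - g held
      fixed.\<close>
    proof (rule q.functional_zero[OF W2 _ c(1) _ _ v(2), of "T (\<lambda>x. u x - g x)"])
      show "T (\<lambda>x. u x - g x) (\<lambda>x. a x - b x) = T (\<lambda>x. u x - g x) a - T (\<lambda>x. u x - g x) b" if "a \<in> p.V" "b \<in> p.V" for a b
        using that p.V_sub_X dX by (intro Tr) auto
    qed (use c(2) core[OF g] in auto)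
  qed
  obtain c where c: "c \<ge> 0" "\<forall>v\<in>p.V. \<bar>T v2 v\<bar> \<le> c * p.total_norm v" using bound[OF vX(2)] by blast
  have "T v2 v1 = 0"
  \<comment> \<open>Density of the operator 1 solutions for data in W1; by symmetry of T the already
    general v2 is placed in front.\<close>
  proof (rule p.functional_zero[OF W1 _ c(1) _ _ v(1), of "T v2"])
    show "T v2 (\<lambda>x. a x - b x) = T v2 a - T v2 b" if "a \<in> p.V" "b \<in> p.V" for a b
      using that p.V_sub_X vX by (intro Tr) auto
    show "T v2 (\<lambda>x. u x - g x) = 0" if g: "g \<in> Cc_infty W1" "weak_solution \<Omega> s l0 m0 l1 m1 g u" for g u
    proof -
      have dX: "(\<lambda>x. u x - g x) \<in> p.X"
        using p.weak_solution_X(2)[OF p.Cc_X[OF g(1)] g(2)] p.V_sub_X by blast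
      show ?thesis using step[OF g] Tsym[OF dX vX(2)] by simp
    qed
  qed (use c(2) in auto)
  then show ?thesis using Tsym[OF vX] by (simp add: T_def)
qed

end

lemma weight_ok_diff:
  assumes "weight_ok f" "weight_ok g" shows "weight_ok (\<lambda>x. f x - g x)"
proof -
  obtain C where C: "\<And>x. \<bar>f x\<bar> \<le> C" using assms(1) by (auto simp: weight_ok_def)
  obtain C' where C': "\<And>x. \<bar>g x\<bar> \<le> C'" using assms(2) by (auto simp: weight_ok_def)
  have "\<bar>f x - g x\<bar> \<le> C + C'" for x using C[of x] C'[of x] by linarith
  then show ?thesis using assms by (auto simp: weight_ok_def)
qed

theorem theorem1p1:
  fixes \<Omega> W1 W2 :: "(real^3) set"
    and s l0 m0 :: real
    and l1 l2 m1 m2 :: "real^3 \<Rightarrow> real"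
  assumes "bounded_lipschitz_domain \<Omega>"
    and "0 < s" and "s < 1"
    and "m0 > 0" and "l0 + m0 \<ge> 0"
    and "l1 \<in> C1_closure \<Omega>" and "m1 \<in> C1_closure \<Omega>"
    and "l2 \<in> C1_closure \<Omega>" and "m2 \<in> C1_closure \<Omega>"
    and "\<forall>x\<in>\<Omega>. l1 x \<ge> 0 \<and> m1 x \<ge> 0"
    and "\<forall>x\<in>\<Omega>. l2 x \<ge> 0 \<and> m2 x \<ge> 0"
    and "open W1" and "W1 \<noteq> {}" and "W1 \<subseteq> - closure \<Omega>"
    and "open W2" and "W2 \<noteq> {}" and "W2 \<subseteq> - closure \<Omega>"
    and "\<forall>g \<in> Cc_infty W1. \<forall>h \<in> Cc_infty W2.
           DN_map \<Omega> s l0 m0 l1 m1 g h = DN_map \<Omega> s l0 m0 l2 m2 g h"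
  shows "\<forall>x\<in>\<Omega>. l1 x = l2 x \<and> m1 x = m2 x"
proof
  have o: "open \<Omega>" "bounded \<Omega>" using assms(1) by (auto simp: bounded_lipschitz_domain_def)
  interpret lame_pair \<Omega> s l0 m0 l1 m1 l2 m2
    by unfold_locales (use assms o in auto)
  fix x assume x: "x \<in> \<Omega>"
  have c: "continuous_on \<Omega> f" if "f \<in> C1_closure \<Omega>" for f
    using that closure_subset[of \<Omega>] by (auto simp: C1_closure_def intro: continuous_on_subset)
  have w: "weight_ok (\<lambda>x. indicator \<Omega> x * (f x - g x))" if "f \<in> C1_closure \<Omega>" "g \<in> C1_closure \<Omega>" for f g
    using weight_ok_diff[OF weight_ok_C1[OF o(2,1) that(1)] weight_ok_C1[OF o(2,1) that(2)]] by (simp add: right_diff_distrib)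
  \<comment> \<open>The differences of the coefficients may change sign, so they fit no
    \<open>lame\<close> locale; but the local form is linear in the coefficients and requires only
    boundedness and measurability of them.\<close>
  have z: "local_form \<Omega> (\<lambda>x. l1 x - l2 x) (\<lambda>x. m1 x - m2 x) (embed1 \<phi>) (embed1 \<eta>) = 0"
    if p: "\<phi> \<in> Cc_infty \<Omega>" and q: "\<eta> \<in> Cc_infty \<Omega>" for \<phi> \<eta>
  proof -
    note V = p.Cc_V[OF Cc_embed1[OF p]] p.Cc_V[OF Cc_embed1[OF q]]
    note E1 = local_form_embed1[OF p.wl p.wm p q] and E2 = local_form_embed1[OF q.wl q.wm p q]
    have "p.B (embed1 \<phi>) (embed1 \<eta>) = q.B (embed1 \<phi>) (embed1 \<eta>)"
      using assms(18) by (intro integral_identity[OF assms(12-17) _ V]) blast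
    then have "0 = local_form \<Omega> l1 m1 (embed1 \<phi>) (embed1 \<eta>) - local_form \<Omega> l2 m2 (embed1 \<phi>) (embed1 \<eta>)"
      using B_diff_local[OF subsetD[OF p.V_sub_X V(1)] subsetD[OF p.V_sub_X V(2)]] by simp
    also have "\<dots> = local_form \<Omega> (\<lambda>x. l1 x - l2 x) (\<lambda>x. m1 x - m2 x) (embed1 \<phi>) (embed1 \<eta>)"
      unfolding local_form_embed1(2)[OF w[OF assms(6,8)] w[OF assms(7,9)] p q] E1(2) E2(2)
        Bochner_Integration.integral_diff[OF E1(1) E2(1), symmetric]
      by (intro Bochner_Integration.integral_cong refl) (simp add: algebra_simps)
    finally show ?thesis by simp
  qed
  have cd: "continuous_on \<Omega> (\<lambda>x. l1 x - l2 x)" "continuous_on \<Omega> (\<lambda>x. m1 x - m2 x)"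
    by (intro continuous_intros c assms)+
  show "l1 x = l2 x \<and> m1 x = m2 x"
    using coefficients_zero[OF o(1) w[OF assms(6,8)] cd(1) w[OF assms(7,9)] cd(2) z x] by simp
qed

end
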